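(* Assume $a$ is (WD) or (SD) and let $\beta,\gamma\ge0$. Consider the problem $$\begin{cases} y_{tt}(t,x)+(ay_{xx})_{xx}(t,x)=0, & t>0,\ x\in(0,1),\\ y(t,0)=0, & t>0,\\ y_x(t,0)=0 \text{ if } a\text{ is (WD)},\quad (ay_{xx})(t,0)=0\text{ if } a\text{ is (SD)}, & t>0,\\ \beta y(t,1)-(ay_{xx})_x(t,1)+y_t(t,1)=0, & t>0,\\ \gamma y_x(t,1)+(ay_{xx})(t,1)+y_{tx}(t,1)=0, & t>0,\\ y(0,x)=y_0(x),\ y_t(0,x)=y_1(x), & x\in(0,1).\end{cases}$$ If $(y_0,y_1)\in\mathcal K_0$, then there exists a unique mild solution $$y\in C^1([0,+\infty);L^2(0,1))\cap C([0,+\infty);K^2_{a,0}(0,1))$$ of this problem, which depends continuously on the initial data $(y_0,y_1)\in\mathcal K_0$. Moreover, if $(y_0,y_1)\in D(\mathcal B)$, then the solution $y$ is classical, in the sense that $$y\in C^2([0,+\infty);L^2(0,1))\cap C^1([0,+\infty);K^2_{a,0}(0,1))\cap C([0,+\infty);D(B))$$ and the equation of the problem holds for all $t\ge0$.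
   Context: Degeneracy. $a$ is weakly degenerate (WD) if $a\in C[0,1]\cap C^1(0,1]$, $a(0)=0$, $a>0$ on $(0,1]$ and $K:=\sup_{x\in(0,1]}\frac{x|a'(x)|}{a(x)}\in(0,1)$; $a$ is strongly degenerate (SD) if $a\in C^1[0,1]$, $a(0)=0$, $a>0$ on $(0,1]$ and $K\in[1,2)$, with $K$ defined by the same formula. Spaces. $K^2_{a,0}(0,1)$: if $a$ is (WD), the set of $u\in H^1(0,1)$ with $u'$ absolutely continuous in $[0,1]$, $u(0)=u'(0)=0$, $\sqrt a u''\in L^2(0,1)$; if $a$ is (SD), the set of $u\in H^1(0,1)$ with $u'$ locally absolutely continuous in $(0,1]$, $u(0)=0$, $\sqrt au''\in L^2(0,1)$. On it one considers the norm $\|u\|_{2,a}^2=\|u\|^2_{L^2(0,1)}+\|u'\|^2_{L^2(0,1)}+\|\sqrt au''\|^2_{L^2(0,1)}$ (or the equivalent norms $\|u\|_2^2=\|u\|^2_{L^2(0,1)}+\|\sqrt au''\|^2_{L^2(0,1)}$ and $\|u\|_{2,\circ}^2=|u'(1)|^2+\|\sqrt au''\|^2_{L^2(0,1)}$). $\mathcal K_0:=K^2_{a,0}(0,1)\times L^2(0,1)$, endowed with the inner product $$\langle(u,v),(\tilde u,\tilde v)\rangle_{\mathcal K_0}:=\int_0^1au''\tilde u''dx+\int_0^1v\tilde v\,dx+\beta u(1)\tilde u(1)+\gamma u'(1)\tilde u'(1)$$ and norm $\|(u,v)\|^2_{\mathcal K_0}:=\int_0^1a(u'')^2dx+\int_0^1v^2dx+\beta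 u^2(1)+\gamma (u'(1))^2$. Operators. $D(B)$ is the set of $u\in K^2_{a,0}(0,1)$ with $au''\in H^2(0,1)$ and, if $a$ is (SD), $(au'')(0)=0$; $Bu:=(au'')''$. $\mathcal B(u,v):=(v,-Bu)$ on $D(\mathcal B):=\{(u,v)\in D(B)\times K^2_{a,0}(0,1):\ \beta u(1)-(au'')'(1)+v(1)=0,\ \gamma u'(1)+(au'')(1)+v'(1)=0\}$. Mild solution. The problem is written as the Cauchy problem $\dot{\mathcal U}(t)=\mathcal B\,\mathcal U(t)$, $t\ge0$, $\mathcal U(0)=(y_0,y_1)$, with $\mathcal U=(y,y_t)$; the mild solution is $\mathcal U(t)=R(t)(y_0,y_1)$, where $(R(t))_{t\ge0}$ is the contraction semigroup on $\mathcal K_0$ generated by $(\mathcal B,D(\mathcal B))$.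
   Formalization: If a is (SD) and β=γ=0, the stated inner product on 𝒦_0 is degenerate ((x,0) has norm zero); continuity and generator of the semigroup are therefore taken in the product norm of K²_{a,0}×L², equivalent to the stated norm in all other cases, while contractivity is kept in the stated norm. *)

theory Defs
  imports "HOL-Analysis.Analysis"
begin

section \<open>The Hilbert space \<open>L\<^sup>2(0,1)\<close>\<close>

abbreviation I01 :: "real measure" where
  "I01 \<equiv> lebesgue_on {0<..<1}"

definition sqint :: "(real \<Rightarrow> real) \<Rightarrow> bool" where
  "sqint f \<longleftrightarrow> f \<in> borel_measurable I01 \<and> integrable I01 (\<lambda>x. (f x)\<^sup>2)"

definition l2_eq :: "(real \<Rightarrow> real) \<Rightarrow> (real \<Rightarrow> real) \<Rightarrow> bool" where
  "l2_eq f g \<longleftrightarrow> sqint f \<and> sqint g \<and> (AE x in I01. f x = g x)"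

lemma sqint_mult:
  assumes "sqint f" "sqint g"
  shows "integrable I01 (\<lambda>x. f x * g x)"
proof (rule Bochner_Integration.integrable_bound)
  show "integrable I01 (\<lambda>x. (f x)\<^sup>2 + (g x)\<^sup>2)"
    using assms by (simp add: sqint_def)
  show "(\<lambda>x. f x * g x) \<in> borel_measurable I01"
    using assms by (intro borel_measurable_times) (simp_all add: sqint_def)
  have "\<bar>u * v\<bar> \<le> u\<^sup>2 + v\<^sup>2" for u v :: real
  proof -
    have "2 * (\<bar>u\<bar> * \<bar>v\<bar>) \<le> u\<^sup>2 + v\<^sup>2"
      using sum_squares_bound[of "\<bar>u\<bar>" "\<bar>v\<bar>"] by simp
    moreover have "0 \<le> \<bar>u\<bar> * \<bar>v\<bar>" by simp
    ultimately show ?thesis unfolding abs_mult by linarith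
  qed
  then show "AE x in I01. norm (f x * g x) \<le> norm ((f x)\<^sup>2 + (g x)\<^sup>2)"
    by (intro AE_I2) simp
qed

lemma sqint_zero: "sqint (\<lambda>x. 0)"
  by (simp add: sqint_def)

lemma sqint_add: "sqint f \<Longrightarrow> sqint g \<Longrightarrow> sqint (\<lambda>x. f x + g x)"
  using sqint_mult[of f g]
  by (auto simp: sqint_def power2_sum mult.assoc)

lemma sqint_cmult: "sqint f \<Longrightarrow> sqint (\<lambda>x. c * f x)"
  by (auto simp: sqint_def power_mult_distrib)

lemma sqint_uminus: "sqint f \<Longrightarrow> sqint (\<lambda>x. - f x)"
  using sqint_cmult[of f "-1"] by simp

lemma sqint_diff: "sqint f \<Longrightarrow> sqint g \<Longrightarrow> sqint (\<lambda>x. f x - g x)"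
  using sqint_add[OF _ sqint_uminus, of f g] by simp

quotient_type l2 = "real \<Rightarrow> real" / partial: l2_eq
  morphisms rep_l2 cls
proof (rule part_equivpI)
  show "\<exists>f. l2_eq f f"
    using sqint_zero by (auto simp: l2_eq_def)
  show "symp l2_eq"
    by (auto simp: symp_def l2_eq_def)
  show "transp l2_eq"
    unfolding transp_def l2_eq_def by (auto elim: AE_mp)
qed

instantiation l2 :: real_vector
begin

lift_definition zero_l2 :: l2 is "\<lambda>x. 0"
  by (simp add: l2_eq_def sqint_zero)

lift_definition plus_l2 :: "l2 \<Rightarrow> l2 \<Rightarrow> l2" is "\<lambda>f g x. f x + g x"
  unfolding l2_eq_def by (auto intro: sqint_add)

lift_definition uminus_l2 :: "l2 \<Rightarrow> l2" is "\<lambda>f x. - f x"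
  unfolding l2_eq_def by (auto intro: sqint_uminus)

lift_definition minus_l2 :: "l2 \<Rightarrow> l2 \<Rightarrow> l2" is "\<lambda>f g x. f x - g x"
  unfolding l2_eq_def by (auto intro: sqint_diff)

lift_definition scaleR_l2 :: "real \<Rightarrow> l2 \<Rightarrow> l2" is "\<lambda>c f x. c * f x"
  unfolding l2_eq_def by (auto intro: sqint_cmult)

instance
proof
  fix u v w :: l2 and c d :: real
  show "u + v + w = u + (v + w)"
    by transfer (auto simp: l2_eq_def sqint_add add.assoc)
  show "u + v = v + u"
    by transfer (auto simp: l2_eq_def sqint_add add.commute)
  show "0 + u = u"
    by transfer (auto simp: l2_eq_def)
  show "- u + u = 0"
    by transfer (auto simp: l2_eq_def sqint_zero)
  show "u - v = u + - v"
    by transfer (auto simp: l2_eq_def sqint_diff)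
  show "c *\<^sub>R (u + v) = c *\<^sub>R u + c *\<^sub>R v"
    by transfer
      (auto simp: l2_eq_def distrib_left intro!: sqint_add sqint_cmult)
  show "(c + d) *\<^sub>R u = c *\<^sub>R u + d *\<^sub>R u"
    by transfer
      (auto simp: l2_eq_def distrib_right intro!: sqint_add sqint_cmult)
  show "c *\<^sub>R d *\<^sub>R u = (c * d) *\<^sub>R u"
    by transfer
      (auto simp: l2_eq_def mult.assoc intro!: sqint_cmult)
  show "1 *\<^sub>R u = u"
    by transfer (auto simp: l2_eq_def)
qed

end

instantiation l2 :: real_inner
begin

lift_definition inner_l2 :: "l2 \<Rightarrow> l2 \<Rightarrow> real" is
  "\<lambda>f g. LINT x|I01. f x * g x"
proof -
  fix f f' g g' assume "l2_eq f f'" "l2_eq g g'"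
  then show "(LINT x|I01. f x * g x) = (LINT x|I01. f' x * g' x)"
    by (intro integral_cong_AE) (auto simp: l2_eq_def sqint_def)
qed

definition norm_l2 :: "l2 \<Rightarrow> real" where
  "norm_l2 u = sqrt (inner u u)"

definition sgn_l2 :: "l2 \<Rightarrow> l2" where
  "sgn_l2 u = u /\<^sub>R norm u"

definition dist_l2 :: "l2 \<Rightarrow> l2 \<Rightarrow> real" where
  "dist_l2 u v = norm (u - v)"

definition uniformity_l2 :: "(l2 \<times> l2) filter" where
  "uniformity_l2 = (INF e\<in>{0<..}. principal {(u, v). dist u v < e})"

definition open_l2 :: "l2 set \<Rightarrow> bool" where
  "open_l2 U \<longleftrightarrow> (\<forall>u\<in>U. \<forall>\<^sub>F (u', v) in uniformity. u' = u \<longrightarrow> v \<in> U)"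

instance
proof
  fix u v w :: l2 and c :: real
  show "dist u v = norm (u - v)"
    by (rule dist_l2_def)
  show "sgn u = u /\<^sub>R norm u"
    by (rule sgn_l2_def)
  show "uniformity = (INF e\<in>{0<..}. principal {(u::l2, v). dist u v < e})"
    by (rule uniformity_l2_def)
  show "open U \<longleftrightarrow> (\<forall>u\<in>U. \<forall>\<^sub>F (u', v) in uniformity. u' = u \<longrightarrow> v \<in> U)" for U :: "l2 set"
    by (rule open_l2_def)
  show "inner u v = inner v u"
    by transfer (simp add: mult.commute)
  show "inner (u + v) w = inner u w + inner v w"
    by transfer (simp add: l2_eq_def distrib_right sqint_mult)
  show "inner (c *\<^sub>R u) v = c * inner u v"
    by transfer (simp add: mult.assoc)
  show "0 \<le> inner u u"
    by transfer simp
  show "inner u u = 0 \<longleftrightarrow> u = 0"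
  proof transfer
    fix f assume "l2_eq f f"
    then have f: "sqint f" by (simp add: l2_eq_def)
    have "(LINT x|I01. f x * f x) = 0 \<longleftrightarrow> (AE x in I01. f x * f x = 0)"
      by (rule integral_nonneg_eq_0_iff_AE) (auto intro: sqint_mult f)
    then show "(LINT x|I01. f x * f x) = 0 \<longleftrightarrow> l2_eq f (\<lambda>x. 0)"
      using f sqint_zero by (simp add: l2_eq_def)
  qed
  show "norm u = sqrt (inner u u)"
    by (rule norm_l2_def)
qed

end

section \<open>Weak derivatives, pointwise values, absolute continuity\<close>

definition repr :: "l2 \<Rightarrow> (real \<Rightarrow> real) \<Rightarrow> bool" where
  "repr u f \<longleftrightarrow> sqint f \<and> cls f = u"

text \<open>The value at \<open>x \<in> [0,1]\<close> of an \<open>L\<^sup>2\<close> class that has a representative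
  continuous at \<open>x\<close> (relative to \<open>[0,1]\<close>); it does not depend on that
  representative.  Where some representative is continuous on a relatively open
  subset of \<open>[0,1]\<close>, \<open>pt u\<close> agrees with it there.\<close>
definition pt :: "l2 \<Rightarrow> real \<Rightarrow> real" where
  "pt u x = (THE c. \<exists>f. repr u f \<and> continuous (at x within {0..1}) f \<and> f x = c)"

definition test_fun :: "(real \<Rightarrow> real) \<Rightarrow> bool" where
  "test_fun \<phi> \<longleftrightarrow> \<phi> C1_differentiable_on UNIV \<and>
     (\<exists>C. compact C \<and> C \<subseteq> {0<..<1} \<and> (\<forall>x. x \<notin> C \<longrightarrow> \<phi> x = 0))"

definition is_wderiv :: "l2 \<Rightarrow> l2 \<Rightarrow> bool" where
  "is_wderiv u g \<longleftrightarrow>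
     (\<forall>\<phi>. test_fun \<phi> \<longrightarrow> inner u (cls (deriv \<phi>)) = - inner g (cls \<phi>))"

definition H1 :: "l2 set" where
  "H1 = {u. \<exists>g. is_wderiv u g}"

definition wderiv :: "l2 \<Rightarrow> l2" where
  "wderiv u = (THE g. is_wderiv u g)"

definition H2 :: "l2 set" where
  "H2 = {u \<in> H1. wderiv u \<in> H1}"

definition abs_cont_on :: "real set \<Rightarrow> (real \<Rightarrow> real) \<Rightarrow> bool" where
  "abs_cont_on S f \<longleftrightarrow>
     (\<forall>\<epsilon>>0. \<exists>\<delta>>0. \<forall>d T. d division_of T \<and> T \<subseteq> S \<and> (\<Sum>k\<in>d. measure lborel k) < \<delta>
        \<longrightarrow> (\<Sum>k\<in>d. \<bar>f (Sup k) - f (Inf k)\<bar>) < \<epsilon>)"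

section \<open>Degeneracy of the coefficient\<close>

definition C1_on :: "real set \<Rightarrow> (real \<Rightarrow> real) \<Rightarrow> bool" where
  "C1_on S f \<longleftrightarrow> (\<exists>f'. (\<forall>x\<in>S. (f has_real_derivative f' x) (at x within S)) \<and> continuous_on S f')"

definition deg_quot :: "(real \<Rightarrow> real) \<Rightarrow> real \<Rightarrow> real" where
  "deg_quot a x = x * \<bar>vector_derivative a (at x within {0..1})\<bar> / a x"

text \<open>The real-valued supremum is meaningful only for a bounded quotient, so
  boundedness (\<open>K < \<infinity>\<close>) is stated separately in \<open>WD\<close> and \<open>SD\<close>.\<close>
definition deg_const :: "(real \<Rightarrow> real) \<Rightarrow> real" where
  "deg_const a = (SUP x\<in>{0<..1}. deg_quot a x)"

definition WD :: "(real \<Rightarrow> real) \<Rightarrow> bool" where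
  "WD a \<longleftrightarrow> continuous_on {0..1} a \<and> C1_on {0<..1} a \<and> a 0 = 0 \<and> (\<forall>x\<in>{0<..1}. 0 < a x) \<and>
     bdd_above (deg_quot a ` {0<..1}) \<and> deg_const a \<in> {0<..<1}"

definition SD :: "(real \<Rightarrow> real) \<Rightarrow> bool" where
  "SD a \<longleftrightarrow> C1_on {0..1} a \<and> a 0 = 0 \<and> (\<forall>x\<in>{0<..1}. 0 < a x) \<and>
     bdd_above (deg_quot a ` {0<..1}) \<and> deg_const a \<in> {1..<2}"

section \<open>The weighted spaces\<close>

text \<open>\<open>u''\<close> need not be square integrable; it is the almost everywhere derivative of
  the locally absolutely continuous function \<open>u'\<close>.\<close>
definition D2 :: "l2 \<Rightarrow> real \<Rightarrow> real" where
  "D2 u = deriv (pt (wderiv u))"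

definition sqrt_a_D2 :: "(real \<Rightarrow> real) \<Rightarrow> l2 \<Rightarrow> l2" where
  "sqrt_a_D2 a u = cls (\<lambda>x. sqrt (a x) * D2 u x)"

definition a_D2 :: "(real \<Rightarrow> real) \<Rightarrow> l2 \<Rightarrow> l2" where
  "a_D2 a u = cls (\<lambda>x. a x * D2 u x)"

definition K2_WD :: "(real \<Rightarrow> real) \<Rightarrow> l2 set" where
  "K2_WD a = {u \<in> H1. (\<exists>f. repr (wderiv u) f \<and> abs_cont_on {0..1} f) \<and>
     pt u 0 = 0 \<and> pt (wderiv u) 0 = 0 \<and> sqint (\<lambda>x. sqrt (a x) * D2 u x)}"

definition K2_SD :: "(real \<Rightarrow> real) \<Rightarrow> l2 set" where
  "K2_SD a = {u \<in> H1. (\<exists>f. repr (wderiv u) f \<and> (\<forall>c\<in>{0<..<1}. abs_cont_on {c..1} f)) \<and>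
     pt u 0 = 0 \<and> sqint (\<lambda>x. sqrt (a x) * D2 u x)}"

definition K2 :: "(real \<Rightarrow> real) \<Rightarrow> l2 set" where
  "K2 a = (if WD a then K2_WD a else K2_SD a)"

definition norm_2a :: "(real \<Rightarrow> real) \<Rightarrow> l2 \<Rightarrow> real" where
  "norm_2a a u = sqrt ((norm u)\<^sup>2 + (norm (wderiv u))\<^sup>2 + (norm (sqrt_a_D2 a u))\<^sup>2)"

definition K0 :: "(real \<Rightarrow> real) \<Rightarrow> (l2 \<times> l2) set" where
  "K0 a = K2 a \<times> UNIV"

definition inner_K0 :: "(real \<Rightarrow> real) \<Rightarrow> real \<Rightarrow> real \<Rightarrow> l2 \<times> l2 \<Rightarrow> l2 \<times> l2 \<Rightarrow> real" where
  "inner_K0 a \<beta> \<gamma> U V =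
     (LINT x|I01. a x * D2 (fst U) x * D2 (fst V) x) + inner (snd U) (snd V) +
     \<beta> * pt (fst U) 1 * pt (fst V) 1 + \<gamma> * pt (wderiv (fst U)) 1 * pt (wderiv (fst V)) 1"

definition norm_K0 :: "(real \<Rightarrow> real) \<Rightarrow> real \<Rightarrow> real \<Rightarrow> l2 \<times> l2 \<Rightarrow> real" where
  "norm_K0 a \<beta> \<gamma> U = sqrt (inner_K0 a \<beta> \<gamma> U U)"

text \<open>The norm of the product \<open>K\<^sup>2\<^sub>a\<^sub>,\<^sub>0 \<times> L\<^sup>2\<close>.  It is equivalent to \<open>norm_K0\<close>, except that
  for strongly degenerate \<open>a\<close> and \<open>\<beta> = \<gamma> = 0\<close> the latter is only a seminorm (it vanishes on
  the pair of the identity function and \<open>0\<close>).  Limits in \<open>K\<^sub>0\<close> are therefore always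
  taken in the product norm.\<close>
definition norm_prod :: "(real \<Rightarrow> real) \<Rightarrow> l2 \<times> l2 \<Rightarrow> real" where
  "norm_prod a U = sqrt ((norm_2a a (fst U))\<^sup>2 + (norm (snd U))\<^sup>2)"

section \<open>The operators\<close>

definition dom_B :: "(real \<Rightarrow> real) \<Rightarrow> l2 set" where
  "dom_B a = {u \<in> K2 a. a_D2 a u \<in> H2 \<and> (SD a \<longrightarrow> pt (a_D2 a u) 0 = 0)}"

definition op_B :: "(real \<Rightarrow> real) \<Rightarrow> l2 \<Rightarrow> l2" where
  "op_B a u = wderiv (wderiv (a_D2 a u))"

definition norm_dom_B :: "(real \<Rightarrow> real) \<Rightarrow> l2 \<Rightarrow> real" where
  "norm_dom_B a u = sqrt ((norm_2a a u)\<^sup>2 + (norm (op_B a u))\<^sup>2)"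

definition dom_calB :: "(real \<Rightarrow> real) \<Rightarrow> real \<Rightarrow> real \<Rightarrow> (l2 \<times> l2) set" where
  "dom_calB a \<beta> \<gamma> = {(u, v). u \<in> dom_B a \<and> v \<in> K2 a \<and>
     \<beta> * pt u 1 - pt (wderiv (a_D2 a u)) 1 + pt v 1 = 0 \<and>
     \<gamma> * pt (wderiv u) 1 + pt (a_D2 a u) 1 + pt (wderiv v) 1 = 0}"

definition calB :: "(real \<Rightarrow> real) \<Rightarrow> l2 \<times> l2 \<Rightarrow> l2 \<times> l2" where
  "calB a U = (snd U, - op_B a (fst U))"

section \<open>Semigroups and solutions\<close>

text \<open>Strongly continuous semigroups of bounded operators on a linear subspace \<open>X\<close> carrying
  its own norm \<open>N\<close>.\<close>
definition C0_semigroup ::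
  "'a::real_vector set \<Rightarrow> ('a \<Rightarrow> real) \<Rightarrow> (real \<Rightarrow> 'a \<Rightarrow> 'a) \<Rightarrow> bool" where
  "C0_semigroup X N R \<longleftrightarrow>
     (\<forall>t\<ge>0. R t ` X \<subseteq> X \<and>
        (\<forall>x\<in>X. \<forall>y\<in>X. \<forall>c d. R t (c *\<^sub>R x + d *\<^sub>R y) = c *\<^sub>R R t x + d *\<^sub>R R t y) \<and>
        (\<exists>M. \<forall>x\<in>X. N (R t x) \<le> M * N x)) \<and>
     (\<forall>x\<in>X. R 0 x = x) \<and>
     (\<forall>s\<ge>0. \<forall>t\<ge>0. \<forall>x\<in>X. R (s + t) x = R s (R t x)) \<and>
     (\<forall>x\<in>X. ((\<lambda>t. N (R t x - x)) \<longlongrightarrow> 0) (at_right 0))"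

definition generator ::
  "'a::real_vector set \<Rightarrow> ('a \<Rightarrow> real) \<Rightarrow> (real \<Rightarrow> 'a \<Rightarrow> 'a) \<Rightarrow> 'a set \<Rightarrow> ('a \<Rightarrow> 'a) \<Rightarrow> bool" where
  "generator X N R D A \<longleftrightarrow> D \<subseteq> X \<and>
     (\<forall>x\<in>X. \<forall>z\<in>X. ((\<lambda>h. N ((R h x - x) /\<^sub>R h - z)) \<longlongrightarrow> 0) (at_right 0) \<longleftrightarrow> x \<in> D \<and> A x = z)"

definition K0_semigroup ::
  "(real \<Rightarrow> real) \<Rightarrow> real \<Rightarrow> real \<Rightarrow> (real \<Rightarrow> l2 \<times> l2 \<Rightarrow> l2 \<times> l2) \<Rightarrow> bool" where
  "K0_semigroup a \<beta> \<gamma> R \<longleftrightarrow>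
     C0_semigroup (K0 a) (norm_prod a) R \<and>
     (\<forall>t\<ge>0. \<forall>U\<in>K0 a. norm_K0 a \<beta> \<gamma> (R t U) \<le> norm_K0 a \<beta> \<gamma> U) \<and>
     generator (K0 a) (norm_prod a) R (dom_calB a \<beta> \<gamma>) (calB a)"

text \<open>Time derivative in \<open>L\<^sup>2\<close>, one-sided at \<open>t = 0\<close>.\<close>
definition ddt :: "(real \<Rightarrow> l2) \<Rightarrow> real \<Rightarrow> l2" where
  "ddt y t = vector_derivative y (at t within {0..})"

definition C0_in :: "l2 set \<Rightarrow> (l2 \<Rightarrow> real) \<Rightarrow> (real \<Rightarrow> l2) \<Rightarrow> bool" where
  "C0_in X N y \<longleftrightarrow>
     (\<forall>t\<ge>0. y t \<in> X \<and> ((\<lambda>s. N (y s - y t)) \<longlongrightarrow> 0) (at t within {0..}))"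

text \<open>The norms \<open>N\<close> used below dominate the one of \<open>L\<^sup>2\<close>, so a derivative in the sense
  of \<open>N\<close> can only be \<open>ddt y t\<close>.\<close>
definition C1_in :: "l2 set \<Rightarrow> (l2 \<Rightarrow> real) \<Rightarrow> (real \<Rightarrow> l2) \<Rightarrow> bool" where
  "C1_in X N y \<longleftrightarrow> C0_in X N y \<and> C0_in X N (ddt y) \<and>
     (\<forall>t\<ge>0. ((\<lambda>s. N ((y s - y t) /\<^sub>R (s - t) - ddt y t)) \<longlongrightarrow> 0) (at t within {0..}))"

definition C2_in :: "l2 set \<Rightarrow> (l2 \<Rightarrow> real) \<Rightarrow> (real \<Rightarrow> l2) \<Rightarrow> bool" where
  "C2_in X N y \<longleftrightarrow> C1_in X N y \<and> C1_in X N (ddt y)"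

definition mild_solution ::
  "(real \<Rightarrow> real) \<Rightarrow> real \<Rightarrow> real \<Rightarrow> l2 \<times> l2 \<Rightarrow> (real \<Rightarrow> l2) \<Rightarrow> bool" where
  "mild_solution a \<beta> \<gamma> U0 y \<longleftrightarrow>
     (\<exists>R. K0_semigroup a \<beta> \<gamma> R \<and> (\<forall>t\<ge>0. (y t, ddt y t) = R t U0))"

definition solves_problem ::
  "(real \<Rightarrow> real) \<Rightarrow> real \<Rightarrow> real \<Rightarrow> l2 \<times> l2 \<Rightarrow> (real \<Rightarrow> l2) \<Rightarrow> bool" where
  "solves_problem a \<beta> \<gamma> U0 y \<longleftrightarrow>
     (\<forall>t\<ge>0. ddt (ddt y) t + op_B a (y t) = 0 \<and>
        pt (y t) 0 = 0 \<and>
        (WD a \<longrightarrow> pt (wderiv (y t)) 0 = 0) \<and>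
        (SD a \<longrightarrow> pt (a_D2 a (y t)) 0 = 0) \<and>
        \<beta> * pt (y t) 1 - pt (wderiv (a_D2 a (y t))) 1 + pt (ddt y t) 1 = 0 \<and>
        \<gamma> * pt (wderiv (y t)) 1 + pt (a_D2 a (y t)) 1 + pt (wderiv (ddt y t)) 1 = 0) \<and>
     y 0 = fst U0 \<and> ddt y 0 = snd U0"

end

(*
The operator calB is dissipative for the energy form inner_K0, but norm_K0 may be a seminorm only
(a strongly degenerate, beta = gamma = 0). Adding the L2 norm of the first component gives a Hilbert
norm equivalent to norm_prod, for which calB minus the identity is maximal dissipative. An element u of the weighted space is determined by w = sqrt a u'' and u'(1), and
u -> (u, w, u(1), u'(1)) is a closed embedding into L2 x L2 x R x R. Integration by parts
identifies calB with its weak form, in which the boundary conditions are natural, so the range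
condition is the Riesz representation theorem. The generated semigroup decreases the energy
norm_K0 on the domain of calB, hence by density everywhere.

The semigroup is built from implicit Euler steps of length 2^(-k). Two semigroups with the same
generator agree by a Gronwall estimate; the local boundedness this requires is the uniform
boundedness principle.

Since u'' is the pointwise derivative of an absolutely continuous function, differentiability
almost everywhere and the fundamental theorem of calculus for such functions come first; they
follow from the Vitali covering theorem.
*)
theory Submission
  imports Defs
begin

text \<open>\<open>D2\<close> is a pointwise derivative, so passing between u and its coordinates
  needs both halves of the fundamental theorem: an element built from w must have w / sqrt a as
  second derivative almost everywhere, and an element of the space must be recovered by integrating
  its derivatives. The obstacle is the endpoint 0, where 1 / a need not be integrable. The bound K <
  2 enters through a(x) >= m x^p with 1 < p < 2: it makes u' = O(x^((1 - p) / 2)) square integrable,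
  and against a flux of order x it makes the boundary terms at 0 vanish. Implicit Euler steps need
  the range condition for every step length h, so the variational problem solved by Riesz carries h
  as a parameter. Outside the domain an orbit need not be differentiable in the state space, yet a
  mild solution asks for y_t to be its second component. This holds in L2 because the first
  component of \<open>calB\<close> is a bounded map, so the identity extends from the domain by
  density.\<close>

subsection \<open>Absolute continuity and differentiation of integrals\<close>

text \<open>\<open>P s t\<close> will be a bound on the difference quotient of a function over \<open>[s, t]\<close>.\<close>
definition straddled :: "(real \<Rightarrow> real \<Rightarrow> bool) \<Rightarrow> real set" where
  "straddled P = {x. \<forall>d>0. \<exists>s t. s < x \<and> x < t \<and> t - s < d \<and> P s t}"

lemma straddledD:
  "x \<in> straddled P \<Longrightarrow> 0 < d \<Longrightarrow> \<exists>s t. s < x \<and> x < t \<and> t - s < d \<and> P s t"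
  by (simp add: straddled_def)

lemma not_straddledD:
  "x \<notin> straddled P \<Longrightarrow> \<exists>d>0. \<forall>s t. s < x \<longrightarrow> x < t \<longrightarrow> t - s < d \<longrightarrow> \<not> P s t"
  unfolding straddled_def by blast

text \<open>For each length bound the points inside some interval satisfying \<open>P\<close> form a
  union of open intervals, so the whole set is a countable intersection of open sets, whatever
  \<open>P\<close> is. This is what requiring x to lie strictly between s and t buys.\<close>

lemma straddled_borel: "straddled P \<in> sets borel"
proof -
  have "straddled P = (\<Inter>n::nat. \<Union>{{s<..<t} |s t. t - s < 1 / real (Suc n) \<and> P s t})"
    (is "_ = ?R")
  proof (intro equalityI subsetI)
    fix x assume x: "x \<in> straddled P"
    show "x \<in> ?R"
    proof
      fix n :: nat
      obtain s t where "s < x" "x < t" "t - s < 1 / real (Suc n)" "P s t"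
        using straddledD[OF x, of "1 / real (Suc n)"] by auto
      then have "x \<in> {s<..<t}" "{s<..<t} \<in> {{s<..<t} |s t. t - s < 1 / real (Suc n) \<and> P s t}"
        by auto
      then show "x \<in> \<Union>{{s<..<t} |s t. t - s < 1 / real (Suc n) \<and> P s t}" by blast
    qed
  next
    fix x assume x: "x \<in> ?R"
    show "x \<in> straddled P"
      unfolding straddled_def
    proof (intro CollectI allI impI)
      fix d :: real assume "0 < d"
      then obtain n where n: "1 / real (Suc n) < d"
        using nat_approx_posE by blast
      from x have "x \<in> \<Union>{{s<..<t} |s t. t - s < 1 / real (Suc n) \<and> P s t}" by blast
      then obtain s t where "x \<in> {s<..<t}" "t - s < 1 / real (Suc n)" "P s t" by blast
      then show "\<exists>s t. s < x \<and> x < t \<and> t - s < d \<and> P s t"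
        using n by (intro exI[of _ s] exI[of _ t]) auto
    qed
  qed
  moreover have "open (\<Union>{{s<..<t} |s t. t - s < 1 / real (Suc n) \<and> P s t})" for n
    by (rule open_Union) auto
  ultimately show ?thesis
    by (auto intro!: sets.countable_INT)
qed

text \<open>In one dimension the closed ball around (s + t) / 2 with radius (t - s) / 2 is the
  interval [s, t], so the Vitali covering theorem for balls applies to intervals that contain x
  without being centred there.\<close>

lemma vitali_intervals:
  fixes S :: "real set"
  assumes cov: "\<And>x d. x \<in> S \<Longrightarrow> 0 < d \<Longrightarrow> \<exists>s t. s \<le> x \<and> x \<le> t \<and> s < t \<and> t - s < d \<and> P s t"
  obtains C where "countable C" "\<And>s t. (s, t) \<in> C \<Longrightarrow> s < t \<and> P s t"
    "pairwise (\<lambda>i j. disjnt {fst i..snd i} {fst j..snd j}) C"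
    "negligible (S - (\<Union>i\<in>C. {fst i..snd i}))"
proof -
  let ?K = "{(s, t). s < t \<and> P s t}"
  let ?a = "\<lambda>i::real \<times> real. (fst i + snd i) / 2"
  let ?r = "\<lambda>i::real \<times> real. (snd i - fst i) / 2"
  have cb: "cball (?a i) (?r i) = {fst i..snd i}" for i
    by (simp add: cball_eq_atLeastAtMost field_simps)
  obtain C where C: "countable C" "C \<subseteq> ?K"
     "pairwise (\<lambda>i j. disjnt (cball (?a i) (?r i)) (cball (?a j) (?r j))) C"
     "negligible(S - (\<Union>i \<in> C. cball (?a i) (?r i)))"
  proof (rule Vitali_covering_theorem_cballs[of ?K ?r S ?a])
    show "\<And>i. i \<in> ?K \<Longrightarrow> 0 < ?r i" by auto
    fix x d :: real assume "x \<in> S" "0 < d"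
    then obtain s t where "s \<le> x" "x \<le> t" "s < t" "t - s < d" "P s t"
      using cov by blast
    then show "\<exists>i. i \<in> ?K \<and> x \<in> cball (?a i) (?r i) \<and> ?r i < d"
      unfolding cb by (intro exI[of _ "(s, t)"]) auto
  qed auto
  show ?thesis
    using C unfolding cb by (intro that[of C]) auto
qed

text \<open>Intervals are kept as pairs of endpoints, because the sums to be estimated are of
  increments between endpoints.\<close>

definition disjoint_ivls :: "(real \<times> real) set \<Rightarrow> bool" where
  "disjoint_ivls D \<longleftrightarrow> finite D \<and> (\<forall>i\<in>D. fst i < snd i) \<and>
     pairwise (\<lambda>i j. disjnt {fst i..snd i} {fst j..snd j}) D"

definition ivls :: "(real \<times> real) set \<Rightarrow> real set" where
  "ivls D = (\<Union>i\<in>D. {fst i..snd i})"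

lemma ivls_lmeasurable: "disjoint_ivls D \<Longrightarrow> ivls D \<in> lmeasurable"
  unfolding ivls_def disjoint_ivls_def by (auto intro!: fmeasurable.finite_UN)

lemma disjoint_ivls_disjoint:
  assumes "disjoint_ivls D" "i \<in> D" "j \<in> D" "i \<noteq> j"
  shows "{fst i..snd i} \<inter> {fst j..snd j} = {}"
  using assms unfolding disjoint_ivls_def pairwise_def disjnt_def by blast

lemma measure_ivls:
  assumes "disjoint_ivls D"
  shows "measure lebesgue (ivls D) = (\<Sum>i\<in>D. snd i - fst i)"
proof -
  have "measure lebesgue (ivls D) = (\<Sum>i\<in>D. measure lebesgue {fst i..snd i})"
    unfolding ivls_def
    using assms disjoint_ivls_disjoint[OF assms]
    by (intro measure_finite_Union) (auto simp: disjoint_ivls_def disjoint_family_on_def)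
  also have "\<dots> = (\<Sum>i\<in>D. snd i - fst i)"
    by (rule sum.cong) (use assms in \<open>auto simp: disjoint_ivls_def less_imp_le\<close>)
  finally show ?thesis .
qed

text \<open>The part of \<open>S\<close> missed by the first n intervals of a countable Vitali
  family decreases to a null set. Since \<open>S\<close> has finite measure, the measures of these
  remainders tend to 0 and finitely many intervals suffice.\<close>

lemma vitali_finite:
  fixes S U :: "real set"
  assumes S: "S \<in> sets lebesgue" and U: "U \<in> lmeasurable" "S \<subseteq> U" and "0 < e"
    and cov: "\<And>x d. x \<in> S \<Longrightarrow> 0 < d \<Longrightarrow> \<exists>s t. s \<le> x \<and> x \<le> t \<and> s < t \<and> t - s < d \<and> P s t"
    and PU: "\<And>s t. P s t \<Longrightarrow> {s..t} \<subseteq> U"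
  obtains D where "disjoint_ivls D" "\<And>i. i \<in> D \<Longrightarrow> P (fst i) (snd i)"
    "ivls D \<subseteq> U" "measure lebesgue (S - ivls D) < e"
proof -
  obtain C where C: "countable C" "\<And>s t. (s, t) \<in> C \<Longrightarrow> s < t \<and> P s t"
    "pairwise (\<lambda>i j. disjnt {fst i..snd i} {fst j..snd j}) C"
    "negligible (S - (\<Union>i\<in>C. {fst i..snd i}))"
    by (rule vitali_intervals[of S P, OF cov]) (assumption | rule that)+
  have Sm: "S \<in> lmeasurable"
    using fmeasurableI2[OF U(1) U(2) S] .
  show ?thesis
  proof (cases "C = {}")
    case True
    then have "negligible S" using C(4) by simp
    then show ?thesis
      using \<open>0 < e\<close>
      by (intro that[of "{}"]) (auto simp: disjoint_ivls_def ivls_def negligible_imp_measure0)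
  next
    case False
    define D where "D n = from_nat_into C ` {..n}" for n :: nat
    have DC: "D n \<subseteq> C" for n
      using from_nat_into[OF False] by (auto simp: D_def)
    have dj: "disjoint_ivls (D n)" for n
      unfolding disjoint_ivls_def
    proof (intro conjI)
      show "finite (D n)" by (simp add: D_def)
      show "\<forall>i\<in>D n. fst i < snd i" using DC C(2) by (metis prod.collapse subsetD)
      show "pairwise (\<lambda>i j. disjnt {fst i..snd i} {fst j..snd j}) (D n)"
        using pairwise_subset[OF C(3) DC] .
    qed
    have meas: "S - ivls (D n) \<in> lmeasurable" for n
      using fmeasurable.Diff[OF Sm ivls_lmeasurable[OF dj]] .
    have "(\<lambda>n. measure lebesgue (S - ivls (D n))) \<longlonglongrightarrow> measure lebesgue (\<Inter>n. S - ivls (D n))"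
    proof (rule Lim_measure_decseq)
      show "range (\<lambda>n. S - ivls (D n)) \<subseteq> sets lebesgue"
        using meas fmeasurableD by blast
      show "decseq (\<lambda>n. S - ivls (D n))"
        by (auto simp: decseq_def ivls_def D_def)
      show "\<And>n. emeasure lebesgue (S - ivls (D n)) \<noteq> \<infinity>"
        using fmeasurableD2[OF meas] by (simp only: infinity_ennreal_def not_False_eq_True)
    qed
    moreover have "(\<Inter>n. S - ivls (D n)) = S - (\<Union>i\<in>C. {fst i..snd i})"
    proof -
      have "(\<Union>n. D n) = C"
      proof
        show "C \<subseteq> (\<Union>n. D n)"
        proof
          fix i assume "i \<in> C"
          then obtain n where "i = from_nat_into C n"
            using range_from_nat_into[OF False C(1)] by blast
          then have "i \<in> D n" by (simp add: D_def)
          then show "i \<in> (\<Union>n. D n)" by blast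
        qed
      qed (use DC in blast)
      then have "(\<Union>i\<in>C. {fst i..snd i}) = (\<Union>n. ivls (D n))"
        by (auto simp: ivls_def)
      then show ?thesis by auto
    qed
    ultimately have "(\<lambda>n. measure lebesgue (S - ivls (D n))) \<longlonglongrightarrow> 0"
      using negligible_imp_measure0[OF C(4)] by simp
    then have "\<forall>\<^sub>F n in sequentially. measure lebesgue (S - ivls (D n)) < e"
      using \<open>0 < e\<close> order_tendstoD(2) by blast
    then obtain n where n: "measure lebesgue (S - ivls (D n)) < e"
      by (auto simp: eventually_sequentially)
    have P: "P (fst i) (snd i)" if "i \<in> D n" for i
      using that DC C(2) by (metis prod.collapse subsetD)
    show ?thesis
      by (rule that[OF dj[of n] P _ n]) (use P PU in \<open>fastforce simp: ivls_def\<close>)+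
  qed
qed

text \<open>Difference quotients over intervals that straddle x determine the derivative once f is
  continuous at x: an interval with x as an endpoint is a limit of straddling ones.\<close>

lemma straddle_has_derivative:
  fixes f :: "real \<Rightarrow> real"
  assumes cont: "isCont f x"
    and sl: "\<And>e. 0 < e \<Longrightarrow> \<exists>d>0. \<forall>s t. s < x \<longrightarrow> x < t \<longrightarrow> t - s < d \<longrightarrow>
              \<bar>f t - f s - L * (t - s)\<bar> \<le> e * (t - s)"
  shows "(f has_real_derivative L) (at x)"
proof -
  have one: "\<exists>d>0. \<forall>s t. s \<le> x \<longrightarrow> x \<le> t \<longrightarrow> t - s < d \<longrightarrow>
              \<bar>f t - f s - L * (t - s)\<bar> \<le> e * (t - s)" if e: "0 < e" for e
  proof -
    obtain d where d: "d > 0" "\<And>s t. s < x \<Longrightarrow> x < t \<Longrightarrow> t - s < d \<Longrightarrow>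
              \<bar>f t - f s - L * (t - s)\<bar> \<le> e * (t - s)"
      using sl[OF e] by blast
    have "\<bar>f t - f s - L * (t - s)\<bar> \<le> e * (t - s)" if "s \<le> x" "x \<le> t" "t - s < d" for s t
    proof -
      define s' t' where "s' n = s - 1 / real (Suc n)" and "t' n = t + 1 / real (Suc n)" for n
      have s'l: "s' \<longlonglongrightarrow> s" and t'l: "t' \<longlonglongrightarrow> t"
        using tendsto_diff[OF tendsto_const LIMSEQ_inverse_real_of_nat, of s]
          tendsto_add[OF tendsto_const LIMSEQ_inverse_real_of_nat, of t]
        unfolding s'_def t'_def by (simp_all add: inverse_eq_divide)
      \<comment> \<open>Only an endpoint equal to x is moved, outwards by 1 / (n + 1), because
        continuity of f is known at x alone.\<close>
      define s'' where "s'' n = (if s = x then s' n else s)" for n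
      define t'' where "t'' n = (if t = x then t' n else t)" for n
      have s''l: "s'' \<longlonglongrightarrow> s" and t''l: "t'' \<longlonglongrightarrow> t"
        using s'l t'l unfolding s''_def t''_def by (cases "s = x"; cases "t = x"; simp)+
      have fs: "(\<lambda>n. f (s'' n)) \<longlonglongrightarrow> f s" 
        using isCont_tendsto_compose[OF cont, of s'' sequentially] s''l by (cases "s = x") (auto simp: s''_def)
      have ft: "(\<lambda>n. f (t'' n)) \<longlonglongrightarrow> f t" 
        using isCont_tendsto_compose[OF cont, of t'' sequentially] t''l by (cases "t = x") (auto simp: t''_def)
      have l1: "(\<lambda>n. \<bar>f (t'' n) - f (s'' n) - L * (t'' n - s'' n)\<bar>) \<longlonglongrightarrow> \<bar>f t - f s - L * (t - s)\<bar>"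
        by (intro tendsto_intros fs ft s''l t''l)
      have l2: "(\<lambda>n. e * (t'' n - s'' n)) \<longlonglongrightarrow> e * (t - s)"
        by (intro tendsto_intros s''l t''l)
      have "(\<lambda>n. t'' n - s'' n) \<longlonglongrightarrow> t - s"
        by (intro tendsto_intros s''l t''l)
      then have "\<forall>\<^sub>F n in sequentially. t'' n - s'' n < d"
        using that(3) order_tendstoD(2) by blast
      moreover have "s'' n < x" "x < t'' n" for n
        using that by (auto simp: s''_def t''_def s'_def t'_def)
      ultimately have "\<forall>\<^sub>F n in sequentially. \<bar>f (t'' n) - f (s'' n) - L * (t'' n - s'' n)\<bar> \<le> e * (t'' n - s'' n)"
        using d(2) by (auto elim!: eventually_mono)
      then show ?thesis
        using tendsto_le[OF _ l2 l1] by simp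
    qed
    then show ?thesis using d(1) by blast
  qed
  show ?thesis
    unfolding has_field_derivative_def has_derivative_within_alt
  proof (intro conjI allI impI)
    show "bounded_linear ((*) L)" by (rule bounded_linear_mult_right)
    fix e :: real assume "0 < e"
    obtain d where d: "d > 0" "\<And>s t. s \<le> x \<Longrightarrow> x \<le> t \<Longrightarrow> t - s < d \<Longrightarrow>
              \<bar>f t - f s - L * (t - s)\<bar> \<le> e * (t - s)"
      using one[OF \<open>0 < e\<close>] by blast
    have "norm (f y - f x - L * (y - x)) \<le> e * norm (y - x)" if "norm (y - x) < d" for y
    proof (cases "x \<le> y")
      case True
      then show ?thesis using d(2)[of x y] that by simp
    next
      case False
      then have "\<bar>f x - f y - L * (x - y)\<bar> \<le> e * (x - y)"
        using d(2)[of y x] that by simp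
      moreover have "f x - f y - L * (x - y) = - (f y - f x - L * (y - x))"
        by (simp add: algebra_simps)
      ultimately show ?thesis using False by (simp only: abs_minus_cancel) (simp add: abs_if)
    qed
    then show "\<exists>d>0. \<forall>y\<in>UNIV. norm (y - x) < d \<longrightarrow> norm (f y - f x - L * (y - x)) \<le> e * norm (y - x)"
      using d(1) by blast
  qed
qed

lemma measure_division:
  assumes "d division_of (T::real set)"
  shows "(\<Sum>k\<in>d. measure lborel k) = measure lebesgue T"
proof -
  have T: "T \<in> lmeasurable"
    using division_ofD(1,4,6)[OF assms] by (metis compact_Union compact_cbox lmeasurable_compact)
  have k: "measure lborel k = integral k (\<lambda>_. 1)" if "k \<in> d" for k
    using division_ofD(4)[OF assms that] by (auto simp: content_real_if)
  have "measure lebesgue T = integral T (\<lambda>_. 1::real)"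
    using lmeasure_integral[OF T] .
  also have "\<dots> = (\<Sum>k\<in>d. integral k (\<lambda>_. 1))"
    by (rule integral_combine_division_topdown[OF _ assms])
      (use T in \<open>simp add: lmeasurable_iff_integrable_on\<close>)
  finally show ?thesis using k by simp
qed

text \<open>Truncate at height n: the excess of |g| over n has small integral by dominated
  convergence, and the truncated part contributes at most n times the measure of the set.\<close>

lemma integral_small_on_small_sets:
  fixes g :: "real \<Rightarrow> real"
  assumes g: "g absolutely_integrable_on S" and S: "S \<in> sets lebesgue" and "0 < e"
  obtains \<delta> where "0 < \<delta>" "\<And>T. T \<in> lmeasurable \<Longrightarrow> T \<subseteq> S \<Longrightarrow> measure lebesgue T < \<delta> \<Longrightarrow>
      integral T (\<lambda>x. \<bar>g x\<bar>) < e"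
proof -
  define h where "h n x = \<bar>g x\<bar> - min \<bar>g x\<bar> (real n)" for n x
  have gi: "(\<lambda>x. \<bar>g x\<bar>) absolutely_integrable_on S"
    using absolutely_integrable_norm[OF g] by (simp add: o_def)
  have gm: "g \<in> borel_measurable (lebesgue_on S)"
    using absolutely_integrable_measurable[OF S] g by blast
  have hm: "h n \<in> borel_measurable (lebesgue_on S)" for n
    unfolding h_def using gm by measurable
  have hint: "h n absolutely_integrable_on S" for n
  proof (rule measurable_bounded_by_integrable_imp_absolutely_integrable[OF hm S])
    show "(\<lambda>x. \<bar>g x\<bar>) integrable_on S"
      using gi set_lebesgue_integral_eq_integral(1) by blast
  qed (auto simp: h_def)
  have "(\<lambda>n. integral S (h n)) \<longlonglongrightarrow> integral S (\<lambda>x. 0)"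
  proof (rule dominated_convergence(2))
    show "h n integrable_on S" for n using hint set_lebesgue_integral_eq_integral(1) by blast
    show "(\<lambda>x. \<bar>g x\<bar>) integrable_on S"
      using gi set_lebesgue_integral_eq_integral(1) by blast
    show "norm (h n x) \<le> \<bar>g x\<bar>" if "x \<in> S" for n x by (auto simp: h_def)
    show "(\<lambda>n. h n x) \<longlonglongrightarrow> 0" if "x \<in> S" for x
    proof (rule tendsto_eventually)
      obtain N where "\<bar>g x\<bar> \<le> real N" using real_arch_simple by blast
      then show "\<forall>\<^sub>F n in sequentially. h n x = 0"
        by (intro eventually_sequentiallyI[of N]) (auto simp: h_def)
    qed
  qed
  then have "\<forall>\<^sub>F n in sequentially. integral S (h n) < e / 2"
    using \<open>0 < e\<close> order_tendstoD(2)[of _ 0 sequentially "e/2"] by simp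
  then obtain n where n: "integral S (h n) < e / 2"
    by (auto simp: eventually_sequentially)
  \<comment> \<open>The truncated part gets the other e / 2; writing n + 1 keeps the quotient
    meaningful for n = 0.\<close>
  define \<delta> where "\<delta> = e / (2 * (real n + 1))"
  show ?thesis
  proof (rule that[of \<delta>])
    show "0 < \<delta>" using \<open>0 < e\<close> by (simp add: \<delta>_def)
    fix T assume T: "T \<in> lmeasurable" "T \<subseteq> S" "measure lebesgue T < \<delta>"
    have Ts: "T \<in> sets lebesgue" using T(1) by auto
    have gT: "(\<lambda>x. \<bar>g x\<bar>) integrable_on T" and hT: "h n integrable_on T"
      using set_integrable_subset[OF gi Ts T(2)] set_integrable_subset[OF hint Ts T(2)]
        set_lebesgue_integral_eq_integral(1) by blast+
    have cT: "(\<lambda>x. real n) integrable_on T"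
      using T(1) integrable_on_cmult_left[of "\<lambda>_. 1" T "real n"]
      by (simp add: lmeasurable_iff_integrable_on)
    have "integral T (\<lambda>x. \<bar>g x\<bar>) \<le> integral T (\<lambda>x. h n x + real n)"
      by (rule integral_le[OF gT integrable_add[OF hT cT]]) (auto simp: h_def)
    also have "\<dots> = integral T (h n) + integral T (\<lambda>x. real n)"
      by (rule integral_add[OF hT cT])
    also have "integral T (\<lambda>x. real n) = real n * measure lebesgue T"
      using lmeasure_integral[OF T(1)] integral_mult_right[of T "real n" "\<lambda>_. 1"] by simp
    also have "integral T (h n) \<le> integral S (h n)"
      by (rule integral_subset_le[OF T(2) hT])
        (use hint set_lebesgue_integral_eq_integral(1) in \<open>auto simp: h_def\<close>)
    also have "integral S (h n) + real n * measure lebesgue T < e"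
    proof -
      have "real n * measure lebesgue T \<le> real n * \<delta>"
        using T(3) by (intro mult_left_mono) auto
      also have "\<dots> \<le> e / 2"
        using \<open>0 < e\<close> by (simp add: \<delta>_def field_simps)
      finally show ?thesis using n by linarith
    qed
    finally show "integral T (\<lambda>x. \<bar>g x\<bar>) < e" by simp
  qed
qed

section \<open>Absolutely continuous functions\<close>

lemma abs_cont_on_integral:
  fixes g :: "real \<Rightarrow> real"
  assumes g: "g absolutely_integrable_on {a..b}"
    and f: "\<And>x y. a \<le> x \<Longrightarrow> x \<le> y \<Longrightarrow> y \<le> b \<Longrightarrow> f y - f x = integral {x..y} g"
  shows "abs_cont_on {a..b} f"
  unfolding abs_cont_on_def
proof (intro allI impI)
  fix e :: real assume "0 < e"
  obtain \<delta> where \<delta>: "0 < \<delta>" "\<And>T. T \<in> lmeasurable \<Longrightarrow> T \<subseteq> {a..b} \<Longrightarrow> measure lebesgue T < \<delta> \<Longrightarrow>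
      integral T (\<lambda>x. \<bar>g x\<bar>) < e"
    using integral_small_on_small_sets[OF g _ \<open>0 < e\<close>] by auto
  have "(\<Sum>k\<in>d. \<bar>f (Sup k) - f (Inf k)\<bar>) < e"
    if d: "d division_of T" and T: "T \<subseteq> {a..b}" and m: "(\<Sum>k\<in>d. measure lborel k) < \<delta>" for d T
  proof -
    have Tm: "T \<in> lmeasurable"
      using division_ofD(1,4,6)[OF d] by (metis compact_Union compact_cbox lmeasurable_compact)
    have gi: "(\<lambda>x. \<bar>g x\<bar>) absolutely_integrable_on {a..b}"
      using absolutely_integrable_norm[OF g] by (simp add: o_def)
    have gT: "(\<lambda>x. \<bar>g x\<bar>) integrable_on T"
      using set_integrable_subset[OF gi _ T] Tm set_lebesgue_integral_eq_integral(1) by blast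
    have "(\<Sum>k\<in>d. \<bar>f (Sup k) - f (Inf k)\<bar>) \<le> (\<Sum>k\<in>d. integral k (\<lambda>x. \<bar>g x\<bar>))"
    proof (rule sum_mono)
      fix k assume k: "k \<in> d"
      obtain u v where uv: "k = {u..v}" "u \<le> v"
        using division_ofD(3,4)[OF d k] by auto
      have sub: "{u..v} \<subseteq> {a..b}" using division_ofD(2)[OF d k] T uv(1) by blast
      have "\<bar>f (Sup k) - f (Inf k)\<bar> = norm (integral {u..v} g)"
        using f[of u v] atLeastatMost_subset_iff[of u v a b] sub uv by simp
      also have "\<dots> \<le> integral {u..v} (\<lambda>x. \<bar>g x\<bar>)"
        by (rule integral_norm_bound_integral)
          (use set_integrable_subset[OF gi _ sub] set_integrable_subset[OF g _ sub]
            set_lebesgue_integral_eq_integral(1) in auto)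
      finally show "\<bar>f (Sup k) - f (Inf k)\<bar> \<le> integral k (\<lambda>x. \<bar>g x\<bar>)" by (simp add: uv)
    qed
    also have "\<dots> = integral T (\<lambda>x. \<bar>g x\<bar>)"
      by (rule integral_combine_division_topdown[OF gT d, symmetric])
    also have "\<dots> < e"
      using \<delta>(2)[OF Tm T] m measure_division[OF d] by simp
    finally show ?thesis .
  qed
  then show "\<exists>\<delta>>0. \<forall>d T. d division_of T \<and> T \<subseteq> {a..b} \<and> (\<Sum>k\<in>d. measure lborel k) < \<delta> \<longrightarrow>
       (\<Sum>k\<in>d. \<bar>f (Sup k) - f (Inf k)\<bar>) < e"
    using \<delta>(1) by blast
qed

lemma abs_cont_on_subset: "abs_cont_on S f \<Longrightarrow> T \<subseteq> S \<Longrightarrow> abs_cont_on T f"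
  unfolding abs_cont_on_def by (meson order_trans)

lemma abs_cont_on_uminus: "abs_cont_on S f \<Longrightarrow> abs_cont_on S (\<lambda>x. - f x)"
  unfolding abs_cont_on_def by (simp add: abs_minus_commute)

lemma abs_cont_on_add:
  assumes "abs_cont_on S f" "abs_cont_on S g"
  shows "abs_cont_on S (\<lambda>x. f x + g x)"
  unfolding abs_cont_on_def
proof (intro allI impI)
  fix e :: real assume "0 < e"
  then have e: "0 < e / 2" by simp
  obtain d1 where d1: "0 < d1" "\<And>d T. d division_of T \<Longrightarrow> T \<subseteq> S \<Longrightarrow> (\<Sum>k\<in>d. measure lborel k) < d1
        \<Longrightarrow> (\<Sum>k\<in>d. \<bar>f (Sup k) - f (Inf k)\<bar>) < e / 2"
    using assms(1) e unfolding abs_cont_on_def by meson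
  obtain d2 where d2: "0 < d2" "\<And>d T. d division_of T \<Longrightarrow> T \<subseteq> S \<Longrightarrow> (\<Sum>k\<in>d. measure lborel k) < d2
        \<Longrightarrow> (\<Sum>k\<in>d. \<bar>g (Sup k) - g (Inf k)\<bar>) < e / 2"
    using assms(2) e unfolding abs_cont_on_def by meson
  have "(\<Sum>k\<in>d. \<bar>f (Sup k) + g (Sup k) - (f (Inf k) + g (Inf k))\<bar>) < e"
    if d: "d division_of T" "T \<subseteq> S" "(\<Sum>k\<in>d. measure lborel k) < min d1 d2" for d T
  proof -
    have "(\<Sum>k\<in>d. \<bar>f (Sup k) + g (Sup k) - (f (Inf k) + g (Inf k))\<bar>) \<le>
          (\<Sum>k\<in>d. \<bar>f (Sup k) - f (Inf k)\<bar> + \<bar>g (Sup k) - g (Inf k)\<bar>)"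
      by (rule sum_mono) arith
    also have "\<dots> < e"
      using d1(2)[OF d(1,2)] d2(2)[OF d(1,2)] d(3) by (simp add: sum.distrib)
    finally show ?thesis .
  qed
  then show "\<exists>\<delta>>0. \<forall>d T. d division_of T \<and> T \<subseteq> S \<and> (\<Sum>k\<in>d. measure lborel k) < \<delta> \<longrightarrow>
       (\<Sum>k\<in>d. \<bar>f (Sup k) + g (Sup k) - (f (Inf k) + g (Inf k))\<bar>) < e"
    using d1(1) d2(1) by (intro exI[of _ "min d1 d2"]) auto
qed

lemma abs_cont_on_mult:
  assumes f: "abs_cont_on S f" and g: "abs_cont_on S g"
    and bf: "\<And>x. x \<in> S \<Longrightarrow> \<bar>f x\<bar> \<le> M" and bg: "\<And>x. x \<in> S \<Longrightarrow> \<bar>g x\<bar> \<le> M"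
  shows "abs_cont_on S (\<lambda>x. f x * g x)"
  unfolding abs_cont_on_def
proof (intro allI impI)
  fix e :: real assume "0 < e"
  \<comment> \<open>The bound is enlarged to a positive number, since it is divided by.\<close>
  define N where "N = \<bar>M\<bar> + 1"
  have N: "0 < N" "M \<le> N" by (auto simp: N_def)
  then have e: "0 < e / (2 * N)" using \<open>0 < e\<close> by simp
  obtain d1 where d1: "0 < d1" "\<And>d T. d division_of T \<Longrightarrow> T \<subseteq> S \<Longrightarrow> (\<Sum>k\<in>d. measure lborel k) < d1
        \<Longrightarrow> (\<Sum>k\<in>d. \<bar>f (Sup k) - f (Inf k)\<bar>) < e / (2 * N)"
    using f e unfolding abs_cont_on_def by meson
  obtain d2 where d2: "0 < d2" "\<And>d T. d division_of T \<Longrightarrow> T \<subseteq> S \<Longrightarrow> (\<Sum>k\<in>d. measure lborel k) < d2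
        \<Longrightarrow> (\<Sum>k\<in>d. \<bar>g (Sup k) - g (Inf k)\<bar>) < e / (2 * N)"
    using g e unfolding abs_cont_on_def by meson
  have "(\<Sum>k\<in>d. \<bar>f (Sup k) * g (Sup k) - f (Inf k) * g (Inf k)\<bar>) < e"
    if d: "d division_of T" "T \<subseteq> S" "(\<Sum>k\<in>d. measure lborel k) < min d1 d2" for d T
  proof -
    have "(\<Sum>k\<in>d. \<bar>f (Sup k) * g (Sup k) - f (Inf k) * g (Inf k)\<bar>) \<le>
          (\<Sum>k\<in>d. N * \<bar>f (Sup k) - f (Inf k)\<bar> + N * \<bar>g (Sup k) - g (Inf k)\<bar>)"
    proof (rule sum_mono)
      fix k assume k: "k \<in> d"
      obtain u v where uv: "k = {u..v}" "u \<le> v"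
        using division_ofD(3,4)[OF d(1) k] by auto
      have "k \<subseteq> S" using division_ofD(2)[OF d(1) k] d(2) by auto
      then have uvS: "u \<in> S" "v \<in> S" using uv by auto
      have "f v * g v - f u * g u = (f v - f u) * g v + f u * (g v - g u)"
        by (simp add: algebra_simps)
      then have "\<bar>f v * g v - f u * g u\<bar> \<le> \<bar>f v - f u\<bar> * \<bar>g v\<bar> + \<bar>f u\<bar> * \<bar>g v - g u\<bar>"
        by (metis abs_mult abs_triangle_ineq)
      also have "\<dots> \<le> \<bar>f v - f u\<bar> * N + N * \<bar>g v - g u\<bar>"
        using bg[OF uvS(2)] bf[OF uvS(1)] N
        by (intro add_mono mult_left_mono mult_right_mono) auto
      finally show "\<bar>f (Sup k) * g (Sup k) - f (Inf k) * g (Inf k)\<bar> \<le>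
          N * \<bar>f (Sup k) - f (Inf k)\<bar> + N * \<bar>g (Sup k) - g (Inf k)\<bar>"
        using uv by (simp add: mult.commute)
    qed
    also have "\<dots> = N * (\<Sum>k\<in>d. \<bar>f (Sup k) - f (Inf k)\<bar>) + N * (\<Sum>k\<in>d. \<bar>g (Sup k) - g (Inf k)\<bar>)"
      by (simp add: sum.distrib sum_distrib_left)
    also have "\<dots> < N * (e / (2 * N)) + N * (e / (2 * N))"
      using d1(2)[OF d(1,2)] d2(2)[OF d(1,2)] d(3) N
      by (intro add_strict_mono mult_strict_left_mono) auto
    also have "\<dots> = e" using N by (simp add: field_simps)
    finally show ?thesis .
  qed
  then show "\<exists>\<delta>>0. \<forall>d T. d division_of T \<and> T \<subseteq> S \<and> (\<Sum>k\<in>d. measure lborel k) < \<delta> \<longrightarrow>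
       (\<Sum>k\<in>d. \<bar>f (Sup k) * g (Sup k) - f (Inf k) * g (Inf k)\<bar>) < e"
    using d1(1) d2(1) by (intro exI[of _ "min d1 d2"]) auto
qed

lemma abs_cont_on_linear: "abs_cont_on {a..b} (\<lambda>x. c * x)"
proof (rule abs_cont_on_integral[where g = "\<lambda>_. c"])
  show "(\<lambda>_. c) absolutely_integrable_on {a..b}"
    using absolutely_integrable_continuous_real[OF continuous_on_const] .
qed (simp add: algebra_simps)

lemma abs_cont_on_imp_continuous:
  assumes "abs_cont_on {a..b} f"
  shows "continuous_on {a..b} f"
  unfolding continuous_on_iff
proof (intro ballI allI impI)
  fix x e :: real assume x: "x \<in> {a..b}" and "0 < e"
  obtain \<delta> where \<delta>: "0 < \<delta>" "\<And>d T. d division_of T \<Longrightarrow> T \<subseteq> {a..b} \<Longrightarrow> (\<Sum>k\<in>d. measure lborel k) < \<delta>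
        \<Longrightarrow> (\<Sum>k\<in>d. \<bar>f (Sup k) - f (Inf k)\<bar>) < e"
    using assms \<open>0 < e\<close> unfolding abs_cont_on_def by meson
  have *: "\<bar>f v - f u\<bar> < e" if "u \<le> v" "a \<le> u" "v \<le> b" "v - u < \<delta>" for u v
  proof -
    have "{{u..v}} division_of {u..v}"
      using that(1) by (metis box_real(2) cbox_interval division_of_self atLeastatMost_empty_iff2 order.strict_iff_not)
    from \<delta>(2)[OF this] that show ?thesis by auto
  qed
  have "dist (f y) (f x) < e" if "y \<in> {a..b}" "dist y x < \<delta>" for y
    using *[of x y] *[of y x] that x by (cases "x \<le> y") (auto simp: dist_real_def abs_minus_commute)
  then show "\<exists>d>0. \<forall>y\<in>{a..b}. dist y x < d \<longrightarrow> dist (f y) (f x) < e"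
    using \<delta>(1) by blast
qed

section \<open>Lebesgue differentiation of indefinite integrals\<close>

lemma lebesgue_differentiation_half:
  fixes g :: "real \<Rightarrow> real"
  assumes g: "g absolutely_integrable_on {a..b}" and "p < q"
    and G: "\<And>x y. a \<le> x \<Longrightarrow> x \<le> y \<Longrightarrow> y \<le> b \<Longrightarrow> G y - G x = integral {x..y} g"
  shows "negligible {x \<in> {a<..<b}. g x < p \<and> 
           x \<in> straddled (\<lambda>s t. a < s \<and> t < b \<and> q * (t - s) < G t - G s)}"
    (is "negligible ?N")
  unfolding negligible_outer_le
proof (intro allI impI)
  fix e :: real assume "0 < e"
  \<comment> \<open>On \<open>E\<close> the integrand g - p is negative, and an open
    \<open>U\<close> containing \<open>E\<close> can be chosen with |g - p| of small integral over U
    - E. Disjoint intervals inside \<open>U\<close> over which \<open>G\<close> grows faster than q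
    then have small total length, because each contributes at least q - p times its length to that
    integral. By Vitali they cover the exceptional set up to a small remainder.\<close>
  define E where "E = {x \<in> {a<..<b}. g x < p}"
  have gm: "g \<in> borel_measurable (lebesgue_on {a<..<b})"
    using absolutely_integrable_measurable[of "{a<..<b}"] g absolutely_integrable_on_Icc_iff_Ioo by auto
  then have Em: "E \<in> sets lebesgue"
  proof -
    have "{x \<in> space (lebesgue_on {a<..<b}). g x < p} \<in> sets (lebesgue_on {a<..<b})"
      using gm by measurable
    then show ?thesis by (simp add: E_def sets_restrict_space_iff)
  qed
  have Nm: "?N \<in> sets lebesgue"
  proof -
    have "?N = E \<inter> straddled (\<lambda>s t. a < s \<and> t < b \<and> q * (t - s) < G t - G s)"
      by (auto simp: E_def)
    then show ?thesis using Em straddled_borel by (auto intro!: sets.Int)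
  qed
  have gp: "(\<lambda>x. g x - p) absolutely_integrable_on {a..b}"
    by (intro set_integral_diff g absolutely_integrable_continuous_real continuous_on_const)
  \<comment> \<open>Divided by q - p this leaves e / 2; the other half is for the points missed by
    the Vitali intervals.\<close>
  define \<eta> where "\<eta> = (q - p) * e / 2"
  have "0 < \<eta>" using \<open>0 < e\<close> \<open>p < q\<close> by (simp add: \<eta>_def)
  obtain \<delta> where \<delta>: "0 < \<delta>" "\<And>T. T \<in> lmeasurable \<Longrightarrow> T \<subseteq> {a..b} \<Longrightarrow> measure lebesgue T < \<delta> \<Longrightarrow>
      integral T (\<lambda>x. \<bar>g x - p\<bar>) < \<eta>"
    using integral_small_on_small_sets[OF gp _ \<open>0 < \<eta>\<close>] by auto
  obtain V where V: "open V" "E \<subseteq> V" "V - E \<in> lmeasurable" "emeasure lebesgue (V - E) < ennreal \<delta>"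
    using sets_lebesgue_outer_open[OF Em \<delta>(1)] by blast
  define U where "U = V \<inter> {a<..<b}"
  have U: "open U" "E \<subseteq> U" "U \<subseteq> {a<..<b}" using V by (auto simp: U_def E_def)
  have Um: "U \<in> lmeasurable"
    unfolding U_def using V(1) by (intro lmeasurable_open bounded_Int) auto
  have UE: "U - E \<in> lmeasurable" "measure lebesgue (U - E) < \<delta>"
  proof -
    show 1: "U - E \<in> lmeasurable"
      by (rule fmeasurableI2[OF Um]) (use Em Um in \<open>auto simp: fmeasurableD\<close>)
    have "measure lebesgue (U - E) \<le> measure lebesgue (V - E)"
      by (rule measure_mono_fmeasurable) (use V 1 in \<open>auto simp: U_def\<close>)
    also have "\<dots> < \<delta>"
      using V(3,4) \<delta>(1) by (metis emeasure_eq_measure2 ennreal_less_iff measure_nonneg)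
    finally show "measure lebesgue (U - E) < \<delta>" .
  qed
  define P where "P s t \<longleftrightarrow> {s..t} \<subseteq> U \<and> s < t \<and> q * (t - s) < G t - G s" for s t
  obtain D where D: "disjoint_ivls D" "\<And>i. i \<in> D \<Longrightarrow> P (fst i) (snd i)"
    "ivls D \<subseteq> U" "measure lebesgue (?N - ivls D) < e / 2"
  proof (rule vitali_finite[OF Nm Um, of "e / 2" P])
    show "?N \<subseteq> U" using U(2) by (auto simp: E_def)
    show "0 < e / 2" using \<open>0 < e\<close> by simp
    fix x d :: real assume x: "x \<in> ?N" and "0 < d"
    then have "x \<in> U" using U(2) by (auto simp: E_def)
    then obtain r where r: "0 < r" "ball x r \<subseteq> U" using U(1) openE by blast
    obtain s t where st: "s < x" "x < t" "t - s < min d r" "a < s \<and> t < b \<and> q * (t - s) < G t - G s"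
      using straddledD[of x _ "min d r"] x \<open>0 < d\<close> r(1) by (metis (no_types, lifting) mem_Collect_eq min_less_iff_conj)
    have "{s..t} \<subseteq> ball x r" using st by (auto simp: dist_real_def)
    then show "\<exists>s t. s \<le> x \<and> x \<le> t \<and> s < t \<and> t - s < d \<and> P s t"
      using st r by (intro exI[of _ s] exI[of _ t]) (auto simp: P_def)
  qed (auto simp: P_def)
  have fin: "finite D" using D(1) by (simp add: disjoint_ivls_def)
  \<comment> \<open>\<open>h\<close> dominates g - p on \<open>U\<close> and vanishes on
    \<open>E\<close>, so its integral over \<open>U\<close> is the small one.\<close>
  define h where "h x = (if x \<in> E then 0 else \<bar>g x - p\<bar>)" for x
  have hi: "(h has_integral integral (U - E) (\<lambda>x. \<bar>g x - p\<bar>)) U"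
  proof -
    have "(\<lambda>x. \<bar>g x - p\<bar>) absolutely_integrable_on {a..b}"
      using absolutely_integrable_norm[OF gp] by (simp add: o_def)
    then have "(\<lambda>x. \<bar>g x - p\<bar>) integrable_on (U - E)"
      using set_integrable_subset[of lebesgue "{a..b}" _ "U - E"] UE(1) U(3) 
        set_lebesgue_integral_eq_integral(1) by (metis (no_types, lifting) Diff_subset fmeasurableD greaterThanLessThan_subseteq_atLeastAtMost_iff order_refl order_trans)
    then have "((\<lambda>x. \<bar>g x - p\<bar>) has_integral integral (U - E) (\<lambda>x. \<bar>g x - p\<bar>)) (U - E)"
      by (rule integrable_integral)
    then have "((\<lambda>x. if x \<in> U - E then \<bar>g x - p\<bar> else 0) has_integral integral (U - E) (\<lambda>x. \<bar>g x - p\<bar>)) U"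
      by (subst has_integral_restrict) auto
    then show ?thesis
      by (rule has_integral_eq[rotated]) (auto simp: h_def)
  qed
  have hI: "h integrable_on {fst i..snd i}" and lower: "(q - p) * (snd i - fst i) \<le> integral {fst i..snd i} h" 
    if i: "i \<in> D" for i
  proof -
    have iU: "{fst i..snd i} \<subseteq> U" and i2: "fst i < snd i" "q * (snd i - fst i) < G (snd i) - G (fst i)"
      using D(2)[OF i] by (auto simp: P_def)
    have "fst i \<in> {fst i..snd i}" "snd i \<in> {fst i..snd i}" using i2(1) by auto
    then have "fst i \<in> {a<..<b}" "snd i \<in> {a<..<b}" using iU U(3) by blast+
    then have ab: "a \<le> fst i" "snd i \<le> b" by auto
    show hI: "h integrable_on {fst i..snd i}"
      using integrable_on_subcbox[of h U "fst i" "snd i"] hi iU by auto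
    have gI: "g integrable_on {fst i..snd i}"
      using integrable_on_subcbox[of g "{a..b}" "fst i" "snd i"] g ab set_lebesgue_integral_eq_integral(1) by auto
    have "(q - p) * (snd i - fst i) \<le> integral {fst i..snd i} g - p * (snd i - fst i)"
      using i2 G[of "fst i" "snd i"] ab by (simp add: algebra_simps)
    also have "\<dots> = integral {fst i..snd i} (\<lambda>x. g x - p)"
      using i2 by (subst integral_diff[OF gI]) (auto simp: mult.commute)
    also have "\<dots> \<le> integral {fst i..snd i} h"
      by (rule integral_le) (use hI gI iU in \<open>auto intro!: integrable_diff simp: h_def E_def\<close>)
    finally show "(q - p) * (snd i - fst i) \<le> integral {fst i..snd i} h" .
  qed
  have hu: "(h has_integral (\<Sum>i\<in>D. integral {fst i..snd i} h)) (ivls D)"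
    unfolding ivls_def
    by (rule has_integral_UN[OF fin]) 
      (use hI disjoint_ivls_disjoint[OF D(1)] in \<open>auto simp: pairwise_def intro: integrable_integral\<close>)
  have "(q - p) * measure lebesgue (ivls D) = (\<Sum>i\<in>D. (q - p) * (snd i - fst i))"
    unfolding measure_ivls[OF D(1)] by (simp add: sum_distrib_left)
  also have "\<dots> \<le> (\<Sum>i\<in>D. integral {fst i..snd i} h)"
    by (rule sum_mono) (rule lower)
  also have "\<dots> \<le> integral (U - E) (\<lambda>x. \<bar>g x - p\<bar>)"
    using has_integral_subset_le[OF D(3) hu hi] by (auto simp: h_def)
  also have "\<dots> < \<eta>"
    by (rule \<delta>(2)[OF UE(1) _ UE(2)]) (use U(3) in auto)
  finally have "(q - p) * measure lebesgue (ivls D) < (q - p) * (e / 2)"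
    by (simp add: \<eta>_def)
  then have "measure lebesgue (ivls D) < e / 2"
    using \<open>p < q\<close> by simp
  have NUm: "?N \<in> lmeasurable"
    by (rule fmeasurableI2[OF Um _ Nm]) (use U(2) in \<open>auto simp: E_def\<close>)
  have Dm: "ivls D \<in> lmeasurable" "?N - ivls D \<in> lmeasurable"
    using ivls_lmeasurable[OF D(1)] fmeasurable.Diff[OF NUm] by auto
  have "measure lebesgue ((?N - ivls D) \<union> ivls D) \<le> measure lebesgue (?N - ivls D) + measure lebesgue (ivls D)"
    by (rule measure_Un_le) (use Dm in auto)
  then have "measure lebesgue ((?N - ivls D) \<union> ivls D) \<le> e"
    using D(4) \<open>measure lebesgue (ivls D) < e / 2\<close> by linarith
  then show "\<exists>T. ?N \<subseteq> T \<and> T \<in> lmeasurable \<and> measure lebesgue T \<le> e"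
    using fmeasurable.Un[OF Dm(2,1)] by (intro exI[of _ "(?N - ivls D) \<union> ivls D"] conjI) blast+
qed

lemma not_straddled_lessD:
  "x \<notin> straddled (\<lambda>s t. C s \<and> C' t \<and> A s t < (B s t :: real)) \<Longrightarrow>
     \<exists>d>0. \<forall>s t. s < x \<longrightarrow> x < t \<longrightarrow> t - s < d \<longrightarrow> C s \<longrightarrow> C' t \<longrightarrow> B s t \<le> A s t"
  by (drule not_straddledD) (simp add: not_less, blast)

lemma indefinite_integral_continuous_at:
  fixes g :: "real \<Rightarrow> real"
  assumes g: "g absolutely_integrable_on {a..b}" and x: "x \<in> {a<..<b}"
    and G: "\<And>x y. a \<le> x \<Longrightarrow> x \<le> y \<Longrightarrow> y \<le> b \<Longrightarrow> G y - G x = integral {x..y} g"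
  shows "isCont G x"
  using continuous_on_interior[OF abs_cont_on_imp_continuous[OF abs_cont_on_integral[OF g G]], of x] x
  by simp

text \<open>Exceptional points are sorted by rational pairs p < q, which keeps the union countable.
  The lower bound for the difference quotients is the upper bound for -G.\<close>

theorem lebesgue_differentiation:
  fixes g :: "real \<Rightarrow> real"
  assumes g: "g absolutely_integrable_on {a..b}"
    and G: "\<And>x y. a \<le> x \<Longrightarrow> x \<le> y \<Longrightarrow> y \<le> b \<Longrightarrow> G y - G x = integral {x..y} g"
  obtains N where "negligible N" "\<And>x. x \<in> {a<..<b} - N \<Longrightarrow> (G has_real_derivative g x) (at x)"
proof -
  define up where "up p q = {x \<in> {a<..<b}. g x < p \<and> 
           x \<in> straddled (\<lambda>s t. a < s \<and> t < b \<and> q * (t - s) < G t - G s)}" for p q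
  define dn where "dn p q = {x \<in> {a<..<b}. - g x < p \<and> 
           x \<in> straddled (\<lambda>s t. a < s \<and> t < b \<and> q * (t - s) < - G t - - G s)}" for p q
  define N where "N = (\<Union>(p, q) \<in> {(p, q). p \<in> \<rat> \<and> q \<in> \<rat> \<and> p < q}. up p q \<union> dn p q)"
  have upN: "up p q \<subseteq> N" and dnN: "dn p q \<subseteq> N" if "p \<in> \<rat>" "q \<in> \<rat>" "p < q" for p q
    using that unfolding N_def by blast+
  have "negligible (up p q)" if "p < q" for p q
    unfolding up_def by (rule lebesgue_differentiation_half[OF g that G])
  moreover have "negligible (dn p q)" if "p < q" for p q
    unfolding dn_def
  proof (rule lebesgue_differentiation_half[where g = "\<lambda>x. - g x" and G = "\<lambda>x. - G x", OF _ that])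
    show "(\<lambda>x. - g x) absolutely_integrable_on {a..b}"
      using absolutely_integrable_scaleR_left[OF g, of "-1"] by simp
    show "- G y - - G x = integral {x..y} (\<lambda>x. - g x)" if "a \<le> x" "x \<le> y" "y \<le> b" for x y
      using G[OF that] by simp
  qed
  moreover have "countable {(p, q). p \<in> \<rat> \<and> q \<in> \<rat> \<and> p < (q::real)}"
    by (rule countable_subset[of _ "\<rat> \<times> \<rat>"]) (auto intro: countable_rat)
  ultimately have "negligible N"
    unfolding N_def by (intro negligible_countable_Union[of "(\<lambda>(p, q). up p q \<union> dn p q) ` _"]) (auto intro: negligible_Un)
  moreover have "(G has_real_derivative g x) (at x)" if x: "x \<in> {a<..<b} - N" for x
  proof (rule straddle_has_derivative)
    show "isCont G x"
      by (rule indefinite_integral_continuous_at[OF g _ G]) (use x in auto)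
    fix e :: real assume "0 < e"
    \<comment> \<open>Two rationals are fitted into (g x, g x + e): the smaller certifies g x < p,
      and as x escapes \<open>up p q\<close>, the larger bounds the difference quotients.\<close>
    obtain p where p: "p \<in> \<rat>" "g x < p" "p < g x + e / 2"
      using Rats_dense_in_real[of "g x" "g x + e / 2"] \<open>0 < e\<close> by auto
    obtain q where q: "q \<in> \<rat>" "g x + e / 2 < q" "q < g x + e"
      using Rats_dense_in_real[of "g x + e / 2" "g x + e"] \<open>0 < e\<close> by auto
    have "x \<notin> up p q"
      using x upN[of p q] p q by auto
    then have ns: "x \<notin> straddled (\<lambda>s t. a < s \<and> t < b \<and> q * (t - s) < G t - G s)"
      using x p by (auto simp: up_def)
    from not_straddled_lessD[OF ns] obtain d1 where d1: "d1 > 0" "\<And>s t. s < x \<Longrightarrow> x < t \<Longrightarrow> t - s < d1 \<Longrightarrow> a < s \<Longrightarrow> t < b \<Longrightarrow> G t - G s \<le> q * (t - s)"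
      by blast
    obtain p' where p': "p' \<in> \<rat>" "- g x < p'" "p' < - g x + e / 2"
      using Rats_dense_in_real[of "- g x" "- g x + e / 2"] \<open>0 < e\<close> by auto
    obtain q' where q': "q' \<in> \<rat>" "- g x + e / 2 < q'" "q' < - g x + e"
      using Rats_dense_in_real[of "- g x + e / 2" "- g x + e"] \<open>0 < e\<close> by auto
    have "x \<notin> dn p' q'"
      using x dnN[of p' q'] p' q' by auto
    then have ns: "x \<notin> straddled (\<lambda>s t. a < s \<and> t < b \<and> q' * (t - s) < - G t - - G s)"
      using x p' by (auto simp: dn_def)
    from not_straddled_lessD[OF ns] obtain d2 where d2: "d2 > 0" "\<And>s t. s < x \<Longrightarrow> x < t \<Longrightarrow> t - s < d2 \<Longrightarrow> a < s \<Longrightarrow> t < b \<Longrightarrow> - G t - - G s \<le> q' * (t - s)"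
      by blast
    define d where "d = Min {d1, d2, x - a, b - x}"
    have "0 < d" using d1(1) d2(1) x by (simp add: d_def)
    moreover have "\<bar>G t - G s - g x * (t - s)\<bar> \<le> e * (t - s)" if st: "s < x" "x < t" "t - s < d" for s t
    proof -
      have ab: "a < s" "t < b" "t - s < d1" "t - s < d2" using st by (auto simp: d_def)
      have "G t - G s \<le> q * (t - s)" using d1(2) st ab by blast
      also have "\<dots> \<le> (g x + e) * (t - s)" using q st by (intro mult_right_mono) auto
      finally have 1: "G t - G s \<le> (g x + e) * (t - s)" .
      have "- G t - - G s \<le> q' * (t - s)" using d2(2) st ab by blast
      also have "\<dots> \<le> (- g x + e) * (t - s)" using q' st by (intro mult_right_mono) auto
      finally have 2: "- G t - - G s \<le> (- g x + e) * (t - s)" .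
      show ?thesis using 1 2 by (simp add: abs_le_iff algebra_simps)
    qed
    ultimately show "\<exists>d>0. \<forall>s t. s < x \<longrightarrow> x < t \<longrightarrow> t - s < d \<longrightarrow> \<bar>G t - G s - g x * (t - s)\<bar> \<le> e * (t - s)"
      by blast
  qed
  ultimately show ?thesis using that by blast
qed

section \<open>The fundamental theorem of calculus for absolutely continuous functions\<close>

lemma sum_division_increments:
  fixes f :: "real \<Rightarrow> real"
  assumes "d division_of {a..b}" "a \<le> b"
  shows "(\<Sum>k\<in>d. f (Sup k) - f (Inf k)) = f b - f a"
proof -
  let ?tag = "\<lambda>k. (Inf k, k) :: real \<times> real set"
  have ne: "Inf k \<in> k" if "k \<in> d" for k
    using division_ofD(3,4)[OF assms(1) that] by auto
  have "?tag ` d tagged_division_of {a..b}"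
  proof (rule tagged_division_ofI)
    show "finite (?tag ` d)" using division_ofD(1)[OF assms(1)] by simp
    show "\<And>x K. (x, K) \<in> ?tag ` d \<Longrightarrow> x \<in> K" using ne by auto
    show "\<And>x K. (x, K) \<in> ?tag ` d \<Longrightarrow> K \<subseteq> {a..b}" using division_ofD(2)[OF assms(1)] by auto
    show "\<And>x K. (x, K) \<in> ?tag ` d \<Longrightarrow> \<exists>a b. K = cbox a b" using division_ofD(4)[OF assms(1)] by auto
    show "interior K1 \<inter> interior K2 = {}" 
      if "(x1, K1) \<in> ?tag ` d" "(x2, K2) \<in> ?tag ` d" "(x1, K1) \<noteq> (x2, K2)" for x1 K1 x2 K2
      using that division_ofD(5)[OF assms(1), of K1 K2] by auto
    show "\<Union> {K. \<exists>x. (x, K) \<in> ?tag ` d} = {a..b}"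
      using division_ofD(6)[OF assms(1)] by (auto simp: image_iff)
  qed
  then have "(\<Sum>(x, K)\<in>?tag ` d. f (Sup K) - f (Inf K)) = f b - f a"
    using additive_tagged_division_1[OF assms(2)] by blast
  moreover have "(\<Sum>(x, K)\<in>?tag ` d. f (Sup K) - f (Inf K)) = (\<Sum>k\<in>d. f (Sup k) - f (Inf k))"
    by (subst sum.reindex) (auto simp: inj_on_def)
  ultimately show ?thesis by simp
qed

text \<open>A gauge argument. At a tag outside \<open>N\<close> the derivative controls the
  increment up to e' times the length of the interval. The intervals tagged in \<open>N\<close> lie
  in an open set of small measure, where absolute continuity makes the sum of the increments
  small.\<close>

theorem abs_cont_on_has_integral_derivative:
  fixes f k :: "real \<Rightarrow> real"
  assumes ac: "abs_cont_on {a..b} f" and "a \<le> b" and N: "negligible N"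
    and der: "\<And>x. x \<in> {a..b} - N \<Longrightarrow> (f has_real_derivative k x) (at x within {a..b})"
  shows "(k has_integral (f b - f a)) {a..b}"
proof -
  \<comment> \<open>With the value 0 on \<open>N\<close>, a tag in \<open>N\<close> contributes only
    the increment of f over its interval; the integral does not change.\<close>
  define k' where "k' x = (if x \<in> N then 0 else k x)" for x
  have "(k' has_integral (f b - f a)) {a..b}"
    unfolding has_integral_real
  proof (intro allI impI)
    fix e :: real assume "0 < e"
    \<comment> \<open>Over intervals of total length b - a this adds up to at most e / 2; the added
      1 guards against a = b.\<close>
    define e' where "e' = e / (2 * (b - a + 1))"
    have e': "0 < e'" using \<open>0 < e\<close> \<open>a \<le> b\<close> by (simp add: e'_def)
    have e2: "0 < e / 2" using \<open>0 < e\<close> by simp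
    obtain \<delta> where \<delta>: "0 < \<delta>" "\<And>d T. d division_of T \<Longrightarrow> T \<subseteq> {a..b} \<Longrightarrow> (\<Sum>k\<in>d. measure lborel k) < \<delta>
        \<Longrightarrow> (\<Sum>k\<in>d. \<bar>f (Sup k) - f (Inf k)\<bar>) < e / 2"
      using ac e2 unfolding abs_cont_on_def by meson
    obtain U where U: "open U" "N \<subseteq> U" "U \<in> lmeasurable" "measure lebesgue U < \<delta>"
    proof -
      have Ns: "N \<in> sets lebesgue" "emeasure lebesgue N = 0"
        using N by (auto simp: negligible_iff_null_sets)
      obtain V where V: "open V" "N \<subseteq> V" "V - N \<in> lmeasurable" "emeasure lebesgue (V - N) < ennreal \<delta>"
        using sets_lebesgue_outer_open[OF Ns(1) \<delta>(1)] by blast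
      have VN: "V = (V - N) \<union> N" using V(2) by auto
      have Nl: "N \<in> lmeasurable" using N negligible_imp_measurable by blast
      have Vl: "V \<in> lmeasurable" using fmeasurable.Un[OF V(3) Nl] VN by simp
      have "measure lebesgue V \<le> measure lebesgue (V - N) + measure lebesgue N"
        using measure_Un_le[of "V - N" lebesgue N] V(3) Nl VN by (metis fmeasurableD)
      also have "measure lebesgue N = 0" using N negligible_imp_measure0 by blast
      also have "measure lebesgue (V - N) + 0 < \<delta>"
        using V(3,4) \<delta>(1) by (metis add.right_neutral emeasure_eq_measure2 ennreal_less_iff measure_nonneg)
      finally show ?thesis using that V Vl by blast
    qed
    have "\<exists>r>0. (x \<in> N \<longrightarrow> ball x r \<subseteq> U) \<and> (x \<in> {a..b} - N \<longrightarrow> (\<forall>y\<in>{a..b}. \<bar>y - x\<bar> < r \<longrightarrow> 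
            \<bar>f y - f x - k x * (y - x)\<bar> \<le> e' * \<bar>y - x\<bar>))" for x
    proof (cases "x \<in> N")
      case True
      then show ?thesis using U(1,2) openE by blast
    next
      case False
      show ?thesis
      proof (cases "x \<in> {a..b}")
        case True
        have "(f has_derivative (*) (k x)) (at x within {a..b})"
          using der[of x] True False by (simp add: has_field_derivative_def)
        then obtain r where "r > 0" "\<forall>y\<in>{a..b}. norm (y - x) < r \<longrightarrow> norm (f y - f x - k x * (y - x)) \<le> e' * norm (y - x)"
          using e' unfolding has_derivative_within_alt by blast
        then show ?thesis using False by auto
      next
        case F: False
        then show ?thesis using False by (intro exI[of _ 1]) auto
      qed
    qed
    then obtain r where r: "\<And>x. 0 < r x" "\<And>x. x \<in> N \<Longrightarrow> ball x (r x) \<subseteq> U"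
      "\<And>x y. x \<in> {a..b} - N \<Longrightarrow> y \<in> {a..b} \<Longrightarrow> \<bar>y - x\<bar> < r x \<Longrightarrow> \<bar>f y - f x - k x * (y - x)\<bar> \<le> e' * \<bar>y - x\<bar>"
      by metis
    define \<gamma> where "\<gamma> x = ball x (r x)" for x
    have "gauge \<gamma>" using r(1) by (auto simp: gauge_def \<gamma>_def)
    moreover have "norm ((\<Sum>(x, K)\<in>p. measure lborel K *\<^sub>R k' x) - (f b - f a)) < e"
      if p: "p tagged_division_of {a..b}" and fine: "\<gamma> fine p" for p
    proof -
      have fin: "finite p" using p by blast
      define q where "q = {z \<in> p. fst z \<in> N}"
      have qp: "q \<subseteq> p" by (auto simp: q_def)
      define \<Phi> where "\<Phi> = (\<lambda>(x, K). measure lborel K *\<^sub>R k' x - (f (Sup K) - f (Inf K)))"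
      have ivl: "\<exists>u v. K = {u..v} \<and> u \<le> x \<and> x \<le> v \<and> a \<le> u \<and> v \<le> b \<and> {u..v} \<subseteq> ball x (r x)" 
        if xK: "(x, K) \<in> p" for x K
      proof -
        obtain u v where uv: "K = {u..v}" using tagged_division_ofD(4)[OF p xK] by auto
        have "x \<in> K" "K \<subseteq> {a..b}" using tagged_division_ofD(2,3)[OF p xK] by auto
        moreover have "K \<subseteq> ball x (r x)" using fine xK by (auto simp: fine_def \<gamma>_def)
        ultimately show ?thesis unfolding uv by (intro exI[of _ u] exI[of _ v]) auto
      qed
      have "(\<Sum>(x, K)\<in>p. measure lborel K *\<^sub>R k' x) - (f b - f a) = sum \<Phi> p"
        unfolding \<Phi>_def using additive_tagged_division_1[OF \<open>a \<le> b\<close> p, of f]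
        by (simp add: sum_subtractf case_prod_unfold)
      also have "\<dots> = sum \<Phi> q + sum \<Phi> (p - q)"
        using sum.subset_diff[OF qp fin] by (simp add: add.commute)
      finally have split: "(\<Sum>(x, K)\<in>p. measure lborel K *\<^sub>R k' x) - (f b - f a) = sum \<Phi> q + sum \<Phi> (p - q)" .
      have "\<bar>sum \<Phi> (p - q)\<bar> \<le> (\<Sum>z\<in>p - q. \<bar>\<Phi> z\<bar>)" by (rule sum_abs)
      also have "\<dots> \<le> (\<Sum>z\<in>p - q. e' * measure lborel (snd z))"
      proof (rule sum_mono)
        fix z assume z: "z \<in> p - q"
        obtain x K where xK: "z = (x, K)" by (cases z)
        obtain u v where uv: "K = {u..v}" "u \<le> x" "x \<le> v" "a \<le> u" "v \<le> b" "{u..v} \<subseteq> ball x (r x)"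
          using ivl[of x K] z xK by auto
        have xN: "x \<in> {a..b} - N" using z xK uv by (auto simp: q_def)
        have "u \<in> {u..v}" "v \<in> {u..v}" using uv by auto
        then have "u \<in> ball x (r x)" "v \<in> ball x (r x)" using uv(6) by blast+
        then have "\<bar>u - x\<bar> < r x" "\<bar>v - x\<bar> < r x" by (auto simp: dist_real_def)
        then have "\<bar>f v - f x - k x * (v - x)\<bar> \<le> e' * \<bar>v - x\<bar>" "\<bar>f u - f x - k x * (u - x)\<bar> \<le> e' * \<bar>u - x\<bar>"
          using r(3)[OF xN, of u] r(3)[OF xN, of v] uv(2-5) by simp_all
        then have b: "\<bar>f v - f x - k x * (v - x)\<bar> \<le> e' * (v - x)" "\<bar>f u - f x - k x * (u - x)\<bar> \<le> e' * (x - u)"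
          using uv by auto
        have "\<Phi> z = (f u - f x - k x * (u - x)) - (f v - f x - k x * (v - x))"
          using xN uv by (simp add: \<Phi>_def xK k'_def algebra_simps)
        then have "\<bar>\<Phi> z\<bar> \<le> e' * (x - u) + e' * (v - x)" using b by linarith
        also have "\<dots> = e' * measure lborel (snd z)" using uv by (simp add: xK algebra_simps)
        finally show "\<bar>\<Phi> z\<bar> \<le> e' * measure lborel (snd z)" .
      qed
      also have "\<dots> \<le> (\<Sum>z\<in>p. e' * measure lborel (snd z))"
        by (rule sum_mono2[OF fin]) (use e' in auto)
      also have "\<dots> = e' * (b - a)"
      proof -
        have "p tagged_division_of cbox a b" using p by simp
        from additive_content_tagged_division[OF this] have "(\<Sum>z\<in>p. measure lborel (snd z)) = b - a"
          using \<open>a \<le> b\<close> by (simp add: case_prod_unfold)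
        then show ?thesis by (simp only: sum_distrib_left[symmetric])
      qed
      also have "\<dots> \<le> e / 2"
      proof -
        have "e' * (b - a) \<le> e' * (b - a + 1)" using e' by simp
        also have "\<dots> = e / 2" using \<open>a \<le> b\<close> by (simp add: e'_def field_simps)
        finally show ?thesis .
      qed
      finally have 1: "\<bar>sum \<Phi> (p - q)\<bar> \<le> e / 2" .
      have qt: "q tagged_partial_division_of {a..b}"
        using tagged_partial_division_subset[OF conjunct1[OF p[unfolded tagged_division_of_def]] qp] .
      have qu: "q tagged_division_of \<Union>(snd ` q)"
        using tagged_partial_division_of_Union_self[OF qt] .
      have qd: "snd ` q division_of \<Union>(snd ` q)"
        using division_of_tagged_division[OF qu] .
      have qU: "\<Union>(snd ` q) \<subseteq> U" "\<Union>(snd ` q) \<subseteq> {a..b}"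
      proof -
        have "K \<subseteq> U \<and> K \<subseteq> {a..b}" if "(x, K) \<in> q" for x K
        proof -
          have "(x, K) \<in> p" "x \<in> N" using that by (auto simp: q_def)
          then obtain u v where "K = {u..v}" "a \<le> u" "v \<le> b" "{u..v} \<subseteq> ball x (r x)" "ball x (r x) \<subseteq> U"
            using ivl[of x K] r(2)[of x] by blast
          then show ?thesis by auto
        qed
        then have "snd z \<subseteq> U \<and> snd z \<subseteq> {a..b}" if "z \<in> q" for z
          using that by (metis prod.collapse)
        then show "\<Union>(snd ` q) \<subseteq> U" "\<Union>(snd ` q) \<subseteq> {a..b}" by blast+
      qed
      have "\<bar>sum \<Phi> q\<bar> \<le> (\<Sum>z\<in>q. \<bar>\<Phi> z\<bar>)" by (rule sum_abs)
      also have "\<dots> = (\<Sum>(x, K)\<in>q. \<bar>f (Sup K) - f (Inf K)\<bar>)"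
        by (rule sum.cong) (auto simp: \<Phi>_def k'_def q_def)
      \<comment> \<open>Reindexing from tags to intervals needs the value 0 on every interval with
        empty interior. On the empty interval it is set by hand, as \<open>Sup\<close> and
        \<open>Inf\<close> of the empty set say nothing.\<close>
      also have "\<dots> = (\<Sum>(x, K)\<in>q. if K = {} then 0 else \<bar>f (Sup K) - f (Inf K)\<bar>)"
        by (rule sum.cong) (use tagged_division_ofD(2)[OF qu] in fastforce)+
      also have "\<dots> = (\<Sum>K\<in>snd ` q. if K = {} then 0 else \<bar>f (Sup K) - f (Inf K)\<bar>)"
      proof (rule sum.over_tagged_division_lemma[OF qu])
        fix u v :: real assume "box u v = {}"
        then have "v \<le> u" by simp
        then have "u = v \<or> v < u" by linarith
        then show "(if cbox u v = {} then 0 else \<bar>f (Sup (cbox u v)) - f (Inf (cbox u v))\<bar>) = 0" by auto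
      qed
      also have "\<dots> = (\<Sum>K\<in>snd ` q. \<bar>f (Sup K) - f (Inf K)\<bar>)"
        by (rule sum.cong) (use division_ofD(3)[OF qd] in auto)
      also have "\<dots> < e / 2"
      proof (rule \<delta>(2)[OF qd qU(2)])
        have "(\<Sum>K\<in>snd ` q. measure lborel K) = measure lebesgue (\<Union>(snd ` q))"
          by (rule measure_division[OF qd])
        also have "\<dots> \<le> measure lebesgue U"
        proof (rule measure_mono_fmeasurable[OF qU(1) _ U(3)])
          have "compact (\<Union>(snd ` q))"
            using division_ofD(1,4)[OF qd] by (metis compact_Union compact_cbox)
          then show "\<Union>(snd ` q) \<in> sets lebesgue" by (rule fmeasurableD[OF lmeasurable_compact])
        qed
        finally show "(\<Sum>K\<in>snd ` q. measure lborel K) < \<delta>" using U(4) by simp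
      qed
      finally have 2: "\<bar>sum \<Phi> q\<bar> < e / 2" .
      show ?thesis unfolding split real_norm_def using 1 2 by linarith
    qed
    ultimately show "\<exists>\<gamma>. gauge \<gamma> \<and> (\<forall>p. p tagged_division_of {a..b} \<and> \<gamma> fine p \<longrightarrow>
          norm ((\<Sum>(x, K)\<in>p. measure lborel K *\<^sub>R k' x) - (f b - f a)) < e)"
      by (intro exI[of _ \<gamma>] conjI allI impI) simp_all
  qed
  then show ?thesis
    using has_integral_spike_eq[OF N, of "{a..b}" k k'] by (simp add: k'_def)
qed

section \<open>Almost everywhere differentiability of absolutely continuous functions\<close>

lemma disjoint_ivls_complement:
  assumes E1: "disjoint_ivls E1" and E2: "disjoint_ivls E2"
    and sub: "\<forall>j\<in>E2. \<exists>i\<in>E1. {fst j..snd j} \<subseteq> {fst i..snd i}"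
  shows "\<exists>r. r division_of \<Union>r \<and> \<Union>r \<subseteq> ivls E1 \<and>
    (\<forall>f :: real \<Rightarrow> real. (\<Sum>k\<in>r. f (Sup k) - f (Inf k)) = 
        (\<Sum>i\<in>E1. f (snd i) - f (fst i)) - (\<Sum>j\<in>E2. f (snd j) - f (fst j)))"
proof -
  let ?I = "\<lambda>j::real \<times> real. {fst j..snd j}"
  have fin: "finite E1" "finite E2" and pos: "\<And>i. i \<in> E1 \<Longrightarrow> fst i < snd i" "\<And>j. j \<in> E2 \<Longrightarrow> fst j < snd j"
    using E1 E2 by (auto simp: disjoint_ivls_def)
  define J where "J i = {j \<in> E2. ?I j \<subseteq> ?I i}" for i
  define P where "P i = ?I ` J i" for i
  have finJ: "finite (J i)" for i using fin(2) by (auto simp: J_def)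
  have Pdiv: "P i division_of \<Union>(P i)" for i
    unfolding division_of_def
  proof (intro conjI ballI impI)
    show "finite (P i)" using finJ by (simp add: P_def)
    fix K assume K: "K \<in> P i"
    then obtain j where j: "j \<in> J i" "K = ?I j" by (auto simp: P_def)
    show "K \<subseteq> \<Union>(P i)" using K by auto
    show "K \<noteq> {}" using j pos(2)[of j] by (auto simp: J_def)
    show "\<exists>a b. K = cbox a b" using j by auto
    fix K' assume K': "K' \<in> P i" "K \<noteq> K'"
    then obtain j' where j': "j' \<in> J i" "K' = ?I j'" by (auto simp: P_def)
    have "j \<noteq> j'" using K' j j' by auto
    then have "K \<inter> K' = {}"
      using disjoint_ivls_disjoint[OF E2, of j j'] j j' by (auto simp: J_def)
    then show "interior K \<inter> interior K' = {}" using interior_subset by blast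
  qed simp
  have "\<exists>q. P i \<subseteq> q \<and> q division_of ?I i" for i
  proof -
    have "\<Union>(P i) \<subseteq> cbox (fst i) (snd i)" by (auto simp: P_def J_def)
    from partial_division_extend_interval[OF Pdiv this] show ?thesis by (metis box_real(2))
  qed
  then obtain q where q: "\<And>i. P i \<subseteq> q i" "\<And>i. q i division_of ?I i" by metis
  \<comment> \<open>Each interval of \<open>E1\<close> has a division extending the
    \<open>E2\<close> intervals inside it; discarding those leaves the gaps. One \<open>r\<close>
    serves all f: the identity gives its total length, the function under study the sum of its
    increments.\<close>
  define r where "r = (\<Union>i\<in>E1. q i - P i)"
  have qsub: "k \<subseteq> ?I i" "k \<noteq> {}" if "k \<in> q i" for k i
    using division_ofD(2,3)[OF q(2) that] by auto
  have rdiv: "r division_of \<Union>r"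
    unfolding division_of_def
  proof (intro conjI ballI impI)
    show "finite r" using fin(1) division_ofD(1)[OF q(2)] by (auto simp: r_def)
    fix K assume K: "K \<in> r"
    then obtain i where i: "i \<in> E1" "K \<in> q i" by (auto simp: r_def)
    show "K \<subseteq> \<Union>r" using K by auto
    show "K \<noteq> {}" using qsub(2)[OF i(2)] .
    show "\<exists>a b. K = cbox a b" using division_ofD(4)[OF q(2) i(2)] .
    fix K' assume K': "K' \<in> r" "K \<noteq> K'"
    then obtain i' where i': "i' \<in> E1" "K' \<in> q i'" by (auto simp: r_def)
    show "interior K \<inter> interior K' = {}"
    proof (cases "i = i'")
      case True
      then show ?thesis using division_ofD(5)[OF q(2), of K i K'] i i' K'(2) by auto
    next
      case False
      then have "K \<inter> K' = {}"
        using disjoint_ivls_disjoint[OF E1 i(1) i'(1)] qsub(1)[OF i(2)] qsub(1)[OF i'(2)] by blast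
      then show ?thesis using interior_subset by blast
    qed
  qed simp
  moreover have "\<Union>r \<subseteq> ivls E1"
    using qsub(1) unfolding r_def ivls_def by blast
  moreover have "(\<Sum>k\<in>r. f (Sup k) - f (Inf k)) = 
        (\<Sum>i\<in>E1. f (snd i) - f (fst i)) - (\<Sum>j\<in>E2. f (snd j) - f (fst j))" for f :: "real \<Rightarrow> real"
  proof -
    let ?F = "\<lambda>k. f (Sup k) - f (Inf k)"
    have "sum ?F r = (\<Sum>i\<in>E1. sum ?F (q i - P i))"
      unfolding r_def
    proof (rule sum.UNION_disjoint[OF fin(1)])
      show "\<forall>i\<in>E1. finite (q i - P i)" using division_ofD(1)[OF q(2)] by auto
      show "\<forall>i\<in>E1. \<forall>j\<in>E1. i \<noteq> j \<longrightarrow> (q i - P i) \<inter> (q j - P j) = {}"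
      proof (intro ballI impI)
        fix i j assume ij: "i \<in> E1" "j \<in> E1" "i \<noteq> j"
        show "(q i - P i) \<inter> (q j - P j) = {}"
          using disjoint_ivls_disjoint[OF E1 ij] qsub[of _ i] qsub[of _ j] by blast
      qed
    qed
    also have "\<dots> = (\<Sum>i\<in>E1. (f (snd i) - f (fst i)) - (\<Sum>j\<in>J i. f (snd j) - f (fst j)))"
    proof (rule sum.cong[OF refl])
      fix i assume i: "i \<in> E1"
      have "sum ?F (q i - P i) = sum ?F (q i) - sum ?F (P i)"
        by (rule sum_diff[OF division_ofD(1)[OF q(2)] q(1)])
      also have "sum ?F (q i) = f (snd i) - f (fst i)"
        by (rule sum_division_increments[OF q(2)]) (use pos(1)[OF i] in auto)
      also have "sum ?F (P i) = (\<Sum>j\<in>J i. ?F (?I j))"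
        unfolding P_def
      proof (subst sum.reindex)
        show "inj_on ?I (J i)"
          using pos(2) by (auto simp: inj_on_def J_def Icc_eq_Icc prod_eq_iff)
             (metis fst_conv less_le_not_le snd_conv)+
      qed simp
      also have "\<dots> = (\<Sum>j\<in>J i. f (snd j) - f (fst j))"
        by (rule sum.cong) (use pos(2) in \<open>auto simp: J_def less_imp_le\<close>)
      finally show "sum ?F (q i - P i) = (f (snd i) - f (fst i)) - (\<Sum>j\<in>J i. f (snd j) - f (fst j))" .
    qed
    also have "\<dots> = (\<Sum>i\<in>E1. f (snd i) - f (fst i)) - (\<Sum>i\<in>E1. \<Sum>j\<in>J i. f (snd j) - f (fst j))"
      by (rule sum_subtractf)
    also have "(\<Sum>i\<in>E1. \<Sum>j\<in>J i. f (snd j) - f (fst j)) = (\<Sum>j\<in>(\<Union>i\<in>E1. J i). f (snd j) - f (fst j))"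
    proof (rule sum.UNION_disjoint[OF fin(1), symmetric])
      show "\<forall>i\<in>E1. finite (J i)" using finJ by auto
      show "\<forall>i\<in>E1. \<forall>i'\<in>E1. i \<noteq> i' \<longrightarrow> J i \<inter> J i' = {}"
      proof (intro ballI impI)
        fix i i' assume ij: "i \<in> E1" "i' \<in> E1" "i \<noteq> i'"
        have "False" if "j \<in> J i" "j \<in> J i'" for j
        proof -
          have "?I j \<subseteq> {}" using disjoint_ivls_disjoint[OF E1 ij] that unfolding J_def by blast
          moreover have "fst j < snd j" using pos(2) that by (auto simp: J_def)
          ultimately show False by simp
        qed
        then show "J i \<inter> J i' = {}" by blast
      qed
    qed
    also have "(\<Union>i\<in>E1. J i) = E2"
      using sub unfolding J_def by blast
    finally show ?thesis .
  qed
  ultimately show ?thesis by (intro exI[of _ r] conjI allI)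
qed

lemma not_straddled_less:
  "x \<notin> straddled (\<lambda>s t. A s t < (B s t :: real)) \<Longrightarrow>
     \<exists>d>0. \<forall>s t. s < x \<longrightarrow> x < t \<longrightarrow> t - s < d \<longrightarrow> B s t \<le> A s t"
  by (drule not_straddledD) (simp add: not_less)

lemma open_outer_approx:
  assumes N: "N \<in> lmeasurable" "N \<subseteq> W" and W: "open W" "W \<in> lmeasurable" and "0 < e"
  obtains U where "open U" "N \<subseteq> U" "U \<subseteq> W" "U \<in> lmeasurable" "measure lebesgue (U - N) < e"
proof -
  obtain V where V: "open V" "N \<subseteq> V" "V - N \<in> lmeasurable" "emeasure lebesgue (V - N) < ennreal e"
    using sets_lebesgue_outer_open[OF _ \<open>0 < e\<close>, of N] N by blast
  have UW: "V \<inter> W \<in> lmeasurable"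
    by (rule fmeasurableI2[OF W(2)]) (use V(1) W(1) in auto)
  have "measure lebesgue (V \<inter> W - N) \<le> measure lebesgue (V - N)"
    by (rule measure_mono_fmeasurable) (use V(3) fmeasurable.Diff[OF UW N(1)] in auto)
  also have "\<dots> < e"
    using V(3,4) \<open>0 < e\<close> by (metis emeasure_eq_measure2 ennreal_less_iff measure_nonneg)
  finally show ?thesis
    using that[of "V \<inter> W"] V(1,2) W(1) N(2) UW by blast
qed

text \<open>If the set had measure m > 0, cover it by disjoint intervals \<open>E1\<close> with
  slopes below -r and then, inside their interiors, by disjoint intervals \<open>E2\<close> with
  slopes above r. What \<open>E1\<close> has outside \<open>E2\<close> has small measure, so by
  absolute continuity the increments over the two families almost agree. But those over
  \<open>E1\<close> total at most -r times a length close to m, and those over \<open>E2\<close> are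
  nonnegative.\<close>

lemma oscillating_slopes_negligible_sym:
  fixes f :: "real \<Rightarrow> real"
  assumes ac: "abs_cont_on {a..b} f" and "0 < r"
  shows "negligible {x \<in> {a<..<b}. x \<in> straddled (\<lambda>s t. f t - f s < - r * (t - s)) \<and>
             x \<in> straddled (\<lambda>s t. r * (t - s) < f t - f s)}"
    (is "negligible ?N")
proof (rule ccontr)
  assume contra: "\<not> negligible ?N"
  define N where "N = ?N"
  have "N = {a<..<b} \<inter> (straddled (\<lambda>s t. f t - f s < - r * (t - s)) \<inter> 
             straddled (\<lambda>s t. r * (t - s) < f t - f s))"
    by (auto simp: N_def)
  also have "\<dots> \<in> lmeasurable"
    by (rule fmeasurableI2[of "{a<..<b}"]) (auto intro!: sets.Int simp: straddled_borel)
  finally have Nm: "N \<in> lmeasurable" .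
  have Nab: "N \<subseteq> {a<..<b}" by (auto simp: N_def)
  define m where "m = measure lebesgue N"
  have m: "0 < m"
    using contra Nm unfolding m_def N_def[symmetric] by (metis negligible_iff_measure measure_nonneg order_le_less)
  have "0 < r * m / 2" using m \<open>0 < r\<close> by simp
  then obtain \<delta> where \<delta>: "0 < \<delta>" "\<And>d T. d division_of T \<Longrightarrow> T \<subseteq> {a..b} \<Longrightarrow> (\<Sum>k\<in>d. measure lborel k) < \<delta>
        \<Longrightarrow> (\<Sum>k\<in>d. \<bar>f (Sup k) - f (Inf k)\<bar>) < r * m / 2"
    using ac unfolding abs_cont_on_def by meson
  \<comment> \<open>The set covered by \<open>E1\<close> but not by \<open>E2\<close> splits into
    three remainders of measure below \<eta> each, hence 3 \<eta> <= \<delta>. With \<eta> <= m / 4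
    the final chain reads m < m / 4 + m / 2.\<close>
  define \<eta> where "\<eta> = min (\<delta> / 3) (m / 4)"
  have \<eta>: "0 < \<eta>" "3 * \<eta> \<le> \<delta>" "\<eta> \<le> m / 4" using \<delta>(1) m by (auto simp: \<eta>_def)
  obtain U where U: "open U" "N \<subseteq> U" "U \<subseteq> {a<..<b}" "U \<in> lmeasurable" "measure lebesgue (U - N) < \<eta>"
    using open_outer_approx[OF Nm Nab _ _ \<eta>(1)] by auto
  define P1 where "P1 s t \<longleftrightarrow> {s..t} \<subseteq> U \<and> s < t \<and> f t - f s < - r * (t - s)" for s t
  obtain E1 where E1: "disjoint_ivls E1" "\<And>i. i \<in> E1 \<Longrightarrow> P1 (fst i) (snd i)"
    "ivls E1 \<subseteq> U" "measure lebesgue (N - ivls E1) < \<eta>"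
  proof (rule vitali_finite[OF fmeasurableD[OF Nm] U(4,2) \<eta>(1), of P1])
    fix x d :: real assume x: "x \<in> N" and "0 < d"
    then obtain \<rho> where \<rho>: "0 < \<rho>" "ball x \<rho> \<subseteq> U" using U(1,2) openE by blast
    obtain s t where st: "s < x" "x < t" "t - s < min d \<rho>" "f t - f s < - r * (t - s)"
      using straddledD[of x "\<lambda>s t. f t - f s < - r * (t - s)" "min d \<rho>"] x \<open>0 < d\<close> \<rho>(1)
      by (auto simp: N_def)
    have "{s..t} \<subseteq> ball x \<rho>" using st by (auto simp: dist_real_def)
    then show "\<exists>s t. s \<le> x \<and> x \<le> t \<and> s < t \<and> t - s < d \<and> P1 s t"
      using st \<rho> by (intro exI[of _ s] exI[of _ t]) (auto simp: P1_def)
  qed (auto simp: P1_def)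
  \<comment> \<open>Passing to the open interiors loses only finitely many endpoints and leaves room
    around each point for the intervals of \<open>E2\<close>.\<close>
  define V where "V = (\<Union>i\<in>E1. {fst i<..<snd i})"
  have V: "open V" "V \<subseteq> ivls E1" by (auto simp: V_def ivls_def)
  have Vm: "V \<in> lmeasurable"
    by (rule fmeasurableI2[OF ivls_lmeasurable[OF E1(1)] V(2)]) (use V(1) in auto)
  have finE1: "finite E1" using E1(1) by (simp add: disjoint_ivls_def)
  have NV: "measure lebesgue (N - V) < \<eta>"
  proof -
    have neg: "negligible (fst ` E1 \<union> snd ` E1)" using finE1 by (intro negligible_finite) auto
    have "N - V \<subseteq> (N - ivls E1) \<union> (fst ` E1 \<union> snd ` E1)"
    proof
      fix x assume x: "x \<in> N - V"
      show "x \<in> (N - ivls E1) \<union> (fst ` E1 \<union> snd ` E1)"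
      proof (cases "x \<in> ivls E1")
        case True
        then obtain i where i: "i \<in> E1" "fst i \<le> x" "x \<le> snd i" by (auto simp: ivls_def)
        then have "x = fst i \<or> x = snd i" using x by (force simp: V_def)
        then show ?thesis using i(1) by auto
      qed (use x in auto)
    qed
    then have "measure lebesgue (N - V) \<le> measure lebesgue ((N - ivls E1) \<union> (fst ` E1 \<union> snd ` E1))"
      using fmeasurableD[OF fmeasurable.Diff[OF Nm Vm]]
        fmeasurable.Un[OF fmeasurable.Diff[OF Nm ivls_lmeasurable[OF E1(1)]] negligible_imp_measurable[OF neg]]
      by (rule measure_mono_fmeasurable)
    also have "\<dots> = measure lebesgue (N - ivls E1)"
      using measure_Un_null_set[of "N - ivls E1" lebesgue "fst ` E1 \<union> snd ` E1"] neg
        fmeasurable.Diff[OF Nm ivls_lmeasurable[OF E1(1)]]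
      by (simp add: negligible_iff_null_sets fmeasurableD)
    finally show ?thesis using E1(4) by simp
  qed
  define N1 where "N1 = N \<inter> V"
  have N1m: "N1 \<in> lmeasurable" unfolding N1_def using fmeasurable.Int[OF Nm Vm] .
  define P2 where "P2 s t \<longleftrightarrow> (\<exists>i\<in>E1. {s..t} \<subseteq> {fst i<..<snd i}) \<and> s < t \<and> r * (t - s) < f t - f s" for s t
  obtain E2 where E2: "disjoint_ivls E2" "\<And>i. i \<in> E2 \<Longrightarrow> P2 (fst i) (snd i)"
    "ivls E2 \<subseteq> V" "measure lebesgue (N1 - ivls E2) < \<eta>"
  proof (rule vitali_finite[OF fmeasurableD[OF N1m] Vm _ \<eta>(1), of P2])
    show "N1 \<subseteq> V" by (auto simp: N1_def)
    fix x d :: real assume x: "x \<in> N1" and "0 < d"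
    then obtain i where i: "i \<in> E1" "x \<in> {fst i<..<snd i}" by (auto simp: N1_def V_def)
    then obtain \<rho> where \<rho>: "0 < \<rho>" "ball x \<rho> \<subseteq> {fst i<..<snd i}" using openE[OF open_greaterThanLessThan] by blast
    obtain s t where st: "s < x" "x < t" "t - s < min d \<rho>" "r * (t - s) < f t - f s"
      using straddledD[of x "\<lambda>s t. r * (t - s) < f t - f s" "min d \<rho>"] x \<open>0 < d\<close> \<rho>(1)
      by (auto simp: N_def N1_def)
    have "{s..t} \<subseteq> ball x \<rho>" using st by (auto simp: dist_real_def)
    then have "{s..t} \<subseteq> {fst i<..<snd i}" using \<rho>(2) by blast
    then show "\<exists>s t. s \<le> x \<and> x \<le> t \<and> s < t \<and> t - s < d \<and> P2 s t"
      using st i(1) unfolding P2_def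
      by (intro exI[of _ s] exI[of _ t]) (auto simp del: greaterThanLessThan_iff)
  next
    fix s t assume "P2 s t"
    then show "{s..t} \<subseteq> V" by (auto simp: P2_def V_def)
  qed auto
  have "\<exists>i\<in>E1. {fst j..snd j} \<subseteq> {fst i..snd i}" if j: "j \<in> E2" for j
  proof -
    obtain i where "i \<in> E1" "{fst j..snd j} \<subseteq> {fst i<..<snd i}"
      using E2(2)[OF j] unfolding P2_def by blast
    moreover have "{fst i<..<snd i} \<subseteq> {fst i..snd i}" by auto
    ultimately show ?thesis by blast
  qed
  then have "\<forall>j\<in>E2. \<exists>i\<in>E1. {fst j..snd j} \<subseteq> {fst i..snd i}" by blast
  from disjoint_ivls_complement[OF E1(1) E2(1) this]
  obtain R where R': "R division_of \<Union>R \<and> \<Union>R \<subseteq> ivls E1 \<and>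
    (\<forall>f :: real \<Rightarrow> real. (\<Sum>k\<in>R. f (Sup k) - f (Inf k)) = 
        (\<Sum>i\<in>E1. f (snd i) - f (fst i)) - (\<Sum>j\<in>E2. f (snd j) - f (fst j)))" ..
  note R = conjunct1[OF R'] conjunct1[OF conjunct2[OF R']] conjunct2[OF conjunct2[OF R']]
  have "(\<Sum>k\<in>R. measure lborel k) = (\<Sum>k\<in>R. Sup k - Inf k)"
  proof (rule sum.cong[OF refl])
    fix k assume k: "k \<in> R"
    obtain u v where "k = {u..v}" "u \<le> v" using division_ofD(3,4)[OF R(1) k] by auto
    then show "measure lborel k = Sup k - Inf k" by simp
  qed
  also have "\<dots> = measure lebesgue (ivls E1) - measure lebesgue (ivls E2)"
    using R(3)[rule_format, of "\<lambda>x. x"] measure_ivls[OF E1(1)] measure_ivls[OF E2(1)] by simp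
  also have "\<dots> = measure lebesgue (ivls E1 - ivls E2)"
    using measurable_measure_Diff[OF ivls_lmeasurable[OF E1(1)] fmeasurableD[OF ivls_lmeasurable[OF E2(1)]]] E2(3) V(2)
    by simp
  also have "\<dots> \<le> measure lebesgue ((U - N) \<union> ((N - V) \<union> (N1 - ivls E2)))"
  proof (rule measure_mono_fmeasurable)
    show "ivls E1 - ivls E2 \<subseteq> (U - N) \<union> ((N - V) \<union> (N1 - ivls E2))"
      using E1(3) by (auto simp: N1_def)
    show "ivls E1 - ivls E2 \<in> sets lebesgue"
      using fmeasurable.Diff[OF ivls_lmeasurable[OF E1(1)] ivls_lmeasurable[OF E2(1)]] by auto
    show "(U - N) \<union> ((N - V) \<union> (N1 - ivls E2)) \<in> lmeasurable"
      using fmeasurable.Diff[OF U(4) Nm] fmeasurable.Diff[OF Nm Vm] 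
        fmeasurable.Diff[OF N1m ivls_lmeasurable[OF E2(1)]] by blast
  qed
  also have "\<dots> \<le> measure lebesgue (U - N) + (measure lebesgue (N - V) + measure lebesgue (N1 - ivls E2))"
    using fmeasurableD[OF fmeasurable.Diff[OF U(4) Nm]] fmeasurableD[OF fmeasurable.Diff[OF Nm Vm]] 
        fmeasurableD[OF fmeasurable.Diff[OF N1m ivls_lmeasurable[OF E2(1)]]]
    by (intro order_trans[OF measure_Un_le] add_left_mono measure_Un_le sets.Un)
  also have "\<dots> < \<delta>" using U(5) NV E2(4) \<eta>(2) by linarith
  finally have "(\<Sum>k\<in>R. measure lborel k) < \<delta>" .
  moreover have "\<Union>R \<subseteq> {a..b}"
  proof -
    have "{a<..<b} \<subseteq> {a..b}" by auto
    then show ?thesis using R(2) E1(3) U(3) by blast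
  qed
  ultimately have "(\<Sum>k\<in>R. \<bar>f (Sup k) - f (Inf k)\<bar>) < r * m / 2"
    using \<delta>(2)[OF R(1)] by blast
  then have "\<bar>\<Sum>k\<in>R. f (Sup k) - f (Inf k)\<bar> < r * m / 2"
    using sum_abs[of "\<lambda>k. f (Sup k) - f (Inf k)" R] by linarith
  then have small: "\<bar>(\<Sum>i\<in>E1. f (snd i) - f (fst i)) - (\<Sum>j\<in>E2. f (snd j) - f (fst j))\<bar> < r * m / 2"
    unfolding R(3)[rule_format] .
  have "(\<Sum>i\<in>E1. f (snd i) - f (fst i)) \<le> (\<Sum>i\<in>E1. - r * (snd i - fst i))"
    using E1(2) by (intro sum_mono) (auto simp: P1_def less_imp_le)
  also have "\<dots> = - r * measure lebesgue (ivls E1)"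
    unfolding measure_ivls[OF E1(1)] by (simp add: sum_distrib_left)
  finally have s1: "(\<Sum>i\<in>E1. f (snd i) - f (fst i)) \<le> - r * measure lebesgue (ivls E1)" .
  have "0 \<le> (\<Sum>j\<in>E2. f (snd j) - f (fst j))"
  proof (rule sum_nonneg)
    fix j assume "j \<in> E2"
    then have "fst j < snd j" "r * (snd j - fst j) < f (snd j) - f (fst j)" using E2(2)[of j] by (auto simp: P2_def)
    moreover from this have "0 \<le> r * (snd j - fst j)" using \<open>0 < r\<close> by (intro mult_nonneg_nonneg) auto
    ultimately show "0 \<le> f (snd j) - f (fst j)" by linarith
  qed
  then have "r * measure lebesgue (ivls E1) < r * (m / 2)" using small s1 by (auto simp: abs_if split: if_splits)
  then have lt: "measure lebesgue (ivls E1) < m / 2" using \<open>0 < r\<close> by simp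
  have "m \<le> measure lebesgue ((N - ivls E1) \<union> ivls E1)"
    unfolding m_def
    using fmeasurable.Un[OF fmeasurable.Diff[OF Nm ivls_lmeasurable[OF E1(1)]] ivls_lmeasurable[OF E1(1)]] Nm
    by (intro measure_mono_fmeasurable) auto
  also have "\<dots> \<le> measure lebesgue (N - ivls E1) + measure lebesgue (ivls E1)"
    using fmeasurable.Diff[OF Nm ivls_lmeasurable[OF E1(1)]] ivls_lmeasurable[OF E1(1)]
    by (intro measure_Un_le) auto
  finally show False using lt E1(4) \<eta>(3) m by linarith
qed

text \<open>Subtracting the linear function with slope (p + q) / 2 makes the two slopes
  opposite.\<close>

lemma oscillating_slopes_negligible:
  fixes f :: "real \<Rightarrow> real"
  assumes ac: "abs_cont_on {a..b} f" and "p < q"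
  shows "negligible {x \<in> {a<..<b}. x \<in> straddled (\<lambda>s t. f t - f s < p * (t - s)) \<and>
             x \<in> straddled (\<lambda>s t. q * (t - s) < f t - f s)}"
proof -
  define c r where "c = (p + q) / 2" and "r = (q - p) / 2"
  have "abs_cont_on {a..b} (\<lambda>x. f x + - c * x)"
    by (rule abs_cont_on_add[OF ac abs_cont_on_linear])
  from oscillating_slopes_negligible_sym[OF this, of r] have
    "negligible {x \<in> {a<..<b}. x \<in> straddled (\<lambda>s t. (f t + - c * t) - (f s + - c * s) < - r * (t - s)) \<and>
             x \<in> straddled (\<lambda>s t. r * (t - s) < (f t + - c * t) - (f s + - c * s))}"
    using \<open>p < q\<close> by (simp add: r_def)
  moreover have "c - r = p" "c + r = q" by (simp_all add: c_def r_def field_simps)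
  then have "(f t + - c * t) - (f s + - c * s) < - r * (t - s) \<longleftrightarrow> f t - f s < p * (t - s)"
    "r * (t - s) < (f t + - c * t) - (f s + - c * s) \<longleftrightarrow> q * (t - s) < f t - f s" for s t
    by (auto simp: algebra_simps)
  ultimately show ?thesis by simp
qed

text \<open>In a window shorter than \<delta> the increments over disjoint intervals total less than
  1. If the set had measure m > 0 in the window, disjoint intervals with slopes above n >= 2 / m
  covering half of that measure would have increments of total at least 1.\<close>

lemma infinite_slopes_negligible:
  fixes f :: "real \<Rightarrow> real"
  assumes ac: "abs_cont_on {a..b} f"
  shows "negligible {x \<in> {a<..<b}. \<forall>n::nat. x \<in> straddled (\<lambda>s t. real n * (t - s) < f t - f s)}"
    (is "negligible ?N")
proof -
  obtain \<delta> where \<delta>: "0 < \<delta>" "\<And>d T. d division_of T \<Longrightarrow> T \<subseteq> {a..b} \<Longrightarrow> (\<Sum>k\<in>d. measure lborel k) < \<delta>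
        \<Longrightarrow> (\<Sum>k\<in>d. \<bar>f (Sup k) - f (Inf k)\<bar>) < 1"
    using ac zero_less_one unfolding abs_cont_on_def by meson
  have loc: "negligible (?N \<inter> {c<..<c + \<delta>/2})" for c
  proof (rule ccontr)
    assume contra: "\<not> negligible (?N \<inter> {c<..<c + \<delta>/2})"
    define N where "N = ?N \<inter> {c<..<c + \<delta>/2}"
    define U where "U = {a<..<b} \<inter> {c<..<c + \<delta>/2}"
    have U: "open U" "N \<subseteq> U" "U \<subseteq> {a<..<b}" by (auto simp: U_def N_def)
    have Um: "U \<in> lmeasurable" unfolding U_def by (intro lmeasurable_open bounded_Int open_Int) auto
    have "N = U \<inter> (\<Inter>n::nat. straddled (\<lambda>s t. real n * (t - s) < f t - f s))"
      by (auto simp: N_def U_def)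
    also have "\<dots> \<in> lmeasurable"
      by (rule fmeasurableI2[OF Um]) (use U(1) in \<open>auto intro!: sets.Int sets.countable_INT simp: straddled_borel\<close>)
    finally have Nm: "N \<in> lmeasurable" .
    define m where "m = measure lebesgue N"
    have m: "0 < m"
      using contra Nm unfolding m_def N_def[symmetric] by (metis negligible_iff_measure measure_nonneg order_le_less)
    then have m2: "0 < m / 2" by simp
    obtain n :: nat where n: "2 / m \<le> real n" using real_arch_simple by blast
    define P where "P s t \<longleftrightarrow> {s..t} \<subseteq> U \<and> s < t \<and> real n * (t - s) < f t - f s" for s t
    obtain D where D: "disjoint_ivls D" "\<And>i. i \<in> D \<Longrightarrow> P (fst i) (snd i)"
      "ivls D \<subseteq> U" "measure lebesgue (N - ivls D) < m / 2"
    proof (rule vitali_finite[OF fmeasurableD[OF Nm] Um U(2) m2, of P])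
      fix x d :: real assume x: "x \<in> N" and "0 < d"
      then obtain \<rho> where \<rho>: "0 < \<rho>" "ball x \<rho> \<subseteq> U" using U(1,2) openE by blast
      obtain s t where st: "s < x" "x < t" "t - s < min d \<rho>" "real n * (t - s) < f t - f s"
        using straddledD[of x "\<lambda>s t. real n * (t - s) < f t - f s" "min d \<rho>"] x \<open>0 < d\<close> \<rho>(1)
        by (auto simp: N_def)
      have "{s..t} \<subseteq> ball x \<rho>" using st by (auto simp: dist_real_def)
      then show "\<exists>s t. s \<le> x \<and> x \<le> t \<and> s < t \<and> t - s < d \<and> P s t"
        using st \<rho> by (intro exI[of _ s] exI[of _ t]) (auto simp: P_def)
    qed (auto simp: P_def)
    \<comment> \<open>Taking the empty family as the one to remove, the complement lemma turns the
      pairs in \<open>D\<close> into a division.\<close>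
    have dje: "disjoint_ivls {}" by (simp add: disjoint_ivls_def)
    have "\<forall>j\<in>{}. \<exists>i\<in>D. {fst j..snd j} \<subseteq> {fst i..snd i}" by simp
    from disjoint_ivls_complement[OF D(1) dje this]
    obtain R where R': "R division_of \<Union>R \<and> \<Union>R \<subseteq> ivls D \<and>
      (\<forall>f :: real \<Rightarrow> real. (\<Sum>k\<in>R. f (Sup k) - f (Inf k)) = 
        (\<Sum>i\<in>D. f (snd i) - f (fst i)) - (\<Sum>j\<in>{}. f (snd j) - f (fst j)))" ..
    note R = conjunct1[OF R'] conjunct1[OF conjunct2[OF R']] and R0 = conjunct2[OF conjunct2[OF R']]
    have R3: "(\<Sum>k\<in>R. f (Sup k) - f (Inf k)) = (\<Sum>i\<in>D. f (snd i) - f (fst i))" for f :: "real \<Rightarrow> real"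
      using R0[rule_format, of f] by simp
    have "(\<Sum>k\<in>R. measure lborel k) = (\<Sum>k\<in>R. Sup k - Inf k)"
    proof (rule sum.cong[OF refl])
      fix k assume k: "k \<in> R"
      obtain u v where "k = {u..v}" "u \<le> v" using division_ofD(3,4)[OF R(1) k] by auto
      then show "measure lborel k = Sup k - Inf k" by simp
    qed
    also have "\<dots> = measure lebesgue (ivls D)"
      using R3[of "\<lambda>x. x"] measure_ivls[OF D(1)] by simp
    also have "\<dots> \<le> measure lebesgue {c<..<c + \<delta>/2}"
      using ivls_lmeasurable[OF D(1)] D(3) by (intro measure_mono_fmeasurable) (auto simp: U_def)
    also have "\<dots> < \<delta>" using \<delta>(1) by simp
    finally have "(\<Sum>k\<in>R. measure lborel k) < \<delta>" .
    moreover have "\<Union>R \<subseteq> {a..b}"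
    proof -
      have "{a<..<b} \<subseteq> {a..b}" by auto
      then show ?thesis using R(2) D(3) U(3) by blast
    qed
    ultimately have "(\<Sum>k\<in>R. \<bar>f (Sup k) - f (Inf k)\<bar>) < 1"
      using \<delta>(2)[OF R(1)] by blast
    then have "(\<Sum>k\<in>R. f (Sup k) - f (Inf k)) < 1"
      using sum_abs[of "\<lambda>k. f (Sup k) - f (Inf k)" R] by linarith
    moreover have "(\<Sum>i\<in>D. real n * (snd i - fst i)) \<le> (\<Sum>i\<in>D. f (snd i) - f (fst i))"
      using D(2) by (intro sum_mono) (auto simp: P_def less_imp_le)
    ultimately have "real n * measure lebesgue (ivls D) < 1"
      unfolding R3 measure_ivls[OF D(1)] by (simp add: sum_distrib_left)
    moreover have "m \<le> measure lebesgue ((N - ivls D) \<union> ivls D)"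
      unfolding m_def
      using fmeasurable.Un[OF fmeasurable.Diff[OF Nm ivls_lmeasurable[OF D(1)]] ivls_lmeasurable[OF D(1)]] Nm
      by (intro measure_mono_fmeasurable) auto
    moreover have "measure lebesgue ((N - ivls D) \<union> ivls D) \<le> measure lebesgue (N - ivls D) + measure lebesgue (ivls D)"
      using fmeasurable.Diff[OF Nm ivls_lmeasurable[OF D(1)]] ivls_lmeasurable[OF D(1)]
      by (intro measure_Un_le) auto
    ultimately have "m / 2 \<le> measure lebesgue (ivls D)" "real n * measure lebesgue (ivls D) < 1" using D(4) by linarith+
    moreover have "1 \<le> real n * (m / 2)" using n m by (simp add: field_simps)
    ultimately show False using mult_left_mono[of "m/2" "measure lebesgue (ivls D)" "real n"] by simp
  qed
  have "?N \<subseteq> (\<Union>c\<in>\<rat>. ?N \<inter> {c<..<c + \<delta>/2})"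
  proof
    fix x assume x: "x \<in> ?N"
    obtain c where "c \<in> \<rat>" "x - \<delta>/2 < c" "c < x"
      using Rats_dense_in_real[of "x - \<delta>/2" x] \<delta>(1) by auto
    then show "x \<in> (\<Union>c\<in>\<rat>. ?N \<inter> {c<..<c + \<delta>/2})" using x by (auto intro!: bexI[of _ c])
  qed
  moreover have "negligible (\<Union>c\<in>\<rat>. ?N \<inter> {c<..<c + \<delta>/2})"
    using loc by (intro negligible_countable_Union) (auto intro: countable_rat)
  ultimately show ?thesis by (rule negligible_subset[rotated])
qed

theorem abs_cont_on_differentiable_ae:
  fixes f :: "real \<Rightarrow> real"
  assumes ac: "abs_cont_on {a..b} f"
  obtains N where "negligible N" "\<And>x. x \<in> {a<..<b} - N \<Longrightarrow> \<exists>D. (f has_real_derivative D) (at x)"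
proof -
  let ?osc = "\<lambda>p q. {x \<in> {a<..<b}. x \<in> straddled (\<lambda>s t. f t - f s < p * (t - s)) \<and>
             x \<in> straddled (\<lambda>s t. q * (t - s) < f t - f s)}"
  let ?N1 = "{x \<in> {a<..<b}. \<forall>n::nat. x \<in> straddled (\<lambda>s t. real n * (t - s) < f t - f s)}"
  let ?N2 = "{x \<in> {a<..<b}. \<forall>n::nat. x \<in> straddled (\<lambda>s t. real n * (t - s) < - f t - - f s)}"
  define N3 where "N3 = (\<Union>(p, q) \<in> {(p, q). p \<in> \<rat> \<and> q \<in> \<rat> \<and> p < q}. ?osc p q)"
  have "countable {(p, q). p \<in> \<rat> \<and> q \<in> \<rat> \<and> p < (q::real)}"
    by (rule countable_subset[of _ "\<rat> \<times> \<rat>"]) (auto intro: countable_rat)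
  then have "negligible N3"
    unfolding N3_def using oscillating_slopes_negligible[OF ac]
    by (intro negligible_countable_Union[of "(\<lambda>(p, q). ?osc p q) ` _"]) auto
  then have neg: "negligible (?N1 \<union> ?N2 \<union> N3)"
    using infinite_slopes_negligible[OF ac] infinite_slopes_negligible[OF abs_cont_on_uminus[OF ac]] 
    by (intro negligible_Un)
  show ?thesis
  proof (rule that[OF neg])
    fix x assume x: "x \<in> {a<..<b} - (?N1 \<union> ?N2 \<union> N3)"
    \<comment> \<open>These slopes bound all sufficiently short straddling quotients from above, so
      the infimum of \<open>S\<close> is the upper derivative at x. It is finite: avoiding
      \<open>?N1\<close> makes \<open>S\<close> nonempty, avoiding \<open>?N2\<close> bounds it
      below.\<close>
    define S where "S = {q. x \<notin> straddled (\<lambda>s t. q * (t - s) < f t - f s)}"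
    obtain n1 :: nat where n1: "real n1 \<in> S" using x by (auto simp: S_def)
    obtain n2 :: nat where ns: "x \<notin> straddled (\<lambda>s t. real n2 * (t - s) < - f t - - f s)" using x by auto
    from not_straddled_less[OF ns] obtain d2 where d2: "d2 > 0" "\<And>s t. s < x \<Longrightarrow> x < t \<Longrightarrow> t - s < d2 \<Longrightarrow> - f t - - f s \<le> real n2 * (t - s)"
      by blast
    have Sd: "\<exists>d>0. \<forall>s t. s < x \<longrightarrow> x < t \<longrightarrow> t - s < d \<longrightarrow> f t - f s \<le> q * (t - s)" if "q \<in> S" for q
      by (rule not_straddled_less) (use that in \<open>simp add: S_def\<close>)
    have low: "- real n2 \<le> q" if qS: "q \<in> S" for q
    proof -
      obtain d where d: "d > 0" "\<And>s t. s < x \<Longrightarrow> x < t \<Longrightarrow> t - s < d \<Longrightarrow> f t - f s \<le> q * (t - s)"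
        using Sd[OF qS] by blast
      define h where "h = min d d2 / 3"
      have h: "0 < h" "2 * h < d" "2 * h < d2" using d(1) d2(1) by (auto simp: h_def)
      have "f (x + h) - f (x - h) \<le> q * (2 * h)" "- f (x + h) - - f (x - h) \<le> real n2 * (2 * h)"
        using d(2)[of "x - h" "x + h"] d2(2)[of "x - h" "x + h"] h by auto
      then have "0 \<le> (q + real n2) * (2 * h)" by (simp add: algebra_simps)
      then show ?thesis using h(1) by (simp add: zero_le_mult_iff)
    qed
    define L where "L = Inf S"
    have bdd: "bdd_below S" using low by (rule bdd_belowI)
    have "(f has_real_derivative L) (at x)"
    proof (rule straddle_has_derivative)
      show "isCont f x"
        using continuous_on_interior[OF abs_cont_on_imp_continuous[OF ac], of x] x by simp
      fix e :: real assume "0 < e"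
      obtain q where qS: "q \<in> S" and q: "q < L + e"
        using cInf_lessD[of S "L + e"] n1 \<open>0 < e\<close> unfolding L_def by force
      obtain d1 where d1: "d1 > 0" "\<And>s t. s < x \<Longrightarrow> x < t \<Longrightarrow> t - s < d1 \<Longrightarrow> f t - f s \<le> q * (t - s)"
        using Sd[OF qS] by blast
      obtain p1 where p1: "p1 \<in> \<rat>" "L - e < p1" "p1 < L - e / 2"
        using Rats_dense_in_real[of "L - e" "L - e / 2"] \<open>0 < e\<close> by auto
      obtain q1 where q1: "q1 \<in> \<rat>" "L - e / 2 < q1" "q1 < L"
        using Rats_dense_in_real[of "L - e / 2" L] \<open>0 < e\<close> by auto
      \<comment> \<open>Slopes above \<open>q1\<close> occur at every scale because
        \<open>q1\<close> lies below the infimum. As x is not an oscillation point for p1 < q1,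
        slopes below \<open>p1\<close> stop at some scale.\<close>
      have "q1 \<notin> S" using q1(3) cInf_lower[OF _ bdd] unfolding L_def by fastforce
      moreover have "x \<notin> ?osc p1 q1" using x p1 q1 unfolding N3_def by auto
      ultimately have ns': "x \<notin> straddled (\<lambda>s t. f t - f s < p1 * (t - s))"
        using x unfolding S_def by auto
      from not_straddled_less[OF ns'] obtain d3 where d3: "d3 > 0" "\<And>s t. s < x \<Longrightarrow> x < t \<Longrightarrow> t - s < d3 \<Longrightarrow> p1 * (t - s) \<le> f t - f s"
        by blast
      have "\<bar>f t - f s - L * (t - s)\<bar> \<le> e * (t - s)" if st: "s < x" "x < t" "t - s < min d1 d3" for s t
      proof -
        have "f t - f s \<le> q * (t - s)" using d1(2) st by simp
        also have "\<dots> \<le> (L + e) * (t - s)" using q st by (intro mult_right_mono) auto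
        finally have 1: "f t - f s \<le> (L + e) * (t - s)" .
        have "(L - e) * (t - s) \<le> p1 * (t - s)" using p1 st by (intro mult_right_mono) auto
        also have "\<dots> \<le> f t - f s" using d3(2) st by simp
        finally have 2: "(L - e) * (t - s) \<le> f t - f s" .
        show ?thesis using 1 2 by (simp add: abs_le_iff algebra_simps)
      qed
      then show "\<exists>d>0. \<forall>s t. s < x \<longrightarrow> x < t \<longrightarrow> t - s < d \<longrightarrow> \<bar>f t - f s - L * (t - s)\<bar> \<le> e * (t - s)"
        using d1(1) d3(1) by (intro exI[of _ "min d1 d3"]) auto
    qed
    then show "\<exists>D. (f has_real_derivative D) (at x)" by blast
  qed
qed

corollary abs_cont_on_has_integral_deriv:
  assumes ac: "abs_cont_on {a..b} f" and "a \<le> b"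
  shows "(deriv f has_integral (f b - f a)) {a..b}"
proof -
  obtain N where N: "negligible N" "\<And>x. x \<in> {a<..<b} - N \<Longrightarrow> \<exists>D. (f has_real_derivative D) (at x)"
    using abs_cont_on_differentiable_ae[OF ac] by blast
  have "negligible (N \<union> {a, b})" using N(1) by auto
  then show ?thesis
  proof (rule abs_cont_on_has_integral_derivative[OF ac \<open>a \<le> b\<close>])
    fix x assume "x \<in> {a..b} - (N \<union> {a, b})"
    then have "\<exists>D. (f has_real_derivative D) (at x)" using N(2)[of x] by auto
    then have "(f has_real_derivative deriv f x) (at x)" using DERIV_imp_deriv by metis
    then show "(f has_real_derivative deriv f x) (at x within {a..b})"
      by (rule has_field_derivative_at_within)
  qed
qed

text \<open>The product of two indefinite integrals is absolutely continuous, and by Lebesgue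
  differentiation it has the derivative of the product rule almost everywhere.\<close>

theorem integration_by_parts_indefinite:
  fixes f g f' g' :: "real \<Rightarrow> real"
  assumes "a \<le> b" and f': "f' absolutely_integrable_on {a..b}" and g': "g' absolutely_integrable_on {a..b}"
    and f: "\<And>x y. a \<le> x \<Longrightarrow> x \<le> y \<Longrightarrow> y \<le> b \<Longrightarrow> f y - f x = integral {x..y} f'"
    and g: "\<And>x y. a \<le> x \<Longrightarrow> x \<le> y \<Longrightarrow> y \<le> b \<Longrightarrow> g y - g x = integral {x..y} g'"
  shows "((\<lambda>x. f' x * g x + f x * g' x) has_integral (f b * g b - f a * g a)) {a..b}"
proof -
  have acf: "abs_cont_on {a..b} f" and acg: "abs_cont_on {a..b} g"
    by (rule abs_cont_on_integral[OF f' f] abs_cont_on_integral[OF g' g]; assumption)+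
  obtain M1 where M1: "\<forall>x\<in>{a..b}. \<bar>f x\<bar> \<le> M1"
    using compact_imp_bounded[OF compact_continuous_image[OF abs_cont_on_imp_continuous[OF acf] compact_Icc]]
    by (auto simp: bounded_iff)
  obtain M2 where M2: "\<forall>x\<in>{a..b}. \<bar>g x\<bar> \<le> M2"
    using compact_imp_bounded[OF compact_continuous_image[OF abs_cont_on_imp_continuous[OF acg] compact_Icc]]
    by (auto simp: bounded_iff)
  have ac: "abs_cont_on {a..b} (\<lambda>x. f x * g x)"
  proof (rule abs_cont_on_mult[OF acf acg, of "max M1 M2"])
    show "\<And>x. x \<in> {a..b} \<Longrightarrow> \<bar>f x\<bar> \<le> max M1 M2" using M1 by (simp add: le_max_iff_disj)
    show "\<And>x. x \<in> {a..b} \<Longrightarrow> \<bar>g x\<bar> \<le> max M1 M2" using M2 by (simp add: le_max_iff_disj)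
  qed
  obtain N1 where N1: "negligible N1" "\<And>x. x \<in> {a<..<b} - N1 \<Longrightarrow> (f has_real_derivative f' x) (at x)"
    using lebesgue_differentiation[OF f' f] by blast
  obtain N2 where N2: "negligible N2" "\<And>x. x \<in> {a<..<b} - N2 \<Longrightarrow> (g has_real_derivative g' x) (at x)"
    using lebesgue_differentiation[OF g' g] by blast
  have "negligible (N1 \<union> N2 \<union> {a, b})" using N1(1) N2(1) by auto
  then show ?thesis
  proof (rule abs_cont_on_has_integral_derivative[OF ac \<open>a \<le> b\<close>])
    fix x assume x: "x \<in> {a..b} - (N1 \<union> N2 \<union> {a, b})"
    have "((\<lambda>x. f x * g x) has_real_derivative f' x * g x + f x * g' x) (at x)"
      using DERIV_mult[OF N1(2) N2(2), of x] x by (simp add: mult.commute add.commute)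
    then show "((\<lambda>x. f x * g x) has_real_derivative f' x * g x + f x * g' x) (at x within {a..b})"
      by (rule has_field_derivative_at_within)
  qed
qed

subsection \<open>The space \<open>L\<^sup>2(0,1)\<close>\<close>

lemma l2_eq_refl: "l2_eq f f \<longleftrightarrow> sqint f"
  by (simp add: l2_eq_def)

lemma sqint_rep_l2: "sqint (rep_l2 u)" and cls_rep_l2: "cls (rep_l2 u) = u"
  using Quotient_rep_reflp[OF Quotient_l2] Quotient_abs_rep[OF Quotient_l2] l2_eq_refl by auto

lemma cls_eq_iff: "sqint f \<Longrightarrow> sqint g \<Longrightarrow> cls f = cls g \<longleftrightarrow> (AE x in I01. f x = g x)"
  using Quotient_rel[OF Quotient_l2, of f g] by (simp add: l2_eq_def)

lemma l2_cases: obtains f where "sqint f" "u = cls f"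
  using sqint_rep_l2 cls_rep_l2 by metis

lemma cls_add: "sqint f \<Longrightarrow> sqint g \<Longrightarrow> cls f + cls g = cls (\<lambda>x. f x + g x)"
  by (simp add: plus_l2.abs_eq l2_eq_refl)

lemma cls_diff: "sqint f \<Longrightarrow> sqint g \<Longrightarrow> cls f - cls g = cls (\<lambda>x. f x - g x)"
  by (simp add: minus_l2.abs_eq l2_eq_refl)

lemma cls_scaleR: "sqint f \<Longrightarrow> c *\<^sub>R cls f = cls (\<lambda>x. c * f x)"
  by (simp add: scaleR_l2.abs_eq l2_eq_refl)

lemma cls_zero: "0 = cls (\<lambda>x. 0)"
  by (simp add: zero_l2.abs_eq)

lemma inner_cls: "sqint f \<Longrightarrow> sqint g \<Longrightarrow> inner (cls f) (cls g) = (LINT x|I01. f x * g x)"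
  by (simp add: inner_l2.abs_eq l2_eq_refl)

lemma norm_cls: "sqint f \<Longrightarrow> (norm (cls f))\<^sup>2 = (LINT x|I01. (f x)\<^sup>2)"
  by (simp only: power2_norm_eq_inner) (simp add: inner_cls power2_eq_square)

lemma AE_I01_I:
  assumes "negligible N" "\<And>x. x \<in> {0<..<1} - N \<Longrightarrow> P x"
  shows "AE x in I01. P x"
proof -
  have "AE x in lebesgue. x \<notin> N"
    using assms(1) by (auto simp: negligible_iff_null_sets intro: AE_not_in)
  then have "AE x in lebesgue. x \<in> {0<..<1} \<longrightarrow> P x"
    by eventually_elim (use assms(2) in auto)
  then show ?thesis by (subst AE_restrict_space_iff) auto
qed

lemma AE_I01_D:
  assumes "AE x in I01. P x"
  obtains N where "negligible N" "\<And>x. x \<in> {0<..<1} - N \<Longrightarrow> P x"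
proof -
  have "AE x in lebesgue. x \<in> {0<..<1} \<longrightarrow> P x"
    using assms by (subst (asm) AE_restrict_space_iff) auto
  then obtain N where "N \<in> null_sets lebesgue" "{x. \<not> (x \<in> {0<..<1} \<longrightarrow> P x)} \<subseteq> N"
    by (auto simp: eventually_ae_filter)
  then show ?thesis using that[of N] by (auto simp: negligible_iff_null_sets)
qed

lemma integrable_I01_iff: 
  fixes f :: "real \<Rightarrow> real"
  shows "integrable I01 f \<longleftrightarrow> f absolutely_integrable_on {0..1}"
proof -
  have "integrable I01 f \<longleftrightarrow> f absolutely_integrable_on {0<..<1}"
    by (simp add: integrable_restrict_space set_integrable_def)
  then show ?thesis using absolutely_integrable_on_Icc_iff_Ioo[where f = f and a = 0 and b = 1] by (simp only:)
qed

lemma integral_I01: 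
  fixes f :: "real \<Rightarrow> real"
  shows "integrable I01 f \<Longrightarrow> (LINT x|I01. f x) = integral {0..1} f"
  using lebesgue_integral_eq_integral[of "{0<..<1}" f] integral_open_interval_real[where f = f and a = 0 and b = 1] by auto

lemma sqint_integrable: "sqint f \<Longrightarrow> integrable I01 f"
proof -
  assume f: "sqint f"
  have "sqint (\<lambda>x. 1)"
    unfolding sqint_def integrable_I01_iff by (intro conjI absolutely_integrable_continuous_real continuous_intros) simp
  from sqint_mult[OF f this] show "integrable I01 f" by simp
qed

lemma sqint_abs_integrable: "sqint f \<Longrightarrow> f absolutely_integrable_on {0..1}"
  using sqint_integrable integrable_I01_iff by blast

lemma sqint_continuous:
  assumes "continuous_on {0..1} f" shows "sqint f"
  unfolding sqint_def
proof
  have "continuous_on {0<..<1} f" by (rule continuous_on_subset[OF assms]) auto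
  then show "f \<in> borel_measurable I01" by (rule continuous_imp_measurable_on_sets_lebesgue) simp
  show "integrable I01 (\<lambda>x. (f x)\<^sup>2)"
    unfolding integrable_I01_iff by (intro absolutely_integrable_continuous_real continuous_intros assms)
qed

lemma sqint_bound:
  assumes "sqint g" "f \<in> borel_measurable I01" "AE x in I01. \<bar>f x\<bar> \<le> \<bar>g x\<bar>"
  shows "sqint f"
  unfolding sqint_def
proof
  show "integrable I01 (\<lambda>x. (f x)\<^sup>2)"
  proof (rule Bochner_Integration.integrable_bound)
    show "integrable I01 (\<lambda>x. (g x)\<^sup>2)" using assms(1) by (simp add: sqint_def)
    show "(\<lambda>x. (f x)\<^sup>2) \<in> borel_measurable I01" using assms(2) by measurable
    show "AE x in I01. norm ((f x)\<^sup>2) \<le> norm ((g x)\<^sup>2)"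
      using assms(3) by eventually_elim (simp add: abs_le_square_iff)
  qed
qed (rule assms(2))

lemma sqint_measurable: "sqint f \<Longrightarrow> f \<in> borel_measurable I01"
  by (simp add: sqint_def)

lemma nn_integral_sq: "sqint f \<Longrightarrow> (\<integral>\<^sup>+x. ennreal ((f x)\<^sup>2) \<partial>I01) = ennreal ((norm (cls f))\<^sup>2)"
  by (subst nn_integral_eq_integral) (auto simp: sqint_def norm_cls)

text \<open>Cauchy-Schwarz against the constant 1, whose norm on (0, 1) is 1.\<close>

lemma nn_integral_abs_le:
  assumes "sqint f"
  shows "(\<integral>\<^sup>+x. ennreal \<bar>f x\<bar> \<partial>I01) \<le> ennreal (norm (cls f))"
proof -
  have one: "sqint (\<lambda>x. 1)" by (intro sqint_continuous continuous_intros)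
  have sa: "sqint (\<lambda>x. \<bar>f x\<bar>)"
    by (rule sqint_bound[OF assms]) (use sqint_measurable[OF assms] in auto)
  have "(LINT x|I01. \<bar>f x\<bar>) = inner (cls (\<lambda>x. \<bar>f x\<bar>)) (cls (\<lambda>x. 1))"
    using inner_cls[OF sa one] by simp
  also have "\<dots> \<le> norm (cls (\<lambda>x. \<bar>f x\<bar>)) * norm (cls (\<lambda>x. 1))" by (rule norm_cauchy_schwarz)
  finally have "(LINT x|I01. \<bar>f x\<bar>) \<le> norm (cls (\<lambda>x. \<bar>f x\<bar>)) * norm (cls (\<lambda>x. 1))" .
  moreover have "norm (cls (\<lambda>x. \<bar>f x\<bar>)) = norm (cls f)"
    by (rule power2_eq_imp_eq) (use norm_cls[OF sa] norm_cls[OF assms] in auto)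
  moreover have "norm (cls (\<lambda>x. 1)) = 1"
    by (rule power2_eq_imp_eq) (use norm_cls[OF one] integral_I01[OF sqint_integrable[OF one]] in auto)
  ultimately have le: "(LINT x|I01. \<bar>f x\<bar>) \<le> norm (cls f)" by simp
  have "(\<integral>\<^sup>+x. ennreal \<bar>f x\<bar> \<partial>I01) = ennreal (LINT x|I01. \<bar>f x\<bar>)"
    by (rule nn_integral_eq_integral) (use sqint_integrable[OF sa] in auto)
  then show ?thesis using ennreal_leI[OF le] by simp
qed

text \<open>Riesz--Fischer: a rapidly Cauchy subsequence converges almost everywhere, and Fatou's
  lemma identifies the pointwise limit as the limit in the mean.\<close>
instance l2 :: banach
proof
  fix X :: "nat \<Rightarrow> l2" assume "Cauchy X"
  define f where "f n = rep_l2 (X n)" for n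
  have f: "sqint (f n)" "cls (f n) = X n" for n
    by (simp_all add: f_def sqint_rep_l2 cls_rep_l2)
  have fm [measurable]: "f n \<in> borel_measurable I01" for n by (rule sqint_measurable[OF f(1)])
  have "\<exists>M. \<forall>m\<ge>M. \<forall>n\<ge>M. norm (X m - X n) < (1/2) ^ k" for k
    using metric_CauchyD[OF \<open>Cauchy X\<close>, of "(1/2) ^ k"] by (simp add: dist_norm)
  then obtain N where N: "\<And>k m n. N k \<le> m \<Longrightarrow> N k \<le> n \<Longrightarrow> norm (X m - X n) < (1/2) ^ k" by metis
  \<comment> \<open>Summing the thresholds gives an index that is at least \<open>N k\<close> for
    every k <= n.\<close>
  define r where "r n = (\<Sum>k\<le>n. N k)" for n
  have rN: "N k \<le> r n" if "k \<le> n" for k n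
    unfolding r_def using that by (intro member_le_sum) auto
  define g where "g n x = f (r (Suc n)) x - f (r n) x" for n x
  have g: "sqint (g n)" for n unfolding g_def by (intro sqint_diff f)
  have gn: "norm (cls (g n)) \<le> (1/2) ^ n" for n
    unfolding g_def using N[OF rN rN, of n "Suc n" n] cls_diff[OF f(1) f(1)] f(2) by (simp add: less_imp_le)
  have "(\<integral>\<^sup>+x. (\<Sum>n. ennreal \<bar>g n x\<bar>) \<partial>I01) = (\<Sum>n. \<integral>\<^sup>+x. ennreal \<bar>g n x\<bar> \<partial>I01)"
    by (rule nn_integral_suminf) (unfold g_def, measurable)
  also have "\<dots> \<le> (\<Sum>n. ennreal ((1/2) ^ n))"
    by (intro suminf_le allI order_trans[OF nn_integral_abs_le[OF g]] ennreal_leI gn) auto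
  also have "\<dots> < \<infinity>"
    by (subst suminf_ennreal2) (auto simp: summable_geometric)
  finally have "AE x in I01. (\<Sum>n. ennreal \<bar>g n x\<bar>) \<noteq> \<infinity>"
    by (intro nn_integral_noteq_infinite) (unfold g_def, measurable)
  then have conv: "AE x in I01. convergent (\<lambda>n. f (r n) x)"
  proof eventually_elim
    case (elim x)
    then have "summable (\<lambda>n. \<bar>g n x\<bar>)" by (intro summable_suminf_not_top) auto
    then have "summable (\<lambda>n. g n x)" by (rule summable_rabs_cancel)
    then have "convergent (\<lambda>m. \<Sum>n<m. g n x)" by (simp add: summable_iff_convergent)
    moreover have "(\<Sum>n<m. g n x) = f (r m) x - f (r 0) x" for m
      unfolding g_def by (rule sum_lessThan_telescope)
    ultimately have "convergent (\<lambda>m. f (r m) x - f (r 0) x)" by simp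
    then obtain l where "(\<lambda>m. f (r m) x - f (r 0) x) \<longlonglongrightarrow> l" by (auto simp: convergent_def)
    then have "(\<lambda>m. (f (r m) x - f (r 0) x) + f (r 0) x) \<longlonglongrightarrow> l + f (r 0) x" by (intro tendsto_intros)
    then show ?case by (auto simp: convergent_def)
  qed
  define F where "F x = lim (\<lambda>n. f (r n) x)" for x
  have Fm [measurable]: "F \<in> borel_measurable I01"
    unfolding F_def by (rule borel_measurable_lim_metric) measurable
  have bound: "(\<integral>\<^sup>+x. ennreal ((f m x - F x)\<^sup>2) \<partial>I01) \<le> ennreal (((1/2) ^ k)\<^sup>2)" if m: "N k \<le> m" for m k
  proof -
    have "AE x in I01. ennreal ((f m x - F x)\<^sup>2) = liminf (\<lambda>n. ennreal ((f m x - f (r n) x)\<^sup>2))"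
      using conv
    proof eventually_elim
      case (elim x)
      have "(\<lambda>n. f (r n) x) \<longlonglongrightarrow> F x" using elim unfolding F_def by (simp add: convergent_LIMSEQ_iff)
      then have "(\<lambda>n. ennreal ((f m x - f (r n) x)\<^sup>2)) \<longlonglongrightarrow> ennreal ((f m x - F x)\<^sup>2)"
        by (intro tendsto_intros)
      then show ?case using lim_imp_Liminf[OF trivial_limit_sequentially] by metis
    qed
    then have "(\<integral>\<^sup>+x. ennreal ((f m x - F x)\<^sup>2) \<partial>I01) = (\<integral>\<^sup>+x. liminf (\<lambda>n. ennreal ((f m x - f (r n) x)\<^sup>2)) \<partial>I01)"
      by (rule nn_integral_cong_AE)
    also have "\<dots> \<le> liminf (\<lambda>n. \<integral>\<^sup>+x. ennreal ((f m x - f (r n) x)\<^sup>2) \<partial>I01)"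
      by (rule nn_integral_liminf) measurable
    also have "\<dots> \<le> liminf (\<lambda>n. ennreal (((1/2) ^ k)\<^sup>2))"
    proof (rule Liminf_mono)
      show "\<forall>\<^sub>F n in sequentially. (\<integral>\<^sup>+x. ennreal ((f m x - f (r n) x)\<^sup>2) \<partial>I01) \<le> ennreal (((1/2) ^ k)\<^sup>2)"
      proof (rule eventually_sequentiallyI)
        fix n assume "k \<le> n"
        then have "norm (X m - X (r n)) < (1/2) ^ k" using N[OF m rN] by blast
        then have "(norm (cls (\<lambda>x. f m x - f (r n) x)))\<^sup>2 \<le> ((1/2) ^ k)\<^sup>2"
          using cls_diff[OF f(1) f(1), of m "r n"] f(2) by (intro power_mono) auto
        then show "(\<integral>\<^sup>+x. ennreal ((f m x - f (r n) x)\<^sup>2) \<partial>I01) \<le> ennreal (((1/2) ^ k)\<^sup>2)"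
          using nn_integral_sq[OF sqint_diff[OF f(1) f(1)], of m "r n"] by (simp add: ennreal_leI)
      qed
    qed
    also have "\<dots> = ennreal (((1/2) ^ k)\<^sup>2)" by (rule lim_imp_Liminf) auto
    finally show ?thesis .
  qed
  have dF: "sqint (\<lambda>x. f m x - F x)" if "N k \<le> m" for m k
    unfolding sqint_def
  proof
    show "integrable I01 (\<lambda>x. (f m x - F x)\<^sup>2)"
    proof (rule integrableI_nonneg)
      show "(\<integral>\<^sup>+x. ennreal ((f m x - F x)\<^sup>2) \<partial>I01) < \<infinity>"
        using bound[OF that] by (simp add: order_le_less_trans[OF _ ennreal_less_top])
    qed (auto simp: Fm fm)
  qed measurable
  have "sqint (\<lambda>x. f (N 0) x - (f (N 0) x - F x))" by (intro sqint_diff f dF[of 0] order_refl)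
  then have sF: "sqint F" by simp
  have "X \<longlonglongrightarrow> cls F"
  proof (rule LIMSEQ_I)
    fix e :: real assume "0 < e"
    then obtain k where k: "(1/2) ^ k < e" using real_arch_pow_inv[of e "1/2"] by auto
    have "norm (X m - cls F) < e" if m: "N k \<le> m" for m
    proof -
      have "(norm (X m - cls F))\<^sup>2 \<le> ((1/2) ^ k)\<^sup>2"
        using bound[OF m] nn_integral_sq[OF dF[OF m]] cls_diff[OF f(1) sF, of m] f(2) by simp
      then have "norm (X m - cls F) \<le> (1/2) ^ k" by (rule power2_le_imp_le) simp
      then show ?thesis using k by simp
    qed
    then show "\<exists>no. \<forall>m\<ge>no. norm (X m - cls F) < e" by blast
  qed
  then show "convergent X" by (auto simp: convergent_def)
qed

lemma norm_cls_integral: "sqint f \<Longrightarrow> (norm (cls f))\<^sup>2 = integral {0..1} (\<lambda>x. (f x)\<^sup>2)"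
  by (simp add: norm_cls integral_I01 sqint_def)

lemma inner_cls_integral: "sqint f \<Longrightarrow> sqint g \<Longrightarrow> inner (cls f) (cls g) = integral {0..1} (\<lambda>x. f x * g x)"
  by (simp add: inner_cls integral_I01 sqint_mult)

lemma abs_integrable_subinterval:
  fixes f :: "real \<Rightarrow> real"
  assumes "f absolutely_integrable_on {a..b}" "a \<le> c" "d \<le> b"
  shows "f absolutely_integrable_on {c..d}"
  by (rule set_integrable_subset[OF assms(1)]) (use assms in auto)

lemma abs_integrable_imp_integrable:
  fixes f :: "real \<Rightarrow> real"
  shows "f absolutely_integrable_on S \<Longrightarrow> f integrable_on S"
  by (rule set_lebesgue_integral_eq_integral(1))

lemma indefinite_integral_diff:
  fixes k :: "real \<Rightarrow> real"
  assumes "k absolutely_integrable_on {a..b}" "a \<le> x" "x \<le> y" "y \<le> b"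
  shows "(c + integral {a..y} k) - (c + integral {a..x} k) = integral {x..y} k"
proof -
  have "integral {a..x} k + integral {x..y} k = integral {a..y} k"
    by (rule Henstock_Kurzweil_Integration.integral_combine[OF assms(2,3)])
      (rule abs_integrable_imp_integrable[OF abs_integrable_subinterval[OF assms(1) order_refl assms(4)]])
  then show ?thesis by simp
qed

lemma indefinite_integral_continuous_on:
  fixes k :: "real \<Rightarrow> real"
  assumes "k absolutely_integrable_on {a..b}"
  shows "continuous_on {a..b} (\<lambda>x. c + integral {a..x} k)"
  by (rule abs_cont_on_imp_continuous[OF abs_cont_on_integral[OF assms indefinite_integral_diff[OF assms]]])

section \<open>Test functions and weak derivatives\<close>

lemma AE_zero_if_integrals_zero:
  fixes f :: "real \<Rightarrow> real"
  assumes f: "f absolutely_integrable_on {0..1}" and z: "\<And>s t. 0 < s \<Longrightarrow> s < t \<Longrightarrow> t < 1 \<Longrightarrow> integral {s..t} f = 0"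
  shows "AE x in I01. f x = 0"
proof -
  define G where "G x = 0 + integral {0..x} f" for x
  have G: "G y - G x = integral {x..y} f" if "0 \<le> x" "x \<le> y" "y \<le> 1" for x y
    unfolding G_def by (rule indefinite_integral_diff[OF f that])
  obtain N where N: "negligible N" "\<And>x. x \<in> {0<..<1} - N \<Longrightarrow> (G has_real_derivative f x) (at x)"
    using lebesgue_differentiation[OF f G] by blast
  show ?thesis
  proof (rule AE_I01_I[OF N(1)])
    fix x assume x: "x \<in> {0<..<1} - N"
    \<comment> \<open>The primitive is constant inside (0, 1), so its derivative, which is f almost
      everywhere, vanishes.\<close>
    have eq: "G y = G x" if "y \<in> {0<..<1}" for y
      using G[of x y] G[of y x] z[of x y] z[of y x] x that by (cases "x = y"; cases "x < y") auto
    have "((\<lambda>_. G x) has_real_derivative f x) (at x)"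
    proof (rule has_field_derivative_transform_within_open[OF N(2)[OF x], of "{0<..<1}"])
      show "x \<in> {0<..<1}" using x by blast
      show "open {0<..<(1::real)}" by simp
      show "G y = G x" if "y \<in> {0<..<1}" for y by (rule eq[OF that])
    qed
    then show "f x = 0" using DERIV_unique DERIV_const by blast
  qed
qed

text \<open>Squaring makes the positive part of (x - s)(t - x) continuously differentiable, and m
  |-> n m / (1 + n m) drives its positive values towards 1 while staying below 1. The result is a C1
  approximation of the indicator of (s, t).\<close>

definition bump :: "real \<Rightarrow> real \<Rightarrow> nat \<Rightarrow> real \<Rightarrow> real" where
  "bump s t n x = real n * (max 0 ((x - s) * (t - x)))\<^sup>2 / (1 + real n * (max 0 ((x - s) * (t - x)))\<^sup>2)"

lemma max_sq_has_derivative: "((\<lambda>z::real. (max 0 z)\<^sup>2) has_real_derivative 2 * max 0 z) (at z)"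
proof -
  consider "z < 0" | "z = 0" | "0 < z" by linarith
  then show ?thesis
  proof cases
    case 1
    have "((\<lambda>z::real. 0) has_real_derivative 2 * max 0 z) (at z)" using 1 by simp
    then show ?thesis
      by (rule has_field_derivative_transform_within_open[of _ _ _ "{..<0}"]) (use 1 in auto)
  next
    case 3
    have "((\<lambda>z::real. z\<^sup>2) has_real_derivative 2 * max 0 z) (at z)" using 3 by (auto intro!: derivative_eq_intros)
    then show ?thesis
      by (rule has_field_derivative_transform_within_open[of _ _ _ "{0<..}"]) (use 3 in auto)
  next
    case 2
    have "((\<lambda>y::real. ((max 0 y)\<^sup>2 - (max 0 0)\<^sup>2) / (y - 0)) \<longlongrightarrow> 0) (at 0)"
    proof (rule Lim_null_comparison)
      show "\<forall>\<^sub>F y in at 0. norm (((max 0 y)\<^sup>2 - (max 0 0)\<^sup>2) / (y - 0)) \<le> \<bar>y::real\<bar>"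
        by (intro always_eventually allI) (auto simp: max_def power2_eq_square)
      show "((\<lambda>y::real. \<bar>y\<bar>) \<longlongrightarrow> 0) (at 0)" by (intro tendsto_rabs_zero tendsto_ident_at)
    qed
    then show ?thesis using 2 by (simp add: has_field_derivative_iff)
  qed
qed

lemma bump_bounds: "0 \<le> bump s t n x" "bump s t n x \<le> 1"
  by (auto simp: bump_def divide_le_eq_1 add_pos_nonneg)

lemma bump_outside: "x \<notin> {s<..<t} \<Longrightarrow> s < t \<Longrightarrow> bump s t n x = 0"
proof -
  assume "x \<notin> {s<..<t}" "s < t"
  then have "(x - s) * (t - x) \<le> 0" by (auto simp: mult_le_0_iff)
  then show "bump s t n x = 0" by (simp add: bump_def max_def)
qed

lemma bump_C1: "bump s t n C1_differentiable_on UNIV"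
proof -
  define p where "p x = (x - s) * (t - x)" for x
  define m where "m x = (max 0 (p x))\<^sup>2" for x
  define m' where "m' x = 2 * max 0 (p x) * (t - x - (x - s))" for x
  have pos: "0 < 1 + real n * m x" for x by (simp add: m_def add_pos_nonneg)
  have p: "(p has_real_derivative (t - x - (x - s))) (at x)" for x
    unfolding p_def by (auto intro!: derivative_eq_intros)
  have m: "(m has_real_derivative m' x) (at x)" for x
    unfolding m_def m'_def using DERIV_chain2[OF max_sq_has_derivative p] .
  define B where "B x = (real n * m' x * (1 + real n * m x) - real n * m x * (real n * m' x)) / (1 + real n * m x)\<^sup>2" for x
  have "(bump s t n has_real_derivative B x) (at x)" for x
  proof -
    have "((\<lambda>x. real n * m x / (1 + real n * m x)) has_real_derivative B x) (at x)"
      unfolding B_def by (rule derivative_eq_intros m refl | (use pos[of x] in \<open>simp add: power2_eq_square\<close>))+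
    then show ?thesis by (simp add: bump_def[abs_def] m_def p_def)
  qed
  moreover have "continuous_on UNIV B"
    unfolding B_def m_def m'_def p_def
    by (intro continuous_intros) (metis add_pos_nonneg less_irrefl mult_nonneg_nonneg of_nat_0_le_iff power_eq_0_iff zero_le_power2 zero_less_one)
  ultimately show ?thesis
    unfolding C1_differentiable_on_def by (auto simp: has_real_derivative_iff_has_vector_derivative intro!: exI[of _ B])
qed

lemma bump_test_fun:
  assumes "0 < s" "s < t" "t < 1" shows "test_fun (bump s t n)"
  unfolding test_fun_def
proof (intro conjI bump_C1 exI[of _ "{s..t}"])
  show "\<forall>x. x \<notin> {s..t} \<longrightarrow> bump s t n x = 0" using bump_outside[OF _ assms(2)] by auto
qed (use assms in auto)

lemma C1_has_deriv:
  assumes "\<phi> C1_differentiable_on UNIV"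
  shows "(\<phi> has_real_derivative deriv \<phi> x) (at x)" "continuous_on UNIV (deriv \<phi>)"
proof -
  obtain D where D: "\<And>x. (\<phi> has_vector_derivative D x) (at x)" "continuous_on UNIV D"
    using assms unfolding C1_differentiable_on_def by auto
  have "(\<phi> has_real_derivative D x) (at x)" for x
    using D(1) by (simp add: has_real_derivative_iff_has_vector_derivative)
  moreover from this have "deriv \<phi> = D" by (auto intro: DERIV_imp_deriv)
  ultimately show "(\<phi> has_real_derivative deriv \<phi> x) (at x)" "continuous_on UNIV (deriv \<phi>)" using D(2) by auto
qed

lemma test_fun_props:
  assumes "test_fun \<phi>"
  shows "sqint \<phi>" "sqint (deriv \<phi>)" "\<phi> 0 = 0" "\<phi> 1 = 0"
    "deriv \<phi> absolutely_integrable_on {0..1}"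
    "\<And>x y. x \<le> y \<Longrightarrow> \<phi> y - \<phi> x = integral {x..y} (deriv \<phi>)"
proof -
  have C1: "\<phi> C1_differentiable_on UNIV" using assms by (simp add: test_fun_def)
  note d = C1_has_deriv[OF C1]
  have "continuous_on UNIV \<phi>" using d(1) by (auto simp: continuous_on_eq_continuous_at intro: DERIV_isCont)
  then show "sqint \<phi>" by (intro sqint_continuous) (rule continuous_on_subset, auto)
  show "sqint (deriv \<phi>)" by (intro sqint_continuous continuous_on_subset[OF d(2)]) auto
  then show "deriv \<phi> absolutely_integrable_on {0..1}" by (rule sqint_abs_integrable)
  show "\<phi> 0 = 0" "\<phi> 1 = 0" using assms by (auto simp: test_fun_def)
  show "\<phi> y - \<phi> x = integral {x..y} (deriv \<phi>)" if "x \<le> y" for x y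
  proof -
    have "(deriv \<phi> has_integral \<phi> y - \<phi> x) {x..y}"
      by (rule fundamental_theorem_of_calculus[OF that])
        (use d(1) in \<open>auto simp: has_real_derivative_iff_has_vector_derivative[symmetric] intro: has_field_derivative_at_within\<close>)
    then show ?thesis by (simp add: integral_unique)
  qed
qed

lemma bump_tendsto_indicator:
  assumes "s < t"
  shows "(\<lambda>n. bump s t n x) \<longlonglongrightarrow> (if x \<in> {s<..<t} then 1 else 0)"
proof (cases "x \<in> {s<..<t}")
  case True
  define m where "m = (max 0 ((x - s) * (t - x)))\<^sup>2"
  have m: "0 < m" using True by (simp add: m_def)
  have "(\<lambda>n. 1 - 1 / (1 + real n * m)) \<longlonglongrightarrow> 1 - 0"
  proof (intro tendsto_diff tendsto_const)
    have "filterlim (\<lambda>n. real n * m) at_top sequentially"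
      by (rule filterlim_tendsto_pos_mult_at_top[OF tendsto_const m filterlim_real_sequentially, unfolded mult.commute[of m]])
    then have "filterlim (\<lambda>n. 1 + real n * m) at_top sequentially"
      by (intro filterlim_tendsto_add_at_top[OF tendsto_const])
    then show "(\<lambda>n. 1 / (1 + real n * m)) \<longlonglongrightarrow> 0"
      using tendsto_inverse_0_at_top by (simp add: divide_inverse)
  qed
  moreover have "1 - 1 / (1 + real n * m) = bump s t n x" for n
  proof -
    have "0 < 1 + real n * m" using m by (simp add: add_pos_nonneg)
    then show ?thesis unfolding bump_def m_def[symmetric] by (simp add: field_simps)
  qed
  ultimately show ?thesis using True by simp
qed (simp add: bump_outside assms del: greaterThanLessThan_iff)

text \<open>The bumps tend boundedly to indicators, so by dominated convergence orthogonality to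
  them makes all integrals over inner intervals vanish.\<close>

lemma zero_if_orthogonal_to_bumps:
  assumes "\<And>s t n. 0 < s \<Longrightarrow> s < t \<Longrightarrow> t < 1 \<Longrightarrow> inner u (cls (bump s t n)) = 0"
  shows "u = 0"
proof -
  obtain f where f: "sqint f" "u = cls f" by (rule l2_cases)
  have "AE x in I01. f x = 0"
  proof (rule AE_zero_if_integrals_zero[OF sqint_abs_integrable[OF f(1)]])
    fix s t :: real assume st: "0 < s" "s < t" "t < 1"
    note b = test_fun_props(1)[OF bump_test_fun[OF st]]
    have "(\<lambda>n. integral {0..1} (\<lambda>x. f x * bump s t n x)) \<longlonglongrightarrow> integral {0..1} (\<lambda>x. f x * (if x \<in> {s<..<t} then 1 else 0))"
    proof (rule dominated_convergence(2))
      show "(\<lambda>x. f x * bump s t n x) integrable_on {0..1}" for n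
        using sqint_mult[OF f(1) b] integrable_I01_iff abs_integrable_imp_integrable by blast
      show "(\<lambda>x. \<bar>f x\<bar>) integrable_on {0..1}"
        using absolutely_integrable_norm[OF sqint_abs_integrable[OF f(1)]] abs_integrable_imp_integrable by (simp add: o_def)
      show "norm (f x * bump s t n x) \<le> \<bar>f x\<bar>" for n x
        using bump_bounds[of s t n x] by (simp add: abs_mult mult_left_le)
      show "(\<lambda>n. f x * bump s t n x) \<longlonglongrightarrow> f x * (if x \<in> {s<..<t} then 1 else 0)" for x
        by (intro tendsto_mult tendsto_const bump_tendsto_indicator st)
    qed
    moreover have "integral {0..1} (\<lambda>x. f x * bump s t n x) = 0" for n
      using assms[OF st, of n] inner_cls_integral[OF f(1) b] f(2) by simp
    ultimately have "integral {0..1} (\<lambda>x. f x * (if x \<in> {s<..<t} then 1 else 0)) = 0"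
      using LIMSEQ_unique[OF tendsto_const[of 0]] by simp
    moreover have "(\<lambda>x. f x * (if x \<in> {s<..<t} then 1 else 0)) = (\<lambda>x. if x \<in> {s<..<t} then f x else 0)" by auto
    ultimately have "integral ({s<..<t} \<inter> {0..1}) f = 0"
      using integral_restrict_Int[of "{0..1}" "{s<..<t}" f] by simp
    moreover have "{s<..<t} \<inter> {0..1} = {s<..<t}" using st by auto
    ultimately show "integral {s..t} f = 0" by (simp add: integral_open_interval_real)
  qed
  then show ?thesis using f cls_eq_iff[OF f(1) sqint_zero] by (simp add: cls_zero)
qed

lemma is_wderiv_unique: "is_wderiv u g \<Longrightarrow> is_wderiv u g' \<Longrightarrow> g = g'"
proof -
  assume "is_wderiv u g" "is_wderiv u g'"
  then have "inner (g - g') (cls (bump s t n)) = 0" if "0 < s" "s < t" "t < 1" for s t n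
    using bump_test_fun[OF that, of n] by (simp add: is_wderiv_def inner_diff_left)
  then have "g - g' = 0" by (rule zero_if_orthogonal_to_bumps)
  then show "g = g'" by simp
qed

lemma wderiv_eqI: "is_wderiv u g \<Longrightarrow> wderiv u = g"
  unfolding wderiv_def using is_wderiv_unique by blast

lemma is_wderiv_wderiv: "u \<in> H1 \<Longrightarrow> is_wderiv u (wderiv u)"
  using wderiv_eqI by (auto simp: H1_def)

lemma is_wderiv_add: "is_wderiv u g \<Longrightarrow> is_wderiv v h \<Longrightarrow> is_wderiv (c *\<^sub>R u + d *\<^sub>R v) (c *\<^sub>R g + d *\<^sub>R h)"
  by (simp add: is_wderiv_def inner_add_left algebra_simps)

lemma is_wderiv_integral:
  assumes k: "sqint k" and f: "\<And>x y. 0 \<le> x \<Longrightarrow> x \<le> y \<Longrightarrow> y \<le> 1 \<Longrightarrow> f y - f x = integral {x..y} k"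
  shows "sqint f" "is_wderiv (cls f) (cls k)"
proof -
  note ka = sqint_abs_integrable[OF k]
  show sf: "sqint f"
    by (rule sqint_continuous[OF abs_cont_on_imp_continuous[OF abs_cont_on_integral[OF ka f]]])
  show "is_wderiv (cls f) (cls k)"
    unfolding is_wderiv_def
  proof (intro allI impI)
    fix \<phi> assume "test_fun \<phi>"
    note \<phi> = test_fun_props[OF this]
    have "((\<lambda>x. k x * \<phi> x + f x * deriv \<phi> x) has_integral (f 1 * \<phi> 1 - f 0 * \<phi> 0)) {0..1}"
      by (rule integration_by_parts_indefinite[OF _ ka \<phi>(5) f \<phi>(6)]) auto
    then have "integral {0..1} (\<lambda>x. k x * \<phi> x + f x * deriv \<phi> x) = 0" using \<phi>(3,4) by (simp add: integral_unique)
    moreover have "integral {0..1} (\<lambda>x. k x * \<phi> x + f x * deriv \<phi> x) = 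
        integral {0..1} (\<lambda>x. k x * \<phi> x) + integral {0..1} (\<lambda>x. f x * deriv \<phi> x)"
      using sqint_mult[OF k \<phi>(1)] sqint_mult[OF sf \<phi>(2)] integrable_I01_iff abs_integrable_imp_integrable
      by (intro integral_add) blast+
    ultimately show "inner (cls f) (cls (deriv \<phi>)) = - inner (cls k) (cls \<phi>)"
      using inner_cls_integral[OF sf \<phi>(2)] inner_cls_integral[OF k \<phi>(1)] by simp
  qed
qed

text \<open>A primitive starting at 0 vanishes to the left of the support, and vanishes again to its
  right because the mean is 0; hence it is a test function.\<close>

lemma mean_zero_antiderivative:
  assumes st: "0 < s" "s < t" "t < 1" and q: "continuous_on UNIV q"
    and supp: "\<And>x. x \<notin> {s..t} \<Longrightarrow> q x = 0" and mean: "integral {0..1} q = 0"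
  obtains \<phi> where "test_fun \<phi>" "deriv \<phi> = q"
proof -
  define \<phi> where "\<phi> x = integral {0..x} q" for x
  have qi: "q integrable_on {x..y}" for x y by (rule integrable_continuous_real) (rule continuous_on_subset[OF q], simp)
  have low: "\<phi> x = 0" if "x < s" for x
  proof -
    have "integral {0..x} q = integral {0..x} (\<lambda>_. 0)" by (rule integral_cong) (use that supp in auto)
    then show ?thesis by (simp add: \<phi>_def)
  qed
  have high: "\<phi> x = 0" if "t < x" for x
  proof -
    have z: "integral {c..d} q = 0" if "t < c" for c d
    proof -
      have "integral {c..d} q = integral {c..d} (\<lambda>_. 0)" by (rule integral_cong) (use that supp in auto)
      then show ?thesis by simp
    qed
    show ?thesis
    proof (cases "x \<le> 1")
      case True
      then show ?thesis
        using Henstock_Kurzweil_Integration.integral_combine[of 0 x 1 q] that st qi z[OF that] mean by (simp add: \<phi>_def)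
    next
      case False
      then show ?thesis
        using Henstock_Kurzweil_Integration.integral_combine[of 0 1 x q] st qi z[of 1 x] mean by (simp add: \<phi>_def)
    qed
  qed
  \<comment> \<open>For negative x the interval {0..x} is empty and the fundamental theorem does not
    apply; the points to the left of s are treated by local constancy instead.\<close>
  have der: "(\<phi> has_real_derivative q x) (at x)" for x
  proof (cases "x < s")
    case True
    have "((\<lambda>_. 0) has_real_derivative q x) (at x)" using supp[of x] True by simp
    then show ?thesis
      by (rule has_field_derivative_transform_within_open[of _ _ _ "{..<s}"]) (use True low in auto)
  next
    case False
    have "(\<phi> has_real_derivative q x) (at x within {0..x + 1})"
      unfolding \<phi>_def by (rule integral_has_real_derivative) (use False st in \<open>auto intro: continuous_on_subset[OF q]\<close>)
    moreover have "at x within {0..x + 1} = at x" by (rule at_within_interior) (use False st in auto)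
    ultimately show ?thesis by simp
  qed
  then have dq: "deriv \<phi> = q" by (auto intro: DERIV_imp_deriv)
  have "\<phi> C1_differentiable_on UNIV"
    unfolding C1_differentiable_on_def
    using der q by (auto simp: has_real_derivative_iff_has_vector_derivative intro!: exI[of _ q])
  then have "test_fun \<phi>"
    unfolding test_fun_def using low high st by (auto intro!: exI[of _ "{s..t}"])
  then show ?thesis using that dq by blast
qed

text \<open>The du Bois-Reymond argument. A bump minus a suitable multiple of the fixed test
  function \<open>\<theta>\<close> has mean 0, so it is the derivative of a test function and
  orthogonal to u. Hence u acts on every bump as the constant c times its mean, with c read off from
  \<open>\<theta>\<close>.\<close>

lemma wderiv_zero_const:
  assumes "is_wderiv u 0"
  obtains c where "u = cls (\<lambda>_. c)"
proof -
  define \<theta> where "\<theta> = bump (1/4) (3/4) 1"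
  have \<theta>t: "test_fun \<theta>" unfolding \<theta>_def by (rule bump_test_fun) auto
  note \<theta> = test_fun_props[OF \<theta>t]
  have cont: "continuous_on UNIV \<phi>" if "test_fun \<phi>" for \<phi>
    using that C1_has_deriv(1)[of \<phi>] unfolding test_fun_def
    by (auto simp: continuous_on_eq_continuous_at intro: DERIV_isCont)
  have one: "sqint (\<lambda>_. c)" for c by (intro sqint_continuous continuous_intros)
  define I where "I = integral {0..1} \<theta>"
  have Ie: "integral {0..1} \<phi> = inner (cls (\<lambda>_. 1)) (cls \<phi>)" if "test_fun \<phi>" for \<phi>
    using inner_cls_integral[OF one test_fun_props(1)[OF that], of 1] by simp
  have "I \<noteq> 0"
  proof
    assume "I = 0"
    have "integral {0..1} \<theta> = 0 \<longleftrightarrow> (\<forall>x\<in>{0..1}. \<theta> x = 0)"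
      by (rule integral_eq_0_iff) (use continuous_on_subset[OF cont[OF \<theta>t]] bump_bounds in \<open>auto simp: \<theta>_def\<close>)
    then have "\<theta> (1/2) = 0" using \<open>I = 0\<close> by (simp add: I_def)
    moreover have "0 < \<theta> (1/2)" by (simp add: \<theta>_def bump_def add_pos_pos)
    ultimately show False by simp
  qed
  define c where "c = inner u (cls \<theta>) / I"
  have "u - cls (\<lambda>_. c) = 0"
  proof (rule zero_if_orthogonal_to_bumps)
    fix s t :: real and n assume st: "0 < s" "s < t" "t < 1"
    define \<psi> where "\<psi> = bump s t n"
    have \<psi>t: "test_fun \<psi>" unfolding \<psi>_def by (rule bump_test_fun[OF st])
    note \<psi> = test_fun_props[OF \<psi>t]
    define J where "J = integral {0..1} \<psi>"
    define q where "q x = \<psi> x - (J / I) * \<theta> x" for x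
    have s\<theta>: "sqint (\<lambda>x. (J / I) * \<theta> x)" by (rule sqint_cmult[OF \<theta>(1)])
    have qc: "continuous_on UNIV q" unfolding q_def by (intro continuous_intros cont \<psi>t \<theta>t)
    have int: "\<psi> integrable_on {0..1}" "\<theta> integrable_on {0..1}"
      using \<psi>(1) \<theta>(1) sqint_abs_integrable abs_integrable_imp_integrable by blast+
    have "integral {0..1} q = integral {0..1} \<psi> - integral {0..1} (\<lambda>x. (J / I) * \<theta> x)"
      unfolding q_def using integrable_on_cmult_left[OF int(2), of "J / I"] by (intro integral_diff[OF int(1)]) simp
    also have "\<dots> = J - (J / I) * I" by (simp add: J_def I_def)
    finally have "integral {0..1} q = J - (J / I) * I" .
    then have mean: "integral {0..1} q = 0" using \<open>I \<noteq> 0\<close> by simp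
    obtain \<phi> where \<phi>: "test_fun \<phi>" "deriv \<phi> = q"
    proof (rule mean_zero_antiderivative[of "min s (1/4)" "max t (3/4)" q])
      show "q x = 0" if "x \<notin> {min s (1/4)..max t (3/4)}" for x
        using that st bump_outside[of x s t n] bump_outside[of x "1/4" "3/4" 1]
        by (auto simp: q_def \<psi>_def \<theta>_def min_def max_def split: if_splits)
    qed (use st qc mean in auto)
    have "inner u (cls q) = 0" using assms \<phi> unfolding is_wderiv_def by (metis inner_zero_left minus_zero)
    moreover have "cls q = cls \<psi> - (J / I) *\<^sub>R cls \<theta>"
      unfolding q_def using cls_diff[OF \<psi>(1) s\<theta>] cls_scaleR[OF \<theta>(1)] by simp
    ultimately have "inner u (cls \<psi>) = (J / I) * inner u (cls \<theta>)" by (simp add: inner_diff_right)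
    also have "\<dots> = c * J" by (simp add: c_def)
    also have "\<dots> = inner (c *\<^sub>R cls (\<lambda>_. 1)) (cls \<psi>)" using Ie[OF \<psi>t] by (simp add: J_def)
    also have "c *\<^sub>R cls (\<lambda>_. 1) = cls (\<lambda>_. c)" using cls_scaleR[OF one, of c 1] by simp
    finally show "inner (u - cls (\<lambda>_. c)) (cls (bump s t n)) = 0" by (simp add: inner_diff_left \<psi>_def)
  qed
  then show ?thesis using that by simp
qed

text \<open>The difference of u and a primitive of k has weak derivative 0 and is therefore
  constant.\<close>

lemma is_wderiv_representative:
  assumes u: "is_wderiv u (cls k)" and k: "sqint k"
  obtains c where "repr u (\<lambda>x. c + integral {0..x} k)"
proof -
  define f where "f x = 0 + integral {0..x} k" for x
  have f: "f y - f x = integral {x..y} k" if "0 \<le> x" "x \<le> y" "y \<le> 1" for x y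
    unfolding f_def by (rule indefinite_integral_diff[OF sqint_abs_integrable[OF k] that])
  note F = is_wderiv_integral[OF k f]
  have "is_wderiv (1 *\<^sub>R u + (-1) *\<^sub>R cls f) (1 *\<^sub>R cls k + (-1) *\<^sub>R cls k)"
    by (rule is_wderiv_add[OF u F(2)])
  then have "is_wderiv (u - cls f) 0" by simp
  then obtain c where c: "u - cls f = cls (\<lambda>_. c)" by (rule wderiv_zero_const)
  have one: "sqint (\<lambda>_. c)" by (intro sqint_continuous continuous_intros)
  have "u = cls (\<lambda>_. c) + cls f" using c by (simp add: algebra_simps)
  also have "\<dots> = cls (\<lambda>x. c + f x)" by (rule cls_add[OF one F(1)])
  finally have "repr u (\<lambda>x. c + f x)" using sqint_add[OF one F(1)] by (simp add: repr_def)
  then show ?thesis using that by (simp add: f_def)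
qed

text \<open>This makes \<open>pt\<close> well defined. If the two values differed, continuity would
  keep the representatives apart on a nonempty open interval, which is not negligible.\<close>

lemma repr_continuous_unique:
  assumes f: "repr u f" "continuous (at x within {0..1}) f" and g: "repr u g" "continuous (at x within {0..1}) g"
    and x: "x \<in> {0..1}"
  shows "f x = g x"
proof (rule ccontr)
  assume ne: "f x \<noteq> g x"
  have "AE y in I01. f y = g y" using f(1) g(1) cls_eq_iff[of f g] by (auto simp: repr_def)
  then obtain N where N: "negligible N" "\<And>y. y \<in> {0<..<1} - N \<Longrightarrow> f y = g y" by (rule AE_I01_D) blast
  have "continuous (at x within {0..1}) (\<lambda>y. f y - g y)" by (intro continuous_intros f g)
  then obtain d where d: "0 < d" "\<And>y. y \<in> {0..1} \<Longrightarrow> dist y x < d \<Longrightarrow> dist (f y - g y) (f x - g x) < \<bar>f x - g x\<bar>"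
    using ne unfolding continuous_within_eps_delta by (metis zero_less_abs_iff eq_iff_diff_eq_0)
  \<comment> \<open>After clipping to [0, 1] the interval is still nonempty, even if x is an
    endpoint.\<close>
  define l r where "l = max 0 (x - d)" and "r = min 1 (x + d)"
  have "l < r" using x d(1) by (auto simp: l_def r_def)
  have "{l<..<r} \<subseteq> N"
  proof
    fix y assume y: "y \<in> {l<..<r}"
    then have "y \<in> {0..1}" "dist y x < d" "y \<in> {0<..<1}" by (auto simp: l_def r_def dist_real_def)
    then have "f y \<noteq> g y" using d(2)[of y] by (auto simp: dist_real_def abs_minus_commute)
    then show "y \<in> N" using N(2) \<open>y \<in> {0<..<1}\<close> by blast
  qed
  then have "negligible {l<..<r}" using N(1) negligible_subset by blast
  then show False using \<open>l < r\<close> open_not_negligible[of "{l<..<r}"] by auto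
qed

lemma pt_eq:
  assumes "repr u f" "continuous (at x within {0..1}) f" "x \<in> {0..1}"
  shows "pt u x = f x"
  unfolding pt_def
proof (rule the_equality)
  show "\<exists>g. repr u g \<and> continuous (at x within {0..1}) g \<and> g x = f x" using assms by blast
  show "c = f x" if "\<exists>g. repr u g \<and> continuous (at x within {0..1}) g \<and> g x = c" for c
    using that repr_continuous_unique[OF assms(1,2) _ _ assms(3)] by metis
qed

lemma pt_eq_continuous_on: "repr u f \<Longrightarrow> continuous_on {0..1} f \<Longrightarrow> x \<in> {0..1} \<Longrightarrow> pt u x = f x"
  by (rule pt_eq) (auto simp: continuous_on_eq_continuous_within)

subsection \<open>Hilbert spaces\<close>

text \<open>A minimising sequence for the distance to \<open>S\<close> is Cauchy by the
  parallelogram law, and at the minimiser no direction in \<open>S\<close> can shorten the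
  distance.\<close>

lemma closed_subspace_projection:
  fixes S :: "'a::{real_inner, banach} set"
  assumes S: "subspace S" "closed S"
  obtains y where "y \<in> S" "\<And>s. s \<in> S \<Longrightarrow> inner (x - y) s = 0"
proof -
  define V where "V = (\<lambda>s. (norm (x - s))\<^sup>2) ` S"
  define d where "d = Inf V"
  have ne: "V \<noteq> {}" using subspace_0[OF S(1)] by (auto simp: V_def)
  have bdd: "bdd_below V" by (rule bdd_belowI[of _ 0]) (auto simp: V_def)
  have dle: "d \<le> (norm (x - s))\<^sup>2" if "s \<in> S" for s
    unfolding d_def using that by (intro cInf_lower bdd) (auto simp: V_def)
  have "\<exists>s\<in>S. (norm (x - s))\<^sup>2 < d + 1 / real (Suc n)" for n
  proof -
    have "\<exists>v\<in>V. v < d + 1 / real (Suc n)"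
      using cInf_lessD[OF ne, of "d + 1 / real (Suc n)"] by (auto simp: d_def)
    then show ?thesis by (auto simp: V_def)
  qed
  then obtain y where y: "\<And>n. y n \<in> S" "\<And>n. (norm (x - y n))\<^sup>2 < d + 1 / real (Suc n)"
    by metis
  have par: "(norm (y m - y n))\<^sup>2 \<le> 2 / real (Suc m) + 2 / real (Suc n)" for m n
  proof -
    have mid: "(1/2) *\<^sub>R (y m + y n) \<in> S" using y(1) S(1) by (simp add: subspace_add subspace_scale)
    have "(norm (y m - y n))\<^sup>2 = 2 * (norm (x - y m))\<^sup>2 + 2 * (norm (x - y n))\<^sup>2 - 4 * (norm (x - (1/2) *\<^sub>R (y m + y n)))\<^sup>2"
      by (simp add: power2_norm_eq_inner inner_diff_left inner_diff_right inner_add_left inner_add_right inner_commute algebra_simps)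
    moreover have "2 / real (Suc k) = 2 * (1 / real (Suc k))" for k by simp
    ultimately show ?thesis using dle[OF mid] y(2)[of m] y(2)[of n] by linarith
  qed
  have "Cauchy y"
  proof (rule metric_CauchyI)
    fix e :: real assume "0 < e"
    obtain M where M: "4 / e\<^sup>2 < real M" using reals_Archimedean2 by blast
    have "dist (y m) (y n) < e" if "m \<ge> M" "n \<ge> M" for m n
    proof -
      have e2: "0 < e\<^sup>2" using \<open>0 < e\<close> by simp
      have "2 / real (Suc k) < e\<^sup>2 / 2" if "k \<ge> M" for k
      proof -
        have "4 / e\<^sup>2 < real (Suc k)" using M that by linarith
        then show ?thesis using e2 by (simp add: field_simps)
      qed
      then have "(norm (y m - y n))\<^sup>2 < e\<^sup>2" using par[of m n] that by (smt (verit) field_sum_of_halves)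
      then show ?thesis using \<open>0 < e\<close> by (simp add: dist_norm power_less_imp_less_base)
    qed
    then show "\<exists>M. \<forall>m\<ge>M. \<forall>n\<ge>M. dist (y m) (y n) < e" by blast
  qed
  then obtain z where z: "y \<longlonglongrightarrow> z" using Cauchy_convergent convergent_def by blast
  have zS: "z \<in> S" using closed_sequentially[OF S(2)] y(1) z by blast
  have "(\<lambda>n. (norm (x - y n))\<^sup>2) \<longlonglongrightarrow> (norm (x - z))\<^sup>2" by (intro tendsto_intros z)
  moreover have "(\<lambda>n. d + 1 / real (Suc n)) \<longlonglongrightarrow> d + 0"
    by (intro tendsto_intros) (use LIMSEQ_inverse_real_of_nat in \<open>simp add: inverse_eq_divide\<close>)
  ultimately have zd: "(norm (x - z))\<^sup>2 \<le> d"
    using y(2) by (intro LIMSEQ_le[of _ _ _ "d"]) (auto intro: less_imp_le)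
  have "inner (x - z) s = 0" if s: "s \<in> S" for s
  proof (cases "s = 0")
    case False
    \<comment> \<open>The multiple of s whose subtraction from x - z shortens it the most.\<close>
    define t where "t = inner (x - z) s / inner s s"
    have ss: "0 < inner s s" using False by simp
    have "z + t *\<^sub>R s \<in> S" using zS s S(1) by (simp add: subspace_add subspace_scale)
    then have "(norm (x - z))\<^sup>2 \<le> (norm (x - (z + t *\<^sub>R s)))\<^sup>2" using dle[of "z + t *\<^sub>R s"] zd by linarith
    also have "\<dots> = (norm (x - z))\<^sup>2 - 2 * t * inner (x - z) s + t\<^sup>2 * inner s s"
    proof -
      have "(norm (w - t *\<^sub>R s))\<^sup>2 = (norm w)\<^sup>2 - 2 * t * inner w s + t\<^sup>2 * inner s s" for w
        unfolding power2_norm_eq_inner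
        by (simp add: inner_diff_left inner_diff_right inner_commute algebra_simps power2_eq_square)
      from this[of "x - z"] show ?thesis by (simp add: diff_diff_eq)
    qed
    also have "\<dots> = (norm (x - z))\<^sup>2 - (inner (x - z) s)\<^sup>2 / inner s s"
      using ss by (simp add: t_def power2_eq_square field_simps)
    finally have "(inner (x - z) s)\<^sup>2 / inner s s \<le> 0" by simp
    then have "(inner (x - z) s)\<^sup>2 \<le> 0" using ss by (simp add: divide_le_0_iff)
    then show ?thesis by simp
  qed simp
  then show ?thesis using that zS by blast
qed

text \<open>The representing element is a multiple of the residual left when a point with nonzero
  value is projected onto the kernel of \<open>L\<close>. A closed subspace takes the place of the
  whole type because the spaces in use are images inside a product type.\<close>

lemma riesz_representation:
  fixes S :: "'a::{real_inner, banach} set" and L :: "'a \<Rightarrow> real"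
  assumes S: "subspace S" "closed S"
    and add: "\<And>x y. x \<in> S \<Longrightarrow> y \<in> S \<Longrightarrow> L (x + y) = L x + L y"
    and scale: "\<And>x c. x \<in> S \<Longrightarrow> L (c *\<^sub>R x) = c * L x"
    and bound: "\<And>x. x \<in> S \<Longrightarrow> \<bar>L x\<bar> \<le> C * norm x"
  obtains u where "u \<in> S" "\<And>x. x \<in> S \<Longrightarrow> inner u x = L x"
proof (cases "\<forall>x\<in>S. L x = 0")
  case True
  then show ?thesis using that[of 0] subspace_0[OF S(1)] by simp
next
  case False
  then obtain x where x: "x \<in> S" "L x \<noteq> 0" by blast
  have diff: "L (x - y) = L x - L y" if "x \<in> S" "y \<in> S" for x y
    using add[OF that(1), of "(-1) *\<^sub>R y"] scale[OF that(2), of "-1"] that S(1) 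
    by (simp add: subspace_neg)
  define K where "K = {x \<in> S. L x = 0}"
  have L0: "L 0 = 0" using scale[OF subspace_0[OF S(1)], of 0] by simp
  have Ks: "subspace K"
    using S(1) add scale L0 by (auto simp: K_def subspace_def)
  have Kc: "closed K"
    unfolding closed_sequential_limits
  proof (intro allI impI, elim conjE)
    fix f l assume f: "\<forall>n. f n \<in> K" "f \<longlonglongrightarrow> l"
    then have lS: "l \<in> S" using closed_sequentially[OF S(2), of f l] by (auto simp: K_def)
    have "(\<lambda>n. C * norm (l - f n)) \<longlonglongrightarrow> C * norm (l - l)" by (intro tendsto_intros f)
    moreover have "\<bar>L l\<bar> \<le> C * norm (l - f n)" for n
      using bound[of "l - f n"] diff[OF lS, of "f n"] f(1) lS S(1) by (auto simp: K_def subspace_diff)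
    ultimately have "\<bar>L l\<bar> \<le> C * norm (l - l)" by (intro LIMSEQ_le_const) auto
    then show "l \<in> K" using lS by (simp add: K_def)
  qed
  obtain y where y: "y \<in> K" "\<And>s. s \<in> K \<Longrightarrow> inner (x - y) s = 0"
    using closed_subspace_projection[OF Ks Kc] by blast
  define z where "z = x - y"
  have zS: "z \<in> S" using x y S(1) by (simp add: z_def K_def subspace_diff)
  have Lz: "L z = L x" using diff[OF x(1), of y] y(1) by (simp add: z_def K_def)
  have zz: "inner z z \<noteq> 0" using Lz x(2) L0 by auto
  show ?thesis
  proof (rule that[of "(L z / inner z z) *\<^sub>R z"])
    show "(L z / inner z z) *\<^sub>R z \<in> S" using zS S(1) by (simp add: subspace_scale)
    fix w assume w: "w \<in> S"
    have "w - (L w / L z) *\<^sub>R z \<in> K"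
      using w zS S(1) Lz x(2) diff[OF w, of "(L w / L z) *\<^sub>R z"] scale[OF zS]
      by (simp add: K_def subspace_diff subspace_scale)
    then have "inner z (w - (L w / L z) *\<^sub>R z) = 0" using y(2) by (simp add: z_def)
    then have "inner z w = (L w / L z) * inner z z" by (simp add: inner_diff_right)
    then show "inner ((L z / inner z z) *\<^sub>R z) w = L w" using zz Lz x(2) by simp
  qed
qed

lemma subspace_closure_real:
  fixes S :: "'a::real_normed_vector set"
  assumes "subspace S" shows "subspace (closure S)"
proof (rule subspaceI)
  show "0 \<in> closure S" using subspace_0[OF assms] closure_subset by blast
next
  fix x y assume "x \<in> closure S" "y \<in> closure S"
  then obtain f g where f: "\<And>n. f n \<in> S" "f \<longlonglongrightarrow> x" and g: "\<And>n. g n \<in> S" "g \<longlonglongrightarrow> y"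
    unfolding closure_sequential by blast
  have "(\<lambda>n. f n + g n) \<longlonglongrightarrow> x + y" by (intro tendsto_add f g)
  then show "x + y \<in> closure S"
    unfolding closure_sequential using subspace_add[OF assms f(1) g(1)]
    by (intro CollectI exI[of _ "\<lambda>n. f n + g n"]) simp
next
  fix x c assume "x \<in> closure S"
  then obtain f where f: "\<And>n. f n \<in> S" "f \<longlonglongrightarrow> x"
    unfolding closure_sequential by blast
  have "(\<lambda>n. c *\<^sub>R f n) \<longlonglongrightarrow> c *\<^sub>R x" by (intro tendsto_scaleR tendsto_const f)
  then show "c *\<^sub>R x \<in> closure S"
    unfolding closure_sequential using subspace_scale[OF assms f(1)]
    by (intro CollectI exI[of _ "\<lambda>n. c *\<^sub>R f n"]) simp
qed

lemma orthogonal_complement_trivial_dense: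
  fixes S X :: "'a::{real_inner, banach} set"
  assumes S: "subspace S" "S \<subseteq> X" and X: "subspace X" "closed X"
    and orth: "\<And>z. z \<in> X \<Longrightarrow> (\<And>s. s \<in> S \<Longrightarrow> inner z s = 0) \<Longrightarrow> z = 0"
  shows "X \<subseteq> closure S"
proof
  fix x assume x: "x \<in> X"
  obtain y where y: "y \<in> closure S" "\<And>s. s \<in> closure S \<Longrightarrow> inner (x - y) s = 0"
    using closed_subspace_projection[OF subspace_closure_real[OF S(1)] closed_closure] by blast
  have "closure S \<subseteq> X" by (rule closure_minimal[OF S(2) X(2)])
  then have "x - y \<in> X" using x y(1) X(1) by (auto intro: subspace_diff)
  then have "x - y = 0" using orth y(2) closure_subset by blast
  then show "x \<in> closure S" using y(1) by simp
qed

subsection \<open>Generation of contraction semigroups\<close>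

text \<open>Spaces are subsets of a Hilbert type, and \<open>A\<close> is a total function that is
  constrained on \<open>D\<close> only. The range condition is assumed for every step length because
  the Euler steps become arbitrarily short.\<close>

locale max_dissipative =
  fixes X D :: "'a::{real_inner, banach} set" and A :: "'a \<Rightarrow> 'a"
  assumes X: "subspace X" "closed X" and D: "subspace D" "D \<subseteq> X"
    and A_X: "x \<in> D \<Longrightarrow> A x \<in> X"
    and A_add: "x \<in> D \<Longrightarrow> y \<in> D \<Longrightarrow> A (x + y) = A x + A y"
    and A_scale: "x \<in> D \<Longrightarrow> A (c *\<^sub>R x) = c *\<^sub>R A x"
    and diss: "x \<in> D \<Longrightarrow> inner (A x) x \<le> 0"
    and range: "0 < h \<Longrightarrow> y \<in> X \<Longrightarrow> \<exists>x\<in>D. x - h *\<^sub>R A x = y"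
begin

lemma A_diff: "x \<in> D \<Longrightarrow> y \<in> D \<Longrightarrow> A (x - y) = A x - A y"
  using A_add[of x "(-1) *\<^sub>R y"] A_scale[of y "-1"] subspace_scale[OF D(1), of y "-1"] by simp

lemma diss_norm: 
  assumes "x \<in> D" "0 \<le> h"
  shows "norm x \<le> norm (x - h *\<^sub>R A x)"
proof (cases "x = 0")
  case False
  have "(norm x)\<^sup>2 \<le> inner (x - h *\<^sub>R A x) x"
    using diss[OF assms(1)] assms(2) mult_nonneg_nonpos[of h "inner (A x) x"] 
    by (simp add: inner_diff_left power2_norm_eq_inner)
  also have "\<dots> \<le> norm (x - h *\<^sub>R A x) * norm x" by (rule norm_cauchy_schwarz)
  finally show ?thesis using False by (simp add: power2_eq_square)
qed simp

text \<open>The resolvent (1 - h A)^(-1), that is, one implicit Euler step; \<open>J_unique\<close>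
  shows that there is only one candidate to choose.\<close>

definition J :: "real \<Rightarrow> 'a \<Rightarrow> 'a" where
  "J h y = (SOME x. x \<in> D \<and> x - h *\<^sub>R A x = y)"

lemma J: assumes "0 < h" "y \<in> X" shows J_D: "J h y \<in> D" and J_eq: "J h y - h *\<^sub>R A (J h y) = y"
proof -
  have "\<exists>x. x \<in> D \<and> x - h *\<^sub>R A x = y" using range[OF assms] by blast
  then have "J h y \<in> D \<and> J h y - h *\<^sub>R A (J h y) = y" unfolding J_def by (rule someI_ex)
  then show "J h y \<in> D" "J h y - h *\<^sub>R A (J h y) = y" by auto
qed

lemma J_unique:
  assumes "0 < h" "x \<in> D" "x - h *\<^sub>R A x = y"
  shows "J h y = x"
proof -
  have y: "y \<in> X" using assms D(2) A_X X(1) by (metis subsetD subspace_diff subspace_scale)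
  note * = J_D[OF assms(1) y] J_eq[OF assms(1) y]
  have "J h y - x - h *\<^sub>R A (J h y - x) = (J h y - h *\<^sub>R A (J h y)) - (x - h *\<^sub>R A x)"
    unfolding A_diff[OF *(1) assms(2)] scaleR_diff_right by simp
  also have "\<dots> = 0" using *(2) assms(3) by simp
  finally show ?thesis
    using diss_norm[of "J h y - x" h] * assms D(1) by (simp add: subspace_diff)
qed

lemma J_X: "0 < h \<Longrightarrow> y \<in> X \<Longrightarrow> J h y \<in> X"
  using J_D D(2) by blast

lemma J_norm: "0 < h \<Longrightarrow> y \<in> X \<Longrightarrow> norm (J h y) \<le> norm y"
  using diss_norm[of "J h y" h] J by simp

lemma J_add: 
  assumes h: "0 < h" and x: "x \<in> X" and y: "y \<in> X" 
  shows "J h (x + y) = J h x + J h y"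
proof (rule J_unique[OF h subspace_add[OF D(1) J_D[OF h x] J_D[OF h y]]])
  have "J h x + J h y - h *\<^sub>R A (J h x + J h y) = (J h x - h *\<^sub>R A (J h x)) + (J h y - h *\<^sub>R A (J h y))"
    unfolding A_add[OF J_D[OF h x] J_D[OF h y]] scaleR_add_right by simp
  then show "J h x + J h y - h *\<^sub>R A (J h x + J h y) = x + y"
    by (simp only: J_eq[OF h x] J_eq[OF h y])
qed

lemma J_scale: 
  assumes h: "0 < h" and x: "x \<in> X"
  shows "J h (c *\<^sub>R x) = c *\<^sub>R J h x"
proof (rule J_unique[OF h subspace_scale[OF D(1) J_D[OF h x]]])
  have "c *\<^sub>R J h x - h *\<^sub>R A (c *\<^sub>R J h x) = c *\<^sub>R (J h x - h *\<^sub>R A (J h x))"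
    unfolding A_scale[OF J_D[OF h x]] scaleR_diff_right by (simp add: mult.commute)
  then show "c *\<^sub>R J h x - h *\<^sub>R A (c *\<^sub>R J h x) = c *\<^sub>R x"
    by (simp only: J_eq[OF h x])
qed

lemma J_diff: "0 < h \<Longrightarrow> x \<in> X \<Longrightarrow> y \<in> X \<Longrightarrow> J h (x - y) = J h x - J h y"
  using J_add[of h x "(-1) *\<^sub>R y"] J_scale[of h y "-1"] subspace_scale[OF X(1), of y "-1"] by simp

lemma J_A: "0 < h \<Longrightarrow> x \<in> D \<Longrightarrow> A (J h x) = J h (A x)"
proof -
  assume h: "0 < h" and x: "x \<in> D"
  have xX: "x \<in> X" using x D(2) by blast
  have "J h x - h *\<^sub>R A (J h x) = x" using J_eq[OF h xX] .
  moreover have "J h x - h *\<^sub>R J h (A x) = J h (x - h *\<^sub>R A x)"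
    using J_diff[OF h xX subspace_scale[OF X(1) A_X[OF x]]] J_scale[OF h A_X[OF x]] by simp
  moreover have "J h (x - h *\<^sub>R A x) = x" using J_unique[OF h x refl] .
  ultimately have "J h x - h *\<^sub>R A (J h x) = J h x - h *\<^sub>R J h (A x)" by simp
  then have "h *\<^sub>R A (J h x) = h *\<^sub>R J h (A x)" by (simp only: diff_left_imp_eq)
  then show ?thesis using h by simp
qed

lemma J_minus_id: "0 < h \<Longrightarrow> x \<in> D \<Longrightarrow> J h x - x = h *\<^sub>R J h (A x)"
  using J_eq[of h x] J_A[of h x] D(2) by (simp add: subset_iff algebra_simps)

lemma Jn_X: "0 < h \<Longrightarrow> y \<in> X \<Longrightarrow> (J h ^^ n) y \<in> X"
  by (induction n) (auto intro: J_X)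

lemma Jn_norm: "0 < h \<Longrightarrow> y \<in> X \<Longrightarrow> norm ((J h ^^ n) y) \<le> norm y"
  by (induction n) (auto intro: order_trans[OF J_norm] Jn_X)

lemma Jn_add: "0 < h \<Longrightarrow> x \<in> X \<Longrightarrow> y \<in> X \<Longrightarrow> (J h ^^ n) (x + y) = (J h ^^ n) x + (J h ^^ n) y"
  by (induction n) (auto simp: J_add Jn_X)

lemma Jn_scale: "0 < h \<Longrightarrow> x \<in> X \<Longrightarrow> (J h ^^ n) (c *\<^sub>R x) = c *\<^sub>R (J h ^^ n) x"
  by (induction n) (auto simp: J_scale Jn_X)

lemma Jn_diff: "0 < h \<Longrightarrow> x \<in> X \<Longrightarrow> y \<in> X \<Longrightarrow> (J h ^^ n) (x - y) = (J h ^^ n) x - (J h ^^ n) y"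
  by (induction n) (auto simp: J_diff Jn_X)

lemma Jn_D: "0 < h \<Longrightarrow> x \<in> D \<Longrightarrow> (J h ^^ n) x \<in> D"
  using D(2) by (induction n) (auto intro: J_D)

lemma Jn_A: "0 < h \<Longrightarrow> x \<in> D \<Longrightarrow> A ((J h ^^ n) x) = (J h ^^ n) (A x)"
  by (induction n) (auto simp: J_A Jn_D)

lemma Jn_minus_id: 
  assumes "0 < h" "x \<in> D"
  shows "norm ((J h ^^ n) x - x) \<le> real n * h * norm (A x)"
proof (induction n)
  case (Suc n)
  have DX: "(J h ^^ n) x \<in> D" using Jn_D assms by blast
  have "norm (J h ((J h ^^ n) x) - (J h ^^ n) x) = h * norm (J h (A ((J h ^^ n) x)))"
    using J_minus_id[OF assms(1) DX] assms(1) by simp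
  also have "\<dots> \<le> h * norm (A x)"
    using J_norm[OF assms(1) A_X[OF DX]] Jn_A[OF assms, of n] Jn_norm[OF assms(1) A_X[OF assms(2)], of n] assms(1)
    by (intro mult_left_mono) auto
  finally have "norm (J h ((J h ^^ n) x) - (J h ^^ n) x) \<le> h * norm (A x)" .
  moreover have "norm (J h ((J h ^^ n) x) - x) \<le> norm (J h ((J h ^^ n) x) - (J h ^^ n) x) + norm ((J h ^^ n) x - x)"
    by (rule norm_diff_triangle_ineq[of _ "(J h ^^ n) x" "(J h ^^ n) x" x, simplified]) 
  ultimately show ?case using Suc by (simp add: algebra_simps)
qed simp

text \<open>In a Hilbert space density comes for free. If z is orthogonal to \<open>D\<close> and x
  = J 1 z, then x - A x = z is orthogonal to x, so the squared norm of x equals the product of A x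
  and x, which is at most 0.\<close>

lemma D_dense: "X \<subseteq> closure D"
proof (rule orthogonal_complement_trivial_dense[OF D X])
  fix z assume z: "z \<in> X" and orth: "\<And>s. s \<in> D \<Longrightarrow> inner z s = 0"
  have J1: "J 1 z \<in> D" "J 1 z - A (J 1 z) = z" using J[of 1 z] z by auto
  have "inner (J 1 z - A (J 1 z)) (J 1 z) = 0" using orth[OF J1(1)] J1(2) by simp
  then have "inner (J 1 z) (J 1 z) \<le> 0" using diss[OF J1(1)] by (simp add: inner_diff_left)
  then have "J 1 z = 0" using inner_ge_zero[of "J 1 z"] inner_eq_zero_iff[of "J 1 z"] by linarith
  moreover have "A 0 = 0" using A_scale[OF subspace_0[OF D(1)], of 0] by simp
  ultimately show "z = 0" using J1(2) by simp
qed

lemma D_approx: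
  assumes "x \<in> X" "0 < e" obtains y where "y \<in> D" "norm (x - y) < e"
proof -
  have "x \<in> closure D" using assms(1) D_dense by blast
  then obtain y where "y \<in> D" "dist y x < e" using closure_approachable assms(2) by blast
  then show ?thesis using that by (simp add: dist_norm norm_minus_commute)
qed

lemma J_close:
  assumes "x \<in> X" "0 < e"
  obtains d where "0 < d" "\<And>h. 0 < h \<Longrightarrow> h < d \<Longrightarrow> norm (J h x - x) < e"
proof -
  obtain y where y: "y \<in> D" "norm (x - y) < e / 3" using D_approx[OF assms(1), of "e / 3"] assms(2) by auto
  have yX: "y \<in> X" using y(1) D(2) by blast
  define d where "d = e / (3 * (norm (A y) + 1))"
  have pos: "0 < 3 * (norm (A y) + 1)" by (simp add: add_nonneg_pos)
  have "norm (J h x - x) < e" if h: "0 < h" "h < d" for h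
  proof -
    have "norm (J h x - x) = norm (J h (x - y) + (J h y - y) + (y - x))"
      using J_diff[OF h(1) assms(1) yX] by (simp add: algebra_simps)
    also have "\<dots> \<le> norm (J h (x - y)) + norm (J h y - y) + norm (y - x)"
      by (intro order_trans[OF norm_triangle_ineq] add_right_mono norm_triangle_ineq)
    also have "norm (J h (x - y)) \<le> norm (x - y)"
      using J_norm[OF h(1)] assms(1) yX X(1) by (simp add: subspace_diff)
    also have "norm (J h y - y) \<le> h * norm (A y)"
      using Jn_minus_id[OF h(1) y(1), of 1] by simp
    also have "h * norm (A y) \<le> d * (norm (A y) + 1)"
      using h by (intro mult_mono) auto
    also have "d * (norm (A y) + 1) = e / 3"
      using pos by (simp add: d_def field_simps)
    finally show ?thesis using y(2) by (simp add: norm_minus_commute)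
  qed
  moreover have "0 < d" using assms(2) pos by (simp add: d_def)
  ultimately show ?thesis using that by blast
qed

text \<open>\<open>A\<close> commutes with \<open>J h\<close> on \<open>D\<close>, so
  \<open>J h y\<close> lies in the domain of the square of \<open>A\<close> whenever y is in
  \<open>D\<close>, and it tends to y. The second-order error estimate for the Euler scheme needs
  such points.\<close>

lemma D2_approx:
  assumes "x \<in> X" "0 < e" obtains y where "y \<in> D" "A y \<in> D" "norm (x - y) < e"
proof -
  obtain y where y: "y \<in> D" "norm (x - y) < e / 2" using D_approx[OF assms(1), of "e / 2"] assms(2) by auto
  have yX: "y \<in> X" using y(1) D(2) by blast
  obtain d where d: "0 < d" "\<And>h. 0 < h \<Longrightarrow> h < d \<Longrightarrow> norm (J h y - y) < e / 2"
    using J_close[OF yX, of "e / 2"] assms(2) by auto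
  have h: "0 < d / 2" "d / 2 < d" using d(1) by auto
  show ?thesis
  proof (rule that[of "J (d / 2) y"])
    show "J (d/2) y \<in> D" using J_D[OF h(1) yX] .
    show "A (J (d/2) y) \<in> D" using J_A[OF h(1) y(1)] J_D[OF h(1) A_X[OF y(1)]] by simp
    have "norm (x - J (d/2) y) \<le> norm (x - y) + norm (y - J (d/2) y)"
      by (rule norm_diff_triangle_ineq[of _ y y, simplified])
    then show "norm (x - J (d/2) y) < e" using y(2) d(2)[OF h] by (simp add: norm_minus_commute)
  qed
qed

text \<open>With \<open>y = J (h/2) (J (h/2) x)\<close> one has \<open>(1 - hA) y = x - h\<^sup>2/4 A\<^sup>2 y\<close>: halving the step of
  the implicit Euler scheme changes one step only to second order.\<close>
lemma J_halving:
  assumes h: "0 < h" and x: "x \<in> D" "A x \<in> D"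
  shows "norm (J h x - J (h/2) (J (h/2) x)) \<le> h\<^sup>2 / 4 * norm (A (A x))"
proof -
  have h2: "0 < h / 2" using h by simp
  define p where "p = J (h/2) x"
  define y where "y = J (h/2) p"
  have p: "p \<in> D" "A p \<in> D" "A (A p) = J (h/2) (A (A x))" "p - (h/2) *\<^sub>R A p = x"
    using J_D[OF h2 subsetD[OF D(2) x(1)]] J_D[OF h2 subsetD[OF D(2) x(2)]] J_A[OF h2 x(1)] J_A[OF h2 x(2)]
      J_eq[OF h2 subsetD[OF D(2) x(1)]] unfolding p_def by simp_all
  have y: "y \<in> D" "A y \<in> D" "A (A y) = J (h/2) (A (A p))" "y - (h/2) *\<^sub>R A y = p"
    using J_D[OF h2 subsetD[OF D(2) p(1)]] J_D[OF h2 subsetD[OF D(2) p(2)]] J_A[OF h2 p(1)] J_A[OF h2 p(2)]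
      J_eq[OF h2 subsetD[OF D(2) p(1)]] unfolding y_def by simp_all
  have "A p = A y - (h/2) *\<^sub>R A (A y)"
    using A_diff[OF y(1) subspace_scale[OF D(1) y(2)]] A_scale[OF y(2)] y(4) by metis
  then have "x = y - (h/2) *\<^sub>R A y - (h/2) *\<^sub>R (A y - (h/2) *\<^sub>R A (A y))"
    using p(4) y(4) by simp
  also have "\<dots> = (y - h *\<^sub>R A y) + (h\<^sup>2/4) *\<^sub>R A (A y)"
    by (simp add: algebra_simps power2_eq_square flip: scaleR_add_left)
  finally have xe: "x = (y - h *\<^sub>R A y) + (h\<^sup>2/4) *\<^sub>R A (A y)" .
  have AAy: "A (A y) \<in> X" using A_X[OF y(2)] .
  have yX: "y - h *\<^sub>R A y \<in> X" using y A_X D(2) X(1) by (auto intro!: subspace_diff subspace_scale)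
  have "J h x = J h (y - h *\<^sub>R A y) + (h\<^sup>2/4) *\<^sub>R J h (A (A y))"
    using J_add[OF h yX subspace_scale[OF X(1) AAy]] J_scale[OF h AAy] xe by metis
  then have "J h x - y = (h\<^sup>2/4) *\<^sub>R J h (A (A y))"
    using J_unique[OF h y(1) refl] by simp
  then have "norm (J h x - y) = h\<^sup>2/4 * norm (J h (A (A y)))" by simp
  also have "\<dots> \<le> h\<^sup>2/4 * norm (A (A x))"
  proof (rule mult_left_mono)
    have "norm (J h (A (A y))) \<le> norm (A (A y))" by (rule J_norm[OF h AAy])
    also have "\<dots> \<le> norm (A (A p))" using J_norm[OF h2 A_X[OF p(2)]] y(3) by simp
    also have "\<dots> \<le> norm (A (A x))" using J_norm[OF h2 A_X[OF x(2)]] p(3) by simp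
    finally show "norm (J h (A (A y))) \<le> norm (A (A x))" .
  qed simp
  finally show ?thesis by (simp add: y_def p_def)
qed

text \<open>One-step errors simply add up: \<open>J h\<close> is a contraction and does not amplify
  the error made so far, and along the fine orbit the second iterate of \<open>A\<close> does not
  grow.\<close>

lemma Jn_halving:
  assumes h: "0 < h" and x: "x \<in> D" "A x \<in> D"
  shows "norm ((J h ^^ n) x - (J (h/2) ^^ (2 * n)) x) \<le> real n * (h\<^sup>2 / 4) * norm (A (A x))"
proof (induction n)
  case (Suc n)
  have h2: "0 < h / 2" using h by simp
  define u v where "u = (J h ^^ n) x" and "v = (J (h/2) ^^ (2 * n)) x"
  have v: "v \<in> D" "A v \<in> D" "A (A v) = (J (h/2) ^^ (2 * n)) (A (A x))"
    unfolding v_def using Jn_D[OF h2] Jn_A[OF h2] x by auto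
  have uv: "u \<in> X" "v \<in> X" using v D(2) Jn_X[OF h] x unfolding u_def by auto
  have "(J h ^^ Suc n) x - (J (h/2) ^^ (2 * Suc n)) x = J h u - J (h/2) (J (h/2) v)"
    by (simp add: u_def v_def)
  also have "\<dots> = J h (u - v) + (J h v - J (h/2) (J (h/2) v))"
    using J_diff[OF h uv] by simp
  finally have "norm ((J h ^^ Suc n) x - (J (h/2) ^^ (2 * Suc n)) x) \<le> norm (J h (u - v)) + norm (J h v - J (h/2) (J (h/2) v))"
    by (metis norm_triangle_ineq)
  also have "norm (J h (u - v)) \<le> norm (u - v)"
    using J_norm[OF h] uv X(1) by (simp add: subspace_diff)
  also have "norm (J h v - J (h/2) (J (h/2) v)) \<le> h\<^sup>2 / 4 * norm (A (A x))"
  proof -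
    have "h\<^sup>2 / 4 * norm (A (A v)) \<le> h\<^sup>2 / 4 * norm (A (A x))"
      using Jn_norm[OF h2 A_X[OF x(2)], of "2 * n"] v(3) by (intro mult_left_mono) auto
    then show ?thesis using J_halving[OF h v(1,2)] by linarith
  qed
  finally show ?case using Suc unfolding u_def v_def by (simp add: algebra_simps)
qed simp

end

section \<open>The limit of the Euler scheme and its generator\<close>

context max_dissipative
begin

text \<open>Dyadic step lengths make consecutive approximations comparable by halving; rounding the
  number of steps down admits every time t, at the cost of at most one step when schemes are
  compared.\<close>

definition S :: "nat \<Rightarrow> real \<Rightarrow> 'a \<Rightarrow> 'a" where
  "S k t x = (J (1 / 2 ^ k) ^^ nat \<lfloor>t * 2 ^ k\<rfloor>) x"

definition T :: "real \<Rightarrow> 'a \<Rightarrow> 'a" where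
  "T t x = lim (\<lambda>k. S k t x)"

lemma step_pos: "0 < 1 / (2::real) ^ k" by simp

lemma S_X: "x \<in> X \<Longrightarrow> S k t x \<in> X"
  unfolding S_def by (rule Jn_X[OF step_pos])

lemma S_norm: "x \<in> X \<Longrightarrow> norm (S k t x) \<le> norm x"
  unfolding S_def by (rule Jn_norm[OF step_pos])

lemma S_add: "x \<in> X \<Longrightarrow> y \<in> X \<Longrightarrow> S k t (x + y) = S k t x + S k t y"
  unfolding S_def by (rule Jn_add[OF step_pos])

lemma S_scale: "x \<in> X \<Longrightarrow> S k t (c *\<^sub>R x) = c *\<^sub>R S k t x"
  unfolding S_def by (rule Jn_scale[OF step_pos])

lemma S_diff: "x \<in> X \<Longrightarrow> y \<in> X \<Longrightarrow> S k t (x - y) = S k t x - S k t y"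
  unfolding S_def by (rule Jn_diff[OF step_pos])

lemma floor_step: "0 \<le> t \<Longrightarrow> real (nat \<lfloor>t * 2 ^ k\<rfloor>) * (1 / 2 ^ k) \<le> t"
proof -
  assume "0 \<le> t"
  then have "real (nat \<lfloor>t * 2 ^ k\<rfloor>) \<le> t * 2 ^ k" by simp
  then show ?thesis by (simp add: field_simps)
qed

lemma floor_halving:
  fixes t :: real and k :: nat
  assumes "0 \<le> t" and n_def: "n = nat \<lfloor>t * 2 ^ k\<rfloor>"
  shows "nat \<lfloor>t * 2 ^ Suc k\<rfloor> = 2 * n \<or> nat \<lfloor>t * 2 ^ Suc k\<rfloor> = Suc (2 * n)"
proof -
  have "0 \<le> t * 2 ^ k" using assms(1) by simp
  then have "nat \<lfloor>2 * (t * 2 ^ k)\<rfloor> = 2 * n \<or> nat \<lfloor>2 * (t * 2 ^ k)\<rfloor> = Suc (2 * n)"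
    unfolding n_def by linarith
  moreover have "t * 2 ^ Suc k = 2 * (t * 2 ^ k)" by simp
  ultimately show ?thesis by (simp only:)
qed

text \<open>The halving error is n h^2 / 4 with n h <= t, hence of order h; an odd number of fine
  steps adds one more step, also of order h. With h = 2^(-k) the bounds are summable.\<close>

lemma S_step:
  assumes x: "x \<in> D" "A x \<in> D" and t: "0 \<le> t"
  shows "norm (S (Suc k) t x - S k t x) \<le> (t / 4 * norm (A (A x)) + norm (A x)) * (1 / 2) ^ k"
proof -
  define h where "h = 1 / (2::real) ^ k"
  define n where "n = nat \<lfloor>t * 2 ^ k\<rfloor>"
  have h: "0 < h" "0 < h / 2" "h / 2 = 1 / 2 ^ Suc k" by (auto simp: h_def)
  have "norm ((J h ^^ n) x - (J (h/2) ^^ (2 * n)) x) \<le> real n * (h\<^sup>2 / 4) * norm (A (A x))"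
    by (rule Jn_halving[OF h(1) x])
  also have "\<dots> = (real n * h) * (h / 4 * norm (A (A x)))" by (simp add: power2_eq_square)
  also have "\<dots> \<le> t * (h / 4 * norm (A (A x)))"
    using floor_step[OF t, of k] h(1) by (intro mult_right_mono) (auto simp: n_def h_def)
  finally have 1: "norm ((J h ^^ n) x - (J (h/2) ^^ (2 * n)) x) \<le> t * (h / 4 * norm (A (A x)))" .
  define m where "m = nat \<lfloor>t * 2 ^ Suc k\<rfloor>"
  have 2: "norm ((J (h/2) ^^ m) x - (J (h/2) ^^ (2 * n)) x) \<le> h * norm (A x)"
  proof (cases "m = 2 * n")
    case True
    then show ?thesis using h(1) by simp
  next
    case False
    then have m: "m = Suc (2 * n)" using floor_halving[OF t n_def] by (simp add: m_def)
    define y where "y = (J (h/2) ^^ (2 * n)) x"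
    have y: "y \<in> D" "A y = (J (h/2) ^^ (2 * n)) (A x)"
      unfolding y_def using Jn_D[OF h(2) x(1)] Jn_A[OF h(2) x(1)] by auto
    have "norm ((J (h/2) ^^ m) x - (J (h/2) ^^ (2 * n)) x) = norm (J (h/2) y - y)"
      by (simp add: m y_def)
    also have "\<dots> \<le> h / 2 * norm (A y)" using Jn_minus_id[OF h(2) y(1), of 1] by simp
    also have "\<dots> \<le> h * norm (A x)"
      using Jn_norm[OF h(2) A_X[OF x(1)], of "2 * n"] y(2) h(1) by (intro mult_mono) auto
    finally show ?thesis .
  qed
  have "norm (S (Suc k) t x - S k t x) = norm (((J (h/2) ^^ m) x - (J (h/2) ^^ (2 * n)) x) - ((J h ^^ n) x - (J (h/2) ^^ (2 * n)) x))"
    unfolding S_def h(3)[symmetric] h_def[symmetric] m_def[symmetric] n_def[symmetric] by simp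
  also have "\<dots> \<le> h * norm (A x) + t * (h / 4 * norm (A (A x)))"
    using norm_triangle_ineq4 1 2 by (smt (verit))
  also have "\<dots> = (t / 4 * norm (A (A x)) + norm (A x)) * h" by (simp add: algebra_simps)
  also have "h = (1 / 2) ^ k" by (simp add: h_def power_divide)
  finally show ?thesis .
qed

lemma S_convergent_D2:
  assumes x: "x \<in> D" "A x \<in> D" and t: "0 \<le> t"
  shows "convergent (\<lambda>k. S k t x)"
proof -
  have "summable (\<lambda>k. S (Suc k) t x - S k t x)"
  proof (rule summable_comparison_test')
    show "summable (\<lambda>k. (t / 4 * norm (A (A x)) + norm (A x)) * (1 / 2) ^ k)"
      by (intro summable_mult summable_geometric) simp
    show "\<And>k. k \<ge> 0 \<Longrightarrow> norm (S (Suc k) t x - S k t x) \<le> (t / 4 * norm (A (A x)) + norm (A x)) * (1 / 2) ^ k"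
      by (rule S_step[OF x t])
  qed
  then have "convergent (\<lambda>n. \<Sum>k<n. S (Suc k) t x - S k t x)"
    by (simp add: summable_iff_convergent)
  then obtain l where "(\<lambda>n. \<Sum>k<n. S (Suc k) t x - S k t x) \<longlonglongrightarrow> l" by (auto simp: convergent_def)
  moreover have "(\<Sum>k<n. S (Suc k) t x - S k t x) = S n t x - S 0 t x" for n
    by (rule sum_lessThan_telescope)
  ultimately have "(\<lambda>n. S n t x - S 0 t x) \<longlonglongrightarrow> l" by simp
  then have "(\<lambda>n. (S n t x - S 0 t x) + S 0 t x) \<longlonglongrightarrow> l + S 0 t x" by (intro tendsto_intros)
  then show ?thesis by (auto simp: convergent_def)
qed

text \<open>Uniform contractivity of the approximations extends convergence from the dense domain of
  the square of \<open>A\<close> to all of \<open>X\<close>.\<close>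

lemma S_tendsto:
  assumes x: "x \<in> X" and t: "0 \<le> t"
  shows "(\<lambda>k. S k t x) \<longlonglongrightarrow> T t x"
proof -
  have "Cauchy (\<lambda>k. S k t x)"
  proof (rule metric_CauchyI)
    fix e :: real assume "0 < e"
    obtain y where y: "y \<in> D" "A y \<in> D" "norm (x - y) < e / 3"
      using D2_approx[OF x, of "e / 3"] \<open>0 < e\<close> by auto
    have yX: "y \<in> X" "x - y \<in> X" using y(1) D(2) x X(1) by (auto intro: subspace_diff)
    have "Cauchy (\<lambda>k. S k t y)" using S_convergent_D2[OF y(1,2) t] Cauchy_convergent_iff by blast
    then obtain M where M: "\<And>m n. m \<ge> M \<Longrightarrow> n \<ge> M \<Longrightarrow> dist (S m t y) (S n t y) < e / 3"
      using metric_CauchyD[of _ "e / 3"] \<open>0 < e\<close> by (metis divide_pos_pos zero_less_numeral)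
    have d: "dist (S k t x) (S k t y) < e / 3" for k
      using S_norm[OF yX(2), of k t] S_diff[OF x yX(1), of k t] y(3) by (simp add: dist_norm)
    have "dist (S m t x) (S n t x) < e" if "m \<ge> M" "n \<ge> M" for m n
    proof -
      have "dist (S m t x) (S n t x) \<le> dist (S m t x) (S m t y) + dist (S m t y) (S n t y) + dist (S n t y) (S n t x)"
        by (meson add_right_mono dist_triangle order_trans)
      then show ?thesis using d[of m] d[of n] M[OF that] by (simp add: dist_commute)
    qed
    then show "\<exists>M. \<forall>m\<ge>M. \<forall>n\<ge>M. dist (S m t x) (S n t x) < e" by blast
  qed
  then show ?thesis unfolding T_def by (simp add: Cauchy_convergent convergent_LIMSEQ_iff[symmetric])
qed

lemma T_X: "x \<in> X \<Longrightarrow> 0 \<le> t \<Longrightarrow> T t x \<in> X"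
  using closed_sequentially[OF X(2) S_X S_tendsto] by blast

lemma T_norm: "x \<in> X \<Longrightarrow> 0 \<le> t \<Longrightarrow> norm (T t x) \<le> norm x"
  by (rule LIMSEQ_le_const2[OF tendsto_norm[OF S_tendsto]]) (auto intro: S_norm)

lemma T_add: "x \<in> X \<Longrightarrow> y \<in> X \<Longrightarrow> 0 \<le> t \<Longrightarrow> T t (x + y) = T t x + T t y"
  using LIMSEQ_unique[OF S_tendsto[of "x + y" t]] tendsto_add[OF S_tendsto[of x t] S_tendsto[of y t]] 
    subspace_add[OF X(1), of x y] S_add by simp

lemma T_scale: "x \<in> X \<Longrightarrow> 0 \<le> t \<Longrightarrow> T t (c *\<^sub>R x) = c *\<^sub>R T t x"
  using LIMSEQ_unique[OF S_tendsto[of "c *\<^sub>R x" t]] tendsto_scaleR[OF tendsto_const S_tendsto[of x t], of c] 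
    subspace_scale[OF X(1), of x c] S_scale by simp

lemma T_diff: "x \<in> X \<Longrightarrow> y \<in> X \<Longrightarrow> 0 \<le> t \<Longrightarrow> T t (x - y) = T t x - T t y"
  using T_add[of x "(-1) *\<^sub>R y" t] T_scale[of y t "-1"] subspace_scale[OF X(1), of y "-1"] by simp

lemma T_0: "x \<in> X \<Longrightarrow> T 0 x = x"
proof -
  assume x: "x \<in> X"
  have "(\<lambda>k. S k 0 x) = (\<lambda>k. x)" by (simp add: S_def)
  then show "T 0 x = x" using S_tendsto[OF x order_refl] LIMSEQ_unique[OF _ tendsto_const[of x]] by metis
qed

text \<open>One further step of vanishing length does not change a limit. This absorbs the rounding
  of the number of steps in the semigroup law.\<close>

lemma J_step_tendsto:
  assumes y: "\<And>k. y k \<in> X" "y \<longlonglongrightarrow> z"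
  shows "(\<lambda>k. J (1 / 2 ^ k) (y k)) \<longlonglongrightarrow> z"
proof (rule LIMSEQ_I)
  fix e :: real assume "0 < e"
  have z: "z \<in> X" using closed_sequentially[OF X(2)] y by blast
  obtain d where d: "0 < d" "\<And>h. 0 < h \<Longrightarrow> h < d \<Longrightarrow> norm (J h z - z) < e / 2"
    using J_close[OF z, of "e / 2"] \<open>0 < e\<close> by auto
  obtain N1 where N1: "\<And>k. k \<ge> N1 \<Longrightarrow> norm (y k - z) < e / 2"
    using LIMSEQ_D[OF y(2), of "e / 2"] \<open>0 < e\<close> by auto
  have "(\<lambda>k. (1 / 2 :: real) ^ k) \<longlonglongrightarrow> 0" by (intro LIMSEQ_power_zero) simp
  then obtain N2 where N2: "\<And>k. k \<ge> N2 \<Longrightarrow> norm ((1 / 2 :: real) ^ k - 0) < d"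
    using LIMSEQ_D[of _ 0 d] d(1) by blast
  have "norm (J (1 / 2 ^ k) (y k) - z) < e" if "k \<ge> max N1 N2" for k
  proof -
    have "1 / 2 ^ k < d" using N2[of k] that by (simp add: power_divide)
    then have "norm (J (1 / 2 ^ k) z - z) < e / 2" using d(2) step_pos by blast
    moreover have "norm (J (1 / 2 ^ k) (y k - z)) \<le> norm (y k - z)"
      by (rule J_norm[OF step_pos]) (use y(1) z X(1) in \<open>auto intro: subspace_diff\<close>)
    moreover have "norm (J (1 / 2 ^ k) (y k) - z) \<le> norm (J (1 / 2 ^ k) (y k - z)) + norm (J (1 / 2 ^ k) z - z)"
    proof -
      have "J (1 / 2 ^ k) (y k) - z = J (1 / 2 ^ k) (y k - z) + (J (1 / 2 ^ k) z - z)"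
        using J_diff[OF step_pos y(1) z, of k k] by simp
      then show ?thesis using norm_triangle_ineq by metis
    qed
    moreover have "norm (y k - z) < e / 2" using N1[of k] that by simp
    ultimately show ?thesis by linarith
  qed
  then show "\<exists>no. \<forall>k\<ge>no. norm (J (1 / 2 ^ k) (y k) - z) < e" by blast
qed

lemma T_semigroup:
  assumes x: "x \<in> X" and st: "0 \<le> s" "0 \<le> t"
  shows "T (s + t) x = T s (T t x)"
proof -
  define y where "y k = S k s (S k t x)" for k
  have yX: "y k \<in> X" for k unfolding y_def by (intro S_X x)
  have ylim: "y \<longlonglongrightarrow> T s (T t x)"
  proof -
    have "(\<lambda>k. S k s (S k t x - T t x)) \<longlonglongrightarrow> 0"
    proof (rule Lim_null_comparison)
      show "\<forall>\<^sub>F k in sequentially. norm (S k s (S k t x - T t x)) \<le> norm (S k t x - T t x)"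
        by (intro always_eventually allI S_norm subspace_diff[OF X(1)] S_X T_X x st)
      show "(\<lambda>k. norm (S k t x - T t x)) \<longlonglongrightarrow> 0"
        using S_tendsto[OF x st(2)] by (simp add: LIM_zero_iff tendsto_norm_zero)
    qed
    from tendsto_add[OF this S_tendsto[OF T_X[OF x st(2)] st(1)]]
    have "(\<lambda>k. S k s (S k t x - T t x) + S k s (T t x)) \<longlonglongrightarrow> T s (T t x)" by simp
    moreover have "S k s (S k t x - T t x) + S k s (T t x) = y k" for k
      unfolding y_def using S_diff[OF S_X[OF x] T_X[OF x st(2)]] by simp
    ultimately show ?thesis by simp
  qed
  \<comment> \<open>The integer part of a sum is the sum of the integer parts or one more, so the
    two schemes differ by at most one step.\<close>
  have alt: "S k (s + t) x = y k \<or> S k (s + t) x = J (1 / 2 ^ k) (y k)" for k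
  proof -
    define m n p where "m = nat \<lfloor>s * 2 ^ k\<rfloor>" and "n = nat \<lfloor>t * 2 ^ k\<rfloor>" and "p = nat \<lfloor>(s + t) * 2 ^ k\<rfloor>"
    have "0 \<le> s * 2 ^ k" "0 \<le> t * 2 ^ k" "(s + t) * 2 ^ k = s * 2 ^ k + t * 2 ^ k"
      using st by (auto simp: algebra_simps)
    then have "p = m + n \<or> p = Suc (m + n)"
      unfolding m_def n_def p_def by linarith
    then show ?thesis
      unfolding y_def S_def m_def[symmetric] n_def[symmetric] p_def[symmetric] by (auto simp: funpow_add)
  qed
  have le: "norm (S k (s + t) x - T s (T t x)) \<le> norm (y k - T s (T t x)) + norm (J (1 / 2 ^ k) (y k) - T s (T t x))" for k
    using alt[of k] by (elim disjE) auto
  have "(\<lambda>k. norm (y k - T s (T t x)) + norm (J (1 / 2 ^ k) (y k) - T s (T t x))) \<longlonglongrightarrow> 0 + 0"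
    by (intro tendsto_add tendsto_norm_zero LIM_zero ylim J_step_tendsto[OF yX ylim])
  then have "(\<lambda>k. norm (y k - T s (T t x)) + norm (J (1 / 2 ^ k) (y k) - T s (T t x))) \<longlonglongrightarrow> 0"
    by simp
  from Lim_null_comparison[OF always_eventually[OF allI[OF le]] this]
  have "(\<lambda>k. S k (s + t) x) \<longlonglongrightarrow> T s (T t x)" by (rule LIM_zero_cancel)
  moreover have "0 \<le> s + t" using st by simp
  ultimately show ?thesis using LIMSEQ_unique[OF S_tendsto[OF x]] by blast
qed

lemma T_minus_id:
  assumes x: "x \<in> D" and t: "0 \<le> t"
  shows "norm (T t x - x) \<le> t * norm (A x)"
proof -
  have xX: "x \<in> X" using x D(2) by blast
  have "(\<lambda>k. norm (S k t x - x)) \<longlonglongrightarrow> norm (T t x - x)" by (intro tendsto_intros S_tendsto xX t)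
  moreover have "norm (S k t x - x) \<le> t * norm (A x)" for k
    using Jn_minus_id[OF step_pos x, of "nat \<lfloor>t * 2 ^ k\<rfloor>" k] mult_right_mono[OF floor_step[OF t], of "norm (A x)" k]
    unfolding S_def by (simp add: mult.assoc)
  ultimately show ?thesis by (intro LIMSEQ_le_const2[of "\<lambda>k. norm (S k t x - x)"]) auto
qed

lemma T_strongly_continuous:
  assumes x: "x \<in> X"
  shows "((\<lambda>t. norm (T t x - x)) \<longlongrightarrow> 0) (at_right 0)"
  unfolding tendsto_iff
proof (intro allI impI)
  fix e :: real assume "0 < e"
  obtain y where y: "y \<in> D" "norm (x - y) < e / 3" using D_approx[OF x, of "e / 3"] \<open>0 < e\<close> by auto
  have yX: "y \<in> X" using y(1) D(2) by blast
  define d where "d = e / (3 * (norm (A y) + 1))"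
  have pos: "0 < 3 * (norm (A y) + 1)" by (simp add: add_nonneg_pos)
  then have d: "0 < d" using \<open>0 < e\<close> by (simp add: d_def)
  have "dist (norm (T t x - x)) 0 < e" if t: "0 < t" "t < d" for t
  proof -
    have "norm (T t x - x) = norm (T t (x - y) + (T t y - y) + (y - x))"
      using T_diff[OF x yX, of t] t by (simp add: algebra_simps)
    also have "\<dots> \<le> norm (T t (x - y)) + norm (T t y - y) + norm (y - x)"
      by (intro order_trans[OF norm_triangle_ineq] add_right_mono norm_triangle_ineq)
    also have "norm (T t (x - y)) \<le> norm (x - y)"
      by (rule T_norm) (use x yX X(1) t in \<open>auto intro: subspace_diff\<close>)
    also have "norm (T t y - y) \<le> t * norm (A y)"
      using T_minus_id[OF y(1)] t by simp
    also have "t * norm (A y) \<le> d * (norm (A y) + 1)"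
      using t by (intro mult_mono) auto
    also have "d * (norm (A y) + 1) = e / 3"
      using pos by (simp add: d_def field_simps)
    finally show ?thesis using y(2) by (simp add: norm_minus_commute)
  qed
  then show "\<forall>\<^sub>F t in at_right 0. dist (norm (T t x - x)) 0 < e"
    using eventually_at_right_less d by (auto simp: eventually_at_right_field intro!: exI[of _ d])
qed

text \<open>Each Euler step adds h times the iterate of \<open>A x\<close>, so everything depends on
  how far these iterates drift from \<open>A x\<close>. As \<open>A x\<close> need not lie in
  \<open>D\<close>, the drift is measured through a nearby w in \<open>D\<close>, whose own drift is
  at most t times the norm of \<open>A w\<close>.\<close>

lemma T_first_order:
  assumes x: "x \<in> D" and w: "w \<in> D" and t: "0 \<le> t"
  shows "norm (T t x - x - t *\<^sub>R A x) \<le> t * (2 * norm (A x - w) + t * norm (A w))"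
proof -
  have xX: "x \<in> X" and AX: "A x \<in> X" and wX: "w \<in> X" using x w D(2) A_X by auto
  have AwX: "A x - w \<in> X" using AX wX X(1) by (rule subspace_diff[rotated 1])
  have B: "norm ((J h ^^ j) (A x) - A x) \<le> 2 * norm (A x - w) + t * norm (A w)" 
    if h: "0 < h" "real j * h \<le> t" for h j
  proof -
    have "(J h ^^ j) (A x) - A x = (J h ^^ j) (A x - w) + ((J h ^^ j) w - w) + (w - A x)"
      using Jn_diff[OF h(1) AX wX] by simp
    then have "norm ((J h ^^ j) (A x) - A x) \<le> norm ((J h ^^ j) (A x - w)) + norm ((J h ^^ j) w - w) + norm (w - A x)"
      by (metis norm_triangle_mono norm_triangle_ineq order_refl)
    also have "norm ((J h ^^ j) (A x - w)) \<le> norm (A x - w)" by (rule Jn_norm[OF h(1) AwX])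
    also have "norm ((J h ^^ j) w - w) \<le> t * norm (A w)"
      using Jn_minus_id[OF h(1) w, of j] mult_right_mono[OF h(2), of "norm (A w)"] by simp
    finally show ?thesis by (simp add: norm_minus_commute)
  qed
  have step: "norm ((J h ^^ n) x - x - (real n * h) *\<^sub>R A x) \<le> real n * h * (2 * norm (A x - w) + t * norm (A w))"
    if h: "0 < h" "real n * h \<le> t" for h n
    using h(2)
  proof (induction n)
    case (Suc n)
    have n: "real n * h \<le> t" using Suc.prems h(1) by (simp add: algebra_simps)
    have DX: "(J h ^^ n) x \<in> D" using Jn_D[OF h(1) x] .
    have "(J h ^^ Suc n) x - (J h ^^ n) x = h *\<^sub>R (J h ^^ Suc n) (A x)"
      using J_minus_id[OF h(1) DX] Jn_A[OF h(1) x] by simp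
    then have "(J h ^^ Suc n) x - x - (real (Suc n) * h) *\<^sub>R A x =
        ((J h ^^ n) x - x - (real n * h) *\<^sub>R A x) + h *\<^sub>R ((J h ^^ Suc n) (A x) - A x)"
      by (simp add: algebra_simps)
    then have "norm ((J h ^^ Suc n) x - x - (real (Suc n) * h) *\<^sub>R A x) \<le>
        norm ((J h ^^ n) x - x - (real n * h) *\<^sub>R A x) + h * norm ((J h ^^ Suc n) (A x) - A x)"
      using h(1) by (metis abs_of_pos norm_scaleR norm_triangle_ineq)
    also have "\<dots> \<le> real n * h * (2 * norm (A x - w) + t * norm (A w)) + h * (2 * norm (A x - w) + t * norm (A w))"
      using Suc.IH[OF n] B[OF h(1) Suc.prems] h(1) by (intro add_mono mult_left_mono) auto
    finally show ?case by (simp add: algebra_simps)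
  qed simp
  define n where "n k = nat \<lfloor>t * 2 ^ k\<rfloor>" for k
  have nt: "real (n k) * (1 / 2 ^ k) \<le> t" for k unfolding n_def by (rule floor_step[OF t])
  have lim: "(\<lambda>k. real (n k) * (1 / 2 ^ k)) \<longlonglongrightarrow> t"
  proof (rule tendsto_sandwich[OF _ _ _ tendsto_const])
    show "\<forall>\<^sub>F k in sequentially. t - (1 / 2) ^ k \<le> real (n k) * (1 / 2 ^ k)"
    proof (intro always_eventually allI)
      fix k
      have "t * 2 ^ k - 1 \<le> real (n k)" unfolding n_def using t by linarith
      then have "(t * 2 ^ k - 1) * (1 / 2 ^ k) \<le> real (n k) * (1 / 2 ^ k)" by (intro mult_right_mono) auto
      moreover have "(t * 2 ^ k - 1) * (1 / 2 ^ k) = t - (1 / 2) ^ k" by (simp add: field_simps power_divide)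
      ultimately show "t - (1 / 2) ^ k \<le> real (n k) * (1 / 2 ^ k)" by simp
    qed
    show "\<forall>\<^sub>F k in sequentially. real (n k) * (1 / 2 ^ k) \<le> t" using nt by simp
    have "(\<lambda>k. t - (1 / 2 :: real) ^ k) \<longlonglongrightarrow> t - 0"
      by (intro tendsto_diff tendsto_const LIMSEQ_power_zero) simp
    then show "(\<lambda>k. t - (1 / 2 :: real) ^ k) \<longlonglongrightarrow> t" by simp
  qed
  have "(\<lambda>k. norm (S k t x - x - (real (n k) * (1 / 2 ^ k)) *\<^sub>R A x)) \<longlonglongrightarrow> norm (T t x - x - t *\<^sub>R A x)"
    by (intro tendsto_norm tendsto_diff tendsto_scaleR S_tendsto xX t lim tendsto_const)
  moreover have "(\<lambda>k. real (n k) * (1 / 2 ^ k) * (2 * norm (A x - w) + t * norm (A w))) \<longlonglongrightarrow> t * (2 * norm (A x - w) + t * norm (A w))"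
    by (intro tendsto_mult lim tendsto_const)
  ultimately show ?thesis
    by (rule LIMSEQ_le) (use step[OF step_pos nt] in \<open>auto simp: S_def n_def\<close>)
qed

lemma T_derivative_0:
  assumes x: "x \<in> D"
  shows "((\<lambda>h. norm ((T h x - x) /\<^sub>R h - A x)) \<longlongrightarrow> 0) (at_right 0)"
  unfolding tendsto_iff
proof (intro allI impI)
  fix e :: real assume "0 < e"
  obtain w where w: "w \<in> D" "norm (A x - w) < e / 4" using D_approx[OF A_X[OF x], of "e / 4"] \<open>0 < e\<close> by auto
  define d where "d = e / (2 * (norm (A w) + 1))"
  have pos: "0 < 2 * (norm (A w) + 1)" by (simp add: add_nonneg_pos)
  then have d: "0 < d" using \<open>0 < e\<close> by (simp add: d_def)
  have "dist (norm ((T t x - x) /\<^sub>R t - A x)) 0 < e" if t: "0 < t" "t < d" for t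
  proof -
    have "(T t x - x) /\<^sub>R t - A x = (T t x - x - t *\<^sub>R A x) /\<^sub>R t"
      using t by (simp add: scaleR_diff_right)
    then have "norm ((T t x - x) /\<^sub>R t - A x) = norm (T t x - x - t *\<^sub>R A x) / t"
      using t by (simp add: divide_inverse mult.commute)
    also have "\<dots> \<le> 2 * norm (A x - w) + t * norm (A w)"
      using T_first_order[OF x w(1), of t] t by (simp add: divide_le_eq mult.commute)
    also have "t * norm (A w) \<le> d * (norm (A w) + 1)"
      using t by (intro mult_mono) auto
    also have "d * (norm (A w) + 1) = e / 2"
      using pos by (simp add: d_def field_simps)
    finally show ?thesis using w(2) by simp
  qed
  then show "\<forall>\<^sub>F t in at_right 0. dist (norm ((T t x - x) /\<^sub>R t - A x)) 0 < e"
    using d by (auto simp: eventually_at_right_field intro!: exI[of _ d])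
qed

text \<open>The generator extends \<open>A\<close> by the first-order estimate; it is not larger
  because \<open>A\<close> is maximal. If x has right derivative z, solve y - A y = x - z in
  \<open>D\<close>. Then d = y - x satisfies (T h d - d) / h -> d, while contractivity makes the
  inner product of this quotient with d at most 0. Hence d = 0.\<close>

theorem T_generator: "generator X norm T D A"
  unfolding generator_def
proof (intro conjI ballI iffI)
  show "D \<subseteq> X" by (rule D(2))
  fix x z assume x: "x \<in> X" and z: "z \<in> X"
  show "((\<lambda>h. norm ((T h x - x) /\<^sub>R h - z)) \<longlongrightarrow> 0) (at_right 0)" if "x \<in> D \<and> A x = z"
    using T_derivative_0 that by blast
  assume lim: "((\<lambda>h. norm ((T h x - x) /\<^sub>R h - z)) \<longlongrightarrow> 0) (at_right 0)"
  obtain y where y: "y \<in> D" "y - A y = x - z"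
    using range[of 1 "x - z"] x z X(1) by (auto simp: subspace_diff)
  have yX: "y \<in> X" using y(1) D(2) by blast
  define d where "d = y - x"
  have dX: "d \<in> X" using x yX X(1) by (simp add: d_def subspace_diff)
  have Ad: "A y - z = d" using y(2) by (simp add: d_def algebra_simps)
  have "((\<lambda>h. (T h x - x) /\<^sub>R h - z) \<longlongrightarrow> 0) (at_right 0)" by (rule tendsto_norm_zero_cancel[OF lim])
  moreover have "((\<lambda>h. (T h y - y) /\<^sub>R h - A y) \<longlongrightarrow> 0) (at_right 0)"
    by (rule tendsto_norm_zero_cancel[OF T_derivative_0[OF y(1)]])
  ultimately have "((\<lambda>h. ((T h y - y) /\<^sub>R h - A y) - ((T h x - x) /\<^sub>R h - z) + d) \<longlongrightarrow> 0 - 0 + d) (at_right 0)"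
    by (intro tendsto_intros)
  moreover have "\<forall>\<^sub>F h in at_right 0. ((T h y - y) /\<^sub>R h - A y) - ((T h x - x) /\<^sub>R h - z) + d = (T h d - d) /\<^sub>R h"
    using eventually_at_right_less[of 0]
  proof eventually_elim
    case (elim h)
    have "T h d = T h y - T h x" using T_diff[OF yX x] elim by (simp add: d_def)
    moreover have "((T h y - y) /\<^sub>R h - A y) - ((T h x - x) /\<^sub>R h - z) + d = ((T h y - T h x) - (y - x)) /\<^sub>R h"
      unfolding Ad[symmetric] by (simp add: scaleR_diff_right)
    ultimately show ?case by (simp add: d_def)
  qed
  ultimately have "((\<lambda>h. (T h d - d) /\<^sub>R h) \<longlongrightarrow> 0 - 0 + d) (at_right 0)"
    by (rule Lim_transform_eventually)
  then have "((\<lambda>h. (T h d - d) /\<^sub>R h) \<longlongrightarrow> d) (at_right 0)" by simp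
  then have "((\<lambda>h. inner ((T h d - d) /\<^sub>R h) d) \<longlongrightarrow> inner d d) (at_right 0)"
    by (intro tendsto_inner tendsto_const)
  moreover have "\<forall>\<^sub>F h in at_right 0. inner ((T h d - d) /\<^sub>R h) d \<le> 0"
    using eventually_at_right_less[of 0]
  proof eventually_elim
    case (elim h)
    have "inner (T h d) d \<le> norm (T h d) * norm d" by (rule norm_cauchy_schwarz)
    also have "\<dots> \<le> norm d * norm d" using T_norm[OF dX] elim by (intro mult_right_mono) auto
    finally have "inner (T h d - d) d \<le> 0"
      by (simp add: inner_diff_left power2_eq_square[symmetric] power2_norm_eq_inner)
    then show ?case using elim by (simp add: mult_nonneg_nonpos)
  qed
  ultimately have "inner d d \<le> 0"
    by (intro tendsto_upperbound[of _ _ "at_right (0::real)"]) auto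
  then have "d = 0" using inner_ge_zero[of d] inner_eq_zero_iff[of d] by linarith
  then show "x \<in> D" "A x = z" using y(1) Ad by (auto simp: d_def)
qed

end

section \<open>Quasi-dissipative operators by exponential rescaling\<close>

lemma tendsto_exp_quotient:
  "((\<lambda>h. (exp (\<omega> * h) - 1) / h) \<longlongrightarrow> \<omega>) (at_right (0::real))"
proof -
  have "((\<lambda>h. exp (\<omega> * h)) has_real_derivative \<omega>) (at 0)"
    by (auto intro!: derivative_eq_intros)
  then have "((\<lambda>h. (exp (\<omega> * h) - 1) / h) \<longlongrightarrow> \<omega>) (at 0)"
    by (simp add: has_field_derivative_iff)
  then show ?thesis by (rule tendsto_within_subset) simp
qed

lemma rescaled_quotient:
  fixes F :: "real \<Rightarrow> 'a::real_normed_vector"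
  assumes "((\<lambda>h. norm ((F h - x) /\<^sub>R h - w)) \<longlongrightarrow> 0) (at_right 0)"
  shows "((\<lambda>h. norm ((exp (\<omega> * h) *\<^sub>R F h - x) /\<^sub>R h - (w + \<omega> *\<^sub>R x))) \<longlongrightarrow> 0) (at_right 0)"
proof -
  have 1: "((\<lambda>h. (F h - x) /\<^sub>R h) \<longlongrightarrow> w) (at_right 0)"
    using tendsto_norm_zero_cancel[OF assms] by (rule LIM_zero_cancel)
  have "((\<lambda>h. exp (\<omega> * h)) \<longlongrightarrow> exp (\<omega> * 0)) (at_right (0::real))"
    by (intro tendsto_intros)
  then have 2: "((\<lambda>h. exp (\<omega> * h)) \<longlongrightarrow> 1) (at_right (0::real))" by simp
  have "((\<lambda>h. exp (\<omega> * h) *\<^sub>R ((F h - x) /\<^sub>R h) + ((exp (\<omega> * h) - 1) / h) *\<^sub>R x) \<longlongrightarrow> 1 *\<^sub>R w + \<omega> *\<^sub>R x) (at_right 0)"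
    by (intro tendsto_add tendsto_scaleR 1 2 tendsto_exp_quotient tendsto_const)
  then have "((\<lambda>h. (exp (\<omega> * h) *\<^sub>R F h - x) /\<^sub>R h) \<longlongrightarrow> w + \<omega> *\<^sub>R x) (at_right 0)"
    by (simp add: scaleR_diff_right scaleR_diff_left diff_divide_distrib divide_inverse algebra_simps)
  then show ?thesis by (intro tendsto_norm_zero LIM_zero)
qed

text \<open>Subtracting \<omega> from \<open>A\<close> makes it dissipative; multiplying the
  resulting contractions by exp (\<omega> t) restores \<open>A\<close> as the generator.\<close>

theorem quasi_dissipative_generates:
  fixes X D :: "'a::{real_inner, banach} set" and A :: "'a \<Rightarrow> 'a"
  assumes X: "subspace X" "closed X" and D: "subspace D" "D \<subseteq> X"
    and A_X: "\<And>x. x \<in> D \<Longrightarrow> A x \<in> X"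
    and A_add: "\<And>x y. x \<in> D \<Longrightarrow> y \<in> D \<Longrightarrow> A (x + y) = A x + A y"
    and A_scale: "\<And>x c. x \<in> D \<Longrightarrow> A (c *\<^sub>R x) = c *\<^sub>R A x"
    and diss: "\<And>x. x \<in> D \<Longrightarrow> inner (A x) x \<le> \<omega> * (norm x)\<^sup>2" and "0 \<le> \<omega>"
    and range: "\<And>h y. 0 < h \<Longrightarrow> y \<in> X \<Longrightarrow> \<exists>x\<in>D. x - h *\<^sub>R A x = y"
  obtains R where "C0_semigroup X norm R" "generator X norm R D A"
    "\<And>t x. 0 \<le> t \<Longrightarrow> x \<in> X \<Longrightarrow> norm (R t x) \<le> exp (\<omega> * t) * norm x" "X \<subseteq> closure D"
proof -
  define A' where "A' x = A x - \<omega> *\<^sub>R x" for x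
  interpret max_dissipative X D A'
  proof unfold_locales
    show "A' x \<in> X" if "x \<in> D" for x
      using that A_X[OF that] D(2) X(1) by (auto simp: A'_def intro!: subspace_diff subspace_scale)
    show "A' (x + y) = A' x + A' y" if "x \<in> D" "y \<in> D" for x y
      using A_add[OF that] by (simp add: A'_def algebra_simps)
    show "A' (c *\<^sub>R x) = c *\<^sub>R A' x" if "x \<in> D" for x c
      using A_scale[OF that] by (simp add: A'_def algebra_simps)
    show "inner (A' x) x \<le> 0" if "x \<in> D" for x
      using diss[OF that] by (simp add: A'_def inner_diff_left power2_norm_eq_inner)
    show "\<exists>x\<in>D. x - h *\<^sub>R A' x = y" if h: "0 < h" and y: "y \<in> X" for h y
    proof -
      \<comment> \<open>The shifted equation reads k x - h A x = y, so dividing by k leads back to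
        the range condition for \<open>A\<close> with step length h / k.\<close>
      define k where "k = 1 + h * \<omega>"
      have k: "0 < k" using h \<open>0 \<le> \<omega>\<close> by (simp add: k_def add_pos_nonneg)
      obtain x where x: "x \<in> D" "x - (h / k) *\<^sub>R A x = (1 / k) *\<^sub>R y"
        using range[of "h / k" "(1 / k) *\<^sub>R y"] h k subspace_scale[OF X(1) y] by auto
      have "k *\<^sub>R (x - (h / k) *\<^sub>R A x) = y" using k unfolding x(2) by simp
      then have "k *\<^sub>R x - h *\<^sub>R A x = y" using k by (simp add: scaleR_diff_right)
      then have "x - h *\<^sub>R A' x = y" by (simp add: A'_def k_def algebra_simps)
      then show ?thesis using x(1) by blast
    qed
  qed (use X D in auto)
  define R where "R t x = exp (\<omega> * t) *\<^sub>R T t x" for t x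
  have T: "T t x = exp (- \<omega> * t) *\<^sub>R R t x" for t x by (simp add: R_def flip: exp_add)
  have bound: "norm (R t x) \<le> exp (\<omega> * t) * norm x" if "0 \<le> t" "x \<in> X" for t x
    using T_norm[OF that(2,1)] by (simp add: R_def)
  have "C0_semigroup X norm R"
    unfolding C0_semigroup_def
  proof (intro conjI allI impI ballI)
    fix t :: real assume t: "0 \<le> t"
    show "R t ` X \<subseteq> X" using T_X t X(1) by (auto simp: R_def intro: subspace_scale)
    show "R t (c *\<^sub>R x + d *\<^sub>R y) = c *\<^sub>R R t x + d *\<^sub>R R t y" if "x \<in> X" "y \<in> X" for x y c d
      using that t X(1) by (simp add: R_def T_add T_scale subspace_scale scaleR_add_right mult.commute)
    show "\<exists>M. \<forall>x\<in>X. norm (R t x) \<le> M * norm x" using bound t by (intro exI[of _ "exp (\<omega> * t)"]) simp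
  next
    show "R 0 x = x" if "x \<in> X" for x using T_0[OF that] by (simp add: R_def)
  next
    fix s t :: real and x assume st: "0 \<le> s" "0 \<le> t" and x: "x \<in> X"
    show "R (s + t) x = R s (R t x)"
      using T_semigroup[OF x st] T_scale[OF T_X[OF x st(2)] st(1)] by (simp add: R_def exp_add distrib_left)
  next
    fix x assume x: "x \<in> X"
    have "((\<lambda>t. T t x - x) \<longlongrightarrow> 0) (at_right 0)"
      by (rule tendsto_norm_zero_cancel[OF T_strongly_continuous[OF x]])
    then have 1: "((\<lambda>t. T t x) \<longlongrightarrow> x) (at_right 0)" by (rule LIM_zero_cancel)
    have "((\<lambda>t. exp (\<omega> * t) *\<^sub>R T t x) \<longlongrightarrow> exp (\<omega> * 0) *\<^sub>R x) (at_right 0)"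
      by (intro tendsto_intros 1)
    then show "((\<lambda>t. norm (R t x - x)) \<longlongrightarrow> 0) (at_right 0)"
      by (intro tendsto_norm_zero LIM_zero) (simp add: R_def)
  qed
  moreover have "generator X norm R D A"
    unfolding generator_def
  proof (intro conjI ballI)
    show "D \<subseteq> X" by (rule D(2))
    fix x z assume x: "x \<in> X" and z: "z \<in> X"
    have zX: "z - \<omega> *\<^sub>R x \<in> X" using x z X(1) by (auto intro: subspace_diff subspace_scale)
    have "((\<lambda>h. norm ((R h x - x) /\<^sub>R h - z)) \<longlongrightarrow> 0) (at_right 0) \<longleftrightarrow>
          ((\<lambda>h. norm ((T h x - x) /\<^sub>R h - (z - \<omega> *\<^sub>R x))) \<longlongrightarrow> 0) (at_right 0)"
    proof
      assume "((\<lambda>h. norm ((R h x - x) /\<^sub>R h - z)) \<longlongrightarrow> 0) (at_right 0)"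
      from rescaled_quotient[OF this, of "- \<omega>"]
      show "((\<lambda>h. norm ((T h x - x) /\<^sub>R h - (z - \<omega> *\<^sub>R x))) \<longlongrightarrow> 0) (at_right 0)"
        unfolding T[symmetric] by simp
    next
      assume "((\<lambda>h. norm ((T h x - x) /\<^sub>R h - (z - \<omega> *\<^sub>R x))) \<longlongrightarrow> 0) (at_right 0)"
      from rescaled_quotient[OF this, of \<omega>]
      show "((\<lambda>h. norm ((R h x - x) /\<^sub>R h - z)) \<longlongrightarrow> 0) (at_right 0)"
        unfolding R_def[symmetric] by simp
    qed
    also have "\<dots> \<longleftrightarrow> x \<in> D \<and> A' x = z - \<omega> *\<^sub>R x"
      using T_generator x zX unfolding generator_def by blast
    also have "\<dots> \<longleftrightarrow> x \<in> D \<and> A x = z" by (simp add: A'_def)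
    finally show "((\<lambda>h. norm ((R h x - x) /\<^sub>R h - z)) \<longlongrightarrow> 0) (at_right 0) \<longleftrightarrow> x \<in> D \<and> A x = z" .
  qed
  ultimately show ?thesis using that bound D_dense by blast
qed

subsection \<open>Regularity and uniqueness of semigroups\<close>

text \<open>The gliding hump argument: approximate maximisers of operators with rapidly growing norms
  are added up so that no later term can cancel the effect of an earlier one.\<close>
theorem uniform_boundedness:
  fixes X :: "'a::banach set" and T :: "nat \<Rightarrow> 'a \<Rightarrow> 'b::real_normed_vector"
  assumes X: "subspace X" "closed X"
    and add: "\<And>n x y. x \<in> X \<Longrightarrow> y \<in> X \<Longrightarrow> T n (x + y) = T n x + T n y"
    and scale: "\<And>n x c. x \<in> X \<Longrightarrow> T n (c *\<^sub>R x) = c *\<^sub>R T n x"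
    and bound: "\<And>n. \<exists>M. \<forall>x\<in>X. norm (T n x) \<le> M * norm x"
    and pointwise: "\<And>x. x \<in> X \<Longrightarrow> \<exists>B. \<forall>n. norm (T n x) \<le> B"
  shows "\<exists>M. \<forall>n. \<forall>x\<in>X. norm (T n x) \<le> M * norm x"
proof (rule ccontr)
  assume contra: "\<not> ?thesis"
  have diff: "T n (x - y) = T n x - T n y" if "x \<in> X" "y \<in> X" for n x y
    using add[OF that(1) subspace_scale[OF X(1) that(2), of "-1"], of n] scale[OF that(2), of n "-1"] by simp
  define N where "N n = (\<lambda>u. norm (T n u)) ` {u \<in> X. norm u \<le> 1}" for n
  define c where "c n = Sup (N n)" for n
  have bdd: "bdd_above (N n)" for n
  proof -
    obtain M where M: "\<forall>x\<in>X. norm (T n x) \<le> M * norm x" using bound by blast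
    have "norm (T n u) \<le> \<bar>M\<bar>" if "u \<in> X" "norm u \<le> 1" for u
    proof -
      have "norm (T n u) \<le> \<bar>M\<bar> * norm u" using M that(1) by (meson abs_ge_self mult_right_mono norm_ge_zero order_trans)
      also have "\<dots> \<le> \<bar>M\<bar> * 1" using that(2) by (intro mult_left_mono) auto
      finally show ?thesis by simp
    qed
    then show ?thesis by (intro bdd_aboveI[of _ "\<bar>M\<bar>"]) (auto simp: N_def)
  qed
  have zN: "N n \<noteq> {}" for n using subspace_0[OF X(1)] by (force simp: N_def)
  have c_bound: "norm (T n x) \<le> c n * norm x" if x: "x \<in> X" for n x
  proof (cases "x = 0")
    case True
    then show ?thesis using scale[OF subspace_0[OF X(1)], of n 0] by simp
  next
    case False
    have "norm (T n ((1 / norm x) *\<^sub>R x)) \<le> c n"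
      unfolding c_def
      by (rule cSup_upper[OF _ bdd]) (use x X(1) False in \<open>auto simp: N_def intro!: imageI subspace_scale\<close>)
    then show ?thesis using scale[OF x, of n "1 / norm x"] False by (simp add: divide_le_eq)
  qed
  \<comment> \<open>Norms of size 4^k will be met with humps of size 3^(-k): the k-th hump has an
    effect of order (4 / 3)^k, while the humps after it have total size at most 3^(-k) / 2.\<close>
  have "\<exists>n. 4 ^ k \<le> c n" for k :: nat
  proof (rule ccontr)
    assume "\<not> (\<exists>n. 4 ^ k \<le> c n)"
    then have "norm (T n x) \<le> 4 ^ k * norm x" if "x \<in> X" for n x
      using c_bound[OF that, of n] mult_right_mono[of "c n" "4 ^ k" "norm x"] by (meson less_imp_le norm_ge_zero not_le order_trans)
    then show False using contra by blast
  qed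
  then obtain n where n: "\<And>k. 4 ^ k \<le> c (n k)" by metis
  \<comment> \<open>Twice the image of \<open>\<xi>\<close> is the difference of the images of x +
    \<xi> and x - \<xi>, so one of these two has an image at least as large as that of
    \<open>\<xi>\<close>. The factor 3 / 4 is the price for \<open>\<xi>\<close> being only an
    approximate maximiser.\<close>
  have hump: "\<exists>y\<in>X. norm (y - x) \<le> r \<and> 3 / 4 * r * c (n k) \<le> norm (T (n k) y)" if x: "x \<in> X" and r: "0 < r" for x r k
  proof -
    have "0 < c (n k)" using n[of k] by (meson less_le_trans zero_less_numeral zero_less_power)
    then have "3 / 4 * c (n k) < Sup (N (n k))" by (simp add: c_def)
    then obtain v where "v \<in> N (n k)" "3 / 4 * c (n k) < v" using less_cSupD[OF zN] by blast
    then obtain u where u: "u \<in> X" "norm u \<le> 1" "3 / 4 * c (n k) < norm (T (n k) u)" by (auto simp: N_def)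
    define \<xi> where "\<xi> = r *\<^sub>R u"
    have \<xi>: "\<xi> \<in> X" "norm \<xi> \<le> r" "3 / 4 * r * c (n k) \<le> norm (T (n k) \<xi>)"
      using u r X(1) scale[OF u(1)] by (auto simp: \<xi>_def mult_left_le subspace_scale mult.assoc mult.left_commute)
    have "2 * norm (T (n k) \<xi>) = norm (T (n k) (x + \<xi>) - T (n k) (x - \<xi>))"
      using add[OF x \<xi>(1)] diff[OF x \<xi>(1)] by (simp flip: scaleR_2)
    also have "\<dots> \<le> norm (T (n k) (x + \<xi>)) + norm (T (n k) (x - \<xi>))" by (rule norm_triangle_ineq4)
    finally have "norm (T (n k) \<xi>) \<le> norm (T (n k) (x + \<xi>)) \<or> norm (T (n k) \<xi>) \<le> norm (T (n k) (x - \<xi>))" by linarith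
    then show ?thesis
    proof
      assume "norm (T (n k) \<xi>) \<le> norm (T (n k) (x + \<xi>))"
      then show ?thesis using \<xi> x X(1) by (intro bexI[of _ "x + \<xi>"]) (auto intro: subspace_add)
    next
      assume "norm (T (n k) \<xi>) \<le> norm (T (n k) (x - \<xi>))"
      then show ?thesis using \<xi> x X(1) by (intro bexI[of _ "x - \<xi>"]) (auto intro: subspace_diff)
    qed
  qed
  define nxt where "nxt k x = (SOME y. y \<in> X \<and> norm (y - x) \<le> (1 / 3) ^ k \<and> 3 / 4 * (1 / 3) ^ k * c (n k) \<le> norm (T (n k) y))" for k x
  have nxt: "nxt k x \<in> X" "norm (nxt k x - x) \<le> (1 / 3) ^ k" "3 / 4 * (1 / 3) ^ k * c (n k) \<le> norm (T (n k) (nxt k x))" if "x \<in> X" for k x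
  proof -
    have "\<exists>y. y \<in> X \<and> norm (y - x) \<le> (1 / 3) ^ k \<and> 3 / 4 * (1 / 3) ^ k * c (n k) \<le> norm (T (n k) y)"
      using hump[OF that, of "(1 / 3) ^ k" k] by auto
    from someI_ex[OF this] show "nxt k x \<in> X" "norm (nxt k x - x) \<le> (1 / 3) ^ k" "3 / 4 * (1 / 3) ^ k * c (n k) \<le> norm (T (n k) (nxt k x))"
      unfolding nxt_def by auto
  qed
  define x where "x = rec_nat 0 nxt"
  have xs: "x (Suc k) = nxt k (x k)" "x 0 = 0" for k by (auto simp: x_def)
  have xX: "x k \<in> X" for k by (induction k) (auto simp: xs nxt(1) subspace_0[OF X(1)])
  have "summable (\<lambda>k. x (Suc k) - x k)"
    by (rule summable_comparison_test'[of "\<lambda>k. (1 / 3 :: real) ^ k"]) (use nxt(2)[OF xX] in \<open>auto simp: xs(1) summable_geometric\<close>)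
  then have "convergent (\<lambda>m. \<Sum>k<m. x (Suc k) - x k)" by (simp add: summable_iff_convergent)
  moreover have "(\<Sum>k<m. x (Suc k) - x k) = x m" for m
    using sum_lessThan_telescope[of x m] by (simp add: xs(2))
  ultimately obtain l where l: "x \<longlonglongrightarrow> l" by (auto simp: convergent_def)
  have lX: "l \<in> X" using closed_sequentially[OF X(2) xX l] .
  have tail: "norm (x (Suc k + m) - x (Suc k)) \<le> (1 / 3) ^ k * ((1 - (1 / 3) ^ m) / 2)" for k m
  proof (induction m)
    case (Suc m)
    have "norm (x (Suc k + Suc m) - x (Suc k)) \<le> norm (x (Suc (Suc k + m)) - x (Suc k + m)) + norm (x (Suc k + m) - x (Suc k))"
      using norm_triangle_ineq[of "x (Suc (Suc k + m)) - x (Suc k + m)" "x (Suc k + m) - x (Suc k)"] by simp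
    also have "\<dots> \<le> (1 / 3) ^ (Suc k + m) + (1 / 3) ^ k * ((1 - (1 / 3) ^ m) / 2)"
      using nxt(2)[OF xX, of "Suc k + m" "Suc k + m"] Suc by (intro add_mono) (simp_all only: xs(1))
    also have "\<dots> = (1 / 3) ^ k * ((1 - (1 / 3) ^ Suc m) / 2)"
      by (simp add: power_add field_simps)
    finally show ?case .
  qed simp
  have close: "norm (l - x (Suc k)) \<le> (1 / 3) ^ k / 2" for k
  proof (rule LIMSEQ_le_const2)
    show "(\<lambda>m. norm (x (Suc k + m) - x (Suc k))) \<longlonglongrightarrow> norm (l - x (Suc k))"
      by (intro tendsto_intros LIMSEQ_ignore_initial_segment[OF l, of "Suc k", unfolded add.commute[of _ "Suc k"]])
    have "(1 / 3) ^ k * ((1 - (1 / 3) ^ m) / 2) \<le> (1 / 3) ^ k / (2::real)" for m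
      by simp
    then show "\<exists>N. \<forall>m\<ge>N. norm (x (Suc k + m) - x (Suc k)) \<le> (1 / 3) ^ k / 2"
      using tail order_trans by blast
  qed
  obtain B where B: "\<And>n. norm (T n l) \<le> B" using pointwise[OF lX] by blast
  \<comment> \<open>Of the 3 / 4 gained at stage k the later humps can cancel 1 / 2, so 1 / 4
    survives.\<close>
  have low: "(4 / 3) ^ k / 4 \<le> B" for k
  proof -
    have "3 / 4 * (1 / 3) ^ k * c (n k) \<le> norm (T (n k) (x (Suc k)))" using nxt(3)[OF xX] by (simp only: xs(1))
    also have "\<dots> = norm (T (n k) l - T (n k) (l - x (Suc k)))" using diff[OF lX xX, of "n k" "Suc k"] by simp
    also have "\<dots> \<le> norm (T (n k) l) + norm (T (n k) (l - x (Suc k)))" by (rule norm_triangle_ineq4)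
    also have "norm (T (n k) (l - x (Suc k))) \<le> c (n k) * norm (l - x (Suc k))"
      by (rule c_bound) (use lX xX X(1) in \<open>auto intro: subspace_diff\<close>)
    also have "\<dots> \<le> c (n k) * ((1 / 3) ^ k / 2)"
      using close[of k] n[of k] by (intro mult_left_mono) (auto intro: order_trans[of 0 "4 ^ k"])
    finally have "(1 / 3) ^ k * c (n k) / 4 \<le> B" using B[of "n k"] by (simp add: algebra_simps)
    moreover have "(1 / 3) ^ k * 4 ^ k / 4 \<le> (1 / 3) ^ k * c (n k) / 4"
      using n[of k] by (intro divide_right_mono mult_left_mono) auto
    moreover have "(1 / 3) ^ k * 4 ^ k = (4 / 3 :: real) ^ k" by (simp add: power_divide)
    ultimately show ?thesis by simp
  qed
  obtain k where "4 * \<bar>B\<bar> + 1 < (4 / 3) ^ k" using real_arch_pow[of "4 / 3" "4 * \<bar>B\<bar> + 1"] by auto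
  then show False using low[of k] by simp
qed

text \<open>This links the vector derivative behind \<open>ddt\<close> to the norm of difference
  quotients used in \<open>generator\<close> and \<open>C1_in\<close>.\<close>

lemma has_vector_derivative_quotient:
  fixes y :: "real \<Rightarrow> 'a::real_normed_vector"
  shows "(y has_vector_derivative d) (at t within S) \<longleftrightarrow>
    ((\<lambda>s. norm ((y s - y t) /\<^sub>R (s - t) - d)) \<longlongrightarrow> 0) (at t within S)"
proof -
  have "norm ((1 / norm (s - t)) *\<^sub>R (y s - (y t + (s - t) *\<^sub>R d))) = norm ((y s - y t) /\<^sub>R (s - t) - d)" if "s \<noteq> t" for s
  proof -
    have "(y s - y t) /\<^sub>R (s - t) - d = (1 / (s - t)) *\<^sub>R (y s - (y t + (s - t) *\<^sub>R d))"
      using that by (simp add: scaleR_diff_right scaleR_add_right divide_inverse diff_diff_eq)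
    then show ?thesis by simp
  qed
  then have "\<forall>\<^sub>F s in at t within S. norm ((1 / norm (s - t)) *\<^sub>R (y s - (y t + (s - t) *\<^sub>R d))) = norm ((y s - y t) /\<^sub>R (s - t) - d)"
    by (auto simp: eventually_at_filter)
  then have "((\<lambda>s. norm ((1 / norm (s - t)) *\<^sub>R (y s - (y t + (s - t) *\<^sub>R d)))) \<longlongrightarrow> 0) (at t within S) \<longleftrightarrow>
    ((\<lambda>s. norm ((y s - y t) /\<^sub>R (s - t) - d)) \<longlongrightarrow> 0) (at t within S)"
    by (rule tendsto_cong)
  then show ?thesis
    unfolding has_vector_derivative_def has_derivative_within
    by (simp only: bounded_linear_scaleR_left tendsto_norm_zero_iff simp_thms)
qed

lemma C0_semigroupD:
  assumes "C0_semigroup X N R"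
  shows "\<And>t x. 0 \<le> t \<Longrightarrow> x \<in> X \<Longrightarrow> R t x \<in> X"
    and "\<And>t x y c d. 0 \<le> t \<Longrightarrow> x \<in> X \<Longrightarrow> y \<in> X \<Longrightarrow> R t (c *\<^sub>R x + d *\<^sub>R y) = c *\<^sub>R R t x + d *\<^sub>R R t y"
    and "\<And>t. 0 \<le> t \<Longrightarrow> \<exists>M. \<forall>x\<in>X. N (R t x) \<le> M * N x"
    and "\<And>x. x \<in> X \<Longrightarrow> R 0 x = x"
    and "\<And>s t x. 0 \<le> s \<Longrightarrow> 0 \<le> t \<Longrightarrow> x \<in> X \<Longrightarrow> R (s + t) x = R s (R t x)"
    and "\<And>x. x \<in> X \<Longrightarrow> ((\<lambda>t. N (R t x - x)) \<longlongrightarrow> 0) (at_right 0)"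
  using assms unfolding C0_semigroup_def by (auto simp: image_subset_iff)

lemma C0_semigroup_diff:
  assumes "C0_semigroup X N R" "0 \<le> t" "x \<in> X" "y \<in> X"
  shows "R t (x - y) = R t x - R t y"
  using C0_semigroupD(2)[OF assms(1-4), of 1 "-1"] by simp

lemma C0_semigroup_scale:
  assumes "C0_semigroup X N R" "0 \<le> t" "x \<in> X"
  shows "R t (c *\<^sub>R x) = c *\<^sub>R R t x"
  using C0_semigroupD(2)[OF assms(1-3,3), of c 0] by simp

text \<open>\<open>C0_semigroup\<close> bounds each operator separately. If no bound were uniform
  near 0, there would be times tending to 0 with operator norms tending to infinity; strong
  continuity makes these operators pointwise bounded, against the uniform boundedness
  principle.\<close>

lemma C0_semigroup_bounded_near_0:
  fixes X :: "'a::banach set"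
  assumes X: "subspace X" "closed X" and sg: "C0_semigroup X norm R"
  obtains \<delta> M where "0 < \<delta>" "\<And>t x. 0 \<le> t \<Longrightarrow> t \<le> \<delta> \<Longrightarrow> x \<in> X \<Longrightarrow> norm (R t x) \<le> M * norm x"
proof -
  note R = C0_semigroupD[OF sg]
  have "\<exists>\<delta>>0. \<exists>M. \<forall>t. 0 \<le> t \<longrightarrow> t \<le> \<delta> \<longrightarrow> (\<forall>x\<in>X. norm (R t x) \<le> M * norm x)"
  proof (rule ccontr)
    assume contra: "\<not> ?thesis"
    have "\<exists>t. 0 \<le> t \<and> t \<le> 1 / real (Suc n) \<and> (\<exists>x\<in>X. real (Suc n) * norm x < norm (R t x))" for n
    proof (rule ccontr)
      assume "\<not> (\<exists>t. 0 \<le> t \<and> t \<le> 1 / real (Suc n) \<and> (\<exists>x\<in>X. real (Suc n) * norm x < norm (R t x)))"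
      then have "\<forall>t. 0 \<le> t \<longrightarrow> t \<le> 1 / real (Suc n) \<longrightarrow> (\<forall>x\<in>X. norm (R t x) \<le> real (Suc n) * norm x)"
        by (meson not_le)
      moreover have "0 < 1 / real (Suc n)" by simp
      ultimately show False using contra by blast
    qed
    then obtain t where t: "\<And>n. 0 \<le> t n" "\<And>n. t n \<le> 1 / real (Suc n)" 
      "\<And>n. \<exists>x\<in>X. real (Suc n) * norm x < norm (R (t n) x)" by metis
    have "\<exists>M. \<forall>n. \<forall>x\<in>X. norm (R (t n) x) \<le> M * norm x"
    proof (rule uniform_boundedness[OF X])
      show "R (t n) (x + y) = R (t n) x + R (t n) y" if "x \<in> X" "y \<in> X" for n x y
        using R(2)[OF t(1) that, of n 1 1] by simp
      show "R (t n) (c *\<^sub>R x) = c *\<^sub>R R (t n) x" if "x \<in> X" for n x c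
        by (rule C0_semigroup_scale[OF sg t(1) that])
      show "\<exists>M. \<forall>x\<in>X. norm (R (t n) x) \<le> M * norm x" for n by (rule R(3)[OF t(1)])
      fix x assume x: "x \<in> X"
      have "(\<lambda>n. R (t n) x) \<longlonglongrightarrow> x"
      proof (rule LIMSEQ_I)
        fix e :: real assume "0 < e"
        have "\<forall>\<^sub>F s in at_right 0. norm (R s x - x) < e"
          using order_tendstoD(2)[OF R(6)[OF x] \<open>0 < e\<close>] .
        then obtain d where d: "0 < d" "\<And>s. 0 < s \<Longrightarrow> s < d \<Longrightarrow> norm (R s x - x) < e"
          by (auto simp: eventually_at_right_field)
        obtain n0 where n0: "1 / real (Suc n0) < d" using d(1) nat_approx_posE by blast
        have "norm (R (t n) x - x) < e" if "n \<ge> n0" for n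
        proof (cases "t n = 0")
          case True
          then show ?thesis using R(4)[OF x] \<open>0 < e\<close> by simp
        next
          case False
          have "1 / real (Suc n) \<le> 1 / real (Suc n0)" using that by (simp add: frac_le)
          then have "t n < d" using t(2)[of n] n0 by linarith
          then show ?thesis using d(2)[of "t n"] t(1)[of n] False by simp
        qed
        then show "\<exists>no. \<forall>n\<ge>no. norm (R (t n) x - x) < e" by blast
      qed
      then have "Bseq (\<lambda>n. R (t n) x)" using convergentI convergent_imp_Bseq by blast
      then show "\<exists>B. \<forall>n. norm (R (t n) x) \<le> B" by (auto simp: Bseq_def)
    qed
    then obtain M where M: "\<And>n x. x \<in> X \<Longrightarrow> norm (R (t n) x) \<le> M * norm x" by blast
    obtain n where n: "M \<le> real n" using real_arch_simple by blast
    obtain x where x: "x \<in> X" "real (Suc n) * norm x < norm (R (t n) x)" using t(3) by blast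
    have "M * norm x \<le> real (Suc n) * norm x" using n by (intro mult_right_mono) auto
    then show False using M[OF x(1), of n] x(2) by linarith
  qed
  then show ?thesis using that by blast
qed

lemma C0_semigroup_locally_bounded:
  fixes X :: "'a::banach set"
  assumes X: "subspace X" "closed X" and sg: "C0_semigroup X norm R" and t: "0 \<le> t"
  obtains \<delta> M where "0 < \<delta>" "0 \<le> M" "\<And>s x. 0 \<le> s \<Longrightarrow> \<bar>s - t\<bar> \<le> \<delta> \<Longrightarrow> x \<in> X \<Longrightarrow> norm (R s x) \<le> M * norm x"
proof -
  note R = C0_semigroupD[OF sg]
  obtain \<delta> M where M: "0 < \<delta>" "\<And>t x. 0 \<le> t \<Longrightarrow> t \<le> \<delta> \<Longrightarrow> x \<in> X \<Longrightarrow> norm (R t x) \<le> M * norm x"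
    using C0_semigroup_bounded_near_0[OF X sg] by blast
  \<comment> \<open>Every s >= 0 within \<delta> / 2 of t lies between \<open>t0\<close> and t0 +
    \<delta>, so \<open>R s\<close> factors into the single operator \<open>R t0\<close> and one
    from the uniformly bounded range.\<close>
  define t0 where "t0 = max 0 (t - \<delta> / 2)"
  have t0: "0 \<le> t0" by (simp add: t0_def)
  obtain M' where M': "\<And>x. x \<in> X \<Longrightarrow> norm (R t0 x) \<le> M' * norm x" using R(3)[OF t0] by blast
  have "norm (R s x) \<le> (\<bar>M'\<bar> * \<bar>M\<bar>) * norm x" if s: "0 \<le> s" "\<bar>s - t\<bar> \<le> \<delta> / 2" and x: "x \<in> X" for s x
  proof -
    have s0: "0 \<le> s - t0" "s - t0 \<le> \<delta>" using s M(1) by (auto simp: t0_def max_def abs_if split: if_splits)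
    have "R s x = R t0 (R (s - t0) x)" using R(5)[OF t0 s0(1) x] by simp
    then have "norm (R s x) \<le> M' * norm (R (s - t0) x)" using M'[OF R(1)[OF s0(1) x]] by simp
    also have "\<dots> \<le> \<bar>M'\<bar> * norm (R (s - t0) x)" by (intro mult_right_mono) auto
    also have "\<dots> \<le> \<bar>M'\<bar> * (\<bar>M\<bar> * norm x)"
    proof (rule mult_left_mono)
      have "norm (R (s - t0) x) \<le> M * norm x" by (rule M(2)[OF s0 x])
      also have "\<dots> \<le> \<bar>M\<bar> * norm x" by (intro mult_right_mono) auto
      finally show "norm (R (s - t0) x) \<le> \<bar>M\<bar> * norm x" .
    qed simp
    finally show ?thesis by (simp add: mult.assoc)
  qed
  then show ?thesis using that[of "\<delta> / 2" "\<bar>M'\<bar> * \<bar>M\<bar>"] M(1) by auto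
qed

lemma at_right_0_compose_dist:
  fixes g :: "real \<Rightarrow> real"
  assumes "(g \<longlongrightarrow> 0) (at_right 0)" 
  shows "((\<lambda>s. g \<bar>s - t\<bar>) \<longlongrightarrow> 0) (at t within S)"
proof (rule filterlim_compose[OF assms])
  have "((\<lambda>s. \<bar>s - t\<bar>) \<longlongrightarrow> \<bar>t - t\<bar>) (at t within S)" by (intro tendsto_intros)
  moreover have "\<forall>\<^sub>F s in at t within S. \<bar>s - t\<bar> \<in> {0<..}"
    by (auto simp: eventually_at_filter)
  ultimately show "filterlim (\<lambda>s. \<bar>s - t\<bar>) (at_right 0) (at t within S)"
    by (auto simp: filterlim_at elim: eventually_mono)
qed

text \<open>From the left, R t x - R s x = R s (R (t - s) x - x) has an operator in front that
  varies with s; this is where bounds locally uniform in time are needed.\<close>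

lemma C0_semigroup_continuous:
  fixes X :: "'a::banach set"
  assumes X: "subspace X" "closed X" and sg: "C0_semigroup X norm R" and t: "0 \<le> t" and x: "x \<in> X"
  shows "((\<lambda>s. R s x) \<longlongrightarrow> R t x) (at t within {0..})"
proof -
  note R = C0_semigroupD[OF sg]
  obtain \<delta> M where M: "0 < \<delta>" "0 \<le> M" "\<And>s x. 0 \<le> s \<Longrightarrow> \<bar>s - t\<bar> \<le> \<delta> \<Longrightarrow> x \<in> X \<Longrightarrow> norm (R s x) \<le> M * norm x"
    using C0_semigroup_locally_bounded[OF X sg t] by blast
  have dX: "R h x - x \<in> X" if "0 \<le> h" for h using R(1)[OF that x] x X(1) by (auto intro: subspace_diff)
  have bnd: "norm (R s x - R t x) \<le> M * norm (R \<bar>s - t\<bar> x - x)" if s: "0 \<le> s" "\<bar>s - t\<bar> \<le> \<delta>" for s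
  proof (cases "t \<le> s")
    case True
    then have "R s x = R t (R (s - t) x)" using R(5)[OF t _ x, of "s - t"] by simp
    then have "R s x - R t x = R t (R (s - t) x - x)"
      using C0_semigroup_diff[OF sg t R(1)[of "s - t" x] x] True x by simp
    then show ?thesis using M(3)[OF t _ dX[of "s - t"]] M(1) True by simp
  next
    case False
    then have "R t x = R s (R (t - s) x)" using R(5)[OF s(1) _ x, of "t - s"] by simp
    then have "R t x - R s x = R s (R (t - s) x - x)"
      using C0_semigroup_diff[OF sg s(1) R(1)[of "t - s" x] x] False x by simp
    moreover have "norm (R s x - R t x) = norm (R t x - R s x)" by (rule norm_minus_commute)
    ultimately show ?thesis using M(3)[OF s dX[of "t - s"]] False by simp
  qed
  have "((\<lambda>s. M * norm (R \<bar>s - t\<bar> x - x)) \<longlongrightarrow> M * 0) (at t within {0..})"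
    by (intro tendsto_mult tendsto_const at_right_0_compose_dist[OF R(6)[OF x]])
  then have "((\<lambda>s. M * norm (R \<bar>s - t\<bar> x - x)) \<longlongrightarrow> 0) (at t within {0..})" by simp
  moreover have "\<forall>\<^sub>F s in at t within {0..}. norm (R s x - R t x) \<le> M * norm (R \<bar>s - t\<bar> x - x)"
    unfolding eventually_at using M(1) bnd by (intro exI[of _ \<delta>]) (auto simp: dist_real_def)
  ultimately have "((\<lambda>s. R s x - R t x) \<longlongrightarrow> 0) (at t within {0..})"
    by (rule Lim_null_comparison[rotated])
  then show ?thesis by (rule LIM_zero_cancel)
qed

text \<open>\<open>R t\<close> is bounded and commutes with the difference quotients at 0, so it
  carries their limit along.\<close>

lemma C0_semigroup_generator_invariant:
  fixes X :: "'a::banach set"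
  assumes X: "subspace X" "closed X" and sg: "C0_semigroup X norm R" and gen: "generator X norm R D A"
    and A_X: "\<And>x. x \<in> D \<Longrightarrow> A x \<in> X" and t: "0 \<le> t" and x: "x \<in> D"
  shows "R t x \<in> D" "A (R t x) = R t (A x)"
proof -
  note R = C0_semigroupD[OF sg]
  have xX: "x \<in> X" using gen x by (auto simp: generator_def)
  obtain M where M: "\<And>x. x \<in> X \<Longrightarrow> norm (R t x) \<le> M * norm x" using R(3)[OF t] by blast
  have lim: "((\<lambda>h. norm ((R h x - x) /\<^sub>R h - A x)) \<longlongrightarrow> 0) (at_right 0)"
    using gen xX A_X[OF x] x unfolding generator_def by blast
  have "((\<lambda>h. norm ((R h (R t x) - R t x) /\<^sub>R h - R t (A x))) \<longlongrightarrow> 0) (at_right 0)"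
  proof (rule Lim_null_comparison)
    have "((\<lambda>h. M * norm ((R h x - x) /\<^sub>R h - A x)) \<longlongrightarrow> M * 0) (at_right 0)"
      by (intro tendsto_mult tendsto_const lim)
    then show "((\<lambda>h. M * norm ((R h x - x) /\<^sub>R h - A x)) \<longlongrightarrow> 0) (at_right 0)" by simp
    show "\<forall>\<^sub>F h in at_right 0. norm (norm ((R h (R t x) - R t x) /\<^sub>R h - R t (A x))) \<le> M * norm ((R h x - x) /\<^sub>R h - A x)"
      using eventually_at_right_less[of 0]
    proof eventually_elim
      case (elim h)
      then have h: "0 \<le> h" by simp
      have q: "R h x - x \<in> X" "(R h x - x) /\<^sub>R h \<in> X"
        using R(1)[OF h xX] xX X(1) by (auto intro!: subspace_diff subspace_scale)
      have "R h (R t x) = R t (R h x)"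
        using R(5)[OF h t xX] R(5)[OF t h xX] by (simp add: add.commute)
      then have "(R h (R t x) - R t x) /\<^sub>R h = R t ((R h x - x) /\<^sub>R h)"
        using C0_semigroup_diff[OF sg t R(1)[OF h xX] xX] C0_semigroup_scale[OF sg t q(1)] by simp
      then have "(R h (R t x) - R t x) /\<^sub>R h - R t (A x) = R t ((R h x - x) /\<^sub>R h - A x)"
        using C0_semigroup_diff[OF sg t q(2) A_X[OF x]] by simp
      then show ?case using M[of "(R h x - x) /\<^sub>R h - A x"] q(2) A_X[OF x] X(1) by (auto intro: subspace_diff)
    qed
  qed
  then show "R t x \<in> D" "A (R t x) = R t (A x)"
    using gen R(1)[OF t xX] R(1)[OF t A_X[OF x]] unfolding generator_def by blast+
qed

text \<open>The right quotient is \<open>R t\<close> applied to the quotient at 0. The left quotient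
  is \<open>R s\<close> applied to it, so its limit has to be moved from R s (A x) to R t (A x) by
  continuity of the orbit of \<open>A x\<close>.\<close>

lemma C0_semigroup_has_vector_derivative:
  fixes X :: "'a::banach set"
  assumes X: "subspace X" "closed X" and sg: "C0_semigroup X norm R" and gen: "generator X norm R D A"
    and A_X: "\<And>x. x \<in> D \<Longrightarrow> A x \<in> X" and t: "0 \<le> t" and x: "x \<in> D"
  shows "((\<lambda>s. R s x) has_vector_derivative R t (A x)) (at t within {0..})"
  unfolding has_vector_derivative_quotient
proof -
  note R = C0_semigroupD[OF sg]
  have xX: "x \<in> X" using gen x by (auto simp: generator_def)
  note AX = A_X[OF x]
  obtain \<delta> M where M: "0 < \<delta>" "0 \<le> M" "\<And>s x. 0 \<le> s \<Longrightarrow> \<bar>s - t\<bar> \<le> \<delta> \<Longrightarrow> x \<in> X \<Longrightarrow> norm (R s x) \<le> M * norm x"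
    using C0_semigroup_locally_bounded[OF X sg t] by blast
  define q where "q h = (R h x - x) /\<^sub>R h" for h
  have lim: "((\<lambda>h. norm (q h - A x)) \<longlongrightarrow> 0) (at_right 0)"
    using gen xX AX x unfolding generator_def q_def by blast
  have qX: "q h \<in> X" if "0 \<le> h" for h 
    using R(1)[OF that xX] xX X(1) by (auto simp: q_def intro!: subspace_diff subspace_scale)
  have step: "norm ((R s' x - R r x) /\<^sub>R (s' - r) - R r (A x)) \<le> M * norm (q (s' - r) - A x)" 
    if r: "0 \<le> r" "r < s'" "\<bar>r - t\<bar> \<le> \<delta>" for r s'
  proof -
    have h: "0 \<le> s' - r" using r by simp
    have d: "R (s' - r) x - x \<in> X" using R(1)[OF h xX] xX X(1) by (auto intro: subspace_diff)
    have "R s' x = R r (R (s' - r) x)" using R(5)[OF r(1) h xX] by simp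
    then have "(R s' x - R r x) /\<^sub>R (s' - r) = R r (q (s' - r))"
      using C0_semigroup_diff[OF sg r(1) R(1)[OF h xX] xX] C0_semigroup_scale[OF sg r(1) d] by (simp add: q_def)
    then have "(R s' x - R r x) /\<^sub>R (s' - r) - R r (A x) = R r (q (s' - r) - A x)"
      using C0_semigroup_diff[OF sg r(1) qX[OF h] AX] by simp
    then show ?thesis using M(3)[OF r(1,3), of "q (s' - r) - A x"] qX[OF h] AX X(1) by (auto intro: subspace_diff)
  qed
  have bnd: "norm ((R s x - R t x) /\<^sub>R (s - t) - R t (A x)) \<le> M * norm (q \<bar>s - t\<bar> - A x) + norm (R s (A x) - R t (A x))"
    if s: "0 \<le> s" "\<bar>s - t\<bar> \<le> \<delta>" "s \<noteq> t" for s
  proof (cases "t < s")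
    case True
    then show ?thesis using step[OF t True] M(1) by (simp add: add_increasing2)
  next
    case False
    then have st: "s < t" using s(3) by simp
    have "(R s x - R t x) /\<^sub>R (s - t) = (R t x - R s x) /\<^sub>R (t - s)"
      by (metis (no_types, opaque_lifting) inverse_minus_eq minus_diff_eq scaleR_minus_left scaleR_minus_right minus_minus)
    then have "(R s x - R t x) /\<^sub>R (s - t) - R t (A x) = ((R t x - R s x) /\<^sub>R (t - s) - R s (A x)) + (R s (A x) - R t (A x))" by simp
    then have "norm ((R s x - R t x) /\<^sub>R (s - t) - R t (A x)) \<le> norm ((R t x - R s x) /\<^sub>R (t - s) - R s (A x)) + norm (R s (A x) - R t (A x))"
      using norm_triangle_ineq by metis
    then show ?thesis using step[OF s(1) st s(2)] st by simp
  qed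
  show "((\<lambda>s. norm ((R s x - R t x) /\<^sub>R (s - t) - R t (A x))) \<longlongrightarrow> 0) (at t within {0..})"
  proof (rule Lim_null_comparison)
    have "((\<lambda>s. M * norm (q \<bar>s - t\<bar> - A x) + norm (R s (A x) - R t (A x))) \<longlongrightarrow> M * 0 + 0) (at t within {0..})"
      by (intro tendsto_add tendsto_mult tendsto_const at_right_0_compose_dist[OF lim] tendsto_norm_zero LIM_zero
          C0_semigroup_continuous[OF X sg t AX])
    then show "((\<lambda>s. M * norm (q \<bar>s - t\<bar> - A x) + norm (R s (A x) - R t (A x))) \<longlongrightarrow> 0) (at t within {0..})" by simp
    show "\<forall>\<^sub>F s in at t within {0..}. norm (norm ((R s x - R t x) /\<^sub>R (s - t) - R t (A x))) \<le> 
        M * norm (q \<bar>s - t\<bar> - A x) + norm (R s (A x) - R t (A x))"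
      unfolding eventually_at using M(1) bnd by (intro exI[of _ \<delta>]) (auto simp: dist_real_def)
  qed
qed

lemma at_within_nonneg: "0 < (t::real) \<Longrightarrow> at t within {0..} = at t"
  by (rule at_within_interior) simp

text \<open>For x in \<open>D\<close> the difference y of the two orbits stays in \<open>D\<close>,
  solves y' = A y and starts at 0. Quasi-dissipativity forces it to vanish, and density with
  boundedness at the fixed time t gives all of \<open>X\<close>.\<close>

theorem C0_semigroup_unique:
  fixes X :: "'a::{real_inner, banach} set"
  assumes X: "subspace X" "closed X" and A_X: "\<And>x. x \<in> D \<Longrightarrow> A x \<in> X" and D: "X \<subseteq> closure D"
    and diffs: "\<And>x y. x \<in> D \<Longrightarrow> y \<in> D \<Longrightarrow> x - y \<in> D \<and> A (x - y) = A x - A y"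
    and diss: "\<And>x. x \<in> D \<Longrightarrow> inner (A x) x \<le> \<omega> * (norm x)\<^sup>2"
    and R: "C0_semigroup X norm R" "generator X norm R D A"
    and S: "C0_semigroup X norm S" "generator X norm S D A"
    and t: "0 \<le> t" and x: "x \<in> X"
  shows "R t x = S t x"
proof -
  have DX: "D \<subseteq> X" using R(2) by (auto simp: generator_def)
  have eq: "R t x = S t x" if x: "x \<in> D" and t: "0 \<le> t" for t x
  proof -
    define y where "y s = R s x - S s x" for s
    have yD: "y s \<in> D" "A (y s) = R s (A x) - S s (A x)" if "0 \<le> s" for s
      using C0_semigroup_generator_invariant[OF X R A_X that x] C0_semigroup_generator_invariant[OF X S A_X that x] diffs
      unfolding y_def by auto
    have der: "(y has_vector_derivative A (y s)) (at s within {0..})" if "0 \<le> s" for s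
      unfolding y_def yD(2)[OF that, unfolded y_def]
      by (intro has_vector_derivative_diff C0_semigroup_has_vector_derivative[OF X R A_X that x]
          C0_semigroup_has_vector_derivative[OF X S A_X that x])
    \<comment> \<open>The exponential factor cancels the growth permitted by \<omega>, so \<phi> is
      nonincreasing from the value 0.\<close>
    define \<phi> where "\<phi> s = exp (- (2 * \<omega>) * s) * inner (y s) (y s)" for s
    define \<phi>' where "\<phi>' s = exp (- (2 * \<omega>) * s) * (2 * inner (A (y s)) (y s) - 2 * \<omega> * (norm (y s))\<^sup>2)" for s
    have der\<phi>: "(\<phi> has_real_derivative \<phi>' s) (at s within {0..})" if "0 \<le> s" for s
    proof -
      have "(y has_derivative (\<lambda>h. h *\<^sub>R A (y s))) (at s within {0..})"
        using der[OF that] by (simp add: has_vector_derivative_def)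
      from has_derivative_inner[OF this this]
      have "((\<lambda>s. inner (y s) (y s)) has_real_derivative (2 * inner (A (y s)) (y s))) (at s within {0..})"
        unfolding has_field_derivative_def by (rule has_derivative_eq_rhs) (auto simp: fun_eq_iff inner_commute)
      then show ?thesis
        unfolding \<phi>_def \<phi>'_def 
        by (auto intro!: derivative_eq_intros simp: algebra_simps power2_norm_eq_inner)
    qed
    have "\<phi> t \<le> \<phi> 0"
    proof (rule DERIV_nonpos_imp_decreasing_open[OF t])
      show "\<exists>y. (\<phi> has_real_derivative y) (at s) \<and> y \<le> 0" if s: "0 < s" "s < t" for s
      proof (intro exI conjI)
        show "(\<phi> has_real_derivative \<phi>' s) (at s)"
          using der\<phi>[of s] s at_within_nonneg[of s] by simp
        show "\<phi>' s \<le> 0"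
          using diss[OF yD(1), of s] s unfolding \<phi>'_def by (intro mult_nonneg_nonpos) auto
      qed
      have "continuous_on {0..} \<phi>"
        using der\<phi> by (auto simp: continuous_on_eq_continuous_within intro: DERIV_continuous)
      then show "continuous_on {0..t} \<phi>" by (rule continuous_on_subset) auto
    qed
    also have "\<phi> 0 = 0" 
      using C0_semigroupD(4)[OF R(1)] C0_semigroupD(4)[OF S(1)] x DX by (auto simp: \<phi>_def y_def subset_iff)
    finally have "inner (y t) (y t) \<le> 0" by (simp add: \<phi>_def mult_le_0_iff)
    then have "y t = 0" using inner_ge_zero[of "y t"] inner_eq_zero_iff[of "y t"] by linarith
    then show ?thesis by (simp add: y_def)
  qed
  obtain M1 where M1: "\<And>x. x \<in> X \<Longrightarrow> norm (R t x) \<le> M1 * norm x" using C0_semigroupD(3)[OF R(1) t] by blast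
  obtain M2 where M2: "\<And>x. x \<in> X \<Longrightarrow> norm (S t x) \<le> M2 * norm x" using C0_semigroupD(3)[OF S(1) t] by blast
  obtain f where f: "\<And>n. f n \<in> D" "f \<longlonglongrightarrow> x" using subsetD[OF D x] unfolding closure_sequential by blast
  have fX: "f n \<in> X" "x - f n \<in> X" for n using f(1) DX x X(1) by (auto intro: subspace_diff)
  have "norm (R t x - S t x) \<le> (M1 + M2) * norm (x - f n)" for n
  proof -
    have "R t x - S t x = R t (x - f n) - S t (x - f n)"
      using C0_semigroup_diff[OF R(1) t x fX(1)] C0_semigroup_diff[OF S(1) t x fX(1)] eq[OF f(1) t] by simp
    then have "norm (R t x - S t x) \<le> norm (R t (x - f n)) + norm (S t (x - f n))" by (metis norm_triangle_ineq4)
    then show ?thesis using M1[OF fX(2), of n] M2[OF fX(2), of n] by (simp add: algebra_simps)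
  qed
  moreover have "(\<lambda>n. (M1 + M2) * norm (x - f n)) \<longlonglongrightarrow> (M1 + M2) * norm (x - x)" by (intro tendsto_intros f(2))
  ultimately have "norm (R t x - S t x) \<le> (M1 + M2) * norm (x - x)" by (intro LIMSEQ_le_const) auto
  then show ?thesis by simp
qed

subsection \<open>Transport along linear isomorphisms\<close>

text \<open>The Hilbert space theorems are about the norm of a type, whereas
  \<open>norm_prod\<close> is a separate function on a subset of a type. The locale moves semigroups
  and generators between two such settings; one constant for both inequalities keeps it symmetric
  under \<open>flip\<close>.\<close>

locale norm_iso =
  fixes X :: "'a::real_vector set" and Y :: "'b::real_vector set" and \<iota> \<kappa> N N' and C :: real
  assumes X: "subspace X" and Y: "subspace Y"
    and \<iota>_Y: "x \<in> X \<Longrightarrow> \<iota> x \<in> Y" and \<kappa>_X: "y \<in> Y \<Longrightarrow> \<kappa> y \<in> X"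
    and \<kappa>\<iota>: "x \<in> X \<Longrightarrow> \<kappa> (\<iota> x) = x" and \<iota>\<kappa>: "y \<in> Y \<Longrightarrow> \<iota> (\<kappa> y) = y"
    and \<iota>_lin: "x \<in> X \<Longrightarrow> x' \<in> X \<Longrightarrow> \<iota> (c *\<^sub>R x + d *\<^sub>R x') = c *\<^sub>R \<iota> x + d *\<^sub>R \<iota> x'"
    and N_le: "x \<in> X \<Longrightarrow> N x \<le> C * N' (\<iota> x)" and N'_le: "x \<in> X \<Longrightarrow> N' (\<iota> x) \<le> C * N x"
    and N_nonneg: "0 \<le> N x" and N'_nonneg: "0 \<le> N' y" and C: "0 \<le> C"
begin

lemma \<iota>_diff: "x \<in> X \<Longrightarrow> x' \<in> X \<Longrightarrow> \<iota> (x - x') = \<iota> x - \<iota> x'"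
  using \<iota>_lin[of x x' 1 "-1"] by simp

lemma \<iota>_scale: "x \<in> X \<Longrightarrow> \<iota> (c *\<^sub>R x) = c *\<^sub>R \<iota> x"
  using \<iota>_lin[of x x c 0] by simp

lemma \<kappa>_lin:
  assumes "y \<in> Y" "y' \<in> Y" shows "\<kappa> (c *\<^sub>R y + d *\<^sub>R y') = c *\<^sub>R \<kappa> y + d *\<^sub>R \<kappa> y'"
proof -
  have "c *\<^sub>R y + d *\<^sub>R y' = \<iota> (c *\<^sub>R \<kappa> y + d *\<^sub>R \<kappa> y')"
    using \<iota>_lin[OF \<kappa>_X \<kappa>_X, OF assms] \<iota>\<kappa> assms by simp
  then show ?thesis
    using \<kappa>\<iota>[of "c *\<^sub>R \<kappa> y + d *\<^sub>R \<kappa> y'"] \<kappa>_X assms X by (simp add: subspace_add subspace_scale)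
qed

lemma flip: "norm_iso Y X \<kappa> \<iota> N' N C"
proof unfold_locales
  show "N' y \<le> C * N (\<kappa> y)" "N (\<kappa> y) \<le> C * N' y" if "y \<in> Y" for y
    using N_le[OF \<kappa>_X[OF that]] N'_le[OF \<kappa>_X[OF that]] \<iota>\<kappa>[OF that] by auto
qed (auto simp: X Y \<iota>_Y \<kappa>_X \<kappa>\<iota> \<iota>\<kappa> \<kappa>_lin N_nonneg N'_nonneg C)

lemma tendsto_transfer:
  assumes "\<forall>\<^sub>F h in F. f h \<in> X" 
  shows "((\<lambda>h. N' (\<iota> (f h))) \<longlongrightarrow> 0) F \<longleftrightarrow> ((\<lambda>h. N (f h)) \<longlongrightarrow> 0) F"
proof
  assume "((\<lambda>h. N' (\<iota> (f h))) \<longlongrightarrow> 0) F"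
  then have "((\<lambda>h. C * N' (\<iota> (f h))) \<longlongrightarrow> C * 0) F" by (intro tendsto_intros)
  then show "((\<lambda>h. N (f h)) \<longlongrightarrow> 0) F"
    by (intro Lim_null_comparison[of "\<lambda>h. N (f h)" "\<lambda>h. C * N' (\<iota> (f h))"]) 
      (use assms N_le N_nonneg in \<open>auto elim: eventually_mono\<close>)
next
  assume "((\<lambda>h. N (f h)) \<longlongrightarrow> 0) F"
  then have "((\<lambda>h. C * N (f h)) \<longlongrightarrow> C * 0) F" by (intro tendsto_intros)
  then show "((\<lambda>h. N' (\<iota> (f h))) \<longlongrightarrow> 0) F"
    by (intro Lim_null_comparison[of "\<lambda>h. N' (\<iota> (f h))" "\<lambda>h. C * N (f h)"]) 
      (use assms N'_le N'_nonneg in \<open>auto elim: eventually_mono\<close>)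
qed

lemma C0_semigroup_transfer:
  assumes sg: "C0_semigroup X N R"
  shows "C0_semigroup Y N' (\<lambda>t y. \<iota> (R t (\<kappa> y)))"
  unfolding C0_semigroup_def
proof (intro conjI allI impI ballI)
  note R = C0_semigroupD[OF sg]
  fix t :: real assume t: "0 \<le> t"
  show "(\<lambda>y. \<iota> (R t (\<kappa> y))) ` Y \<subseteq> Y" using R(1)[OF t] \<iota>_Y \<kappa>_X by auto
  show "\<iota> (R t (\<kappa> (c *\<^sub>R x + d *\<^sub>R y))) = c *\<^sub>R \<iota> (R t (\<kappa> x)) + d *\<^sub>R \<iota> (R t (\<kappa> y))" if "x \<in> Y" "y \<in> Y" for x y c d
    using that by (simp add: \<kappa>_lin \<kappa>_X \<iota>_lin R(1,2) t)
  obtain M where M: "\<And>x. x \<in> X \<Longrightarrow> N (R t x) \<le> M * N x" using R(3)[OF t] by blast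
  have "N' (\<iota> (R t (\<kappa> y))) \<le> (C * \<bar>M\<bar> * C) * N' y" if y: "y \<in> Y" for y
  proof -
    have "N' (\<iota> (R t (\<kappa> y))) \<le> C * N (R t (\<kappa> y))" by (rule N'_le[OF R(1)[OF t \<kappa>_X[OF y]]])
    also have "\<dots> \<le> C * (\<bar>M\<bar> * (C * N' y))"
    proof (rule mult_left_mono[OF _ C])
      have "N (R t (\<kappa> y)) \<le> M * N (\<kappa> y)" by (rule M[OF \<kappa>_X[OF y]])
      also have "\<dots> \<le> \<bar>M\<bar> * N (\<kappa> y)" by (intro mult_right_mono N_nonneg) auto
      also have "\<dots> \<le> \<bar>M\<bar> * (C * N' y)"
        using N_le[OF \<kappa>_X[OF y]] \<iota>\<kappa>[OF y] by (intro mult_left_mono) auto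
      finally show "N (R t (\<kappa> y)) \<le> \<bar>M\<bar> * (C * N' y)" .
    qed
    finally show ?thesis by (simp add: mult.assoc)
  qed
  then show "\<exists>M. \<forall>x\<in>Y. N' (\<iota> (R t (\<kappa> x))) \<le> M * N' x" by blast
next
  note R = C0_semigroupD[OF sg]
  show "\<iota> (R 0 (\<kappa> x)) = x" if "x \<in> Y" for x using that by (simp add: R(4) \<kappa>_X \<iota>\<kappa>)
  show "\<iota> (R (s + t) (\<kappa> x)) = \<iota> (R s (\<kappa> (\<iota> (R t (\<kappa> x)))))" if "0 \<le> s" "0 \<le> t" "x \<in> Y" for s t x
    using that by (simp add: R(1,5) \<kappa>_X \<kappa>\<iota>)
  fix y assume y: "y \<in> Y"
  have ev: "\<forall>\<^sub>F t in at_right 0. R t (\<kappa> y) \<in> X"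
    using eventually_at_right_less[of 0] by eventually_elim (use R(1)[OF _ \<kappa>_X[OF y]] in auto)
  then have "\<forall>\<^sub>F t in at_right 0. R t (\<kappa> y) - \<kappa> y \<in> X"
    by eventually_elim (use \<kappa>_X[OF y] X in \<open>auto intro: subspace_diff\<close>)
  from tendsto_transfer[OF this] R(6)[OF \<kappa>_X[OF y]]
  have "((\<lambda>t. N' (\<iota> (R t (\<kappa> y) - \<kappa> y))) \<longlongrightarrow> 0) (at_right 0)" by blast
  moreover have "\<forall>\<^sub>F t in at_right 0. N' (\<iota> (R t (\<kappa> y) - \<kappa> y)) = N' (\<iota> (R t (\<kappa> y)) - y)"
    using ev by eventually_elim (use \<kappa>_X[OF y] in \<open>simp add: \<iota>_diff \<iota>\<kappa>[OF y]\<close>)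
  ultimately show "((\<lambda>t. N' (\<iota> (R t (\<kappa> y)) - y)) \<longlongrightarrow> 0) (at_right 0)"
    by (rule Lim_transform_eventually)
qed

lemma generator_transfer:
  assumes sg: "C0_semigroup X N R" and gen: "generator X N R D A" and A_X: "\<And>x. x \<in> D \<Longrightarrow> A x \<in> X"
    and D': "\<And>y. y \<in> D' \<longleftrightarrow> y \<in> Y \<and> \<kappa> y \<in> D" and A': "\<And>y. y \<in> D' \<Longrightarrow> A' y = \<iota> (A (\<kappa> y))"
  shows "generator Y N' (\<lambda>t y. \<iota> (R t (\<kappa> y))) D' A'"
  unfolding generator_def
proof (intro conjI ballI)
  note R = C0_semigroupD[OF sg]
  show "D' \<subseteq> Y" using D' by blast
  fix y z assume y: "y \<in> Y" and z: "z \<in> Y"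
  note yX = \<kappa>_X[OF y] and zX = \<kappa>_X[OF z]
  have ev: "\<forall>\<^sub>F t in at_right 0. R t (\<kappa> y) \<in> X"
    using eventually_at_right_less[of 0] by eventually_elim (use R(1)[OF _ yX] in auto)
  then have evq: "\<forall>\<^sub>F h in at_right 0. (R h (\<kappa> y) - \<kappa> y) /\<^sub>R h - \<kappa> z \<in> X"
    by eventually_elim (use yX zX X in \<open>auto intro!: subspace_diff subspace_scale\<close>)
  have "\<forall>\<^sub>F h in at_right 0. N' (\<iota> ((R h (\<kappa> y) - \<kappa> y) /\<^sub>R h - \<kappa> z)) = N' ((\<iota> (R h (\<kappa> y)) - y) /\<^sub>R h - z)"
    using ev
  proof eventually_elim
    case (elim h)
    have d: "R h (\<kappa> y) - \<kappa> y \<in> X" "(R h (\<kappa> y) - \<kappa> y) /\<^sub>R h \<in> X" using elim yX X by (auto intro!: subspace_diff subspace_scale)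
    show ?case using \<iota>_diff[OF d(2) zX] \<iota>_scale[OF d(1)] \<iota>_diff[OF elim yX] by (simp add: \<iota>\<kappa> y z)
  qed
  then have "((\<lambda>h. N' ((\<iota> (R h (\<kappa> y)) - y) /\<^sub>R h - z)) \<longlongrightarrow> 0) (at_right 0) \<longleftrightarrow>
        ((\<lambda>h. N' (\<iota> ((R h (\<kappa> y) - \<kappa> y) /\<^sub>R h - \<kappa> z))) \<longlongrightarrow> 0) (at_right 0)"
    by (rule tendsto_cong[symmetric])
  also have "\<dots> \<longleftrightarrow> ((\<lambda>h. N ((R h (\<kappa> y) - \<kappa> y) /\<^sub>R h - \<kappa> z)) \<longlongrightarrow> 0) (at_right 0)"
    by (rule tendsto_transfer[OF evq])
  also have "\<dots> \<longleftrightarrow> \<kappa> y \<in> D \<and> A (\<kappa> y) = \<kappa> z"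
    using gen yX zX unfolding generator_def by blast
  also have "\<dots> \<longleftrightarrow> y \<in> D' \<and> A' y = z"
    using D' A' y z A_X \<kappa>\<iota> \<iota>\<kappa> by metis
  finally show "((\<lambda>h. N' ((\<iota> (R h (\<kappa> y)) - y) /\<^sub>R h - z)) \<longlongrightarrow> 0) (at_right 0) \<longleftrightarrow> y \<in> D' \<and> A' y = z" .
qed

end

section \<open>Pointwise bounds and exceptional sets in L2\<close>

lemma sqint_iff_abs_integrable:
  "sqint f \<longleftrightarrow> f absolutely_integrable_on {0..1} \<and> (\<lambda>x. (f x)\<^sup>2) absolutely_integrable_on {0..1}"
proof -
  have "f \<in> borel_measurable I01" if "f absolutely_integrable_on {0..1}"
    using that unfolding integrable_I01_iff[symmetric] by (rule borel_measurable_integrable)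
  then show ?thesis using sqint_abs_integrable[of f] unfolding sqint_def integrable_I01_iff by blast
qed

lemma sqint_spike:
  assumes f: "sqint f" and N: "negligible N" and eq: "\<And>x. x \<in> {0<..<1} - N \<Longrightarrow> g x = f x"
  shows "sqint g" "cls g = cls f"
proof -
  have N': "negligible (N \<union> {0, 1})" using N by auto
  have eq': "g x = f x" if "x \<in> {0..1} - (N \<union> {0, 1})" for x using eq[of x] that by auto
  have "g absolutely_integrable_on {0..1}"
    by (rule absolutely_integrable_spike[OF _ N' eq']) (use f sqint_iff_abs_integrable in auto)
  moreover have "(\<lambda>x. (g x)\<^sup>2) absolutely_integrable_on {0..1}"
  proof (rule absolutely_integrable_spike[OF _ N'])
    show "(\<lambda>x. (f x)\<^sup>2) absolutely_integrable_on {0..1}" using f sqint_iff_abs_integrable by blast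
  qed (simp add: eq')
  ultimately show g: "sqint g" using sqint_iff_abs_integrable by blast
  show "cls g = cls f"
    unfolding cls_eq_iff[OF g f] by (rule AE_I01_I[OF N eq])
qed

lemma norm_cls_mono:
  assumes "sqint f" "sqint g" "AE x in I01. \<bar>f x\<bar> \<le> \<bar>g x\<bar>"
  shows "norm (cls f) \<le> norm (cls g)"
proof (rule power2_le_imp_le)
  have "AE x in I01. (f x)\<^sup>2 \<le> (g x)\<^sup>2" using assms(3) by eventually_elim (simp add: abs_le_square_iff)
  then show "(norm (cls f))\<^sup>2 \<le> (norm (cls g))\<^sup>2"
    unfolding norm_cls[OF assms(1)] norm_cls[OF assms(2)]
    using assms(1,2) by (intro integral_mono_AE) (auto simp: sqint_def)
qed simp

lemma norm_cls_le_const: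
  assumes "sqint f" "\<And>x. x \<in> {0<..<1} \<Longrightarrow> \<bar>f x\<bar> \<le> c"
  shows "norm (cls f) \<le> c"
proof -
  have c: "sqint (\<lambda>_. c)" by (intro sqint_continuous continuous_intros)
  have "0 \<le> c" using assms(2)[of "1/2"] by force
  have "norm (cls f) \<le> norm (cls (\<lambda>_. c))"
    by (rule norm_cls_mono[OF assms(1) c]) (rule AE_I01_I[of "{}"], use assms(2) in force, use assms(2) in force)
  also have "\<dots> = c"
    by (rule power2_eq_imp_eq) (use \<open>0 \<le> c\<close> norm_cls_integral[OF c] in auto)
  finally show ?thesis .
qed

lemma integral_le_norm:
  assumes "sqint g" "0 \<le> x" "x \<le> 1"
  shows "\<bar>integral {0..x} g\<bar> \<le> norm (cls g)"
proof -
  note ga = sqint_abs_integrable[OF assms(1)]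
  have gn: "(\<lambda>x. \<bar>g x\<bar>) absolutely_integrable_on {0..1}"
    using absolutely_integrable_norm[OF ga] by (simp add: o_def)
  have gx: "(\<lambda>x. \<bar>g x\<bar>) integrable_on {0..x}" "g integrable_on {0..x}"
    using abs_integrable_subinterval[OF gn order_refl assms(3)] abs_integrable_subinterval[OF ga order_refl assms(3)]
      abs_integrable_imp_integrable by blast+
  have "\<bar>integral {0..x} g\<bar> \<le> integral {0..x} (\<lambda>x. \<bar>g x\<bar>)"
    using integral_norm_bound_integral[OF gx(2,1)] by simp
  also have "\<dots> \<le> integral {0..1} (\<lambda>x. \<bar>g x\<bar>)"
    by (rule integral_subset_le) (use assms gx gn abs_integrable_imp_integrable in auto)
  also have "\<dots> = (LINT x|I01. \<bar>g x\<bar>)" using integral_I01 gn integrable_I01_iff by metis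
  also have "\<dots> \<le> norm (cls g)"
  proof -
    have "ennreal (LINT x|I01. \<bar>g x\<bar>) \<le> ennreal (norm (cls g))"
      using nn_integral_abs_le[OF assms(1)] nn_integral_eq_integral[of I01 "\<lambda>x. \<bar>g x\<bar>"] gn integrable_I01_iff by auto
    then show ?thesis by simp
  qed
  finally show ?thesis .
qed

lemma integral_cong_interior:
  fixes f g :: "real \<Rightarrow> real"
  assumes "negligible N" "\<And>x. x \<in> {c<..<d} - N \<Longrightarrow> f x = g x"
  shows "integral {c..d} f = integral {c..d} g"
proof (rule integral_spike[of "N \<union> {c, d}"])
  show "negligible (N \<union> {c, d})" using assms(1) by auto
qed (use assms(2) in auto)

subsection \<open>The degenerate coefficient\<close>

text \<open>By definition of K, x |a'(x)| <= K a(x), so a(x) x^(-K) is nonincreasing and at least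
  its value at 1. The set \<open>S\<close> covers both domains on which \<open>a\<close> is
  continuously differentiable.\<close>

lemma deg_lower_bound:
  assumes cont: "continuous_on {0<..1} a" and S: "S = {0<..1} \<or> S = {0..1}" and C1: "C1_on S a" 
    and pos: "\<And>x. x \<in> {0<..1} \<Longrightarrow> 0 < a x" and bdd: "bdd_above (deg_quot a ` {0<..1})"
    and x: "0 < x" "x \<le> 1"
  shows "a 1 * x powr deg_const a \<le> a x"
proof -
  define K where "K = deg_const a"
  obtain a' where a': "\<And>x. x \<in> S \<Longrightarrow> (a has_real_derivative a' x) (at x within S)"
    using C1 by (auto simp: C1_on_def)
  have der: "(a has_real_derivative a' y) (at y)" if "y \<in> {0<..<1}" for y
  proof -
    have "{0<..<1} \<subseteq> S" using S by auto
    then have "y \<in> interior S" using that by (intro interiorI[of "{0<..<1}"]) auto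
    then show ?thesis using a'[of y] at_within_interior[of y S] interior_subset[of S] by auto
  qed
  have quot: "y * \<bar>a' y\<bar> \<le> K * a y" if "y \<in> {0<..<1}" for y
  proof -
    have "vector_derivative a (at y within {0..1}) = a' y"
    proof -
      have "at y within {0..1} = at y" by (rule at_within_interior) (use that in auto)
      then show ?thesis
        using der[OF that] by (simp add: has_real_derivative_iff_has_vector_derivative vector_derivative_at)
    qed
    then have "y * \<bar>a' y\<bar> / a y = deg_quot a y" by (simp add: deg_quot_def)
    also have "\<dots> \<le> K" unfolding K_def deg_const_def by (rule cSUP_upper[OF _ bdd]) (use that in auto)
    finally show ?thesis using pos[of y] that by (simp add: divide_le_eq)
  qed
  define h where "h y = a y * y powr (- K)" for y
  have "h 1 \<le> h x"
  proof (rule DERIV_nonpos_imp_decreasing_open[OF x(2)])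
    fix y assume y: "x < y" "y < 1"
    then have y0: "y \<in> {0<..<1}" using x by auto
    show "\<exists>z. (h has_real_derivative z) (at y) \<and> z \<le> 0"
    proof (intro exI conjI)
      show "(h has_real_derivative (a' y * y powr (- K) + a y * (- K * y powr (- K - 1)))) (at y)"
        unfolding h_def using y0 by (auto intro!: derivative_eq_intros der)
      have "a' y * y powr (- K) + a y * (- K * y powr (- K - 1)) = (y * a' y - K * a y) * y powr (- K - 1)"
        using y0 by (simp add: powr_diff field_simps)
      also have "\<dots> \<le> 0"
      proof (rule mult_nonpos_nonneg)
        have "y * a' y \<le> y * \<bar>a' y\<bar>" using y0 by (intro mult_left_mono) auto
        then show "y * a' y - K * a y \<le> 0" using quot[OF y0] by linarith
      qed simp
      finally show "a' y * y powr (- K) + a y * (- K * y powr (- K - 1)) \<le> 0" .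
    qed
  next
    show "continuous_on {x..1} h"
      unfolding h_def using x by (intro continuous_intros continuous_on_subset[OF cont]) auto
  qed
  then have "a 1 \<le> a x * x powr (- K)" by (simp add: h_def)
  then have "a 1 * x powr K \<le> (a x * x powr (- K)) * x powr K" by (intro mult_right_mono) auto
  also have "\<dots> = a x" using x by (simp add: mult.assoc flip: powr_add)
  finally show ?thesis by (simp add: K_def)
qed

text \<open>One exponent p in (1, 2) serves both kinds of degeneracy: on (0, 1] replacing K by a
  larger p only weakens the lower bound, and p > 1 avoids a logarithm when x^(-p) is integrated.
  Integrability of 1 / a is kept for the case K < 1.\<close>

locale degenerate_coefficient =
  fixes a :: "real \<Rightarrow> real" and p m :: real
  assumes cont: "continuous_on {0..1} a" and pos: "x \<in> {0<..1} \<Longrightarrow> 0 < a x"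
    and p: "1 < p" "p < 2" and m: "0 < m" and lower: "x \<in> {0<..1} \<Longrightarrow> m * x powr p \<le> a x"
    and WD_SD: "WD a \<noteq> SD a"
    and WD_integrable: "WD a \<Longrightarrow> (\<lambda>x. 1 / a x) absolutely_integrable_on {0..1}"

lemma degenerate_coefficientI:
  assumes "WD a \<or> SD a" obtains p m where "degenerate_coefficient a p m"
proof -
  define K where "K = deg_const a"
  have K: "0 < K" "K < 2" using assms by (auto simp: K_def WD_def SD_def)
  have xor: "WD a \<noteq> SD a" using assms by (auto simp: WD_def SD_def)
  have cont: "continuous_on {0..1} a"
    using assms by (auto simp: WD_def SD_def C1_on_def intro: DERIV_continuous_on)
  have pos: "0 < a x" if "x \<in> {0<..1}" for x using assms that by (auto simp: WD_def SD_def)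
  have cont': "continuous_on {0<..1} a" by (rule continuous_on_subset[OF cont]) auto
  obtain S where S: "S = {0<..1} \<or> S = {0..1}" "C1_on S a" using assms unfolding WD_def SD_def by blast
  have bdd: "bdd_above (deg_quot a ` {0<..1})" using assms by (auto simp: WD_def SD_def)
  have low: "a 1 * x powr K \<le> a x" if "x \<in> {0<..1}" for x
    unfolding K_def by (rule deg_lower_bound[OF cont' S pos bdd]) (use that in auto)
  \<comment> \<open>Halfway between max 1 K and 2, hence strictly between 1 and 2 and at least
    K.\<close>
  define p where "p = (max 1 K + 2) / 2"
  have p: "1 < p" "p < 2" "K \<le> p" using K by (auto simp: p_def max_def)
  have "degenerate_coefficient a p (a 1)"
  proof unfold_locales
    show "a 1 * x powr p \<le> a x" if "x \<in> {0<..1}" for x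
    proof -
      have "x powr p \<le> x powr K" using that p(3) by (intro powr_mono') auto
      then have "a 1 * x powr p \<le> a 1 * x powr K" using pos[of 1] by (intro mult_left_mono) auto
      then show ?thesis using low[OF that] by simp
    qed
    show "(\<lambda>x. 1 / a x) absolutely_integrable_on {0..1}" if "WD a"
    proof -
      have K1: "K < 1" using that by (auto simp: WD_def K_def)
      have "(\<lambda>x. 1 / a x) absolutely_integrable_on {0<..<1}"
      proof (rule measurable_bounded_by_integrable_imp_absolutely_integrable)
        show "(\<lambda>x. 1 / a x) \<in> borel_measurable (lebesgue_on {0<..<1})"
        proof (rule continuous_imp_measurable_on_sets_lebesgue)
          have "\<forall>x\<in>{0<..<1}. a x \<noteq> 0"
          proof
            fix x :: real assume "x \<in> {0<..<1}"
            then show "a x \<noteq> 0" using pos[of x] by auto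
          qed
          then show "continuous_on {0<..<1} (\<lambda>x. 1 / a x)"
            by (intro continuous_intros continuous_on_subset[OF cont]) auto
        qed simp
        have "(\<lambda>x. x powr (- K)) integrable_on {0..1}" using K1 by (intro integrable_on_powr_from_0) auto
        then have "(\<lambda>x. 1 / a 1 * x powr (- K)) integrable_on {0..1}"
          using integrable_cmul[of "\<lambda>x. x powr (- K)" "{0..1}" "1 / a 1"] by simp
        then show "(\<lambda>x. 1 / a 1 * x powr (- K)) integrable_on {0<..<1}"
          by (simp only: integrable_on_open_interval_real)
        fix x :: real assume x: "x \<in> {0<..<1}"
        have "1 / a x \<le> 1 / (a 1 * x powr K)"
          using low[of x] x pos[of 1] pos[of x] by (intro divide_left_mono) (auto intro!: mult_pos_pos)
        also have "\<dots> = 1 / a 1 * x powr (- K)" by (simp add: powr_minus divide_inverse)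
        finally show "norm (1 / a x) \<le> 1 / a 1 * x powr (- K)" using pos[of x] x by simp
      qed simp
      then show ?thesis by (simp only: absolutely_integrable_on_Icc_iff_Ioo)
    qed
  qed (use cont pos p xor in auto)
  then show ?thesis using that by blast
qed

section \<open>The weighted space in coordinates\<close>

context degenerate_coefficient
begin

lemma nonneg_0: "x \<in> {0<..1} \<Longrightarrow> 0 \<le> a x" using pos by (simp add: less_imp_le)

text \<open>The coordinates on \<open>K2\<close>: with \<open>w = sqrt a u''\<close> and \<open>c = u'(1)\<close> one has \<open>u'' = k w\<close>, \<open>u' = dpar c w\<close>
  and \<open>u = fpar c w\<close>.\<close>
definition k :: "(real \<Rightarrow> real) \<Rightarrow> real \<Rightarrow> real" where "k w x = w x / sqrt (a x)"

text \<open>The integration starts from 1 because \<open>k w\<close> need not be integrable up to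
  0.\<close>

definition dpar :: "real \<Rightarrow> (real \<Rightarrow> real) \<Rightarrow> real \<Rightarrow> real" where
  "dpar c w x = c - integral {x..1} (k w)"

definition fpar :: "real \<Rightarrow> (real \<Rightarrow> real) \<Rightarrow> real \<Rightarrow> real" where
  "fpar c w x = integral {0..x} (dpar c w)"

text \<open>The factor 1 / sqrt a restricted to [e, 1]: pairing w with it integrates
  \<open>k w\<close> over [e, 1]. In the weakly degenerate case e = 0 is allowed as well.\<close>

definition cut :: "real \<Rightarrow> real \<Rightarrow> real" where
  "cut e x = (if x < e then 0 else 1 / sqrt (a x))"

text \<open>Bounds the \<open>L\<^sup>2\<close> norm of \<open>1 / sqrt a\<close> on \<open>(x, 1)\<close>, by \<open>a x \<ge> m x\<^sup>p\<close>.\<close>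
definition B :: "real \<Rightarrow> real" where
  "B x = sqrt (1 / (m * (p - 1))) * x powr ((1 - p) / 2)"

lemma B_nonneg: "0 \<le> B x" using m p by (simp add: B_def)

lemma B_sq: "0 < x \<Longrightarrow> (B x)\<^sup>2 = 1 / (m * (p - 1)) * x powr (1 - p)"
  using m p by (simp add: B_def power_mult_distrib power2_eq_square[of "x powr _"] flip: powr_add)

lemma measurable_a: "a \<in> borel_measurable I01"
  by (rule continuous_imp_measurable_on_sets_lebesgue[OF continuous_on_subset[OF cont]]) auto

lemma measurable_cut: "cut e \<in> borel_measurable I01"
proof -
  have id: "(\<lambda>x. x) \<in> borel_measurable I01"
    by (rule continuous_imp_measurable_on_sets_lebesgue) (auto intro: continuous_on_id)
  have 1: "{x \<in> space I01. x < e} \<in> sets I01"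
    by (rule borel_measurable_less[OF id borel_measurable_const])
  have 2: "(\<lambda>x. 1 / sqrt (a x)) \<in> borel_measurable I01"
    by (intro borel_measurable_divide borel_measurable_const measurable_compose[OF measurable_a borel_measurable_sqrt])
  show ?thesis unfolding cut_def by (rule measurable_If[OF borel_measurable_const 2 1])
qed

text \<open>The square of \<open>B\<close> is a multiple of x^(1 - p), which is integrable at 0
  because p < 2.\<close>

lemma sqint_B: "sqint B"
  unfolding sqint_def integrable_I01_iff
proof
  show "B \<in> borel_measurable I01"
    unfolding B_def by (rule continuous_imp_measurable_on_sets_lebesgue) (auto intro!: continuous_intros)
  have "(\<lambda>x. x powr (1 - p)) absolutely_integrable_on {0..1}"
    by (rule nonnegative_absolutely_integrable_1) (use p in \<open>auto intro!: integrable_on_powr_from_0\<close>)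
  then have "(\<lambda>x. 1 / (m * (p - 1)) * x powr (1 - p)) absolutely_integrable_on {0..1}"
    by (intro set_integrable_mult_right) auto
  then show "(\<lambda>x. (B x)\<^sup>2) absolutely_integrable_on {0..1}"
  proof (rule absolutely_integrable_spike)
    show "negligible {0::real}" by simp
    show "(B x)\<^sup>2 = 1 / (m * (p - 1)) * x powr (1 - p)" if "x \<in> {0..1} - {0}" for x
      by (rule B_sq) (use that in auto)
  qed
qed

lemma sqint_cut:
  assumes e: "0 < e" "e \<le> 1"
  shows "sqint (cut e)" "norm (cls (cut e)) \<le> B e"
proof -
  note meas = measurable_cut[of e]
  have ci: "(\<lambda>x. 1 / a x) integrable_on {e..1}"
  proof (intro integrable_continuous_real continuous_intros continuous_on_subset[OF cont])
    show "\<forall>x\<in>{e..1}. a x \<noteq> 0"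
    proof
      fix x assume "x \<in> {e..1}"
      then show "a x \<noteq> 0" using pos[of x] e by auto
    qed
  qed (use e in auto)
  have eq: "(cut e x)\<^sup>2 = (if x \<in> {e..1} then 1 / a x else 0)" if "x \<in> {0..1}" for x
    using that pos[of x] e by (auto simp: cut_def power_divide)
  have i1: "((\<lambda>x. if x \<in> {e..1} then 1 / a x else 0) has_integral integral {e..1} (\<lambda>x. 1 / a x)) {0..1}"
    using integrable_integral[OF ci] e by (subst has_integral_restrict) auto
  have hi: "((\<lambda>x. (cut e x)\<^sup>2) has_integral integral {e..1} (\<lambda>x. 1 / a x)) {0..1}"
    using has_integral_eq[OF _ i1, of "\<lambda>x. (cut e x)\<^sup>2"] eq by simp
  show sq: "sqint (cut e)"
    unfolding sqint_def integrable_I01_iff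
    by (intro conjI meas nonnegative_absolutely_integrable_1) (use hi in auto)
  have "(norm (cls (cut e)))\<^sup>2 = integral {e..1} (\<lambda>x. 1 / a x)"
    using norm_cls_integral[OF sq] hi by (simp add: integral_unique)
  also have "\<dots> \<le> (B e)\<^sup>2"
  proof -
    \<comment> \<open>A primitive of the majorant x^(-p) / m of 1 / a. Since F 1 is negative,
      dropping it leaves - F e, the square of \<open>B e\<close>.\<close>
    define F where "F x = - (1 / (m * (p - 1))) * x powr (1 - p)" for x
    have "((\<lambda>x. 1 / m * x powr (- p)) has_integral (F 1 - F e)) {e..1}"
    proof (rule fundamental_theorem_of_calculus[OF e(2)])
      fix x assume x: "x \<in> {e..1}"
      have "(F has_real_derivative 1 / m * x powr (- p)) (at x within {e..1})"
      proof -
        have "(F has_real_derivative - (1 / (m * (p - 1))) * ((1 - p) * x powr (1 - p - 1))) (at x within {e..1})"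
          unfolding F_def using x e p m by (auto intro!: derivative_eq_intros)
        moreover have "m \<noteq> 0" "p - 1 \<noteq> 0" using p m by auto
        then have "- (1 / (m * (p - 1))) * (1 - p) = 1 / m" by (simp add: divide_simps)
        then have "- (1 / (m * (p - 1))) * ((1 - p) * x powr (1 - p - 1)) = 1 / m * x powr (- p)"
          by (simp only: mult.assoc[symmetric]) simp
        ultimately show ?thesis by (simp only:)
      qed
      then show "(F has_vector_derivative 1 / m * x powr (- p)) (at x within {e..1})"
        by (simp add: has_real_derivative_iff_has_vector_derivative)
    qed
    moreover have "1 / a x \<le> 1 / m * x powr (- p)" if "x \<in> {e..1}" for x
    proof -
      have "1 / a x \<le> 1 / (m * x powr p)"
        using lower[of x] that e m pos[of x] by (intro divide_left_mono) (auto intro!: mult_pos_pos)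
      then show ?thesis by (simp add: powr_minus divide_inverse)
    qed
    ultimately have "integral {e..1} (\<lambda>x. 1 / a x) \<le> F 1 - F e"
      using has_integral_le[OF integrable_integral[OF ci]] by blast
    also have "\<dots> \<le> - F e" using m p by (simp add: F_def)
    also have "\<dots> = (B e)\<^sup>2" using B_sq[OF e(1)] by (simp add: F_def)
    finally show ?thesis .
  qed
  finally show "norm (cls (cut e)) \<le> B e" by (rule power2_le_imp_le) (rule B_nonneg)
qed

lemma k_integral_bound:
  assumes w: "sqint w" and c: "sqint (cut e)" and e: "0 \<le> e" "e \<le> 1"
  shows "k w absolutely_integrable_on {e..1}" "\<bar>integral {e..1} (k w)\<bar> \<le> norm (cls w) * norm (cls (cut e))"
proof -
  have i: "(\<lambda>x. w x * cut e x) absolutely_integrable_on {0..1}"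
    using sqint_mult[OF w c] integrable_I01_iff by blast
  have eq: "w x * cut e x = k w x" if "x \<in> {e..1}" for x using that by (simp add: cut_def k_def)
  show "k w absolutely_integrable_on {e..1}"
    by (rule absolutely_integrable_spike[OF abs_integrable_subinterval[OF i e(1) order_refl], of "{}"]) (use eq in auto)
  have "inner (cls w) (cls (cut e)) = integral {0..1} (\<lambda>x. w x * cut e x)" by (rule inner_cls_integral[OF w c])
  also have "\<dots> = integral {0..1} (\<lambda>x. if x \<in> {e..1} then k w x else 0)"
    by (rule integral_cong) (auto simp: cut_def k_def)
  also have "\<dots> = integral ({e..1} \<inter> {0..1}) (k w)" by (rule integral_restrict_Int)
  also have "{e..1} \<inter> {0..1} = {e..1}" using e by auto
  finally show "\<bar>integral {e..1} (k w)\<bar> \<le> norm (cls w) * norm (cls (cut e))"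
    using Cauchy_Schwarz_ineq2[of "cls w" "cls (cut e)"] by simp
qed

lemma k_integrable: "sqint w \<Longrightarrow> 0 < e \<Longrightarrow> k w absolutely_integrable_on {e..1}"
  using k_integral_bound(1)[OF _ sqint_cut(1), of w e] by (cases "e \<le> 1") auto

lemma k_tail: "sqint w \<Longrightarrow> 0 < e \<Longrightarrow> e \<le> 1 \<Longrightarrow> \<bar>integral {e..1} (k w)\<bar> \<le> norm (cls w) * B e"
  using k_integral_bound(2)[OF _ sqint_cut(1), of w e] mult_left_mono[OF sqint_cut(2), of e "norm (cls w)"] by force

lemma sqint_cut_0: "WD a \<Longrightarrow> sqint (cut 0)"
  unfolding sqint_def integrable_I01_iff
proof
  assume wd: "WD a"
  show "cut 0 \<in> borel_measurable I01" by (rule measurable_cut)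
  show "(\<lambda>x. (cut 0 x)\<^sup>2) absolutely_integrable_on {0..1}"
    by (rule absolutely_integrable_spike[OF WD_integrable[OF wd], of "{0}"])
      (use nonneg_0 in \<open>auto simp: cut_def power_divide\<close>)
qed

lemma k_integrable_WD: "WD a \<Longrightarrow> sqint w \<Longrightarrow> k w absolutely_integrable_on {0..1}"
  using k_integral_bound(1)[OF _ sqint_cut_0, of w] by simp

lemma k_integral_WD: "WD a \<Longrightarrow> sqint w \<Longrightarrow> \<bar>integral {0..1} (k w)\<bar> \<le> norm (cls w) * norm (cls (cut 0))"
  using k_integral_bound(2)[OF _ sqint_cut_0, of w] by simp

lemma dpar_diff:
  assumes w: "sqint w" and x: "0 < x \<or> WD a \<and> 0 \<le> x" "x \<le> y" "y \<le> 1"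
  shows "dpar c w y - dpar c w x = integral {x..y} (k w)"
proof -
  have "k w absolutely_integrable_on {x..1}"
    using k_integrable[OF w] abs_integrable_subinterval[OF k_integrable_WD[OF _ w]] x(1) by auto
  then have "integral {x..y} (k w) + integral {y..1} (k w) = integral {x..1} (k w)"
    by (intro Henstock_Kurzweil_Integration.integral_combine x abs_integrable_imp_integrable)
  then show ?thesis by (simp add: dpar_def)
qed

lemma dpar_abs_cont: "sqint w \<Longrightarrow> 0 < e \<Longrightarrow> abs_cont_on {e..1} (dpar c w)"
  by (rule abs_cont_on_integral[OF k_integrable]) (auto intro!: dpar_diff)

lemma dpar_abs_cont_WD: "WD a \<Longrightarrow> sqint w \<Longrightarrow> abs_cont_on {0..1} (dpar c w)"
  by (rule abs_cont_on_integral[OF k_integrable_WD]) (auto intro!: dpar_diff)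

lemma dpar_continuous_at:
  assumes "sqint w" "0 < x" "x \<le> 1"
  shows "continuous (at x within {0..1}) (dpar c w)"
proof -
  have "continuous_on {x/2..1} (dpar c w)"
    by (rule abs_cont_on_imp_continuous[OF dpar_abs_cont]) (use assms in auto)
  then have "continuous (at x within {x/2..1}) (dpar c w)"
    using assms by (auto simp: continuous_on_eq_continuous_within)
  moreover have "at x within {0..1} = at x within {x/2..1}"
    by (rule at_within_nhd[of x "{x/2<..}"]) (use assms in auto)
  ultimately show ?thesis by simp
qed

lemma dpar_bound: "sqint w \<Longrightarrow> 0 < x \<Longrightarrow> x \<le> 1 \<Longrightarrow> \<bar>dpar c w x\<bar> \<le> \<bar>c\<bar> + norm (cls w) * B x"
  using k_tail[of w x] unfolding dpar_def by linarith

text \<open>The tail estimate dominates the derivative by |c| plus a multiple of \<open>B\<close>,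
  which is square integrable even where the derivative is unbounded near 0.\<close>

lemma dpar_sqint:
  assumes w: "sqint w"
  shows "sqint (dpar c w)" "norm (cls (dpar c w)) \<le> \<bar>c\<bar> + norm (cls w) * norm (cls B)"
proof -
  define b where "b x = \<bar>c\<bar> + norm (cls w) * B x" for x
  have c: "sqint (\<lambda>_. \<bar>c\<bar>)" by (intro sqint_continuous continuous_intros)
  have sb: "sqint b" unfolding b_def by (intro sqint_add sqint_cmult c sqint_B)
  have meas: "dpar c w \<in> borel_measurable I01"
  proof (rule continuous_imp_measurable_on_sets_lebesgue)
    show "continuous_on {0<..<1} (dpar c w)"
    proof (rule continuous_at_imp_continuous_on, rule ballI)
      fix x :: real assume x: "x \<in> {0<..<1}"
      have "at x within {0..1} = at x" by (rule at_within_interior) (use x in auto)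
      then show "isCont (dpar c w) x" using dpar_continuous_at[OF w, of x c] x by simp
    qed
  qed simp
  have le: "AE x in I01. \<bar>dpar c w x\<bar> \<le> \<bar>b x\<bar>"
  proof (rule AE_I01_I[of "{}"])
    fix x :: real assume "x \<in> {0<..<1} - {}"
    then show "\<bar>dpar c w x\<bar> \<le> \<bar>b x\<bar>" using dpar_bound[OF w, of x c] by (auto simp: b_def)
  qed simp
  show s: "sqint (dpar c w)" by (rule sqint_bound[OF sb meas le])
  have "norm (cls (dpar c w)) \<le> norm (cls b)" by (rule norm_cls_mono[OF s sb le])
  also have "cls b = cls (\<lambda>_. \<bar>c\<bar>) + norm (cls w) *\<^sub>R cls B"
    unfolding b_def using cls_add[OF c sqint_cmult[OF sqint_B]] cls_scaleR[OF sqint_B] by simp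
  also have "norm \<dots> \<le> norm (cls (\<lambda>_. \<bar>c\<bar>)) + norm (cls w) * norm (cls B)"
    by (rule order_trans[OF norm_triangle_ineq]) simp
  also have "norm (cls (\<lambda>_. \<bar>c\<bar>)) \<le> \<bar>c\<bar>" by (rule norm_cls_le_const[OF c]) simp
  finally show "norm (cls (dpar c w)) \<le> \<bar>c\<bar> + norm (cls w) * norm (cls B)" by simp
qed

lemma fpar_diff: "sqint w \<Longrightarrow> 0 \<le> x \<Longrightarrow> x \<le> y \<Longrightarrow> y \<le> 1 \<Longrightarrow> fpar c w y - fpar c w x = integral {x..y} (dpar c w)"
  using indefinite_integral_diff[OF sqint_abs_integrable[OF dpar_sqint(1)], of w x y 0 c] by (simp add: fpar_def)

lemma fpar_continuous: "sqint w \<Longrightarrow> continuous_on {0..1} (fpar c w)"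
  by (rule abs_cont_on_imp_continuous[OF abs_cont_on_integral[OF sqint_abs_integrable[OF dpar_sqint(1)] fpar_diff]])

lemma fpar_sqint: "sqint w \<Longrightarrow> sqint (fpar c w)"
  by (rule sqint_continuous[OF fpar_continuous])

lemma fpar_bound: "sqint w \<Longrightarrow> 0 \<le> x \<Longrightarrow> x \<le> 1 \<Longrightarrow> \<bar>fpar c w x\<bar> \<le> norm (cls (dpar c w))"
  unfolding fpar_def by (rule integral_le_norm[OF dpar_sqint(1)])

lemma fpar_norm: "sqint w \<Longrightarrow> norm (cls (fpar c w)) \<le> norm (cls (dpar c w))"
  by (rule norm_cls_le_const[OF fpar_sqint]) (auto intro: fpar_bound)

lemma is_wderiv_fpar: "sqint w \<Longrightarrow> is_wderiv (cls (fpar c w)) (cls (dpar c w))"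
  by (rule is_wderiv_integral(2)[OF dpar_sqint(1) fpar_diff])

text \<open>In the weakly degenerate case the condition \<open>u'(0) = 0\<close> determines the slope \<open>c\<close>.\<close>
definition adm :: "real \<Rightarrow> (real \<Rightarrow> real) \<Rightarrow> bool" where
  "adm c w \<longleftrightarrow> sqint w \<and> (WD a \<longrightarrow> c = integral {0..1} (k w))"

lemma par_props:
  assumes w: "sqint w" and u: "u = cls (fpar c w)"
  shows "u \<in> H1" "wderiv u = cls (dpar c w)" "repr u (fpar c w)" "repr (wderiv u) (dpar c w)"
    "\<And>x. x \<in> {0..1} \<Longrightarrow> pt u x = fpar c w x"
    "\<And>x. x \<in> {0<..1} \<Longrightarrow> pt (wderiv u) x = dpar c w x"
    "pt (wderiv u) 1 = c" "pt u 0 = 0"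
    "\<exists>N. negligible N \<and> (\<forall>x\<in>{0<..<1} - N. D2 u x = k w x)"
    "sqint (\<lambda>x. sqrt (a x) * D2 u x)" "sqrt_a_D2 a u = cls w"
proof -
  show "u \<in> H1" using is_wderiv_fpar[OF w] u by (auto simp: H1_def)
  show wd: "wderiv u = cls (dpar c w)" using wderiv_eqI[OF is_wderiv_fpar[OF w]] u by simp
  show ru: "repr u (fpar c w)" using u fpar_sqint[OF w] by (simp add: repr_def)
  show rg: "repr (wderiv u) (dpar c w)" using wd dpar_sqint[OF w] by (simp add: repr_def)
  show ptu: "pt u x = fpar c w x" if "x \<in> {0..1}" for x
    by (rule pt_eq_continuous_on[OF ru fpar_continuous[OF w] that])
  show ptg: "pt (wderiv u) x = dpar c w x" if "x \<in> {0<..1}" for x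
    by (rule pt_eq[OF rg dpar_continuous_at[OF w]]) (use that in auto)
  show "pt (wderiv u) 1 = c" using ptg[of 1] by (simp add: dpar_def)
  show "pt u 0 = 0" using ptu[of 0] by (simp add: fpar_def)
  \<comment> \<open>\<open>k w\<close> may fail to be integrable at 0, so Lebesgue differentiation
    is applied on each interval (1 / (n + 1), 1) and the exceptional sets are collected.\<close>
  have "\<exists>N. negligible N \<and> (\<forall>x\<in>{1 / real (Suc n)<..<1} - N. (dpar c w has_real_derivative k w x) (at x))" for n
  proof -
    have e: "0 < 1 / real (Suc n)" by simp
    obtain N where "negligible N" "\<And>x. x \<in> {1 / real (Suc n)<..<1} - N \<Longrightarrow> (dpar c w has_real_derivative k w x) (at x)"
      using lebesgue_differentiation[OF k_integrable[OF w e] dpar_diff[OF w]] e by (metis order_less_le_trans)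
    then show ?thesis by blast
  qed
  then obtain N where N: "\<And>n. negligible (N n)" 
    "\<And>n x. x \<in> {1 / real (Suc n)<..<1} - N n \<Longrightarrow> (dpar c w has_real_derivative k w x) (at x)" by metis
  define M where "M = (\<Union>n. N n)"
  have M: "negligible M" unfolding M_def using N(1) by (intro negligible_Union_nat) 
  have D2: "D2 u x = k w x" if x: "x \<in> {0<..<1} - M" for x
  proof -
    obtain n where "1 / real (Suc n) < x" using x nat_approx_posE[of x] by auto
    then have "(dpar c w has_real_derivative k w x) (at x)" using N(2)[of x n] x by (auto simp: M_def)
    then have "(pt (wderiv u) has_real_derivative k w x) (at x)"
      by (rule has_field_derivative_transform_within_open[of _ _ _ "{0<..<1}"]) (use x ptg in auto)
    then show ?thesis by (simp add: D2_def DERIV_imp_deriv)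
  qed
  then show "\<exists>N. negligible N \<and> (\<forall>x\<in>{0<..<1} - N. D2 u x = k w x)" using M by blast
  have eq: "sqrt (a x) * D2 u x = w x" if "x \<in> {0<..<1} - M" for x
    using D2[OF that] pos[of x] that by (simp add: k_def)
  show "sqint (\<lambda>x. sqrt (a x) * D2 u x)" by (rule sqint_spike(1)[OF w M eq])
  show "sqrt_a_D2 a u = cls w" unfolding sqrt_a_D2_def by (rule sqint_spike(2)[OF w M eq])
qed

lemma par_in_K2:
  assumes adm: "adm c w" and u: "u = cls (fpar c w)"
  shows "u \<in> K2 a" "WD a \<Longrightarrow> pt (wderiv u) 0 = 0"
proof -
  have w: "sqint w" using adm by (simp add: adm_def)
  note P = par_props[OF w u]
  show wd0: "pt (wderiv u) 0 = 0" if wd: "WD a"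
  proof -
    have "pt (wderiv u) 0 = dpar c w 0"
      by (rule pt_eq_continuous_on[OF P(4) abs_cont_on_imp_continuous[OF dpar_abs_cont_WD[OF wd w]]]) simp
    then show ?thesis using adm wd by (simp add: adm_def dpar_def)
  qed
  show "u \<in> K2 a"
  proof (cases "WD a")
    case True
    then show ?thesis using P(1,4,8,10) wd0 dpar_abs_cont_WD[OF True w] by (auto simp: K2_def K2_WD_def)
  next
    case False
    then show ?thesis using P(1,4,8,10) dpar_abs_cont[OF w] by (auto simp: K2_def K2_SD_def)
  qed
qed

text \<open>The absolutely continuous representative of u' is recovered from its almost everywhere
  derivative by the fundamental theorem, so it coincides with \<open>dpar c w\<close>. Then u is a
  primitive of it up to a constant, which u(0) = 0 removes.\<close>

lemma K2_par:
  assumes u: "u \<in> K2 a"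
  defines "w \<equiv> \<lambda>x. sqrt (a x) * D2 u x" and "c \<equiv> pt (wderiv u) 1"
  shows "adm c w" "u = cls (fpar c w)"
proof -
  have H1: "u \<in> H1" and pt0: "pt u 0 = 0" and w: "sqint w"
    using u by (auto simp: K2_def K2_WD_def K2_SD_def w_def split: if_splits)
  obtain f where f: "repr (wderiv u) f" "\<And>e. 0 < e \<Longrightarrow> e < 1 \<Longrightarrow> abs_cont_on {e..1} f"
    and fWD: "WD a \<Longrightarrow> abs_cont_on {0..1} f"
  proof (cases "WD a")
    case True
    then obtain f where "repr (wderiv u) f" "abs_cont_on {0..1} f" using u by (auto simp: K2_def K2_WD_def)
    then show ?thesis using that abs_cont_on_subset[of "{0..1}" f] by auto
  next
    case False
    then obtain f where "repr (wderiv u) f" "\<forall>c\<in>{0<..<1}. abs_cont_on {c..1} f" using u by (auto simp: K2_def K2_SD_def)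
    then show ?thesis using that False by auto
  qed
  have ptf: "pt (wderiv u) x = f x" if "x \<in> {0<..1}" for x
  proof (rule pt_eq[OF f(1)])
    have "continuous_on {x/2..1} f"
      by (rule abs_cont_on_imp_continuous[OF f(2)]) (use that in auto)
    then have "continuous (at x within {x/2..1}) f"
      using that by (auto simp: continuous_on_eq_continuous_within)
    moreover have "at x within {0..1} = at x within {x/2..1}"
      by (rule at_within_nhd[of x "{x/2<..}"]) (use that in auto)
    ultimately show "continuous (at x within {0..1}) f" by simp
  qed (use that in auto)
  have cf: "c = f 1" using ptf[of 1] by (simp add: c_def)
  have D2f: "D2 u x = deriv f x" if x: "x \<in> {0<..<1}" for x
  proof -
    have "eventually (\<lambda>y. pt (wderiv u) y = f y) (nhds x)"
      using eventually_nhds_in_open[of "{0<..<1}" x] x by (auto elim!: eventually_mono intro: ptf)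
    then show ?thesis unfolding D2_def by (intro deriv_cong_ev) auto
  qed
  have kw: "k w x = deriv f x" if "x \<in> {0<..<1}" for x
    using D2f[OF that] pos[of x] that by (simp add: k_def w_def)
  have ik: "integral {x..1} (k w) = f 1 - f x" if ac: "abs_cont_on {x..1} f" and x: "0 \<le> x" "x \<le> 1" for x
  proof -
    have "integral {x..1} (k w) = integral {x..1} (deriv f)"
      by (rule integral_cong_interior[of "{}"]) (use kw x in auto)
    also have "\<dots> = f 1 - f x" using abs_cont_on_has_integral_deriv[OF ac x(2)] by (rule integral_unique)
    finally show ?thesis .
  qed
  have dpf: "dpar c w x = f x" if "x \<in> {0<..<1}" for x
    using ik[OF f(2)[of x]] that by (simp add: dpar_def cf)
  have "cls (dpar c w) = cls f"
    by (rule sqint_spike(2)[of f "{}"]) (use f(1) dpf in \<open>auto simp: repr_def\<close>)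
  then have "wderiv u = cls (dpar c w)" using f(1) by (simp add: repr_def)
  then obtain c0 where "repr u (\<lambda>x. c0 + integral {0..x} (dpar c w))"
    using is_wderiv_representative[of u "dpar c w"] is_wderiv_wderiv[OF H1] dpar_sqint(1)[OF w] by auto
  then have r: "repr u (\<lambda>x. c0 + fpar c w x)" by (simp add: fpar_def)
  have "pt u 0 = c0 + fpar c w 0"
    by (rule pt_eq_continuous_on[OF r]) (auto intro!: continuous_intros fpar_continuous w)
  then have "c0 = 0" using pt0 by (simp add: fpar_def)
  then show "u = cls (fpar c w)" using r by (simp add: repr_def)
  have "c = integral {0..1} (k w)" if wd: "WD a"
  proof -
    have "pt (wderiv u) 0 = 0" using u wd by (simp add: K2_def K2_WD_def)
    moreover have "pt (wderiv u) 0 = f 0"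
      by (rule pt_eq_continuous_on[OF f(1) abs_cont_on_imp_continuous[OF fWD[OF wd]]]) simp
    ultimately show ?thesis using ik[OF fWD[OF wd]] cf by simp
  qed
  then show "adm c w" using w by (simp add: adm_def)
qed

end

section \<open>Linearity, norm estimates and closedness of the weighted space\<close>

context degenerate_coefficient
begin

abbreviation W :: "l2 \<Rightarrow> l2" where "W \<equiv> sqrt_a_D2 a"

lemma k_lin: "k (\<lambda>x. \<alpha> * w x + \<beta> * w' x) = (\<lambda>x. \<alpha> * k w x + \<beta> * k w' x)"
  by (simp add: k_def fun_eq_iff add_divide_distrib)

lemma integral_lin:
  fixes f g :: "real \<Rightarrow> real"
  assumes "f absolutely_integrable_on S" "g absolutely_integrable_on S"
  shows "integral S (\<lambda>x. \<alpha> * f x + \<beta> * g x) = \<alpha> * integral S f + \<beta> * integral S g"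
  using assms[THEN abs_integrable_imp_integrable] 
    integrable_cmul[of f S \<alpha>] integrable_cmul[of g S \<beta>]
  by (simp add: integral_add)

lemma dpar_lin:
  assumes "sqint w" "sqint w'" "0 < x"
  shows "dpar (\<alpha> * c + \<beta> * c') (\<lambda>x. \<alpha> * w x + \<beta> * w' x) x = \<alpha> * dpar c w x + \<beta> * dpar c' w' x"
  unfolding dpar_def k_lin integral_lin[OF k_integrable[OF assms(1,3)] k_integrable[OF assms(2,3)]]
  by (simp add: algebra_simps)

lemma fpar_lin:
  assumes w: "sqint w" "sqint w'" and x: "0 \<le> x" "x \<le> 1"
  shows "fpar (\<alpha> * c + \<beta> * c') (\<lambda>x. \<alpha> * w x + \<beta> * w' x) x = \<alpha> * fpar c w x + \<beta> * fpar c' w' x"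
proof -
  have "fpar (\<alpha> * c + \<beta> * c') (\<lambda>x. \<alpha> * w x + \<beta> * w' x) x = integral {0..x} (\<lambda>x. \<alpha> * dpar c w x + \<beta> * dpar c' w' x)"
    unfolding fpar_def by (rule integral_cong_interior[of "{}"]) (use dpar_lin[OF w] in auto)
  also have "\<dots> = \<alpha> * fpar c w x + \<beta> * fpar c' w' x"
    unfolding fpar_def
    by (rule integral_lin; rule abs_integrable_subinterval[OF sqint_abs_integrable[OF dpar_sqint(1)]]) (use w x in auto)
  finally show ?thesis .
qed

lemma adm_lin:
  assumes "adm c w" "adm c' w'"
  shows "adm (\<alpha> * c + \<beta> * c') (\<lambda>x. \<alpha> * w x + \<beta> * w' x)"
  using assms sqint_add[OF sqint_cmult sqint_cmult, of w w' \<alpha> \<beta>] integral_lin[OF k_integrable_WD k_integrable_WD, of w w' \<alpha> \<beta>]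
  unfolding adm_def k_lin by auto

text \<open>\<open>D2\<close> and \<open>pt\<close> come from pointwise derivatives and definite
  descriptions, so their linearity is not visible; in the coordinates c and w it is.\<close>

lemma K2_lin:
  assumes u: "u \<in> K2 a" and v: "v \<in> K2 a" and z_def: "z = \<alpha> *\<^sub>R u + \<beta> *\<^sub>R v"
  shows "z \<in> K2 a" "W z = \<alpha> *\<^sub>R W u + \<beta> *\<^sub>R W v" "wderiv z = \<alpha> *\<^sub>R wderiv u + \<beta> *\<^sub>R wderiv v"
    "pt z 1 = \<alpha> * pt u 1 + \<beta> * pt v 1" "pt (wderiv z) 1 = \<alpha> * pt (wderiv u) 1 + \<beta> * pt (wderiv v) 1"
proof -
  obtain c w where u': "adm c w" "u = cls (fpar c w)" using K2_par[OF u] by blast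
  obtain c' w' where v': "adm c' w'" "v = cls (fpar c' w')" using K2_par[OF v] by blast
  have w: "sqint w" "sqint w'" using u' v' by (auto simp: adm_def)
  note adm = adm_lin[OF u'(1) v'(1), of \<alpha> \<beta>]
  define c'' w'' where "c'' = \<alpha> * c + \<beta> * c'" and "w'' = (\<lambda>x. \<alpha> * w x + \<beta> * w' x)"
  have adm: "adm c'' w''" using adm_lin[OF u'(1) v'(1)] by (simp add: c''_def w''_def)
  then have w'': "sqint w''" by (simp add: adm_def)
  have cl: "cls (\<lambda>x. \<alpha> * f x + \<beta> * g x) = \<alpha> *\<^sub>R cls f + \<beta> *\<^sub>R cls g" if "sqint f" "sqint g" for f g
    using cls_scaleR[OF that(1)] cls_scaleR[OF that(2)] cls_add[OF sqint_cmult[OF that(1)] sqint_cmult[OF that(2)]] by simp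
  have z: "z = cls (fpar c'' w'')"
  proof -
    have "cls (fpar c'' w'') = cls (\<lambda>x. \<alpha> * fpar c w x + \<beta> * fpar c' w' x)"
      by (rule sqint_spike(2)[of _ "{}"]) 
        (use fpar_lin[OF w] in \<open>auto simp: c''_def w''_def intro!: sqint_add sqint_cmult fpar_sqint w\<close>)
    then show ?thesis using cl[OF fpar_sqint[OF w(1)] fpar_sqint[OF w(2)]] u' v' by (simp add: z_def)
  qed
  note U = par_props[OF w(1) u'(2)] and V = par_props[OF w(2) v'(2)] and Z = par_props[OF w'' z]
  show "z \<in> K2 a" by (rule par_in_K2(1)[OF adm z])
  show "W z = \<alpha> *\<^sub>R W u + \<beta> *\<^sub>R W v"
    using cl[OF w] unfolding U(11) V(11) Z(11) by (simp add: w''_def)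
  have "cls (dpar c'' w'') = cls (\<lambda>x. \<alpha> * dpar c w x + \<beta> * dpar c' w' x)"
    by (rule sqint_spike(2)[of _ "{}"]) 
      (use dpar_lin[OF w] in \<open>auto simp: c''_def w''_def intro!: sqint_add sqint_cmult dpar_sqint(1) w\<close>)
  then show "wderiv z = \<alpha> *\<^sub>R wderiv u + \<beta> *\<^sub>R wderiv v"
    using cl[OF dpar_sqint(1)[OF w(1)] dpar_sqint(1)[OF w(2)]] unfolding U(2) V(2) Z(2) by simp
  show "pt z 1 = \<alpha> * pt u 1 + \<beta> * pt v 1"
    using U(5)[of 1] V(5)[of 1] Z(5)[of 1] fpar_lin[OF w, of 1] by (simp add: c''_def w''_def)
  show "pt (wderiv z) 1 = \<alpha> * pt (wderiv u) 1 + \<beta> * pt (wderiv v) 1"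
    unfolding U(7) V(7) Z(7) by (simp add: c''_def)
qed

lemma k_zero: "k (\<lambda>_. 0) = (\<lambda>_. 0)"
  by (simp add: k_def fun_eq_iff)

lemma dpar_zero: "dpar c (\<lambda>_. 0) = (\<lambda>_. c)"
  by (simp add: dpar_def k_zero fun_eq_iff)

lemma fpar_zero: "0 \<le> x \<Longrightarrow> fpar c (\<lambda>_. 0) x = c * x"
  by (simp add: fpar_def dpar_zero)

lemma adm_zero: "adm 0 (\<lambda>_. 0)"
  by (simp add: adm_def k_zero sqint_zero)

lemma zero_in_K2: "0 \<in> K2 a"
proof -
  have "fpar 0 (\<lambda>_. 0) = (\<lambda>_. 0)" by (simp add: fpar_def dpar_zero fun_eq_iff)
  then have "0 = cls (fpar 0 (\<lambda>_. 0))" by (simp add: cls_zero)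
  from par_in_K2(1)[OF adm_zero this] show ?thesis .
qed

lemma subspace_K2: "subspace (K2 a)"
proof (rule subspaceI)
  show "x + y \<in> K2 a" if "x \<in> K2 a" "y \<in> K2 a" for x y
    using K2_lin(1)[OF that, of "x + y" 1 1] by simp
  show "c *\<^sub>R x \<in> K2 a" if "x \<in> K2 a" for c x
    using K2_lin(1)[OF that that, of "c *\<^sub>R x" c 0] by simp
qed (rule zero_in_K2)

lemma K2_diff:
  assumes "u \<in> K2 a" "v \<in> K2 a"
  shows "u - v \<in> K2 a" "W (u - v) = W u - W v" "wderiv (u - v) = wderiv u - wderiv v"
    "pt (u - v) 1 = pt u 1 - pt v 1" "pt (wderiv (u - v)) 1 = pt (wderiv u) 1 - pt (wderiv v) 1"
  using K2_lin[OF assms, of "u - v" 1 "-1"] by simp_all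

lemma integral_a_D2:
  assumes "u \<in> K2 a" "v \<in> K2 a"
  shows "(LINT x|I01. a x * D2 u x * D2 v x) = inner (W u) (W v)"
proof -
  have s: "sqint (\<lambda>x. sqrt (a x) * D2 u x)" "sqint (\<lambda>x. sqrt (a x) * D2 v x)"
    using K2_par(1)[OF assms(1)] K2_par(1)[OF assms(2)] by (auto simp: adm_def)
  have "inner (W u) (W v) = (LINT x|I01. (sqrt (a x) * D2 u x) * (sqrt (a x) * D2 v x))"
    unfolding sqrt_a_D2_def by (rule inner_cls[OF s])
  also have "\<dots> = (LINT x|I01. a x * D2 u x * D2 v x)"
  proof (rule Bochner_Integration.integral_cong[OF refl])
    fix x assume "x \<in> space I01"
    then have "0 \<le> a x" using nonneg_0[of x] by simp
    then have "sqrt (a x) * sqrt (a x) = a x" by simp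
    then show "(sqrt (a x) * D2 u x) * (sqrt (a x) * D2 v x) = a x * D2 u x * D2 v x"
      by (metis mult.assoc mult.left_commute)
  qed
  finally show ?thesis by simp
qed

lemma K2_norm_bounds:
  assumes u: "u \<in> K2 a"
  shows "norm (wderiv u) \<le> \<bar>pt (wderiv u) 1\<bar> + norm (W u) * norm (cls B)"
    "norm u \<le> norm (wderiv u)" "\<bar>pt u 1\<bar> \<le> norm (wderiv u)"
proof -
  obtain c w where u': "adm c w" "u = cls (fpar c w)" using K2_par[OF u] by blast
  have w: "sqint w" using u' by (auto simp: adm_def)
  note U = par_props[OF w u'(2)]
  show "norm (wderiv u) \<le> \<bar>pt (wderiv u) 1\<bar> + norm (W u) * norm (cls B)"
    using dpar_sqint(2)[OF w, of c] unfolding U(2)[symmetric] U(11)[symmetric] by (simp only: U(7))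
  show "norm u \<le> norm (wderiv u)" using fpar_norm[OF w, of c] U(2) u'(2) by simp
  show "\<bar>pt u 1\<bar> \<le> norm (wderiv u)" using fpar_bound[OF w, of 1 c] U(2) U(5)[of 1] by simp
qed

text \<open>The slope u'(1) is controlled by the norms of u and \<open>W u\<close>: u splits into c
  times the identity and \<open>fpar 0 w\<close>, whose norm is bounded by that of
  \<open>W u\<close>, and the identity has nonzero norm.\<close>

lemma slope_bound:
  obtains C where "0 \<le> C" "\<And>u. u \<in> K2 a \<Longrightarrow> \<bar>pt (wderiv u) 1\<bar> \<le> C * (norm u + norm (W u))"
proof -
  define i where "i = cls (\<lambda>x::real. x)"
  have si: "sqint (\<lambda>x. x)" by (intro sqint_continuous continuous_intros)
  have "i \<noteq> 0"
  proof
    assume "i = 0"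
    then have "AE x in I01. x = 0" using cls_eq_iff[OF si sqint_zero] by (simp add: i_def cls_zero)
    then obtain N where N: "negligible N" "\<And>x. x \<in> {0<..<1} - N \<Longrightarrow> x = (0::real)" by (rule AE_I01_D) blast
    then have "{0<..<1} \<subseteq> N" by force
    then have "negligible {0<..<(1::real)}" using N(1) negligible_subset by blast
    then show False using open_not_negligible[of "{0<..<(1::real)}"] by auto
  qed
  then have ni: "0 < norm i" by simp
  define C where "C = (1 + norm (cls B)) / norm i"
  have "\<bar>pt (wderiv u) 1\<bar> \<le> C * (norm u + norm (W u))" if u: "u \<in> K2 a" for u
  proof -
    obtain c w where u': "adm c w" "u = cls (fpar c w)" using K2_par[OF u] by blast
    have w: "sqint w" using u' by (auto simp: adm_def)
    note U = par_props[OF w u'(2)]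
    have fid: "fpar 1 (\<lambda>_. 0) x = x" if "0 \<le> x" for x using fpar_zero[OF that] by simp
    have fc: "fpar c w x = c * x + fpar 0 w x" if "0 \<le> x" "x \<le> 1" for x
      using fpar_lin[OF sqint_zero w that, of c 1 1 0] fid[OF that(1)] by simp
    have "u = cls (\<lambda>x. c * x + fpar 0 w x)"
      unfolding u'(2) by (rule sqint_spike(2)[of _ "{}"]) (use fc in \<open>auto intro!: sqint_add sqint_cmult si fpar_sqint w\<close>)
    also have "\<dots> = c *\<^sub>R i + cls (fpar 0 w)"
      unfolding i_def using cls_add[OF sqint_cmult[OF si] fpar_sqint[OF w]] cls_scaleR[OF si] by simp
    finally have "c *\<^sub>R i = u - cls (fpar 0 w)" by simp
    then have "\<bar>c\<bar> * norm i \<le> norm u + norm (cls (fpar 0 w))"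
      using norm_triangle_ineq4[of u "cls (fpar 0 w)"] by (metis norm_scaleR)
    also have "norm (cls (fpar 0 w)) \<le> norm (W u) * norm (cls B)"
      using fpar_norm[OF w, of 0] dpar_sqint(2)[OF w, of 0] U(11) by simp
    also have "norm u + norm (W u) * norm (cls B) \<le> (1 + norm (cls B)) * (norm u + norm (W u))"
      by (simp add: algebra_simps)
    finally have "\<bar>c\<bar> \<le> (1 + norm (cls B)) * (norm u + norm (W u)) / norm i" using ni by (simp add: le_divide_eq)
    then show ?thesis unfolding U(7) C_def by simp
  qed
  moreover have "0 \<le> C" using ni by (simp add: C_def)
  ultimately show ?thesis using that by blast
qed

lemma K2_bounds:
  obtains C where "0 \<le> C" "\<And>u. u \<in> K2 a \<Longrightarrow> \<bar>pt (wderiv u) 1\<bar> \<le> C * (norm u + norm (W u))"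
    "\<And>u. u \<in> K2 a \<Longrightarrow> \<bar>pt u 1\<bar> \<le> C * (norm u + norm (W u))"
    "\<And>u. u \<in> K2 a \<Longrightarrow> norm (wderiv u) \<le> C * (norm u + norm (W u))"
proof -
  obtain C where C: "0 \<le> C" "\<And>u. u \<in> K2 a \<Longrightarrow> \<bar>pt (wderiv u) 1\<bar> \<le> C * (norm u + norm (W u))"
    using slope_bound by blast
  define C' where "C' = C + norm (cls B)"
  have "C \<le> C'" by (simp add: C'_def)
  have wd: "norm (wderiv u) \<le> C' * (norm u + norm (W u))" if u: "u \<in> K2 a" for u
  proof -
    have "norm (W u) * norm (cls B) \<le> norm (cls B) * (norm u + norm (W u))" by (simp add: algebra_simps)
    moreover have "C' * (norm u + norm (W u)) = C * (norm u + norm (W u)) + norm (cls B) * (norm u + norm (W u))"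
      by (simp add: C'_def algebra_simps)
    ultimately show ?thesis using K2_norm_bounds(1)[OF u] C(2)[OF u] by linarith
  qed
  show ?thesis
  proof (rule that[of C'])
    show "0 \<le> C'" using C(1) by (simp add: C'_def)
    show "\<bar>pt (wderiv u) 1\<bar> \<le> C' * (norm u + norm (W u))" if u: "u \<in> K2 a" for u
      using C(2)[OF u] mult_right_mono[OF \<open>C \<le> C'\<close>, of "norm u + norm (W u)"] by simp
    show "\<bar>pt u 1\<bar> \<le> C' * (norm u + norm (W u))" if u: "u \<in> K2 a" for u
      using wd[OF u] K2_norm_bounds(3)[OF u] by linarith
  qed (rule wd)
qed

text \<open>Convergence of u and \<open>W u\<close> forces the slopes to converge by
  \<open>slope_bound\<close>. The limit slope and the limit of \<open>W u\<close> satisfy the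
  constraint of the weakly degenerate case, so they define an element of the space, and the sequence
  converges to it.\<close>

lemma K2_closed:
  assumes un: "\<And>n. un n \<in> K2 a" and lim: "un \<longlonglongrightarrow> u" "(\<lambda>n. W (un n)) \<longlonglongrightarrow> W0"
  shows "u \<in> K2 a" "W u = W0" "(\<lambda>n. pt (un n) 1) \<longlonglongrightarrow> pt u 1" "(\<lambda>n. pt (wderiv (un n)) 1) \<longlonglongrightarrow> pt (wderiv u) 1"
proof -
  obtain C where C: "0 \<le> C" "\<And>u. u \<in> K2 a \<Longrightarrow> \<bar>pt (wderiv u) 1\<bar> \<le> C * (norm u + norm (W u))"
    using slope_bound by blast
  define c where "c n = pt (wderiv (un n)) 1" for n
  have "Cauchy c"
  proof (rule metric_CauchyI)
    fix e :: real assume "0 < e"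
    \<comment> \<open>Two contributions of at most C d each; C + 1 is used because C may be
      0.\<close>
    define d where "d = (e / 2) / (C + 1)"
    have d: "0 < d" using \<open>0 < e\<close> C(1) by (simp add: d_def)
    have "Cauchy un" "Cauchy (\<lambda>n. W (un n))" using lim by (auto intro: LIMSEQ_imp_Cauchy)
    then obtain M1 M2 where M1: "\<And>m n. m \<ge> M1 \<Longrightarrow> n \<ge> M1 \<Longrightarrow> dist (un m) (un n) < d"
      and M2: "\<And>m n. m \<ge> M2 \<Longrightarrow> n \<ge> M2 \<Longrightarrow> dist (W (un m)) (W (un n)) < d"
      using metric_CauchyD[OF _ d] by metis
    have "dist (c m) (c n) < e" if "m \<ge> max M1 M2" "n \<ge> max M1 M2" for m n
    proof -
      have "dist (c m) (c n) = \<bar>pt (wderiv (un m - un n)) 1\<bar>"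
        using K2_diff(5)[OF un un, of m n] by (simp add: c_def dist_real_def)
      also have "\<dots> \<le> C * (norm (un m - un n) + norm (W (un m) - W (un n)))"
        using C(2)[OF K2_diff(1)[OF un un, of m n]] K2_diff(2)[OF un un, of m n] by simp
      also have "\<dots> \<le> C * (d + d)"
        using M1[of m n] M2[of m n] that C(1) by (intro mult_left_mono add_mono) (auto simp: dist_norm)
      also have "\<dots> < (C + 1) * (d + d)" using d by simp
      also have "\<dots> = (C + 1) * d + (C + 1) * d" by (rule distrib_left)
      also have "(C + 1) * d = e / 2"
      proof -
        have "C + 1 \<noteq> 0" using C(1) by simp
        from iffD1[OF nonzero_eq_divide_eq[OF this] d_def] show ?thesis by (simp only: mult.commute)
      qed
      also have "e / 2 + e / 2 = e" by simp
      finally show ?thesis .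
    qed
    then show "\<exists>M. \<forall>m\<ge>M. \<forall>n\<ge>M. dist (c m) (c n) < e" by blast
  qed
  then obtain c0 where c0: "c \<longlonglongrightarrow> c0" using Cauchy_convergent convergent_def by blast
  define w where "w = rep_l2 W0"
  have w: "sqint w" "cls w = W0" by (simp_all add: w_def sqint_rep_l2 cls_rep_l2)
  have adm: "adm c0 w"
    unfolding adm_def
  proof (intro conjI impI w(1))
    assume wd: "WD a"
    define wn where "wn n x = sqrt (a x) * D2 (un n) x" for n x
    have wn: "sqint (wn n)" "c n = integral {0..1} (k (wn n))" for n
      using K2_par(1)[OF un[of n]] wd by (auto simp: adm_def wn_def[abs_def] c_def)
    have "\<bar>c n - integral {0..1} (k w)\<bar> \<le> norm (W (un n) - W0) * norm (cls (cut 0))" for n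
    proof -
      have s: "sqint (\<lambda>x. 1 * wn n x + (-1) * w x)" by (intro sqint_add sqint_cmult wn w)
      have "c n - integral {0..1} (k w) = integral {0..1} (k (\<lambda>x. 1 * wn n x + (-1) * w x))"
        unfolding k_lin integral_lin[OF k_integrable_WD[OF wd wn(1)] k_integrable_WD[OF wd w(1)]] wn(2) by simp
      moreover have "W (un n) - W0 = cls (\<lambda>x. 1 * wn n x + (-1) * w x)"
        using cls_diff[OF wn(1) w(1)] w(2) by (simp add: sqrt_a_D2_def wn_def[abs_def])
      ultimately show ?thesis using k_integral_WD[OF wd s] by simp
    qed
    moreover have "(\<lambda>n. norm (W (un n) - W0) * norm (cls (cut 0))) \<longlonglongrightarrow> 0"
      using tendsto_mult_left_zero[OF tendsto_norm_zero[OF LIM_zero[OF lim(2)]]] .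
    ultimately have "(\<lambda>n. c n - integral {0..1} (k w)) \<longlonglongrightarrow> 0"
      by (intro Lim_null_comparison[of "\<lambda>n. c n - integral {0..1} (k w)" "\<lambda>n. norm (W (un n) - W0) * norm (cls (cut 0))"]) auto
    then have "c \<longlonglongrightarrow> integral {0..1} (k w)" by (rule LIM_zero_cancel)
    then show "c0 = integral {0..1} (k w)" using c0 LIMSEQ_unique by blast
  qed
  define v where "v = cls (fpar c0 w)"
  note V = par_props[OF w(1) v_def] and vK = par_in_K2(1)[OF adm v_def]
  have b: "norm (wderiv (un n - v)) \<le> \<bar>c n - c0\<bar> + norm (W (un n) - W0) * norm (cls B)" for n
    using K2_norm_bounds(1)[OF K2_diff(1)[OF un vK, of n]] K2_diff(2,5)[OF un vK, of n] V(7,11) w(2) by (simp add: c_def)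
  have "(\<lambda>n. \<bar>c n - c0\<bar> + norm (W (un n) - W0) * norm (cls B)) \<longlonglongrightarrow> \<bar>c0 - c0\<bar> + norm (W0 - W0) * norm (cls B)"
    by (intro tendsto_intros c0 lim)
  then have z: "(\<lambda>n. \<bar>c n - c0\<bar> + norm (W (un n) - W0) * norm (cls B)) \<longlonglongrightarrow> 0" by simp
  have "(\<lambda>n. un n - v) \<longlonglongrightarrow> 0"
  proof (rule Lim_null_comparison[OF always_eventually z], rule allI)
    show "norm (un n - v) \<le> \<bar>c n - c0\<bar> + norm (W (un n) - W0) * norm (cls B)" for n
      using K2_norm_bounds(2)[OF K2_diff(1)[OF un vK, of n]] b[of n] by linarith
  qed
  then have "un \<longlonglongrightarrow> v" by (rule LIM_zero_cancel)
  then have uv: "u = v" using lim(1) LIMSEQ_unique by blast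
  show "u \<in> K2 a" "W u = W0" using uv vK V(11) w(2) by auto
  show "(\<lambda>n. pt (wderiv (un n)) 1) \<longlonglongrightarrow> pt (wderiv u) 1" using c0 V(7) uv unfolding c_def by simp
  have "(\<lambda>n. pt (un n) 1 - pt v 1) \<longlonglongrightarrow> 0"
  proof (rule Lim_null_comparison[OF always_eventually z], rule allI)
    show "norm (pt (un n) 1 - pt v 1) \<le> \<bar>c n - c0\<bar> + norm (W (un n) - W0) * norm (cls B)" for n
      using K2_norm_bounds(3)[OF K2_diff(1)[OF un vK, of n]] K2_diff(4)[OF un vK, of n] b[of n] by simp
  qed
  then show "(\<lambda>n. pt (un n) 1) \<longlonglongrightarrow> pt u 1" unfolding uv by (rule LIM_zero_cancel)
qed

text \<open>The weights are parameters because two inner products are needed: the one of the state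
  space and the h-dependent one in the range condition.\<close>

definition emb :: "real \<Rightarrow> real \<Rightarrow> real \<Rightarrow> l2 \<Rightarrow> l2 \<times> l2 \<times> real \<times> real" where
  "emb c1 c2 c3 u = (u, c1 *\<^sub>R W u, c2 * pt u 1, c3 * pt (wderiv u) 1)"

lemma emb_lin:
  assumes "u \<in> K2 a" "v \<in> K2 a"
  shows "emb c1 c2 c3 (\<alpha> *\<^sub>R u + \<beta> *\<^sub>R v) = \<alpha> *\<^sub>R emb c1 c2 c3 u + \<beta> *\<^sub>R emb c1 c2 c3 v"
  using K2_lin[OF assms refl, of \<alpha> \<beta>] by (simp add: emb_def algebra_simps)

lemma subspace_emb: "subspace (emb c1 c2 c3 ` K2 a)"
proof (rule subspaceI)
  have "emb c1 c2 c3 0 = 0" using emb_lin[OF zero_in_K2 zero_in_K2, of c1 c2 c3 0 0] by simp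
  then show "0 \<in> emb c1 c2 c3 ` K2 a" using zero_in_K2 by (metis imageI)
next
  fix x y assume "x \<in> emb c1 c2 c3 ` K2 a" "y \<in> emb c1 c2 c3 ` K2 a"
  then obtain u v where uv: "u \<in> K2 a" "v \<in> K2 a" "x = emb c1 c2 c3 u" "y = emb c1 c2 c3 v" by blast
  then show "x + y \<in> emb c1 c2 c3 ` K2 a"
    using emb_lin[OF uv(1,2), of c1 c2 c3 1 1] uv(3,4) 
    by (intro image_eqI[OF _ subspace_add[OF subspace_K2 uv(1,2)]]) simp
next
  fix x and c :: real assume "x \<in> emb c1 c2 c3 ` K2 a"
  then obtain u where u: "u \<in> K2 a" "x = emb c1 c2 c3 u" by blast
  have "c *\<^sub>R x = emb c1 c2 c3 (c *\<^sub>R u)" using emb_lin[OF u(1,1), of c1 c2 c3 c 0] u(2) by simp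
  then show "c *\<^sub>R x \<in> emb c1 c2 c3 ` K2 a" by (rule image_eqI[OF _ subspace_scale[OF subspace_K2 u(1)]])
qed

text \<open>The first two components control the two boundary values, so only \<open>c1\<close> has
  to be nonzero; \<open>c2\<close> and \<open>c3\<close> do vanish in the state space when \<beta> =
  \<gamma> = 0.\<close>

lemma closed_emb:
  assumes "c1 \<noteq> 0" shows "closed (emb c1 c2 c3 ` K2 a)"
  unfolding closed_sequential_limits
proof (intro allI impI, elim conjE)
  fix x l assume x: "\<forall>n. x n \<in> emb c1 c2 c3 ` K2 a" and l: "x \<longlonglongrightarrow> l"
  have "\<forall>n. \<exists>v. v \<in> K2 a \<and> x n = emb c1 c2 c3 v" using x by (simp add: image_iff Bex_def)
  from choice[OF this] obtain u where "\<forall>n. u n \<in> K2 a \<and> x n = emb c1 c2 c3 (u n)" ..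
  then have u: "\<And>n. u n \<in> K2 a" "\<And>n. x n = emb c1 c2 c3 (u n)" by simp_all
  obtain l1 l2 l3 l4 where ll: "l = (l1, l2, l3, l4)" by (cases l)
  have x_eq: "x = (\<lambda>n. (u n, c1 *\<^sub>R W (u n), c2 * pt (u n) 1, c3 * pt (wderiv (u n)) 1))"
    using u(2) by (simp add: fun_eq_iff emb_def)
  have t: "u \<longlonglongrightarrow> l1" "(\<lambda>n. c1 *\<^sub>R W (u n)) \<longlonglongrightarrow> l2" "(\<lambda>n. c2 * pt (u n) 1) \<longlonglongrightarrow> l3"
    "(\<lambda>n. c3 * pt (wderiv (u n)) 1) \<longlonglongrightarrow> l4"
    using tendsto_fst[OF l] tendsto_fst[OF tendsto_snd[OF l]] tendsto_fst[OF tendsto_snd[OF tendsto_snd[OF l]]]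
      tendsto_snd[OF tendsto_snd[OF tendsto_snd[OF l]]]
    unfolding x_eq ll by simp_all
  have "(\<lambda>n. (1 / c1) *\<^sub>R (c1 *\<^sub>R W (u n))) \<longlonglongrightarrow> (1 / c1) *\<^sub>R l2" by (intro tendsto_intros t)
  then have W: "(\<lambda>n. W (u n)) \<longlonglongrightarrow> (1 / c1) *\<^sub>R l2" using assms by simp
  note K = K2_closed[OF u(1) t(1) W]
  have "c2 * pt l1 1 = l3"
    by (rule LIMSEQ_unique[OF tendsto_mult[OF tendsto_const K(3)] t(3)])
  moreover have "c3 * pt (wderiv l1) 1 = l4"
    by (rule LIMSEQ_unique[OF tendsto_mult[OF tendsto_const K(4)] t(4)])
  ultimately have "l = emb c1 c2 c3 l1" using K(2) assms by (simp add: emb_def ll)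
  then show "l \<in> emb c1 c2 c3 ` K2 a" by (rule image_eqI[OF _ K(1)])
qed

lemma inner_emb: "inner (emb c1 c2 c3 u) (emb c1 c2 c3 v) = 
    inner u v + c1\<^sup>2 * inner (W u) (W v) + c2\<^sup>2 * (pt u 1 * pt v 1) + c3\<^sup>2 * (pt (wderiv u) 1 * pt (wderiv v) 1)"
  by (simp add: emb_def power2_eq_square)

end

section \<open>Integration by parts against the flux\<close>

lemma tendsto_inverse_Suc: "(\<lambda>n. 1 / real (Suc n)) \<longlonglongrightarrow> 0"
  using LIMSEQ_inverse_real_of_nat by (simp add: inverse_eq_divide)

lemma continuous_on_tendsto_0:
  fixes f :: "real \<Rightarrow> real"
  assumes "continuous_on {0..1} f" shows "(\<lambda>n. f (1 / real (Suc n))) \<longlonglongrightarrow> f 0"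
  by (rule continuous_on_tendsto_compose[OF assms tendsto_inverse_Suc]) (auto simp: divide_le_eq)

lemma integral_tail_tendsto:
  fixes h :: "real \<Rightarrow> real"
  assumes h: "h absolutely_integrable_on {0..1}"
  shows "(\<lambda>n. integral {1 / real (Suc n)..1} h) \<longlonglongrightarrow> integral {0..1} h"
proof -
  have e: "0 \<le> 1 / real (Suc n)" "1 / real (Suc n) \<le> 1" for n by (auto simp: divide_le_eq)
  have "(\<lambda>n. 0 + integral {0..1 / real (Suc n)} h) \<longlonglongrightarrow> 0 + integral {0..0} h"
    by (rule continuous_on_tendsto_0[OF indefinite_integral_continuous_on[OF h]])
  then have "(\<lambda>n. (0 + integral {0..1} h) - (0 + integral {0..1 / real (Suc n)} h)) \<longlonglongrightarrow> (0 + integral {0..1} h) - (0 + integral {0..0} h)"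
    by (rule tendsto_diff[OF tendsto_const])
  then show ?thesis unfolding indefinite_integral_diff[OF h e(1) e(2) order_refl] by simp
qed

context degenerate_coefficient
begin

text \<open>\<open>G\<close> will be the flux a u'', so the quotient is sqrt a u''. If
  \<open>a\<close> is weakly degenerate, \<open>G\<close> is bounded and 1 / sqrt a is square
  integrable. If it is strongly degenerate, G(0) = 0 gives |G(x)| <= M x, and sqrt a is at least
  sqrt m x.\<close>

lemma flux_sqint:
  assumes G: "\<And>x y. 0 \<le> x \<Longrightarrow> x \<le> y \<Longrightarrow> y \<le> 1 \<Longrightarrow> G y - G x = integral {x..y} G1"
    and G1: "continuous_on {0..1} G1" and G0: "SD a \<Longrightarrow> G 0 = 0"
  shows "sqint (\<lambda>x. G x / sqrt (a x))" "\<exists>M. 0 \<le> M \<and> (\<forall>x\<in>{0..1}. \<bar>G x - G 0\<bar> \<le> M * x)"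
proof -
  have G1a: "G1 absolutely_integrable_on {0..1}" by (rule absolutely_integrable_continuous_real[OF G1])
  have cont: "continuous_on {0..1} G"
    by (rule abs_cont_on_imp_continuous[OF abs_cont_on_integral[OF G1a G]])
  obtain M where M: "\<forall>x\<in>{0..1}. \<bar>G1 x\<bar> \<le> M"
    using compact_imp_bounded[OF compact_continuous_image[OF G1 compact_Icc]] by (auto simp: bounded_iff)
  have M0: "0 \<le> M" using M by force
  have lip: "\<bar>G x - G 0\<bar> \<le> M * x" if x: "x \<in> {0..1}" for x
  proof -
    have gi: "G1 integrable_on {0..x}"
      by (rule integrable_continuous_real[OF continuous_on_subset[OF G1]]) (use x in auto)
    have "\<bar>integral {0..x} G1\<bar> \<le> integral {0..x} (\<lambda>_. M)"
      using integral_norm_bound_integral[OF gi, of "\<lambda>_. M"] M x by auto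
    then show ?thesis using G[of 0 x] x by (simp add: mult.commute)
  qed
  then show "\<exists>M. 0 \<le> M \<and> (\<forall>x\<in>{0..1}. \<bar>G x - G 0\<bar> \<le> M * x)" using M0 by blast
  have meas: "(\<lambda>x. G x / sqrt (a x)) \<in> borel_measurable I01"
    by (intro borel_measurable_divide measurable_compose[OF measurable_a borel_measurable_sqrt]
        continuous_imp_measurable_on_sets_lebesgue continuous_on_subset[OF cont]) auto
  show "sqint (\<lambda>x. G x / sqrt (a x))"
  proof (cases "WD a")
    case True
    obtain M' where M': "\<forall>x\<in>{0..1}. \<bar>G x\<bar> \<le> M'"
      using compact_imp_bounded[OF compact_continuous_image[OF cont compact_Icc]] by (auto simp: bounded_iff)
    show ?thesis
    proof (rule sqint_bound[OF sqint_cmult[OF sqint_cut_0[OF True], of M'] meas], rule AE_I01_I[of "{}"])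
      fix x :: real assume "x \<in> {0<..<1} - {}"
      then have x: "0 < x" "x < 1" by auto
      have "\<bar>G x\<bar> \<le> M'" using M' x by simp
      then have "\<bar>G x\<bar> \<le> \<bar>M'\<bar>" by linarith
      then have "\<bar>G x\<bar> * (1 / sqrt (a x)) \<le> \<bar>M'\<bar> * (1 / sqrt (a x))"
        using x pos[of x] by (intro mult_right_mono) auto
      then show "\<bar>G x / sqrt (a x)\<bar> \<le> \<bar>M' * cut 0 x\<bar>"
        using x pos[of x] by (simp add: cut_def abs_mult)
    qed simp
  next
    case False
    then have "SD a" using WD_SD by simp
    then have G00: "G 0 = 0" using G0 by simp
    have sc: "sqint (\<lambda>_. M / sqrt m)" by (intro sqint_continuous continuous_intros)
    show ?thesis
    proof (rule sqint_bound[OF sc meas], rule AE_I01_I[of "{}"])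
      fix x :: real assume "x \<in> {0<..<1} - {}"
      then have x: "0 < x" "x < 1" by auto
      \<comment> \<open>Here p < 2 is used: on (0, 1) the lower bound m x^p exceeds m x^2.\<close>
      have "x powr 2 \<le> x powr p" using x p by (intro powr_mono') auto
      then have "m * x\<^sup>2 \<le> m * x powr p" using x m by (intro mult_left_mono) (auto simp: powr_numeral)
      then have "m * x\<^sup>2 \<le> a x" using lower[of x] x by simp
      then have "sqrt m * x \<le> sqrt (a x)" using x m by (intro real_le_rsqrt) (simp add: power_mult_distrib)
      then have "M * x * sqrt m \<le> M * sqrt (a x)" using M0 by (simp add: mult.assoc mult.commute[of x] mult_left_mono)
      then have "M * x / sqrt (a x) \<le> M / sqrt m" using m pos[of x] x by (simp add: field_simps)
      moreover have "\<bar>G x\<bar> / sqrt (a x) \<le> M * x / sqrt (a x)"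
        using lip[of x] x pos[of x] G00 by (intro divide_right_mono) auto
      ultimately show "\<bar>G x / sqrt (a x)\<bar> \<le> \<bar>M / sqrt m\<bar>" using pos[of x] x M0 m by (simp add: abs_divide)
    qed simp
  qed
qed

text \<open>The product x B(x) is a multiple of x^((3 - p) / 2), a positive power.\<close>

lemma B_times_id: "(\<lambda>n. 1 / real (Suc n) * B (1 / real (Suc n))) \<longlonglongrightarrow> 0"
proof -
  define q where "q = (3 - p) / 2"
  have q: "0 < q" using p by (simp add: q_def)
  have "(\<lambda>n. (1 / real (Suc n)) powr q) \<longlonglongrightarrow> 0 powr q"
    by (rule tendsto_powr2[OF tendsto_inverse_Suc tendsto_const]) (use q in auto)
  then have "(\<lambda>n. sqrt (1 / (m * (p - 1))) * (1 / real (Suc n)) powr q) \<longlonglongrightarrow> sqrt (1 / (m * (p - 1))) * 0"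
    by (intro tendsto_mult tendsto_const) simp
  moreover have "x * B x = sqrt (1 / (m * (p - 1))) * x powr q" if "0 < x" for x
  proof -
    have "x * x powr ((1 - p) / 2) = x powr (1 + (1 - p) / 2)" using that by (simp add: powr_add)
    also have "1 + (1 - p) / 2 = q" by (simp add: q_def field_simps)
    finally show ?thesis by (simp add: B_def)
  qed
  then have "1 / real (Suc n) * B (1 / real (Suc n)) = sqrt (1 / (m * (p - 1))) * (1 / real (Suc n)) powr q" for n
    by (metis divide_pos_pos of_nat_0_less_iff zero_less_Suc zero_less_one)
  ultimately show ?thesis by (simp only: mult_zero_right)
qed

text \<open>The boundary terms at \<open>0\<close> vanish: \<open>\<phi>(0) = 0\<close>, and either \<open>\<phi>'(0) = 0\<close> or \<open>G(x) = O(x)\<close>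
  while \<open>\<phi>'(x) = O(B x)\<close> and \<open>x B x \<rightarrow> 0\<close>, as \<open>p < 2\<close>.\<close>
lemma flux_integration_by_parts:
  assumes G: "\<And>x y. 0 \<le> x \<Longrightarrow> x \<le> y \<Longrightarrow> y \<le> 1 \<Longrightarrow> G y - G x = integral {x..y} G1"
    and G1: "\<And>x y. 0 \<le> x \<Longrightarrow> x \<le> y \<Longrightarrow> y \<le> 1 \<Longrightarrow> G1 y - G1 x = integral {x..y} G2"
    and G2: "sqint G2" and G0: "SD a \<Longrightarrow> G 0 = 0"
    and \<phi>: "\<phi> \<in> K2 a"
  shows "inner (cls (\<lambda>x. G x / sqrt (a x))) (W \<phi>) = G 1 * pt (wderiv \<phi>) 1 - G1 1 * pt \<phi> 1 + inner (cls G2) \<phi>"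
proof -
  note G2a = sqint_abs_integrable[OF G2]
  have G1c: "continuous_on {0..1} G1"
    by (rule abs_cont_on_imp_continuous[OF abs_cont_on_integral[OF G2a G1]])
  have G1a: "G1 absolutely_integrable_on {0..1}" by (rule absolutely_integrable_continuous_real[OF G1c])
  have Gc: "continuous_on {0..1} G"
    by (rule abs_cont_on_imp_continuous[OF abs_cont_on_integral[OF G1a G]])
  have fs: "sqint (\<lambda>x. G x / sqrt (a x))" by (rule flux_sqint(1)[OF G G1c G0])
  obtain c w where \<phi>': "adm c w" "\<phi> = cls (fpar c w)" using K2_par[OF \<phi>] by blast
  have w: "sqint w" using \<phi>' by (auto simp: adm_def)
  note P = par_props[OF w \<phi>'(2)]
  define f g where "f = fpar c w" and "g = dpar c w"
  have sf: "sqint f" and sg: "sqint g" using fpar_sqint[OF w] dpar_sqint(1)[OF w] by (auto simp: f_def g_def)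
  have fc: "continuous_on {0..1} f" using fpar_continuous[OF w] by (simp add: f_def)
  define e where "e n = 1 / real (Suc n)" for n
  have e: "0 < e n" "e n \<le> 1" for n by (auto simp: e_def divide_le_eq)
  \<comment> \<open>Two integrations by parts away from 0: subtracting the product rule for
    \<open>G1\<close> and f from the one for \<open>G\<close> and g cancels the mixed term G1
    g.\<close>
  have step: "integral {e n..1} (\<lambda>x. G x * k w x) = G 1 * g 1 - G (e n) * g (e n) - (G1 1 * f 1 - G1 (e n) * f (e n)) + integral {e n..1} (\<lambda>x. G2 x * f x)" for n
  proof -
    have i1: "((\<lambda>x. G1 x * g x + G x * k w x) has_integral (G 1 * g 1 - G (e n) * g (e n))) {e n..1}"
    proof (rule integration_by_parts_indefinite)
      show "G1 absolutely_integrable_on {e n..1}" by (rule abs_integrable_subinterval[OF G1a]) (use e[of n] in auto)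
      show "k w absolutely_integrable_on {e n..1}" by (rule k_integrable[OF w e(1)])
      show "G y - G x = integral {x..y} G1" if "e n \<le> x" "x \<le> y" "y \<le> 1" for x y using G[of x y] that e[of n] by simp
      show "g y - g x = integral {x..y} (k w)" if "e n \<le> x" "x \<le> y" "y \<le> 1" for x y
        unfolding g_def using dpar_diff[OF w, of x y] that e[of n] by simp
    qed (rule e)
    have i2: "((\<lambda>x. G2 x * f x + G1 x * g x) has_integral (G1 1 * f 1 - G1 (e n) * f (e n))) {e n..1}"
    proof (rule integration_by_parts_indefinite)
      show "G2 absolutely_integrable_on {e n..1}" by (rule abs_integrable_subinterval[OF G2a]) (use e[of n] in auto)
      show "g absolutely_integrable_on {e n..1}" by (rule abs_integrable_subinterval[OF sqint_abs_integrable[OF sg]]) (use e[of n] in auto)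
      show "G1 y - G1 x = integral {x..y} G2" if "e n \<le> x" "x \<le> y" "y \<le> 1" for x y using G1[of x y] that e[of n] by simp
      show "f y - f x = integral {x..y} g" if "e n \<le> x" "x \<le> y" "y \<le> 1" for x y
        unfolding f_def g_def using fpar_diff[OF w, of x y] that e[of n] by simp
    qed (rule e)
    have "(\<lambda>x. G2 x * f x) absolutely_integrable_on {0..1}"
      using sqint_mult[OF G2 sf] integrable_I01_iff by blast
    then have "(\<lambda>x. G2 x * f x) absolutely_integrable_on {e n..1}"
      by (rule abs_integrable_subinterval) (use e[of n] in auto)
    then have i3: "((\<lambda>x. G2 x * f x) has_integral integral {e n..1} (\<lambda>x. G2 x * f x)) {e n..1}"
      by (intro integrable_integral abs_integrable_imp_integrable)
    from has_integral_add[OF has_integral_diff[OF i1 i2] i3]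
    show ?thesis by (intro integral_unique) simp
  qed
  have Gk: "(\<lambda>x. G x * k w x) = (\<lambda>x. (G x / sqrt (a x)) * w x)" by (simp add: k_def)
  have Gka: "(\<lambda>x. G x * k w x) absolutely_integrable_on {0..1}"
    unfolding Gk using sqint_mult[OF fs w] integrable_I01_iff by blast
  have G2f: "(\<lambda>x. G2 x * f x) absolutely_integrable_on {0..1}"
    using sqint_mult[OF G2 sf] integrable_I01_iff by blast
  have Gg0: "(\<lambda>n. G (e n) * g (e n)) \<longlonglongrightarrow> 0"
  proof (cases "WD a")
    case True
    have "continuous_on {0..1} g" unfolding g_def by (rule abs_cont_on_imp_continuous[OF dpar_abs_cont_WD[OF True w]])
    then have "(\<lambda>n. G (e n) * g (e n)) \<longlonglongrightarrow> G 0 * g 0"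
      unfolding e_def by (intro tendsto_mult continuous_on_tendsto_0 Gc)
    moreover have "g 0 = 0" using \<phi>'(1) True by (simp add: g_def dpar_def adm_def)
    ultimately show ?thesis by simp
  next
    case False
    then have "G 0 = 0" using WD_SD G0 by simp
    then obtain M where M: "0 \<le> M" "\<forall>x\<in>{0..1}. \<bar>G x\<bar> \<le> M * x" using flux_sqint(2)[OF G G1c \<open>SD a \<Longrightarrow> G 0 = 0\<close>] by auto
    have "norm (G (e n) * g (e n)) \<le> M * (\<bar>c\<bar> * e n + norm (cls w) * (e n * B (e n)))" for n
    proof -
      have "norm (G (e n) * g (e n)) \<le> (M * e n) * (\<bar>c\<bar> + norm (cls w) * B (e n))"
        unfolding norm_mult g_def using M dpar_bound[OF w e(1)[of n] e(2)[of n], of c] e[of n] by (intro mult_mono) (auto simp: less_imp_le)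
      then show ?thesis by (simp add: algebra_simps)
    qed
    moreover have "(\<lambda>n. M * (\<bar>c\<bar> * e n + norm (cls w) * (e n * B (e n)))) \<longlonglongrightarrow> M * (\<bar>c\<bar> * 0 + norm (cls w) * 0)"
      unfolding e_def by (intro tendsto_intros tendsto_inverse_Suc B_times_id)
    ultimately show ?thesis
      by (intro Lim_null_comparison[of "\<lambda>n. G (e n) * g (e n)" "\<lambda>n. M * (\<bar>c\<bar> * e n + norm (cls w) * (e n * B (e n)))"]) auto
  qed
  have f0: "f 0 = 0" by (simp add: f_def fpar_def)
  have "(\<lambda>n. G1 (e n) * f (e n)) \<longlonglongrightarrow> G1 0 * f 0"
    unfolding e_def by (intro tendsto_mult continuous_on_tendsto_0 G1c fc)
  then have Gf0: "(\<lambda>n. G1 (e n) * f (e n)) \<longlonglongrightarrow> 0" using f0 by simp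
  have "(\<lambda>n. G 1 * g 1 - G (e n) * g (e n) - (G1 1 * f 1 - G1 (e n) * f (e n)) + integral {e n..1} (\<lambda>x. G2 x * f x))
      \<longlonglongrightarrow> G 1 * g 1 - 0 - (G1 1 * f 1 - 0) + integral {0..1} (\<lambda>x. G2 x * f x)"
    by (intro tendsto_add tendsto_diff tendsto_const Gg0 Gf0) (unfold e_def, rule integral_tail_tendsto[OF G2f])
  then have "(\<lambda>n. integral {e n..1} (\<lambda>x. G x * k w x)) \<longlonglongrightarrow> G 1 * g 1 - G1 1 * f 1 + integral {0..1} (\<lambda>x. G2 x * f x)"
    unfolding step by simp
  moreover have "(\<lambda>n. integral {e n..1} (\<lambda>x. G x * k w x)) \<longlonglongrightarrow> integral {0..1} (\<lambda>x. G x * k w x)"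
    unfolding e_def by (rule integral_tail_tendsto[OF Gka])
  ultimately have "integral {0..1} (\<lambda>x. G x * k w x) = G 1 * g 1 - G1 1 * f 1 + integral {0..1} (\<lambda>x. G2 x * f x)"
    using LIMSEQ_unique by blast
  moreover have "integral {0..1} (\<lambda>x. G x * k w x) = inner (cls (\<lambda>x. G x / sqrt (a x))) (W \<phi>)"
    unfolding Gk P(11) using inner_cls_integral[OF fs w] by simp
  moreover have "integral {0..1} (\<lambda>x. G2 x * f x) = inner (cls G2) \<phi>"
    using inner_cls_integral[OF G2 sf] \<phi>'(2) by (simp add: f_def)
  moreover have "g 1 = pt (wderiv \<phi>) 1" using P(7) by (simp add: g_def dpar_def)
  moreover have "f 1 = pt \<phi> 1" using P(5)[of 1] by (simp add: f_def)
  ultimately show ?thesis by simp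
qed

section \<open>The operator and its weak form\<close>

lemma H2_representative:
  assumes "U \<in> H2"
  obtains G G1 G2 where "repr U G" "sqint G2" "cls G2 = wderiv (wderiv U)"
    "\<And>x y. 0 \<le> x \<Longrightarrow> x \<le> y \<Longrightarrow> y \<le> 1 \<Longrightarrow> G y - G x = integral {x..y} G1"
    "\<And>x y. 0 \<le> x \<Longrightarrow> x \<le> y \<Longrightarrow> y \<le> 1 \<Longrightarrow> G1 y - G1 x = integral {x..y} G2"
    "pt U 0 = G 0" "pt U 1 = G 1" "pt (wderiv U) 1 = G1 1"
proof -
  have H: "is_wderiv U (wderiv U)" "is_wderiv (wderiv U) (wderiv (wderiv U))"
    using assms is_wderiv_wderiv by (auto simp: H2_def)
  define G2 where "G2 = rep_l2 (wderiv (wderiv U))"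
  have G2: "sqint G2" "cls G2 = wderiv (wderiv U)" by (simp_all add: G2_def sqint_rep_l2 cls_rep_l2)
  have "is_wderiv (wderiv U) (cls G2)" using H(2) G2(2) by simp
  then obtain c1 where r1: "repr (wderiv U) (\<lambda>x. c1 + integral {0..x} G2)"
    by (rule is_wderiv_representative[OF _ G2(1)])
  define G1 where "G1 x = c1 + integral {0..x} G2" for x
  have G1d: "G1 y - G1 x = integral {x..y} G2" if "0 \<le> x" "x \<le> y" "y \<le> 1" for x y
    unfolding G1_def by (rule indefinite_integral_diff[OF sqint_abs_integrable[OF G2(1)] that])
  have r1': "repr (wderiv U) G1" using r1 by (simp add: G1_def[abs_def])
  have G1s: "sqint G1" "cls G1 = wderiv U" using r1' by (auto simp: repr_def)
  have G1c: "continuous_on {0..1} G1"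
    by (rule abs_cont_on_imp_continuous[OF abs_cont_on_integral[OF sqint_abs_integrable[OF G2(1)] G1d]])
  have "is_wderiv U (cls G1)" using H(1) G1s(2) by simp
  then obtain c0 where r0: "repr U (\<lambda>x. c0 + integral {0..x} G1)"
    by (rule is_wderiv_representative[OF _ G1s(1)])
  define G where "G x = c0 + integral {0..x} G1" for x
  have Gd: "G y - G x = integral {x..y} G1" if "0 \<le> x" "x \<le> y" "y \<le> 1" for x y
    unfolding G_def by (rule indefinite_integral_diff[OF sqint_abs_integrable[OF G1s(1)] that])
  have r0': "repr U G" using r0 by (simp add: G_def[abs_def])
  have Gc: "continuous_on {0..1} G"
    by (rule abs_cont_on_imp_continuous[OF abs_cont_on_integral[OF sqint_abs_integrable[OF G1s(1)] Gd]])
  show ?thesis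
    by (rule that[OF r0' G2 Gd G1d]) 
      (auto intro: pt_eq_continuous_on[OF r0' Gc] pt_eq_continuous_on[OF r1' G1c])
qed

lemma weak_form:
  assumes uv: "(u, v) \<in> dom_calB a \<beta> \<gamma>" and \<phi>: "\<phi> \<in> K2 a"
  shows "inner (op_B a u) \<phi> = inner (W u) (W \<phi>) + (\<beta> * pt u 1 + pt v 1) * pt \<phi> 1 + 
    (\<gamma> * pt (wderiv u) 1 + pt (wderiv v) 1) * pt (wderiv \<phi>) 1"
proof -
  have u: "u \<in> K2 a" "a_D2 a u \<in> H2" "SD a \<Longrightarrow> pt (a_D2 a u) 0 = 0"
    and bc: "\<beta> * pt u 1 - pt (wderiv (a_D2 a u)) 1 + pt v 1 = 0" "\<gamma> * pt (wderiv u) 1 + pt (a_D2 a u) 1 + pt (wderiv v) 1 = 0"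
    using uv by (auto simp: dom_calB_def dom_B_def)
  obtain G G1 G2 where rG: "repr (a_D2 a u) G" and G2: "sqint G2" "cls G2 = op_B a u"
    and G: "\<And>x y. 0 \<le> x \<Longrightarrow> x \<le> y \<Longrightarrow> y \<le> 1 \<Longrightarrow> G y - G x = integral {x..y} G1"
    and G1: "\<And>x y. 0 \<le> x \<Longrightarrow> x \<le> y \<Longrightarrow> y \<le> 1 \<Longrightarrow> G1 y - G1 x = integral {x..y} G2"
    and pts: "pt (a_D2 a u) 0 = G 0" "pt (a_D2 a u) 1 = G 1" "pt (wderiv (a_D2 a u)) 1 = G1 1"
    using H2_representative[OF u(2)] unfolding op_B_def by metis
  have G0: "SD a \<Longrightarrow> G 0 = 0" using u(3) pts(1) by simp
  have ibp: "inner (cls (\<lambda>x. G x / sqrt (a x))) (W \<phi>) = G 1 * pt (wderiv \<phi>) 1 - G1 1 * pt \<phi> 1 + inner (cls G2) \<phi>"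
    by (rule flux_integration_by_parts[OF G G1 G2(1) G0 \<phi>])
  have s: "sqint (\<lambda>x. sqrt (a x) * D2 u x)" using K2_par(1)[OF u(1)] by (simp add: adm_def)
  have "AE x in I01. a x * D2 u x = G x"
  proof -
    \<comment> \<open>\<open>a_D2\<close> is the class of this function, and classes can be compared
      only for square integrable functions; sqrt a is bounded, and the rest is given.\<close>
    have "sqint (\<lambda>x. a x * D2 u x)"
    proof -
      obtain M where M: "\<forall>x\<in>{0..1}. \<bar>sqrt (a x)\<bar> \<le> M"
        using compact_imp_bounded[OF compact_continuous_image[OF continuous_on_real_sqrt[OF cont] compact_Icc]] 
        by (auto simp: bounded_iff)
      show ?thesis
      proof (rule sqint_bound)
        show "sqint (\<lambda>x. M * (sqrt (a x) * D2 u x))" by (rule sqint_cmult[OF s])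
        have eq: "a x * D2 u x = sqrt (a x) * (sqrt (a x) * D2 u x)" if "x \<in> {0<..<1}" for x
          using nonneg_0[of x] that by (simp flip: mult.assoc)
        have "(\<lambda>x. sqrt (a x) * (sqrt (a x) * D2 u x)) \<in> borel_measurable I01"
          by (intro borel_measurable_times measurable_compose[OF measurable_a borel_measurable_sqrt] sqint_measurable[OF s])
        then show "(\<lambda>x. a x * D2 u x) \<in> borel_measurable I01"
          by (rule measurable_cong[THEN iffD1, rotated]) (simp add: eq)
        show "AE x in I01. \<bar>a x * D2 u x\<bar> \<le> \<bar>M * (sqrt (a x) * D2 u x)\<bar>"
        proof (rule AE_I01_I[of "{}"])
          fix x :: real assume x: "x \<in> {0<..<1} - {}"
          have "\<bar>sqrt (a x)\<bar> \<le> M" using M x by simp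
          then have "\<bar>sqrt (a x)\<bar> \<le> \<bar>M\<bar>" by linarith
          then have "\<bar>sqrt (a x)\<bar> * \<bar>sqrt (a x) * D2 u x\<bar> \<le> \<bar>M\<bar> * \<bar>sqrt (a x) * D2 u x\<bar>" by (intro mult_right_mono) auto
          then show "\<bar>a x * D2 u x\<bar> \<le> \<bar>M * (sqrt (a x) * D2 u x)\<bar>" unfolding abs_mult[symmetric] using eq[of x] x by (simp only: Diff_empty)
        qed simp
      qed
    qed
    then show ?thesis using rG cls_eq_iff by (auto simp: repr_def a_D2_def)
  qed
  then obtain N where N: "negligible N" "\<And>x. x \<in> {0<..<1} - N \<Longrightarrow> a x * D2 u x = G x" by (rule AE_I01_D) blast
  have eqW: "G x / sqrt (a x) = sqrt (a x) * D2 u x" if x: "x \<in> {0<..<1} - N" for x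
  proof -
    have "0 < a x" using pos[of x] x by simp
    then show ?thesis using N(2)[OF x] by (simp add: field_simps)
  qed
  have "cls (\<lambda>x. G x / sqrt (a x)) = W u" unfolding sqrt_a_D2_def by (rule sqint_spike(2)[OF s N(1) eqW])
  then have "inner (W u) (W \<phi>) = G 1 * pt (wderiv \<phi>) 1 - G1 1 * pt \<phi> 1 + inner (op_B a u) \<phi>"
    using ibp G2(2) by simp
  moreover have "G1 1 = \<beta> * pt u 1 + pt v 1" "G 1 = - (\<gamma> * pt (wderiv u) 1 + pt (wderiv v) 1)" using bc pts by linarith+
  ultimately show ?thesis by (simp add: algebra_simps)
qed

text \<open>Integrate z twice to a candidate flux \<open>G\<close>, with constants chosen from the
  boundary data. Integration by parts gives G / sqrt a the same weak form as \<open>W u\<close>, so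
  their difference is orthogonal to every \<open>W \<phi>\<close> and vanishes. Thus a u'' is
  \<open>G\<close>, which has all the properties asked of the domain.\<close>

lemma weak_form_imp_dom_calB:
  assumes u: "u \<in> K2 a" and v: "v \<in> K2 a"
    and weak: "\<And>\<phi>. \<phi> \<in> K2 a \<Longrightarrow> inner z \<phi> = inner (W u) (W \<phi>) + (\<beta> * pt u 1 + pt v 1) * pt \<phi> 1 + 
      (\<gamma> * pt (wderiv u) 1 + pt (wderiv v) 1) * pt (wderiv \<phi>) 1"
  shows "(u, v) \<in> dom_calB a \<beta> \<gamma>" "op_B a u = z"
proof -
  define P Q where "P = \<gamma> * pt (wderiv u) 1 + pt (wderiv v) 1" and "Q = \<beta> * pt u 1 + pt v 1"
  define G2 where "G2 = rep_l2 z"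
  have G2: "sqint G2" "cls G2 = z" by (simp_all add: G2_def sqint_rep_l2 cls_rep_l2)
  note G2a = sqint_abs_integrable[OF G2(1)]
  define q1 where "q1 = Q - integral {0..1} G2"
  define G1 where "G1 x = q1 + integral {0..x} G2" for x
  have G1: "G1 y - G1 x = integral {x..y} G2" if "0 \<le> x" "x \<le> y" "y \<le> 1" for x y
    unfolding G1_def by (rule indefinite_integral_diff[OF G2a that])
  have G11: "G1 1 = Q" by (simp add: G1_def q1_def)
  have G1c: "continuous_on {0..1} G1"
    by (rule abs_cont_on_imp_continuous[OF abs_cont_on_integral[OF G2a G1]])
  have G1a: "G1 absolutely_integrable_on {0..1}" by (rule absolutely_integrable_continuous_real[OF G1c])
  \<comment> \<open>One constant is left and two conditions compete for it. In the strongly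
    degenerate case it goes to G(0) = 0, and the value at 1 must come from the weak form; otherwise
    it goes to the value at 1.\<close>
  define q0 where "q0 = (if SD a then 0 else - P - integral {0..1} G1)"
  define G where "G x = q0 + integral {0..x} G1" for x
  have G: "G y - G x = integral {x..y} G1" if "0 \<le> x" "x \<le> y" "y \<le> 1" for x y
    unfolding G_def by (rule indefinite_integral_diff[OF G1a that])
  have G0: "G 0 = 0" if "SD a" using that by (simp add: G_def q0_def)
  have Gc: "continuous_on {0..1} G"
    by (rule abs_cont_on_imp_continuous[OF abs_cont_on_integral[OF G1a G]])
  have Gs: "sqint G" and G1s: "sqint G1" by (rule sqint_continuous[OF Gc], rule sqint_continuous[OF G1c])
  have ibp: "inner (cls (\<lambda>x. G x / sqrt (a x))) (W \<phi>) = G 1 * pt (wderiv \<phi>) 1 - G1 1 * pt \<phi> 1 + inner (cls G2) \<phi>"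
    if "\<phi> \<in> K2 a" for \<phi> by (rule flux_integration_by_parts[OF G G1 G2(1) G0 that])
  have fs: "sqint (\<lambda>x. G x / sqrt (a x))" by (rule flux_sqint(1)[OF G G1c G0])
  \<comment> \<open>In the strongly degenerate case the identity function is an admissible test
    function with W = 0 and value and slope 1 at 1; it yields the remaining boundary
    condition.\<close>
  have G_1: "G 1 = - P"
  proof (cases "SD a")
    case True
    then have nWD: "\<not> WD a" using WD_SD by simp
    define i where "i = cls (fpar 1 (\<lambda>_. 0))"
    have adm: "adm 1 (\<lambda>_. 0)" using nWD by (simp add: adm_def sqint_zero)
    have iK: "i \<in> K2 a" by (rule par_in_K2(1)[OF adm i_def])
    note I = par_props[OF sqint_zero i_def]
    have "W i = 0" "pt (wderiv i) 1 = 1" "pt i 1 = 1" using I(7,11) I(5)[of 1] fpar_zero[of 1 1] by (simp_all add: cls_zero)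
    then show ?thesis using ibp[OF iK] weak[OF iK] G11 G2(2) by (simp add: P_def Q_def)
  next
    case False
    then show ?thesis by (simp add: G_def q0_def)
  qed
  have orth: "inner (W u - cls (\<lambda>x. G x / sqrt (a x))) (W \<phi>) = 0" if "\<phi> \<in> K2 a" for \<phi>
    using ibp[OF that] weak[OF that] G11 G_1 G2(2) by (simp add: inner_diff_left P_def Q_def algebra_simps)
  \<comment> \<open>The functions \<open>W \<phi>\<close> exhaust L2: the slope c = integral of
    \<open>k w\<close> makes any w admissible. So the difference itself may be used for
    testing.\<close>
  have Wu: "W u = cls (\<lambda>x. G x / sqrt (a x))"
  proof -
    define y where "y = W u - cls (\<lambda>x. G x / sqrt (a x))"
    obtain w where w: "sqint w" "y = cls w" by (rule l2_cases)
    define c where "c = integral {0..1} (k w)"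
    have adm: "adm c w" using w(1) by (simp add: adm_def c_def)
    have "W (cls (fpar c w)) = y" using par_props(11)[OF w(1) refl] w(2) by simp
    then have "inner y y = 0" using orth[OF par_in_K2(1)[OF adm refl]] by (simp add: y_def)
    then show ?thesis by (simp add: y_def)
  qed
  have s: "sqint (\<lambda>x. sqrt (a x) * D2 u x)" using K2_par(1)[OF u] by (simp add: adm_def)
  then have "AE x in I01. sqrt (a x) * D2 u x = G x / sqrt (a x)"
    using Wu cls_eq_iff[OF s fs] by (simp add: sqrt_a_D2_def)
  then obtain N where N: "negligible N" "\<And>x. x \<in> {0<..<1} - N \<Longrightarrow> sqrt (a x) * D2 u x = G x / sqrt (a x)" 
    by (rule AE_I01_D) blast
  have "a x * D2 u x = G x" if x: "x \<in> {0<..<1} - N" for x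
  proof -
    have ax: "0 < a x" using pos[of x] x by simp
    have "a x * D2 u x = sqrt (a x) * (sqrt (a x) * D2 u x)" using ax by (simp flip: mult.assoc)
    also have "\<dots> = G x" unfolding N(2)[OF x] using ax by simp
    finally show ?thesis .
  qed
  then have aD: "a_D2 a u = cls G" unfolding a_D2_def by (rule sqint_spike(2)[OF Gs N(1)])
  have w1: "is_wderiv (a_D2 a u) (cls G1)" unfolding aD by (rule is_wderiv_integral(2)[OF G1s G])
  then have wd1: "wderiv (a_D2 a u) = cls G1" by (rule wderiv_eqI)
  have w2: "is_wderiv (cls G1) (cls G2)" by (rule is_wderiv_integral(2)[OF G2(1) G1])
  then have wd2: "wderiv (cls G1) = z" using wderiv_eqI G2(2) by simp
  show "op_B a u = z" by (simp add: op_B_def wd1 wd2)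
  have H2: "a_D2 a u \<in> H2" using w1 w2 by (auto simp: H2_def H1_def wd1)
  have rG: "repr (a_D2 a u) G" using aD Gs by (simp add: repr_def)
  have rG1: "repr (wderiv (a_D2 a u)) G1" using wd1 G1s by (simp add: repr_def)
  have pts: "pt (a_D2 a u) x = G x" "pt (wderiv (a_D2 a u)) x = G1 x" if "x \<in> {0..1}" for x
    using pt_eq_continuous_on[OF rG Gc that] pt_eq_continuous_on[OF rG1 G1c that] by auto
  show "(u, v) \<in> dom_calB a \<beta> \<gamma>"
    using u v H2 G0 G11 G_1 pts[of 0] pts[of 1] by (auto simp: dom_calB_def dom_B_def P_def Q_def)
qed

end

text \<open>For x outside the domain the orbit need not be differentiable, but its image under
  \<open>P\<close> is when P A = Q is bounded. For v in the domain the mean value inequality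
  controls the increments of P (R s v) through Q (R s v), with an error proportional to the distance
  of v from x, and then v tends to x. It is applied with the two components of the state.\<close>

lemma C0_semigroup_component_derivative:
  fixes X :: "'a::banach set" and P Q :: "'a \<Rightarrow> 'b::real_normed_vector"
  assumes X: "subspace X" "closed X" and sg: "C0_semigroup X norm R" and gen: "generator X norm R D A"
    and A_X: "\<And>x. x \<in> D \<Longrightarrow> A x \<in> X" and D: "X \<subseteq> closure D"
    and P: "bounded_linear P" and Q: "bounded_linear Q" and PA: "\<And>x. x \<in> D \<Longrightarrow> P (A x) = Q x"
    and t: "0 \<le> t" and x: "x \<in> X"
  shows "((\<lambda>s. P (R s x)) has_vector_derivative Q (R t x)) (at t within {0..})"
  unfolding has_vector_derivative_def has_derivative_within_alt
proof (intro conjI allI impI bounded_linear_scaleR_left)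
  fix e :: real assume e: "0 < e"
  have DX: "D \<subseteq> X" using gen by (simp add: generator_def)
  obtain \<delta> M where \<delta>: "0 < \<delta>" "0 \<le> M"
    and bound: "\<And>s x. 0 \<le> s \<Longrightarrow> \<bar>s - t\<bar> \<le> \<delta> \<Longrightarrow> x \<in> X \<Longrightarrow> norm (R s x) \<le> M * norm x"
    using C0_semigroup_locally_bounded[OF X sg t] by blast
  have "((\<lambda>s. Q (R s x)) \<longlongrightarrow> Q (R t x)) (at t within {0..})"
    by (rule bounded_linear.tendsto[OF Q C0_semigroup_continuous[OF X sg t x]])
  from tendstoD[OF this e]
  obtain d where d: "0 < d" "\<forall>s\<in>{0..}. s \<noteq> t \<and> dist s t < d \<longrightarrow> dist (Q (R s x)) (Q (R t x)) < e"
    unfolding eventually_at by (elim exE conjE)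
  have near: "norm (Q (R s x) - Q (R t x)) \<le> e" if "0 \<le> s" "\<bar>s - t\<bar> < d" for s
    using d(2)[rule_format, of s] that e by (cases "s = t") (auto simp: dist_norm)
  obtain K where K: "0 \<le> K" "\<And>y. norm (Q y) \<le> norm y * K" using bounded_linear.nonneg_bounded[OF Q] by blast
  obtain L where L: "0 \<le> L" "\<And>y. norm (P y) \<le> norm y * L" using bounded_linear.nonneg_bounded[OF P] by blast
  note Pd = linear_diff[OF bounded_linear.linear[OF P]] and Qd = linear_diff[OF bounded_linear.linear[OF Q]]
  define S where "S = {0..} \<inter> ball t (min d \<delta>)"
  have S: "r \<in> S \<longleftrightarrow> 0 \<le> r \<and> \<bar>r - t\<bar> < d \<and> \<bar>r - t\<bar> < \<delta>" for r by (auto simp: S_def dist_real_def)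
  have cS: "convex S" unfolding S_def by (intro convex_Int convex_ball) simp
  have tS: "t \<in> S" using t d(1) \<delta>(1) by (simp add: S)
  have main: "norm (P (R s x) - P (R t x) - (s - t) *\<^sub>R Q (R t x)) \<le> e * \<bar>s - t\<bar>" if s: "s \<in> S" for s
  proof -
    \<comment> \<open>The first term comes from replacing x by v inside \<open>Q\<close> along the
      segment, the second from replacing it inside \<open>P\<close> at s and at t.\<close>
    define c where "c = \<bar>s - t\<bar> * (M * K) + 2 * (M * L)"
    have c: "0 \<le> c" using \<delta>(2) K(1) L(1) by (simp add: c_def)
    have approx: "norm (P (R s x) - P (R t x) - (s - t) *\<^sub>R Q (R t x)) \<le> e * \<bar>s - t\<bar> + c * norm (x - v)" if v: "v \<in> D" for v
    proof -
      have vX: "v \<in> X" using v DX by blast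
      have xv: "x - v \<in> X" by (rule subspace_diff[OF X(1) x vX])
      have diff: "norm (R r x - R r v) \<le> M * norm (x - v)" if "r \<in> S" for r
        using bound[of r "x - v"] xv that C0_semigroup_diff[OF sg _ x vX, of r] by (simp add: S)
      \<comment> \<open>Subtracting the linear function with slope Q (R t x) leaves a derivative
        that is small near t.\<close>
      have der: "((\<lambda>r. P (R r v) - r *\<^sub>R Q (R t x)) has_derivative (\<lambda>h. h *\<^sub>R (Q (R r v) - Q (R t x)))) (at r within S)"
        if r: "r \<in> S" for r
      proof -
        have r0: "0 \<le> r" using r by (simp add: S)
        have "((\<lambda>r. R r v) has_vector_derivative R r (A v)) (at r within {0..})"
          by (rule C0_semigroup_has_vector_derivative[OF X sg gen A_X r0 v])
        from bounded_linear.has_vector_derivative[OF P this]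
        have "((\<lambda>r. P (R r v)) has_vector_derivative P (R r (A v))) (at r within {0..})" .
        moreover have "P (R r (A v)) = Q (R r v)"
          using C0_semigroup_generator_invariant[OF X sg gen A_X r0 v] PA by metis
        ultimately have "((\<lambda>r. P (R r v)) has_vector_derivative Q (R r v)) (at r within S)"
          using has_vector_derivative_within_subset[of _ _ r "{0..}" S] by (simp add: S_def)
        then have "((\<lambda>r. P (R r v) - r *\<^sub>R Q (R t x)) has_vector_derivative Q (R r v) - 1 *\<^sub>R Q (R t x)) (at r within S)"
          by (intro has_vector_derivative_diff has_vector_derivative_scaleR[THEN has_vector_derivative_eq_rhs] derivative_eq_intros) auto
        then show ?thesis by (simp add: has_vector_derivative_def)
      qed
      have on: "onorm (\<lambda>h. h *\<^sub>R (Q (R r v) - Q (R t x))) \<le> e + M * norm (x - v) * K" if r: "r \<in> S" for r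
      proof (rule onorm_le)
        fix h :: real
        have "norm (Q (R r v) - Q (R t x)) \<le> norm (Q (R r x) - Q (R t x)) + norm (Q (R r x - R r v))"
          unfolding Qd using norm_triangle_ineq4[of "Q (R r x) - Q (R t x)" "Q (R r x) - Q (R r v)"] by simp
        also have "norm (Q (R r x - R r v)) \<le> M * norm (x - v) * K"
          using K(2)[of "R r x - R r v"] mult_right_mono[OF diff[OF r] K(1)] by linarith
        also have "norm (Q (R r x) - Q (R t x)) \<le> e" using near r by (simp add: S)
        finally have "norm (Q (R r v) - Q (R t x)) \<le> e + M * norm (x - v) * K" by simp
        then show "norm (h *\<^sub>R (Q (R r v) - Q (R t x))) \<le> (e + M * norm (x - v) * K) * norm h"
          unfolding norm_scaleR real_norm_def mult.commute[of "\<bar>h\<bar>"] by (rule mult_right_mono) simp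
      qed
      have "norm ((P (R s v) - s *\<^sub>R Q (R t x)) - (P (R t v) - t *\<^sub>R Q (R t x))) \<le> (e + M * norm (x - v) * K) * norm (s - t)"
        by (rule differentiable_bound[OF cS der on s tS])
      moreover have "norm (P (R r x) - P (R r v)) \<le> M * norm (x - v) * L" if "r \<in> S" for r
        using L(2)[of "R r x - R r v"] mult_right_mono[OF diff[OF that] L(1)] by (simp add: Pd)
      note this[OF s] this[OF tS]
      moreover have "P (R s x) - P (R t x) - (s - t) *\<^sub>R Q (R t x) = 
          ((P (R s v) - s *\<^sub>R Q (R t x)) - (P (R t v) - t *\<^sub>R Q (R t x))) + ((P (R s x) - P (R s v)) - (P (R t x) - P (R t v)))"
        by (simp add: algebra_simps)
      then have "norm (P (R s x) - P (R t x) - (s - t) *\<^sub>R Q (R t x)) \<le> 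
          norm ((P (R s v) - s *\<^sub>R Q (R t x)) - (P (R t v) - t *\<^sub>R Q (R t x))) + (norm (P (R s x) - P (R s v)) + norm (P (R t x) - P (R t v)))"
        by (metis norm_triangle_ineq norm_triangle_ineq4 add_left_mono order_trans)
      ultimately show ?thesis by (simp add: c_def algebra_simps)
    qed
    show ?thesis
    proof (rule field_le_epsilon)
      fix \<epsilon> :: real assume \<epsilon>: "0 < \<epsilon>"
      have "0 < \<epsilon> / (c + 1)" using \<epsilon> c by simp
      then obtain v where v: "v \<in> D" "dist v x < \<epsilon> / (c + 1)" using x D closure_approachable by (metis subsetD)
      then have "norm (x - v) \<le> \<epsilon> / (c + 1)" by (simp add: dist_norm norm_minus_commute)
      then have "(c + 1) * norm (x - v) \<le> \<epsilon>" using c by (simp add: field_simps)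
      moreover have "c * norm (x - v) \<le> (c + 1) * norm (x - v)" by (simp add: algebra_simps)
      ultimately show "norm (P (R s x) - P (R t x) - (s - t) *\<^sub>R Q (R t x)) \<le> e * \<bar>s - t\<bar> + \<epsilon>"
        using approx[OF v(1)] by linarith
    qed
  qed
  show "\<exists>d>0. \<forall>s\<in>{0..}. norm (s - t) < d \<longrightarrow> norm (P (R s x) - P (R t x) - (s - t) *\<^sub>R Q (R t x)) \<le> e * norm (s - t)"
    using d(1) \<delta>(1) main by (intro exI[of _ "min d \<delta>"]) (auto simp: S)
qed

lemma norm_fst_snd_le: "norm (fst p) \<le> norm p" "norm (snd p) \<le> norm p"
  using norm_fst_le[of "fst p" "snd p"] norm_snd_le[of "snd p" "fst p"] by simp_all

section \<open>The beam operator in coordinates\<close>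

locale degenerate_beam = degenerate_coefficient +
  fixes \<beta> \<gamma> :: real
  assumes \<beta>: "0 \<le> \<beta>" and \<gamma>: "0 \<le> \<gamma>"
begin

definition flow_form :: "l2 \<Rightarrow> l2 \<Rightarrow> l2 \<Rightarrow> real" where
  "flow_form u v \<phi> = inner (W u) (W \<phi>) + (\<beta> * pt u 1 + pt v 1) * pt \<phi> 1 +
    (\<gamma> * pt (wderiv u) 1 + pt (wderiv v) 1) * pt (wderiv \<phi>) 1"

lemma dom_calB_iff:
  assumes "u \<in> K2 a" "v \<in> K2 a"
  shows "(u, v) \<in> dom_calB a \<beta> \<gamma> \<and> op_B a u = z \<longleftrightarrow> (\<forall>\<phi>\<in>K2 a. inner z \<phi> = flow_form u v \<phi>)"
  using weak_form[of u v \<beta> \<gamma>] weak_form_imp_dom_calB[OF assms, of z \<beta> \<gamma>] unfolding flow_form_def by metis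

lemma dom_calB_K2: "U \<in> dom_calB a \<beta> \<gamma> \<Longrightarrow> fst U \<in> K2 a" "U \<in> dom_calB a \<beta> \<gamma> \<Longrightarrow> snd U \<in> K2 a"
  by (auto simp: dom_calB_def dom_B_def)

lemma dom_calB_K0: "U \<in> dom_calB a \<beta> \<gamma> \<Longrightarrow> U \<in> K0 a" "U \<in> dom_calB a \<beta> \<gamma> \<Longrightarrow> calB a U \<in> K0 a"
  using dom_calB_K2[of U] by (auto simp: K0_def calB_def mem_Times_iff)

text \<open>Linearity is read off the weak form, where \<open>K2_lin\<close> makes both sides
  linear, and carried back to the domain by \<open>dom_calB_iff\<close>; the flux and its boundary
  values need no separate treatment.\<close>

lemma calB_lin:
  assumes U: "U \<in> dom_calB a \<beta> \<gamma>" and V: "V \<in> dom_calB a \<beta> \<gamma>"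
  shows "c *\<^sub>R U + d *\<^sub>R V \<in> dom_calB a \<beta> \<gamma>" "calB a (c *\<^sub>R U + d *\<^sub>R V) = c *\<^sub>R calB a U + d *\<^sub>R calB a V"
proof -
  define u u' where "u = c *\<^sub>R fst U + d *\<^sub>R fst V" and "u' = c *\<^sub>R snd U + d *\<^sub>R snd V"
  note L = K2_lin[OF dom_calB_K2(1)[OF U] dom_calB_K2(1)[OF V] u_def] 
  note L' = K2_lin[OF dom_calB_K2(2)[OF U] dom_calB_K2(2)[OF V] u'_def] 
  have w: "inner (op_B a (fst Z)) \<phi> = flow_form (fst Z) (snd Z) \<phi>" if "Z \<in> dom_calB a \<beta> \<gamma>" "\<phi> \<in> K2 a" for Z \<phi>
    unfolding flow_form_def by (rule weak_form) (use that in auto)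
  have dom: "(u, u') \<in> dom_calB a \<beta> \<gamma> \<and> op_B a u = c *\<^sub>R op_B a (fst U) + d *\<^sub>R op_B a (fst V)"
    unfolding dom_calB_iff[OF L(1) L'(1)]
  proof
    fix \<phi> assume \<phi>: "\<phi> \<in> K2 a"
    show "inner (c *\<^sub>R op_B a (fst U) + d *\<^sub>R op_B a (fst V)) \<phi> = flow_form u u' \<phi>"
      unfolding inner_add_left inner_scaleR_left w[OF U \<phi>] w[OF V \<phi>] flow_form_def L(2,4,5) L'(2,4,5)
      by (simp add: algebra_simps)
  qed
  have "c *\<^sub>R U + d *\<^sub>R V = (u, u')" by (simp add: prod_eq_iff u_def u'_def)
  then show "c *\<^sub>R U + d *\<^sub>R V \<in> dom_calB a \<beta> \<gamma>" "calB a (c *\<^sub>R U + d *\<^sub>R V) = c *\<^sub>R calB a U + d *\<^sub>R calB a V"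
    using dom by (simp_all only:) (simp_all add: calB_def u'_def)
qed

text \<open>The state space in coordinates: the second derivative and the boundary values at \<open>1\<close> become
  components, so that the norm of the ambient Hilbert space is the energy norm completed by the
  \<open>L\<^sup>2\<close> norm of the first component.\<close>
definition coord :: "l2 \<times> l2 \<Rightarrow> (l2 \<times> l2 \<times> real \<times> real) \<times> l2" where
  "coord U = (emb 1 (sqrt \<beta>) (sqrt \<gamma>) (fst U), snd U)"

definition uncoord :: "(l2 \<times> l2 \<times> real \<times> real) \<times> l2 \<Rightarrow> l2 \<times> l2" where
  "uncoord y = (fst (fst y), snd y)"

abbreviation "E \<equiv> coord ` K0 a"
abbreviation "DE \<equiv> coord ` dom_calB a \<beta> \<gamma>"

definition BE :: "(l2 \<times> l2 \<times> real \<times> real) \<times> l2 \<Rightarrow> (l2 \<times> l2 \<times> real \<times> real) \<times> l2" where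
  "BE y = coord (calB a (uncoord y))"

lemma uncoord_coord [simp]: "uncoord (coord U) = U"
  by (simp add: coord_def uncoord_def emb_def)

lemma BE_coord: "BE (coord U) = coord (calB a U)"
  by (simp add: BE_def)

lemma coord_lin:
  assumes "U \<in> K0 a" "V \<in> K0 a"
  shows "coord (c *\<^sub>R U + d *\<^sub>R V) = c *\<^sub>R coord U + d *\<^sub>R coord V"
  using assms by (simp add: coord_def K0_def mem_Times_iff emb_lin)

lemma E_eq: "E = emb 1 (sqrt \<beta>) (sqrt \<gamma>) ` K2 a \<times> UNIV"
  by (auto simp: coord_def K0_def image_iff Bex_def)

lemma subspace_E: "subspace E" and closed_E: "closed E"
  unfolding E_eq by (intro subspace_Times subspace_emb subspace_UNIV) (intro closed_Times closed_emb closed_UNIV; simp)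

lemma subspace_K0: "subspace (K0 a)"
  unfolding K0_def by (intro subspace_Times subspace_K2 subspace_UNIV)

lemma subspace_DE: "subspace DE"
proof (rule subspaceI)
  have l: "c *\<^sub>R x + d *\<^sub>R y \<in> DE" if "x \<in> DE" "y \<in> DE" for x y c d
  proof -
    obtain U V where UV: "U \<in> dom_calB a \<beta> \<gamma>" "V \<in> dom_calB a \<beta> \<gamma>" "x = coord U" "y = coord V" using \<open>x \<in> DE\<close> \<open>y \<in> DE\<close> by blast
    then have "c *\<^sub>R x + d *\<^sub>R y = coord (c *\<^sub>R U + d *\<^sub>R V)" using coord_lin dom_calB_K0(1) by simp
    then show ?thesis using calB_lin(1)[OF UV(1,2)] by blast
  qed
  show "x + y \<in> DE" if "x \<in> DE" "y \<in> DE" for x y using l[OF that, of 1 1] by simp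
  show "c *\<^sub>R x \<in> DE" if "x \<in> DE" for c x using l[OF that that, of c 0] by simp
  have z: "flow_form 0 0 \<phi> = 0" for \<phi>
    using K2_lin(2-5)[OF zero_in_K2 zero_in_K2, of 0 0 0] by (simp add: flow_form_def)
  have "(0, 0) \<in> dom_calB a \<beta> \<gamma>" using dom_calB_iff[OF zero_in_K2 zero_in_K2, of 0] z by simp
  then have "coord (0, 0) \<in> DE" by blast
  then show "0 \<in> DE" using l[of "coord (0, 0)" "coord (0, 0)" 0 0] by simp
qed

lemma BE_lin:
  assumes "x \<in> DE" "y \<in> DE" shows "BE (c *\<^sub>R x + d *\<^sub>R y) = c *\<^sub>R BE x + d *\<^sub>R BE y"
proof -
  obtain U V where UV: "U \<in> dom_calB a \<beta> \<gamma>" "V \<in> dom_calB a \<beta> \<gamma>" "x = coord U" "y = coord V" using assms by blast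
  then have "c *\<^sub>R x + d *\<^sub>R y = coord (c *\<^sub>R U + d *\<^sub>R V)" using coord_lin dom_calB_K0(1) by simp
  then show ?thesis using UV BE_coord calB_lin(2)[OF UV(1,2)] coord_lin dom_calB_K0(2) by simp
qed

lemma DE_E: "DE \<subseteq> E" using dom_calB_K0(1) by blast

lemma BE_E: "x \<in> DE \<Longrightarrow> BE x \<in> E" using dom_calB_K0(2) by (auto simp: BE_coord)

lemma BE_fst: "x \<in> DE \<Longrightarrow> fst (fst (BE x)) = snd x"
  by (auto simp: BE_coord) (simp add: coord_def calB_def emb_def)

lemma inner_coord: "inner (coord U) (coord V) = inner (fst U) (fst V) + inner (W (fst U)) (W (fst V)) + 
    \<beta> * (pt (fst U) 1 * pt (fst V) 1) + \<gamma> * (pt (wderiv (fst U)) 1 * pt (wderiv (fst V)) 1) + inner (snd U) (snd V)"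
  using \<beta> \<gamma> by (simp add: coord_def inner_emb)

lemma norm_K0_coord: 
  assumes "U \<in> K0 a" 
  shows "norm_K0 a \<beta> \<gamma> U = sqrt ((norm (coord U))\<^sup>2 - (norm (fst (fst (coord U))))\<^sup>2)"
proof -
  have "fst U \<in> K2 a" using assms by (simp add: K0_def mem_Times_iff)
  then show ?thesis
    unfolding norm_K0_def inner_K0_def integral_a_D2[OF \<open>fst U \<in> K2 a\<close> \<open>fst U \<in> K2 a\<close>] power2_norm_eq_inner inner_coord
    by (simp add: coord_def emb_def algebra_simps)
qed

text \<open>In the weak form tested with v the terms in \<open>W\<close>, \<beta> and \<gamma>
  cancel. What remains is minus the squares of v(1) and v'(1), the boundary damping, and the product
  of u and v contributed by the added L2 norm.\<close>

lemma BE_energy: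
  assumes "x \<in> DE"
  shows "inner (BE x) x \<le> inner (snd x) (fst (fst x))"
proof -
  obtain u v where uv: "(u, v) \<in> dom_calB a \<beta> \<gamma>" "x = coord (u, v)" using assms by auto
  have v: "v \<in> K2 a" using dom_calB_K2(2)[OF uv(1)] by simp
  have "inner (BE x) x = inner v u - (pt v 1)\<^sup>2 - (pt (wderiv v) 1)\<^sup>2"
    unfolding uv(2) BE_coord inner_coord using weak_form[OF uv(1) v] inner_commute[of "W u" "W v"]
    by (simp add: calB_def algebra_simps power2_eq_square)
  then show ?thesis unfolding uv(2) by (simp add: coord_def emb_def)
qed

lemma BE_dissipative:
  assumes "x \<in> DE" shows "inner (BE x) x \<le> 1 * (norm x)\<^sup>2"
proof -
  have "inner (snd x) (fst (fst x)) \<le> norm (snd x) * norm (fst (fst x))" by (rule norm_cauchy_schwarz)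
  also have "\<dots> \<le> norm x * norm x"
    by (intro mult_mono order_trans[OF norm_fst_snd_le(1) norm_fst_snd_le(1)] norm_fst_snd_le(2)) auto
  finally show ?thesis using BE_energy[OF assms] by (simp add: power2_eq_square)
qed

text \<open>The equations are u - h v = f and v + h B u = g. Inserting v = (u - f) / h into the weak
  form and multiplying by h^2 gives a problem for u alone, whose left-hand side is the inner product
  of \<open>emb\<close> with weights h, sqrt (h^2 \<beta> + h) and sqrt (h^2 \<gamma> + h). The
  damping supplies the extra h in the last two weights and the boundary values of f in
  \<open>L\<close>.\<close>

lemma BE_range:
  assumes h: "0 < h" and y: "y \<in> E"
  shows "\<exists>x\<in>DE. x - h *\<^sub>R BE x = y"
proof -
  obtain f g where fg: "f \<in> K2 a" "y = coord (f, g)" using y by (auto simp: K0_def)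
  define e where "e = emb h (sqrt (h\<^sup>2 * \<beta> + h)) (sqrt (h\<^sup>2 * \<gamma> + h))"
  define L where "L s = inner (f + h *\<^sub>R g) (fst s) + h * (pt f 1 * pt (fst s) 1 + pt (wderiv f) 1 * pt (wderiv (fst s)) 1)"
    for s :: "l2 \<times> l2 \<times> real \<times> real"
  have fe: "fst (e u) = u" for u by (simp add: e_def emb_def)
  obtain C where C: "0 \<le> C" "\<And>u. u \<in> K2 a \<Longrightarrow> \<bar>pt (wderiv u) 1\<bar> \<le> C * (norm u + norm (W u))"
    "\<And>u. u \<in> K2 a \<Longrightarrow> \<bar>pt u 1\<bar> \<le> C * (norm u + norm (W u))"
    using K2_bounds by metis
  \<comment> \<open>The second component of \<open>e u\<close> is h W u, so bounding the norms of u
    and \<open>W u\<close> by that of \<open>e u\<close> costs the factor 1 + 1 / h.\<close>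
  define M where "M = norm (f + h *\<^sub>R g) + h * ((\<bar>pt f 1\<bar> + \<bar>pt (wderiv f) 1\<bar>) * (C * (1 + 1 / h)))"
  have L_lin: "L (c *\<^sub>R s + d *\<^sub>R t) = c * L s + d * L t" if st: "s \<in> e ` K2 a" "t \<in> e ` K2 a" for s t c d
  proof -
    obtain u v where uv: "u \<in> K2 a" "v \<in> K2 a" "s = e u" "t = e v" using st by blast
    have "c *\<^sub>R s + d *\<^sub>R t = e (c *\<^sub>R u + d *\<^sub>R v)" using uv emb_lin by (simp add: e_def)
    then show ?thesis using K2_lin(4,5)[OF uv(1,2) refl, of c d] uv(3,4)
      by (simp add: L_def fe inner_add_right algebra_simps)
  qed
  have L_bound: "\<bar>L s\<bar> \<le> M * norm s" if s: "s \<in> e ` K2 a" for s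
  proof -
    obtain u where u: "u \<in> K2 a" "s = e u" using s by blast
    have n1: "norm u \<le> norm s" using norm_fst_snd_le(1)[of s] u(2) fe by simp
    have "norm (h *\<^sub>R W u) \<le> norm s" 
      using order_trans[OF norm_fst_snd_le(1) norm_fst_snd_le(2)[of s]] u(2) by (simp add: e_def emb_def)
    then have n2: "norm (W u) \<le> norm s / h" using h by (simp add: field_simps)
    have "C * (norm u + norm (W u)) \<le> C * (norm s + norm s / h)" using n1 n2 C(1) by (intro mult_left_mono) auto
    also have "\<dots> = C * (1 + 1 / h) * norm s" by (simp add: algebra_simps)
    finally have c: "\<bar>pt u 1\<bar> \<le> C * (1 + 1 / h) * norm s" "\<bar>pt (wderiv u) 1\<bar> \<le> C * (1 + 1 / h) * norm s"
      using C(2,3)[OF u(1)] by linarith+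
    have "\<bar>pt f 1 * pt u 1 + pt (wderiv f) 1 * pt (wderiv u) 1\<bar> \<le> \<bar>pt f 1\<bar> * \<bar>pt u 1\<bar> + \<bar>pt (wderiv f) 1\<bar> * \<bar>pt (wderiv u) 1\<bar>"
      unfolding abs_mult[symmetric] by (rule abs_triangle_ineq)
    also have "\<dots> \<le> \<bar>pt f 1\<bar> * (C * (1 + 1 / h) * norm s) + \<bar>pt (wderiv f) 1\<bar> * (C * (1 + 1 / h) * norm s)"
      by (intro add_mono mult_left_mono c) auto
    finally have "h * \<bar>pt f 1 * pt u 1 + pt (wderiv f) 1 * pt (wderiv u) 1\<bar> \<le> h * (((\<bar>pt f 1\<bar> + \<bar>pt (wderiv f) 1\<bar>) * (C * (1 + 1 / h))) * norm s)"
      using h by (intro mult_left_mono) (auto simp: algebra_simps)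
    moreover have "\<bar>inner (f + h *\<^sub>R g) u\<bar> \<le> norm (f + h *\<^sub>R g) * norm s"
      using Cauchy_Schwarz_ineq2[of "f + h *\<^sub>R g" u] mult_left_mono[OF n1 norm_ge_zero[of "f + h *\<^sub>R g"]] by linarith
    moreover have "\<bar>L s\<bar> \<le> \<bar>inner (f + h *\<^sub>R g) u\<bar> + h * \<bar>pt f 1 * pt u 1 + pt (wderiv f) 1 * pt (wderiv u) 1\<bar>"
      using abs_triangle_ineq[of "inner (f + h *\<^sub>R g) u" "h * (pt f 1 * pt u 1 + pt (wderiv f) 1 * pt (wderiv u) 1)"] h
      by (simp add: L_def u(2) fe abs_mult)
    moreover have "M * norm s = norm (f + h *\<^sub>R g) * norm s + h * (((\<bar>pt f 1\<bar> + \<bar>pt (wderiv f) 1\<bar>) * (C * (1 + 1 / h))) * norm s)"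
      unfolding M_def distrib_right[of "norm _"] by (simp only: mult.assoc)
    ultimately show ?thesis by linarith
  qed
  have "subspace (e ` K2 a)" "closed (e ` K2 a)" 
    unfolding e_def using subspace_emb closed_emb h by auto
  then have "\<exists>s\<in>e ` K2 a. \<forall>t\<in>e ` K2 a. inner s t = L t"
  proof (rule riesz_representation[of "e ` K2 a" L])
    show "L (x + y) = L x + L y" if "x \<in> e ` K2 a" "y \<in> e ` K2 a" for x y using L_lin[OF that, of 1 1] by simp
    show "L (c *\<^sub>R x) = c * L x" if "x \<in> e ` K2 a" for c x using L_lin[OF that that, of c 0] by simp
    show "\<bar>L x\<bar> \<le> M * norm x" if "x \<in> e ` K2 a" for x by (rule L_bound[OF that])
  qed blast
  then obtain s where s: "s \<in> e ` K2 a" "\<And>t. t \<in> e ` K2 a \<Longrightarrow> inner s t = L t" by blast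
  obtain u where u: "u \<in> K2 a" "s = e u" using s(1) by blast
  define v where "v = (1 / h) *\<^sub>R u + (- 1 / h) *\<^sub>R f"
  define z where "z = (1 / h) *\<^sub>R (g - v)"
  note V = K2_lin[OF u(1) fg(1) v_def]
  have uf: "u - h *\<^sub>R v = f" using h by (simp add: v_def algebra_simps)
  have "(u, v) \<in> dom_calB a \<beta> \<gamma> \<and> op_B a u = z"
    unfolding dom_calB_iff[OF u(1) V(1)]
  proof
    fix \<phi> assume \<phi>: "\<phi> \<in> K2 a"
    have hb: "0 \<le> h\<^sup>2 * \<beta> + h" "0 \<le> h\<^sup>2 * \<gamma> + h" using h \<beta> \<gamma> by auto
    have r: "inner u \<phi> + h\<^sup>2 * inner (W u) (W \<phi>) + (h\<^sup>2 * \<beta> + h) * (pt u 1 * pt \<phi> 1) + (h\<^sup>2 * \<gamma> + h) * (pt (wderiv u) 1 * pt (wderiv \<phi>) 1)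
      = inner f \<phi> + h * inner g \<phi> + h * (pt f 1 * pt \<phi> 1 + pt (wderiv f) 1 * pt (wderiv \<phi>) 1)"
      using s(2)[OF imageI[OF \<phi>]] hb unfolding u(2) L_def fe unfolding e_def inner_emb by (simp add: emb_def inner_add_left)
    have "h\<^sup>2 * inner z \<phi> = h * inner g \<phi> - inner u \<phi> + inner f \<phi>"
      using h by (simp add: z_def v_def inner_diff_left inner_add_left power2_eq_square algebra_simps)
    moreover have "h\<^sup>2 * flow_form u v \<phi> = h\<^sup>2 * inner (W u) (W \<phi>) + (h\<^sup>2 * \<beta> * pt u 1 + h * (pt u 1 - pt f 1)) * pt \<phi> 1
        + (h\<^sup>2 * \<gamma> * pt (wderiv u) 1 + h * (pt (wderiv u) 1 - pt (wderiv f) 1)) * pt (wderiv \<phi>) 1"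
      unfolding flow_form_def V(4,5) using h by (simp add: power2_eq_square algebra_simps)
    moreover note r
    ultimately have "h\<^sup>2 * inner z \<phi> = h\<^sup>2 * flow_form u v \<phi>" by (simp only: distrib_left distrib_right left_diff_distrib right_diff_distrib ac_simps)
    then show "inner z \<phi> = flow_form u v \<phi>" using h by simp
  qed
  then have uv: "(u, v) \<in> dom_calB a \<beta> \<gamma>" "op_B a u = z" by auto
  have "1 *\<^sub>R (u, v) + (- h) *\<^sub>R calB a (u, v) = (f, g)"
    using uf uv(2) h by (simp add: calB_def z_def)
  then have "coord (u, v) - h *\<^sub>R BE (coord (u, v)) = y"
    unfolding BE_coord fg(2) using coord_lin[OF dom_calB_K0[OF uv(1)], of 1 "- h"] by simp
  then show ?thesis using uv(1) by blast
qed

end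

section \<open>Transfer to the product norm and decay of the energy\<close>

context degenerate_beam
begin

lemma norm_prod_sq: "(norm_prod a U)\<^sup>2 = (norm (fst U))\<^sup>2 + (norm (wderiv (fst U)))\<^sup>2 + (norm (W (fst U)))\<^sup>2 + (norm (snd U))\<^sup>2"
  by (simp add: norm_prod_def norm_2a_def)

lemma norm_coord_sq: "(norm (coord U))\<^sup>2 = (norm (fst U))\<^sup>2 + (norm (W (fst U)))\<^sup>2 + 
    \<beta> * (pt (fst U) 1)\<^sup>2 + \<gamma> * (pt (wderiv (fst U)) 1)\<^sup>2 + (norm (snd U))\<^sup>2"
  unfolding power2_norm_eq_inner inner_coord by (simp add: power2_eq_square)

lemma norm_prod_iso: obtains C where "norm_iso (K0 a) E coord uncoord (norm_prod a) norm C"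
proof -
  obtain C where C: "0 \<le> C" "\<And>u. u \<in> K2 a \<Longrightarrow> \<bar>pt (wderiv u) 1\<bar> \<le> C * (norm u + norm (W u))"
    "\<And>u. u \<in> K2 a \<Longrightarrow> \<bar>pt u 1\<bar> \<le> C * (norm u + norm (W u))"
    "\<And>u. u \<in> K2 a \<Longrightarrow> norm (wderiv u) \<le> C * (norm u + norm (W u))"
    by (rule K2_bounds) metis
  \<comment> \<open>The 2 comes from (x + y)^2 <= 2 (x^2 + y^2). In \<open>M\<close> the three
    multiples of \<open>c\<close> pay for u', for the \<beta> term and for the \<gamma>
    term.\<close>
  define c where "c = 2 * C\<^sup>2"
  define M where "M = 1 + c * (1 + \<beta> + \<gamma>)"
  have c0: "0 \<le> c" by (simp add: c_def)
  then have M: "0 \<le> M" using \<beta> \<gamma> by (simp add: M_def)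
  have sq: "y\<^sup>2 \<le> c * ((norm u)\<^sup>2 + (norm (W u))\<^sup>2)" if "\<bar>y\<bar> \<le> C * (norm u + norm (W u))" for y u
  proof -
    have "\<bar>y\<bar>\<^sup>2 \<le> (C * (norm u + norm (W u)))\<^sup>2" using that by (intro power_mono) auto
    moreover have "(norm u + norm (W u))\<^sup>2 \<le> 2 * ((norm u)\<^sup>2 + (norm (W u))\<^sup>2)"
      using sum_squares_bound[of "norm u" "norm (W u)"] by (simp add: power2_sum)
    then have "C\<^sup>2 * (norm u + norm (W u))\<^sup>2 \<le> C\<^sup>2 * (2 * ((norm u)\<^sup>2 + (norm (W u))\<^sup>2))" by (intro mult_left_mono) auto
    ultimately show ?thesis unfolding c_def power_mult_distrib power2_abs by linarith
  qed
  have le: "norm_prod a U \<le> sqrt M * norm (coord U)" "norm (coord U) \<le> sqrt M * norm_prod a U" if U: "U \<in> K0 a" for U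
  proof -
    have u: "fst U \<in> K2 a" using U by (auto simp: K0_def)
    define r where "r = (norm (fst U))\<^sup>2 + (norm (W (fst U)))\<^sup>2"
    have r0: "0 \<le> r" by (simp add: r_def)
    note s = sq[OF C(2)[OF u], folded r_def] sq[OF C(3)[OF u], folded r_def]
    have s3: "(norm (wderiv (fst U)))\<^sup>2 \<le> c * r" unfolding r_def by (rule sq) (use C(4)[OF u] in simp)
    have b: "0 \<le> \<beta> * (pt (fst U) 1)\<^sup>2" "0 \<le> \<gamma> * (pt (wderiv (fst U)) 1)\<^sup>2" using \<beta> \<gamma> by auto
    have b': "\<beta> * (pt (fst U) 1)\<^sup>2 \<le> \<beta> * (c * r)" "\<gamma> * (pt (wderiv (fst U)) 1)\<^sup>2 \<le> \<gamma> * (c * r)"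
      using s \<beta> \<gamma> by (intro mult_left_mono; simp)+
    have p: "0 \<le> \<beta> * (c * r)" "0 \<le> \<gamma> * (c * r)" "0 \<le> c * r" using \<beta> \<gamma> c0 r0 by auto
    have M_mult: "r + c * r + \<beta> * (c * r) + \<gamma> * (c * r) + y \<le> M * (r + y)" "r + y \<le> (r + y) * M" if "0 \<le> y" for y
    proof -
      have "0 \<le> c * (1 + \<beta> + \<gamma>) * y" using that c0 \<beta> \<gamma> by simp
      then show "r + c * r + \<beta> * (c * r) + \<gamma> * (c * r) + y \<le> M * (r + y)" by (simp add: M_def algebra_simps)
      then show "r + y \<le> (r + y) * M" using p by (simp add: mult.commute)
    qed
    have y: "0 \<le> (norm (snd U))\<^sup>2" by simp
    have "(norm_prod a U)\<^sup>2 \<le> M * (r + (norm (snd U))\<^sup>2)"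
      using M_mult(1)[OF y] s3 p unfolding norm_prod_sq r_def by linarith
    also have "\<dots> \<le> M * (norm (coord U))\<^sup>2" 
      using M b by (intro mult_left_mono) (auto simp: norm_coord_sq r_def)
    finally have "(norm_prod a U)\<^sup>2 \<le> (sqrt M * norm (coord U))\<^sup>2" using M by (simp add: power_mult_distrib)
    then show "norm_prod a U \<le> sqrt M * norm (coord U)" by (rule power2_le_imp_le) (use M in simp)
    have "(norm (coord U))\<^sup>2 \<le> M * (r + (norm (snd U))\<^sup>2)"
      using M_mult(1)[OF y] b' p unfolding norm_coord_sq r_def by linarith
    also have "\<dots> \<le> M * (norm_prod a U)\<^sup>2" 
      using M by (intro mult_left_mono) (auto simp: norm_prod_sq r_def)
    finally have "(norm (coord U))\<^sup>2 \<le> (sqrt M * norm_prod a U)\<^sup>2" using M by (simp add: power_mult_distrib)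
    then show "norm (coord U) \<le> sqrt M * norm_prod a U" by (rule power2_le_imp_le) (use M in \<open>simp add: norm_prod_def\<close>)
  qed
  have "norm_iso (K0 a) E coord uncoord (norm_prod a) norm (sqrt M)"
    by unfold_locales (use subspace_K0 subspace_E coord_lin le M in \<open>auto simp: norm_prod_def\<close>)
  then show ?thesis by (rule that)
qed

lemma DE_iff: "y \<in> DE \<longleftrightarrow> y \<in> E \<and> uncoord y \<in> dom_calB a \<beta> \<gamma>"
  using DE_E by auto

lemma transfer:
  assumes R: "C0_semigroup (K0 a) (norm_prod a) R" "generator (K0 a) (norm_prod a) R (dom_calB a \<beta> \<gamma>) (calB a)"
  shows "C0_semigroup E norm (\<lambda>t y. coord (R t (uncoord y)))" "generator E norm (\<lambda>t y. coord (R t (uncoord y))) DE BE"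
proof -
  obtain C where C: "norm_iso (K0 a) E coord uncoord (norm_prod a) norm C" by (rule norm_prod_iso)
  show "C0_semigroup E norm (\<lambda>t y. coord (R t (uncoord y)))" by (rule norm_iso.C0_semigroup_transfer[OF C R(1)])
  show "generator E norm (\<lambda>t y. coord (R t (uncoord y))) DE BE"
    by (rule norm_iso.generator_transfer[OF C R]) (use dom_calB_K0(2) DE_iff in \<open>auto simp: BE_def\<close>)
qed

lemma transfer_back:
  assumes S: "C0_semigroup E norm S" "generator E norm S DE BE"
  shows "C0_semigroup (K0 a) (norm_prod a) (\<lambda>t U. uncoord (S t (coord U)))"
    "generator (K0 a) (norm_prod a) (\<lambda>t U. uncoord (S t (coord U))) (dom_calB a \<beta> \<gamma>) (calB a)"
proof -
  obtain C where "norm_iso (K0 a) E coord uncoord (norm_prod a) norm C" by (rule norm_prod_iso)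
  then have C: "norm_iso E (K0 a) uncoord coord norm (norm_prod a) C" by (rule norm_iso.flip)
  show "C0_semigroup (K0 a) (norm_prod a) (\<lambda>t U. uncoord (S t (coord U)))" by (rule norm_iso.C0_semigroup_transfer[OF C S(1)])
  have iff: "U \<in> dom_calB a \<beta> \<gamma> \<longleftrightarrow> U \<in> K0 a \<and> coord U \<in> DE" for U
    using dom_calB_K0(1) by (metis DE_iff imageI uncoord_coord)
  show "generator (K0 a) (norm_prod a) (\<lambda>t U. uncoord (S t (coord U))) (dom_calB a \<beta> \<gamma>) (calB a)"
    by (rule norm_iso.generator_transfer[OF C S BE_E iff]) (simp_all only: BE_def uncoord_coord)
qed

lemma BE_diff: "x \<in> DE \<Longrightarrow> y \<in> DE \<Longrightarrow> x - y \<in> DE \<and> BE (x - y) = BE x - BE y"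
  using BE_lin[of x y 1 "-1"] subspace_diff[OF subspace_DE] by simp

lemma beam_semigroup:
  obtains S where "C0_semigroup E norm S" "generator E norm S DE BE" 
    "\<And>t x. 0 \<le> t \<Longrightarrow> x \<in> E \<Longrightarrow> norm (S t x) \<le> exp t * norm x" "E \<subseteq> closure DE"
proof (rule quasi_dissipative_generates[OF subspace_E closed_E subspace_DE DE_E BE_E _ _ BE_dissipative])
  show "BE (x + y) = BE x + BE y" if "x \<in> DE" "y \<in> DE" for x y using BE_lin[OF that, of 1 1] by simp
  show "BE (c *\<^sub>R x) = c *\<^sub>R BE x" if "x \<in> DE" for x c using BE_lin[OF that that, of c 0] by simp
  show "\<exists>x\<in>DE. x - h *\<^sub>R BE x = y" if "0 < h" "y \<in> E" for h y by (rule BE_range[OF that])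
qed (use that in auto)

lemma coord_semigroup_unique:
  assumes R: "C0_semigroup E norm R" "generator E norm R DE BE"
    and S: "C0_semigroup E norm S" "generator E norm S DE BE" and t: "0 \<le> t" "x \<in> E"
  shows "R t x = S t x"
proof -
  obtain S0 where "E \<subseteq> closure DE" by (rule beam_semigroup)
  then show ?thesis
    by (intro C0_semigroup_unique[OF subspace_E closed_E BE_E _ BE_diff BE_dissipative R S t])
qed

text \<open>The difference is the energy. On the domain its derivative is twice the inner product of
  \<open>BE\<close> x with x minus that of the two components, which is at most 0 by
  \<open>BE_energy\<close>: the growth of the full norm comes only from the added L2 norm.\<close>

lemma energy_decreasing:
  assumes S: "C0_semigroup E norm S" "generator E norm S DE BE" and t: "0 \<le> t" and x: "x \<in> E"
  shows "(norm (S t x))\<^sup>2 - (norm (fst (fst (S t x))))\<^sup>2 \<le> (norm x)\<^sup>2 - (norm (fst (fst x)))\<^sup>2"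
proof -
  define e where "e x = (norm x)\<^sup>2 - (norm (fst (fst x)))\<^sup>2" for x :: "(l2 \<times> l2 \<times> real \<times> real) \<times> l2"
  have e_eq: "e x = inner x x - inner (fst (fst x)) (fst (fst x))" for x by (simp add: e_def power2_norm_eq_inner)
  note D = C0_semigroupD[OF S(1)]
  have dom: "e (S t x) \<le> e x" if x: "x \<in> DE" for x
  proof -
    have xE: "x \<in> E" using x DE_E by blast
    have der: "((\<lambda>s. S s x) has_vector_derivative BE (S r x)) (at r within {0..})" "S r x \<in> DE" if r: "0 \<le> r" for r
      using C0_semigroup_has_vector_derivative[OF subspace_E closed_E S BE_E r x]
        C0_semigroup_generator_invariant[OF subspace_E closed_E S BE_E r x] by simp_all
    have ed: "((\<lambda>s. e (S s x)) has_real_derivative 2 * (inner (BE (S r x)) (S r x) - inner (snd (S r x)) (fst (fst (S r x))))) (at r within {0..})"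
      if r: "0 \<le> r" for r
    proof -
      have d: "((\<lambda>s. S s x) has_derivative (\<lambda>h. h *\<^sub>R BE (S r x))) (at r within {0..})"
        using der(1)[OF r] by (simp add: has_vector_derivative_def)
      have d1: "((\<lambda>s. fst (fst (S s x))) has_derivative (\<lambda>h. h *\<^sub>R snd (S r x))) (at r within {0..})"
        using has_derivative_fst[OF has_derivative_fst[OF d]] BE_fst[OF der(2)[OF r]] by simp
      have "((\<lambda>s. inner (S s x) (S s x) - inner (fst (fst (S s x))) (fst (fst (S s x)))) has_derivative
          (\<lambda>h. (inner (S r x) (h *\<^sub>R BE (S r x)) + inner (h *\<^sub>R BE (S r x)) (S r x)) - 
            (inner (fst (fst (S r x))) (h *\<^sub>R snd (S r x)) + inner (h *\<^sub>R snd (S r x)) (fst (fst (S r x)))))) (at r within {0..})"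
        by (intro has_derivative_diff has_derivative_inner d d1)
      then show ?thesis unfolding e_eq has_field_derivative_def
        by (rule has_derivative_eq_rhs) (auto simp: fun_eq_iff inner_commute algebra_simps)
    qed
    show ?thesis
    proof (cases "t = 0")
      case True
      then show ?thesis using D(4)[OF xE] by simp
    next
      case False
      then have t0: "0 < t" using t by simp
      have "e (S t x) \<le> e (S 0 x)"
      proof (rule DERIV_nonpos_imp_decreasing_open[OF less_imp_le[OF t0]])
        fix r assume r: "0 < r" "r < t"
        have "inner (BE (S r x)) (S r x) \<le> inner (snd (S r x)) (fst (fst (S r x)))"
          by (rule BE_energy) (use der(2)[of r] r in simp)
        then show "\<exists>y. ((\<lambda>s. e (S s x)) has_real_derivative y) (at r) \<and> y \<le> 0"
          using ed[of r] r at_within_nonneg[OF r(1)] by (intro exI conjI) auto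
      next
        show "continuous_on {0..t} (\<lambda>s. e (S s x))"
          using ed by (intro continuous_on_subset[of "{0..}" _ "{0..t}"] DERIV_continuous_on) auto
      qed
      then show ?thesis using D(4)[OF xE] by simp
    qed
  qed
  obtain S0 where "E \<subseteq> closure DE" by (rule beam_semigroup)
  then have "x \<in> closure DE" using x by blast
  then obtain f where f: "\<And>n. f n \<in> DE" "f \<longlonglongrightarrow> x" unfolding closure_sequential by blast
  have fE: "f n \<in> E" for n using f(1) DE_E by blast
  obtain M where M: "\<And>x. x \<in> E \<Longrightarrow> norm (S t x) \<le> M * norm x" using D(3)[OF t] by blast
  have "(\<lambda>n. S t (f n)) \<longlonglongrightarrow> S t x"
  proof (rule LIM_zero_cancel, rule Lim_null_comparison[OF always_eventually])
    show "\<forall>n. norm (S t (f n) - S t x) \<le> M * norm (f n - x)"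
      using M[OF subspace_diff[OF subspace_E fE x]] C0_semigroup_diff[OF S(1) t fE x] by simp
    have "(\<lambda>n. M * norm (f n - x)) \<longlonglongrightarrow> M * 0"
      by (intro tendsto_mult tendsto_const tendsto_norm_zero LIM_zero f(2))
    then show "(\<lambda>n. M * norm (f n - x)) \<longlonglongrightarrow> 0" by simp
  qed
  then have "(\<lambda>n. e (S t (f n))) \<longlonglongrightarrow> e (S t x)" unfolding e_def by (intro tendsto_intros)
  moreover have "(\<lambda>n. e (f n)) \<longlonglongrightarrow> e x" unfolding e_def by (intro tendsto_intros f(2))
  ultimately have "e (S t x) \<le> e x" by (rule LIMSEQ_le) (use dom f(1) in auto)
  then show ?thesis by (simp add: e_def)
qed

lemma K0_semigroup_exists: obtains R where "K0_semigroup a \<beta> \<gamma> R"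
proof -
  obtain S where S: "C0_semigroup E norm S" "generator E norm S DE BE" by (rule beam_semigroup)
  define R where "R t U = uncoord (S t (coord U))" for t U
  note T = transfer_back[OF S, folded R_def]
  have "norm_K0 a \<beta> \<gamma> (R t U) \<le> norm_K0 a \<beta> \<gamma> U" if t: "0 \<le> t" and U: "U \<in> K0 a" for t U
  proof -
    have cU: "coord U \<in> E" using U by blast
    have "S t (coord U) \<in> E" by (rule C0_semigroupD(1)[OF S(1) t cU])
    then have "coord (R t U) = S t (coord U)" by (auto simp: R_def)
    then show ?thesis
      using energy_decreasing[OF S t cU] norm_K0_coord[OF U] norm_K0_coord[OF C0_semigroupD(1)[OF T(1) t U]] by simp
  qed
  then have "K0_semigroup a \<beta> \<gamma> R" using T by (simp add: K0_semigroup_def R_def[abs_def])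
  then show ?thesis by (rule that)
qed

end

section \<open>Regularity and continuous dependence of solutions\<close>

lemma C0_in_cong: "(\<And>t. 0 \<le> t \<Longrightarrow> y t = z t) \<Longrightarrow> C0_in X N y \<longleftrightarrow> C0_in X N z"
  unfolding C0_in_def by (intro all_cong1 imp_cong conj_cong refl tendsto_cong) (auto simp: eventually_at_filter)

lemma ddt_eqI:
  assumes "(u has_vector_derivative d) (at t within {0..})" "0 \<le> t" "\<And>t. 0 \<le> t \<Longrightarrow> y t = u t"
  shows "ddt y t = d"
proof -
  have "(y has_vector_derivative d) (at t within {0..})"
    using has_vector_derivative_transform[of t "{0..}" y u d] assms by simp
  moreover have "at_right t \<le> at t within {0..}" by (rule at_le) (use assms(2) in auto)
  then have "at t within {0..} \<noteq> bot" using trivial_limit_at_right_real[of t] by (metis bot_unique)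
  ultimately show ?thesis unfolding ddt_def by (intro vector_derivative_within)
qed

text \<open>A mild solution is prescribed for t >= 0 only. Regularity is shown for components of
  orbits and carried over by agreement on that half-line.\<close>

lemma C1_inI:
  assumes y: "\<And>t. 0 \<le> t \<Longrightarrow> y t = u t" "\<And>t. 0 \<le> t \<Longrightarrow> ddt y t = v t"
    and "C0_in X N u" "C0_in X N v"
    and q: "\<And>t. 0 \<le> t \<Longrightarrow> ((\<lambda>s. N ((u s - u t) /\<^sub>R (s - t) - v t)) \<longlongrightarrow> 0) (at t within {0..})"
  shows "C1_in X N y"
proof -
  have "((\<lambda>s. N ((y s - y t) /\<^sub>R (s - t) - ddt y t)) \<longlongrightarrow> 0) (at t within {0..})" if "0 \<le> t" for t
    by (rule tendsto_cong[THEN iffD1, OF _ q[OF that]]) (use y that in \<open>auto simp: eventually_at_filter\<close>)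
  then show ?thesis using assms C0_in_cong[where y = y and z = u and X = X and N = N] C0_in_cong[where y = "ddt y" and z = v and X = X and N = N] by (simp add: C1_in_def)
qed

context degenerate_beam
begin

lemma norm_prod_ge: "norm_2a a (fst U) \<le> norm_prod a U" "norm (fst U) \<le> norm_prod a U" "norm (snd U) \<le> norm_prod a U"
proof -
  have "sqrt ((norm_2a a (fst U))\<^sup>2) \<le> norm_prod a U" "sqrt ((norm (snd U))\<^sup>2) \<le> norm_prod a U"
    unfolding norm_prod_def by (rule real_sqrt_le_mono, simp)+
  moreover have "sqrt ((norm (fst U))\<^sup>2) \<le> norm_2a a (fst U)" unfolding norm_2a_def by (rule real_sqrt_le_mono) simp
  moreover have "0 \<le> norm_2a a (fst U)" by (simp add: norm_2a_def)
  ultimately show "norm_2a a (fst U) \<le> norm_prod a U" "norm (fst U) \<le> norm_prod a U" "norm (snd U) \<le> norm_prod a U"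
    by simp_all
qed

lemma tendsto_norm_prod:
  assumes "((\<lambda>s. norm_prod a (F s)) \<longlongrightarrow> 0) G"
  shows "((\<lambda>s. norm_2a a (fst (F s))) \<longlongrightarrow> 0) G" "((\<lambda>s. norm (fst (F s))) \<longlongrightarrow> 0) G" "((\<lambda>s. norm (snd (F s))) \<longlongrightarrow> 0) G"
  by (rule Lim_null_comparison[OF always_eventually assms]; use norm_prod_ge in \<open>simp add: norm_2a_def\<close>)+

lemma K0_semigroup_unique:
  assumes "K0_semigroup a \<beta> \<gamma> R" "K0_semigroup a \<beta> \<gamma> R'" "0 \<le> t" "U \<in> K0 a"
  shows "R t U = R' t U"
proof -
  have "coord (R t (uncoord (coord U))) = coord (R' t (uncoord (coord U)))"
    by (rule coord_semigroup_unique[OF transfer transfer]) (use assms in \<open>auto simp: K0_semigroup_def\<close>)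
  then show ?thesis by (metis uncoord_coord)
qed

context
  fixes R assumes R: "K0_semigroup a \<beta> \<gamma> R"
begin

lemma R_semigroup: "C0_semigroup (K0 a) (norm_prod a) R" and R_generator: "generator (K0 a) (norm_prod a) R (dom_calB a \<beta> \<gamma>) (calB a)"
  using R by (simp_all add: K0_semigroup_def)

lemmas coord_R = transfer[OF R_semigroup R_generator]

lemma R_K0: "0 \<le> t \<Longrightarrow> U \<in> K0 a \<Longrightarrow> R t U \<in> K0 a"
  by (rule C0_semigroupD(1)[OF R_semigroup])

lemma R_dom:
  assumes "0 \<le> t" "U \<in> dom_calB a \<beta> \<gamma>" 
  shows "R t U \<in> dom_calB a \<beta> \<gamma>" "calB a (R t U) = R t (calB a U)"
proof -
  have U: "coord U \<in> DE" using assms(2) by blast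
  note I = C0_semigroup_generator_invariant[OF subspace_E closed_E coord_R BE_E assms(1) U, unfolded uncoord_coord BE_coord]
  show "R t U \<in> dom_calB a \<beta> \<gamma>" using I(1) by (metis DE_iff uncoord_coord)
  show "calB a (R t U) = R t (calB a U)" using I(2) by (metis uncoord_coord)
qed

lemma eventually_nonneg: "\<forall>\<^sub>F s in at t within {0..}. 0 \<le> (s::real)"
  by (simp add: eventually_at_filter)

lemma norm_prod_tendsto_iff:
  assumes "\<forall>\<^sub>F s in G. F s \<in> K0 a"
  shows "((\<lambda>s. norm (coord (F s))) \<longlongrightarrow> 0) G \<longleftrightarrow> ((\<lambda>s. norm_prod a (F s)) \<longlongrightarrow> 0) G"
proof -
  obtain C where C: "norm_iso (K0 a) E coord uncoord (norm_prod a) norm C" by (rule norm_prod_iso)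
  show ?thesis by (rule norm_iso.tendsto_transfer[OF C assms])
qed

lemma R_continuous:
  assumes t: "0 \<le> t" and U: "U \<in> K0 a"
  shows "((\<lambda>s. norm_prod a (R s U - R t U)) \<longlongrightarrow> 0) (at t within {0..})"
proof -
  have cd: "coord (V - V') = coord V - coord V'" if "V \<in> K0 a" "V' \<in> K0 a" for V V'
    using coord_lin[OF that, of 1 "-1"] by simp
  have "((\<lambda>s. coord (R s U)) \<longlongrightarrow> coord (R t U)) (at t within {0..})"
    using C0_semigroup_continuous[OF subspace_E closed_E coord_R(1) t imageI[OF U]] by simp
  then have l: "((\<lambda>s. norm (coord (R s U) - coord (R t U))) \<longlongrightarrow> 0) (at t within {0..})"
    by (intro tendsto_norm_zero LIM_zero)
  have "((\<lambda>s. norm (coord (R s U - R t U))) \<longlongrightarrow> 0) (at t within {0..})"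
    by (rule tendsto_cong[THEN iffD1, OF eventually_mono[OF eventually_nonneg] l]) (simp add: cd R_K0 t U)
  moreover have "\<forall>\<^sub>F s in at t within {0..}. R s U - R t U \<in> K0 a"
    by (rule eventually_mono[OF eventually_nonneg]) (intro subspace_diff[OF subspace_K0] R_K0 U t)
  ultimately show ?thesis using norm_prod_tendsto_iff[of "\<lambda>s. R s U - R t U"] by simp
qed

lemma R_differentiable:
  assumes t: "0 \<le> t" and U: "U \<in> dom_calB a \<beta> \<gamma>"
  shows "((\<lambda>s. norm_prod a ((R s U - R t U) /\<^sub>R (s - t) - R t (calB a U))) \<longlongrightarrow> 0) (at t within {0..})"
proof -
  note K = dom_calB_K0[OF U]
  have cd: "coord ((V - V') /\<^sub>R c - V'') = (coord V - coord V') /\<^sub>R c - coord V''" 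
    if "V \<in> K0 a" "V' \<in> K0 a" "V'' \<in> K0 a" for V V' V'' c
    using coord_lin[OF that(1,2), of 1 "-1"] coord_lin[OF subspace_diff[OF subspace_K0 that(1,2)] that(3), of "inverse c" "-1"] by simp
  have "((\<lambda>s. coord (R s U)) has_vector_derivative coord (R t (calB a U))) (at t within {0..})"
    using C0_semigroup_has_vector_derivative[OF subspace_E closed_E coord_R BE_E t imageI[OF U]] by (simp add: BE_coord)
  then have l: "((\<lambda>s. norm ((coord (R s U) - coord (R t U)) /\<^sub>R (s - t) - coord (R t (calB a U)))) \<longlongrightarrow> 0) (at t within {0..})"
    by (simp only: has_vector_derivative_quotient)
  have "((\<lambda>s. norm (coord ((R s U - R t U) /\<^sub>R (s - t) - R t (calB a U)))) \<longlongrightarrow> 0) (at t within {0..})"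
    by (rule tendsto_cong[THEN iffD1, OF eventually_mono[OF eventually_nonneg] l]) (simp add: cd R_K0 t K)
  moreover have "\<forall>\<^sub>F s in at t within {0..}. (R s U - R t U) /\<^sub>R (s - t) - R t (calB a U) \<in> K0 a"
    by (rule eventually_mono[OF eventually_nonneg]) 
      (intro subspace_diff[OF subspace_K0] subspace_scale[OF subspace_K0] R_K0 K t)
  ultimately show ?thesis using norm_prod_tendsto_iff[of "\<lambda>s. (R s U - R t U) /\<^sub>R (s - t) - R t (calB a U)"] by simp
qed

text \<open>A mild solution requires the second component of the orbit to be \<open>ddt\<close> of
  the first for every initial state, also outside the domain of the generator. This gives
  existence.\<close>

lemma R_fst_derivative:
  assumes t: "0 \<le> t" and U: "U \<in> K0 a"
  shows "((\<lambda>s. fst (R s U)) has_vector_derivative snd (R t U)) (at t within {0..})"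
proof -
  obtain S0 where D: "E \<subseteq> closure DE" by (rule beam_semigroup)
  have P: "bounded_linear (\<lambda>x. fst (fst x))" by (intro bounded_linear_intros)
  have "((\<lambda>s. fst (fst (coord (R s (uncoord (coord U)))))) has_vector_derivative snd (coord (R t (uncoord (coord U))))) (at t within {0..})"
    by (rule C0_semigroup_component_derivative[OF subspace_E closed_E coord_R BE_E D P bounded_linear_snd BE_fst t imageI[OF U]])
  then show ?thesis unfolding uncoord_coord by (simp add: coord_def emb_def)
qed

lemma R_fst_quotient:
  "0 \<le> t \<Longrightarrow> U \<in> K0 a \<Longrightarrow>
    ((\<lambda>s. norm ((fst (R s U) - fst (R t U)) /\<^sub>R (s - t) - snd (R t U))) \<longlongrightarrow> 0) (at t within {0..})"
  by (rule has_vector_derivative_quotient[THEN iffD1, OF R_fst_derivative])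

lemma C0_in_R:
  assumes U: "U \<in> K0 a"
  shows "C0_in (K2 a) (norm_2a a) (\<lambda>t. fst (R t U))" "C0_in UNIV norm (\<lambda>t. fst (R t U))" "C0_in UNIV norm (\<lambda>t. snd (R t U))"
  using tendsto_norm_prod[OF R_continuous[OF _ U]] R_K0[OF _ U] by (auto simp: C0_in_def K0_def mem_Times_iff)

lemma mild_solution_eq:
  assumes U: "U \<in> K0 a" and y: "mild_solution a \<beta> \<gamma> U y" and t: "0 \<le> t"
  shows "y t = fst (R t U)" "ddt y t = snd (R t U)"
proof -
  obtain R' where R': "K0_semigroup a \<beta> \<gamma> R'" "\<And>t. 0 \<le> t \<Longrightarrow> (y t, ddt y t) = R' t U"
    using y by (auto simp: mild_solution_def)
  then have "(y t, ddt y t) = R t U" using K0_semigroup_unique[OF R R'(1) t U] t by simp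
  then show "y t = fst (R t U)" "ddt y t = snd (R t U)" by (metis fst_conv, metis snd_conv)
qed

lemma mild_solution_exists:
  assumes U: "U \<in> K0 a"
  shows "mild_solution a \<beta> \<gamma> U (\<lambda>t. fst (R t U))"
  unfolding mild_solution_def using ddt_eqI[OF R_fst_derivative[OF _ U]] R by (intro exI[of _ R]) (auto simp: prod_eq_iff)

lemma mild_solution_C1:
  assumes U: "U \<in> K0 a" and y: "mild_solution a \<beta> \<gamma> U y"
  shows "C1_in UNIV norm y" "C0_in (K2 a) (norm_2a a) y"
proof -
  note e = mild_solution_eq[OF U y]
  show "C1_in UNIV norm y"
    by (rule C1_inI[OF e C0_in_R(2,3)[OF U] R_fst_quotient[OF _ U]])
  show "C0_in (K2 a) (norm_2a a) y" using C0_in_cong[OF e(1), where X = "K2 a" and N = "norm_2a a"] C0_in_R(1)[OF U] by simp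
qed

lemma mild_solution_diff:
  assumes U: "U \<in> K0 a" and V: "V \<in> K0 a" and y: "mild_solution a \<beta> \<gamma> U y" and z: "mild_solution a \<beta> \<gamma> V z" and t: "0 \<le> t"
  shows "(y t - z t, ddt y t - ddt z t) = R t (U - V)"
  unfolding mild_solution_eq[OF U y t] mild_solution_eq[OF V z t] C0_semigroup_diff[OF R_semigroup t U V] by (simp add: prod_eq_iff)

lemma R_contraction: "0 \<le> t \<Longrightarrow> U \<in> K0 a \<Longrightarrow> norm_K0 a \<beta> \<gamma> (R t U) \<le> norm_K0 a \<beta> \<gamma> U"
  using R by (simp add: K0_semigroup_def)

text \<open>Contraction in the energy says nothing about the product norm when the energy is a
  seminorm. The growth bound exp t known for the constructed semigroup carries over to any
  \<open>R\<close> by uniqueness.\<close>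

lemma R_bounded: "\<exists>C. \<forall>U\<in>K0 a. \<forall>t\<in>{0..T}. norm_prod a (R t U) \<le> C * norm_prod a U"
proof -
  obtain C where C: "norm_iso (K0 a) E coord uncoord (norm_prod a) norm C" by (rule norm_prod_iso)
  obtain S0 where S0: "C0_semigroup E norm S0" "generator E norm S0 DE BE" 
    "\<And>t x. 0 \<le> t \<Longrightarrow> x \<in> E \<Longrightarrow> norm (S0 t x) \<le> exp t * norm x" 
    by (rule beam_semigroup) (rule that; (assumption | simp))
  have "norm_prod a (R t U) \<le> C * (exp T * (C * norm_prod a U))" if U: "U \<in> K0 a" and t: "t \<in> {0..T}" for U t
  proof -
    have t0: "0 \<le> t" using t by simp
    have "norm_prod a (R t U) \<le> C * norm (coord (R t U))" by (rule norm_iso.N_le[OF C R_K0[OF t0 U]])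
    also have "coord (R t U) = S0 t (coord U)"
      using coord_semigroup_unique[OF coord_R S0(1,2) t0 imageI[OF U]] by simp
    also have "norm (S0 t (coord U)) \<le> exp t * norm (coord U)" by (rule S0(3)[OF t0 imageI[OF U]])
    also have "exp t * norm (coord U) \<le> exp T * (C * norm_prod a U)"
      using t norm_iso.N'_le[OF C U] by (intro mult_mono) auto
    finally show ?thesis using norm_iso.C[OF C] by (simp add: mult_left_mono)
  qed
  then show ?thesis by (intro exI[of _ "C * (exp T * C)"]) (simp add: mult.assoc)
qed

text \<open>On the domain \<open>R t\<close> commutes with \<open>calB\<close>, so (y_t, -B y) is
  itself the orbit of \<open>calB a U\<close>. Applying the results for mild solutions to this orbit
  gives one more time derivative, and its continuity is the continuity of B y.\<close>

lemma mild_solution_classical: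
  assumes U: "U \<in> dom_calB a \<beta> \<gamma>" and y: "mild_solution a \<beta> \<gamma> U y"
  shows "C2_in UNIV norm y" "C1_in (K2 a) (norm_2a a) y" "C0_in (dom_B a) (norm_dom_B a) y" "solves_problem a \<beta> \<gamma> U y"
proof -
  note K = dom_calB_K0[OF U]
  note e = mild_solution_eq[OF K(1) y]
  have cal: "snd (R t U) = fst (R t (calB a U))" "op_B a (fst (R t U)) = - snd (R t (calB a U))" if "0 \<le> t" for t
    using R_dom(2)[OF that U, symmetric] by (simp_all add: calB_def)
  have v: "ddt y t = fst (R t (calB a U))" if "0 \<le> t" for t using e(2)[OF that] cal(1)[OF that] by simp
  have w: "ddt (ddt y) t = snd (R t (calB a U))" if "0 \<le> t" for t
    by (rule ddt_eqI[OF R_fst_derivative[OF that K(2)] that v])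
  have "C1_in UNIV norm (ddt y)"
    by (rule C1_inI[OF v w C0_in_R(2,3)[OF K(2)] R_fst_quotient[OF _ K(2)]])
  then show "C2_in UNIV norm y" using mild_solution_C1[OF K(1) y] by (simp add: C2_in_def)
  have q: "((\<lambda>s. norm_2a a ((fst (R s U) - fst (R t U)) /\<^sub>R (s - t) - fst (R t (calB a U)))) \<longlongrightarrow> 0) (at t within {0..})" if "0 \<le> t" for t
    using tendsto_norm_prod(1)[OF R_differentiable[OF that U]] by (simp only: fst_diff fst_scaleR)
  show "C1_in (K2 a) (norm_2a a) y"
    by (rule C1_inI[OF e(1) v C0_in_R(1)[OF K(1)] C0_in_R(1)[OF K(2)] q])
  have dom: "(y t, ddt y t) \<in> dom_calB a \<beta> \<gamma>" if "0 \<le> t" for t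
    using R_dom(1)[OF that U] e[OF that] by simp
  have lim: "((\<lambda>s. norm_dom_B a (y s - y t)) \<longlongrightarrow> 0) (at t within {0..})" if t: "0 \<le> t" for t
  proof -
    \<comment> \<open>The part of the graph norm that involves \<open>op_B\<close> is the second
      component of the orbit of \<open>calB a U\<close>, up to sign.\<close>
    have eq: "norm_dom_B a (y s - y t) = sqrt ((norm_2a a (fst (R s U - R t U)))\<^sup>2 + (norm (snd (R s (calB a U) - R t (calB a U))))\<^sup>2)"
      if s: "0 \<le> s" for s
    proof -
      have c: "calB a (R s U - R t U) = calB a (R s U) - calB a (R t U)"
        using calB_lin(2)[OF R_dom(1)[OF s U] R_dom(1)[OF t U], of 1 "-1"] by simp
      have "- op_B a (fst (R s U - R t U)) = snd (calB a (R s U - R t U))" by (simp add: calB_def)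
      also have "\<dots> = snd (R s (calB a U) - R t (calB a U))" unfolding c R_dom(2)[OF s U] R_dom(2)[OF t U] ..
      finally have "norm (op_B a (fst (R s U - R t U))) = norm (snd (R s (calB a U) - R t (calB a U)))"
        by (metis norm_minus_cancel)
      then show ?thesis unfolding norm_dom_B_def e(1)[OF s] e(1)[OF t] fst_diff[symmetric] by simp
    qed
    have "((\<lambda>s. sqrt ((norm_2a a (fst (R s U - R t U)))\<^sup>2 + (norm (snd (R s (calB a U) - R t (calB a U))))\<^sup>2)) \<longlongrightarrow> sqrt (0\<^sup>2 + 0\<^sup>2)) (at t within {0..})"
      by (intro tendsto_intros tendsto_norm_prod(1)[OF R_continuous[OF t K(1)]] tendsto_norm_prod(3)[OF R_continuous[OF t K(2)]])
    then have l: "((\<lambda>s. sqrt ((norm_2a a (fst (R s U - R t U)))\<^sup>2 + (norm (snd (R s (calB a U) - R t (calB a U))))\<^sup>2)) \<longlongrightarrow> 0) (at t within {0..})"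
      by simp
    show ?thesis
      by (rule tendsto_cong[THEN iffD2, OF eventually_mono[OF eventually_nonneg] l]) (rule eq)
  qed
  have domB: "y t \<in> dom_B a" if "0 \<le> t" for t using dom[OF that] by (simp add: dom_calB_def)
  then show "C0_in (dom_B a) (norm_dom_B a) y" using lim by (simp add: C0_in_def)
  have "pt (y t) 0 = 0 \<and> (WD a \<longrightarrow> pt (wderiv (y t)) 0 = 0)" if "0 \<le> t" for t
    using domB[OF that] by (auto simp: dom_B_def K2_def K2_WD_def K2_SD_def split: if_splits)
  moreover have "ddt (ddt y) t + op_B a (y t) = 0" if "0 \<le> t" for t
    using w[OF that] cal(2)[OF that] e(1)[OF that] by simp
  moreover have "y 0 = fst U" "ddt y 0 = snd U"
    using e[OF order_refl] C0_semigroupD(4)[OF R_semigroup K(1)] by simp_all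
  ultimately show "solves_problem a \<beta> \<gamma> U y"
    using dom by (simp add: solves_problem_def dom_calB_def dom_B_def)
qed

end

end

text \<open>Continuous dependence takes two forms because the energy may be only a seminorm:
  contraction holds in the energy for all times, whereas the product norm, which separates states,
  is controlled on bounded time intervals.\<close>

theorem theorem4p2:
  fixes a :: "real \<Rightarrow> real" and \<beta> \<gamma> :: real
  assumes "WD a \<or> SD a" and "0 \<le> \<beta>" and "0 \<le> \<gamma>"
  shows
    "(\<forall>U0\<in>K0 a. \<exists>y. mild_solution a \<beta> \<gamma> U0 y \<and>
        C1_in UNIV norm y \<and> C0_in (K2 a) (norm_2a a) y \<and>
        (\<forall>z. mild_solution a \<beta> \<gamma> U0 z \<longrightarrow> (\<forall>t\<ge>0. z t = y t))) \<and>
     (\<forall>U0\<in>K0 a. \<forall>V0\<in>K0 a. \<forall>y z. mild_solution a \<beta> \<gamma> U0 y \<and> mild_solution a \<beta> \<gamma> V0 z \<longrightarrow>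
        (\<forall>t\<ge>0. norm_K0 a \<beta> \<gamma> (y t - z t, ddt y t - ddt z t) \<le> norm_K0 a \<beta> \<gamma> (U0 - V0))) \<and>
     (\<forall>T\<ge>0. \<exists>C. \<forall>U0\<in>K0 a. \<forall>V0\<in>K0 a. \<forall>y z.
        mild_solution a \<beta> \<gamma> U0 y \<and> mild_solution a \<beta> \<gamma> V0 z \<longrightarrow>
        (\<forall>t\<in>{0..T}. norm_prod a (y t - z t, ddt y t - ddt z t) \<le> C * norm_prod a (U0 - V0))) \<and>
     (\<forall>U0\<in>dom_calB a \<beta> \<gamma>. \<forall>y. mild_solution a \<beta> \<gamma> U0 y \<longrightarrow>
        C2_in UNIV norm y \<and> C1_in (K2 a) (norm_2a a) y \<and> C0_in (dom_B a) (norm_dom_B a) y \<and>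
        solves_problem a \<beta> \<gamma> U0 y)"
proof -
  obtain p m where "degenerate_coefficient a p m" by (rule degenerate_coefficientI[OF assms(1)])
  then interpret degenerate_beam a p m \<beta> \<gamma>
    using assms(2,3) by (simp add: degenerate_beam_def degenerate_beam_axioms_def)
  obtain R where R: "K0_semigroup a \<beta> \<gamma> R" by (rule K0_semigroup_exists)
  have ex: "\<exists>y. mild_solution a \<beta> \<gamma> U y \<and> C1_in UNIV norm y \<and> C0_in (K2 a) (norm_2a a) y \<and>
        (\<forall>z. mild_solution a \<beta> \<gamma> U z \<longrightarrow> (\<forall>t\<ge>0. z t = y t))" if U: "U \<in> K0 a" for U
    using mild_solution_exists[OF R U] mild_solution_C1[OF R U] mild_solution_eq(1)[OF R U] 
    by (intro exI[of _ "\<lambda>t. fst (R t U)"]) simp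
  note K0_diff = subspace_diff[OF subspace_K0]
  have d: "(y t - z t, ddt y t - ddt z t) = R t (U - V)"
    if "U \<in> K0 a" "V \<in> K0 a" "mild_solution a \<beta> \<gamma> U y \<and> mild_solution a \<beta> \<gamma> V z" "0 \<le> t" for U V y z t
    using mild_solution_diff[OF R] that by auto
  have bd: "\<exists>C. \<forall>U0\<in>K0 a. \<forall>V0\<in>K0 a. \<forall>y z.
        mild_solution a \<beta> \<gamma> U0 y \<and> mild_solution a \<beta> \<gamma> V0 z \<longrightarrow>
        (\<forall>t\<in>{0..T}. norm_prod a (y t - z t, ddt y t - ddt z t) \<le> C * norm_prod a (U0 - V0))" for T
  proof -
    obtain C where "\<forall>U\<in>K0 a. \<forall>t\<in>{0..T}. norm_prod a (R t U) \<le> C * norm_prod a U" using R_bounded[OF R] by blast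
    then show ?thesis by (intro exI[of _ C] ballI allI impI) (simp add: d K0_diff)
  qed
  show ?thesis
    by (intro conjI ballI allI impI ex bd mild_solution_classical[OF R]) (simp_all add: d K0_diff R_contraction[OF R])
qed

end
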